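(* Let $q:[0,\infty)\to[0,\infty)$ be continuous on $[0,\infty)$ and $C^\infty$ on $(0,\infty)$, with $q(0)=0$ and $q(r)>0$ for $r>0$. Let $g=q'/q$ on $(0,\infty)$, where $g:(0,\infty)\to(0,\infty)$, and assume $g'(r)\ne0$ for all $r\in(0,\infty)$. Let $R$ be the associated generalized cone Radon transform in $\mathbb{R}^2$. Let $\alpha\in\mathbb{R}$, let $0<a<b$ and $0<c$, let $\mathcal{A}=[a,b]\times[-c,c]$, and let $\mathcal{L}$ be given by $$\mathcal{L}f=R^*\left(\chi_{\mathcal{A}}\frac{\mathrm{d}^2}{\mathrm{d}E^2}Rf\right).$$ Let $f\in\mathcal{E}'(X)$ and $(\mathbf{x},\boldsymbol\xi)\in\mathrm{WF}^\alpha(f)$, with $\mathbf{x}=(x_1,x_2)$ and $\boldsymbol\xi=(\xi_1,\xi_2)$. Then $(\mathbf{x},\boldsymbol\xi)\in\mathrm{WF}^{\alpha-1}(\mathcal{L}f)$ if (1) $\xi_1\neq0$ and $\xi_2\neq0$, and (2) $\frac{x_2}{q(r)}\in(a,b)$ and $x_1-r\omega\in(-c,c)$, where $r=g^{-1}\left(\frac{|\xi_1|}{x_2|\xi_2|}\right)$ and $\omega=-\frac{\xi_1\xi_2}{|\xi_1\xi_2|}$. If $(\mathbf{x},\boldsymbol\xi)$ does not satisfy condition (1), or it does satisfy (1) but $\frac{x_2}{q(r)}\notin[a,b]$ or $x_1-r\omega\notin[-c,c]$, then $\mathcal{L}f$ is smooth at $\mathbf{x}$ in direction $\boldsymbol\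xi$.
   Context: Notation. $X=\{(x_1,x_2)\in\mathbb{R}^2:x_2>0\}$ and $Y=(0,\infty)\times\mathbb{R}$, with points of $Y$ written $(E,x_0)$. $\mathcal{E}'(X)$ denotes the compactly supported distributions on $X$; $T^*(X)$ is identified with $X\times\mathbb{R}^2$. For $(E,x_0)\in Y$ let $$S(E,x_0)=\{(x_1,x_2): x_2=Eq(|x_1-x_0|),\ x_1\in\mathbb{R}\setminus\{x_0\}\},\qquad \Psi(E,x_0,\mathbf{x})=x_2-Eq(|x_1-x_0|).$$ The generalized cone Radon transform in $\mathbb{R}^2$ associated with $q$ is, for compactly supported $f\in L^2(X)$, $$Rf(E,x_0)=\int_{S(E,x_0)} f\,\mathrm{d}S=\int_X f(\mathbf{x})\,\|\nabla_{\mathbf{x}}\Psi\|\,\delta(\Psi(E,x_0,\mathbf{x}))\,\mathrm{d}\mathbf{x},$$ where $\mathrm{d}S$ is arc length measure. $R$ is a Fourier integral operator and extends to a map $\mathcal{E}'(X)\to\mathcal{D}'(Y)$. $R^*$ denotes the formal adjoint (backprojection) of $R$. $\chi_{\mathcal{A}}$ is the characteristic function of $\mathcal{A}$, regarded as a set of points $(E,x_0)\in Y$. Since $g'$ is never zero, $g$ is injective, and $g^{-1}$ denotes its inverse. Fourier transform: $\mathcal{F}f(\boldsymbol\xi)=\int e^{-i\mathbf{x}\cdot\boldsymbol\xi}f(\mathbf{x})\,\mathrm{d}\mathbf{x}$. Wavefront sets. A distribution $f$ is smooth at $\mathbf{x}$ in direction $\boldsymbol\xi\neq\mathbf{0}$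 if there are neighborhoods $U$ of $\mathbf{x}$ and $V$ of $\boldsymbol\xi$ such that for every $\phi\in\mathcal{D}(U)$ (smooth, compactly supported in $U$) and $N\in\mathbb{R}$ there is a constant $C_N$ with $|\mathcal{F}(\phi f)(\lambda\boldsymbol\eta)|\le C_N(1+|\lambda|)^{-N}$ for all $\boldsymbol\eta\in V$ and $\lambda>0$. A distribution $f$ is (Sobolev) smooth to order $\alpha$ at $(\mathbf{x},\boldsymbol\xi)$ if there are a smooth cutoff function $\varphi$ at $\mathbf{x}$ (compactly supported, nonzero at $\mathbf{x}$) and a conic neighborhood $V$ of $\boldsymbol\xi$ with $\int_V|\mathcal{F}(\varphi f)(\boldsymbol\eta)|^2(1+\|\boldsymbol\eta\|^2)^\alpha\,\mathrm{d}\boldsymbol\eta<\infty$. If $f$ is not smooth to order $\alpha$ at $(\mathbf{x},\boldsymbol\xi)$, then $(\mathbf{x},\boldsymbol\xi)$ is in the Sobolev wavefront set $\mathrm{WF}^\alpha(f)$. *)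

theory Defs
  imports "HOL-Analysis.Analysis"
begin

section \<open>Smooth functions and distributions\<close>

fun iter_deriv :: "'a::euclidean_space list \<Rightarrow> ('a \<Rightarrow> 'b::real_normed_vector) \<Rightarrow> 'a \<Rightarrow> 'b" where
  "iter_deriv [] f = f"
| "iter_deriv (v # vs) f = (\<lambda>x. frechet_derivative (iter_deriv vs f) (at x) v)"

text \<open>Only used for open sets. Differentiability of every iterated partial derivative entails
  continuity of all of them, so this is the usual class of infinitely differentiable functions.\<close>

definition smooth_on :: "'a::euclidean_space set \<Rightarrow> ('a \<Rightarrow> 'b::real_normed_vector) \<Rightarrow> bool" where
  "smooth_on \<Omega> f \<longleftrightarrow> (\<forall>vs. set vs \<subseteq> Basis \<longrightarrow> iter_deriv vs f differentiable_on \<Omega>)"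

definition test_functions :: "'a::euclidean_space set \<Rightarrow> ('a \<Rightarrow> complex) set" where
  "test_functions \<Omega> = {\<phi>. smooth_on UNIV \<phi> \<and>
     compact (closure {x. \<phi> x \<noteq> 0}) \<and> closure {x. \<phi> x \<noteq> 0} \<subseteq> \<Omega>}"

text \<open>Distributions are complex linear functionals, represented by total functions on
  \<open>'a \<Rightarrow> complex\<close> whose values outside the relevant function space carry no meaning. The compactly
  supported distributions on an open set \<open>\<Omega>\<close> are the continuous functionals on the Frechet
  space of smooth functions on \<open>\<Omega>\<close>. The estimate, with \<open>K\<close> a subset of \<open>\<Omega>\<close>, forces the value to depend
  only on the restriction of the argument to \<open>\<Omega>\<close>.\<close>

definition compactly_supported_distributions ::
    "'a::euclidean_space set \<Rightarrow> (('a \<Rightarrow> complex) \<Rightarrow> complex) set" where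
  "compactly_supported_distributions \<Omega> = {u.
     (\<forall>\<phi> \<psi>. smooth_on \<Omega> \<phi> \<longrightarrow> smooth_on \<Omega> \<psi> \<longrightarrow> u (\<lambda>x. \<phi> x + \<psi> x) = u \<phi> + u \<psi>) \<and>
     (\<forall>\<phi> c. smooth_on \<Omega> \<phi> \<longrightarrow> u (\<lambda>x. c * \<phi> x) = c * u \<phi>) \<and>
     (\<exists>K C N. compact K \<and> K \<subseteq> \<Omega> \<and>
       (\<forall>\<phi> M. smooth_on \<Omega> \<phi> \<longrightarrow>
          (\<forall>x\<in>K. \<forall>vs. set vs \<subseteq> Basis \<and> length vs \<le> N \<longrightarrow> norm (iter_deriv vs \<phi> x) \<le> M) \<longrightarrow>
          norm (u \<phi>) \<le> C * M))}"

definition distr_deriv ::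
    "'a::euclidean_space \<Rightarrow> (('a \<Rightarrow> complex) \<Rightarrow> complex) \<Rightarrow> ('a \<Rightarrow> complex) \<Rightarrow> complex" where
  "distr_deriv v u = (\<lambda>\<phi>. - u (\<lambda>x. frechet_derivative \<phi> (at x) v))"

text \<open>The regularisation \<open>h * \<rho>\<^sub>\<epsilon>\<close> with \<open>\<rho>\<^sub>\<epsilon>(y) = \<epsilon>\<^sup>-\<^sup>n \<rho>(y/\<epsilon>)\<close>.\<close>

definition mollify ::
    "('a::euclidean_space \<Rightarrow> complex) \<Rightarrow> ('a \<Rightarrow> complex) \<Rightarrow> real \<Rightarrow> 'a \<Rightarrow> complex" where
  "mollify \<rho> h \<epsilon> = (\<lambda>y. LINT z|lborel. h (y - \<epsilon> *\<^sub>R z) * \<rho> z)"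

text \<open>\<open>w\<close> is the product of the function \<open>h\<close> and the distribution \<open>u\<close> on \<open>W\<close>: the distributional
  limit of the products of \<open>u\<close> with the regularisations of \<open>h\<close>, for every mollifier. It is the
  ordinary product where \<open>h\<close> is smooth, and Hoermander's product where the wavefront sets
  of \<open>h\<close> and \<open>u\<close> contain no opposite covectors.\<close>

definition distr_product_on ::
    "'a::euclidean_space set \<Rightarrow> ('a \<Rightarrow> complex) \<Rightarrow> (('a \<Rightarrow> complex) \<Rightarrow> complex)
       \<Rightarrow> (('a \<Rightarrow> complex) \<Rightarrow> complex) \<Rightarrow> bool" where
  "distr_product_on W h u w \<longleftrightarrow>
     (\<forall>\<phi>\<in>test_functions W. \<forall>\<rho>\<in>test_functions UNIV. (LINT z|lborel. \<rho> z) = 1 \<longrightarrow>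
        ((\<lambda>\<epsilon>. u (\<lambda>y. mollify \<rho> h \<epsilon> y * \<phi> y)) \<longlongrightarrow> w \<phi>) (at_right 0))"

text \<open>A distribution \<open>w\<close> with compact support in \<open>\<Omega>\<close> which is the product of \<open>h\<close> and \<open>u\<close> on every open
  subset on which that product exists. If it exists on all of \<open>\<Omega>\<close>, then \<open>w\<close> is determined on
  test functions on \<open>\<Omega>\<close>. For the characteristic function of a rectangle, the product with the
  distributions considered below exists off the four corners, all of whose covectors belong to the
  wavefront set of the characteristic function. At the corners it can fail to exist; then any
  distribution extending it across the corners is admitted.\<close>

definition is_distr_product ::
    "'a::euclidean_space set \<Rightarrow> ('a \<Rightarrow> complex) \<Rightarrow> (('a \<Rightarrow> complex) \<Rightarrow> complex)
       \<Rightarrow> (('a \<Rightarrow> complex) \<Rightarrow> complex) \<Rightarrow> bool" where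
  "is_distr_product \<Omega> h u w \<longleftrightarrow>
     w \<in> compactly_supported_distributions \<Omega> \<and>
     (\<forall>W. open W \<and> W \<subseteq> \<Omega> \<and> (\<exists>v. distr_product_on W h u v) \<longrightarrow> distr_product_on W h u w)"


section \<open>Wavefront sets\<close>

text \<open>The Fourier transform of \<open>\<phi>u\<close>, which for a test function \<open>\<phi>\<close> is the function
  \<open>\<xi> \<mapsto> \<langle>u, \<phi> exp(-i x\<cdot>\<xi>)\<rangle>\<close>.\<close>

definition fourier_cutoff ::
    "(('a::euclidean_space \<Rightarrow> complex) \<Rightarrow> complex) \<Rightarrow> ('a \<Rightarrow> complex) \<Rightarrow> 'a \<Rightarrow> complex" where
  "fourier_cutoff u \<phi> \<xi> = u (\<lambda>x. exp (- \<i> * complex_of_real (x \<bullet> \<xi>)) * \<phi> x)"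

definition smooth_at_direction ::
    "'a::euclidean_space set \<Rightarrow> (('a \<Rightarrow> complex) \<Rightarrow> complex) \<Rightarrow> 'a \<Rightarrow> 'a \<Rightarrow> bool" where
  "smooth_at_direction \<Omega> u x \<xi> \<longleftrightarrow>
     (\<exists>U V. open U \<and> x \<in> U \<and> U \<subseteq> \<Omega> \<and> open V \<and> \<xi> \<in> V \<and>
        (\<forall>\<phi>\<in>test_functions U. \<forall>N::real. \<exists>C. \<forall>\<eta>\<in>V. \<forall>t>0.
           norm (fourier_cutoff u \<phi> (t *\<^sub>R \<eta>)) \<le> C * (1 + \<bar>t\<bar>) powr (- N)))"

definition sobolev_smooth_at ::
    "'a::euclidean_space set \<Rightarrow> real \<Rightarrow> (('a \<Rightarrow> complex) \<Rightarrow> complex) \<Rightarrow> 'a \<Rightarrow> 'a \<Rightarrow> bool" where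
  "sobolev_smooth_at \<Omega> \<alpha> u x \<xi> \<longleftrightarrow>
     (\<exists>\<phi>\<in>test_functions \<Omega>. \<phi> x \<noteq> 0 \<and>
        (\<exists>V. open V \<and> \<xi> \<in> V \<and> (\<forall>\<eta>\<in>V. \<forall>t>0. t *\<^sub>R \<eta> \<in> V) \<and>
           (\<integral>\<^sup>+ \<eta>\<in>V. ennreal ((norm (fourier_cutoff u \<phi> \<eta>))\<^sup>2 * (1 + (norm \<eta>)\<^sup>2) powr \<alpha>) \<partial>lborel)
             < \<infinity>))"

definition sobolev_WF ::
    "'a::euclidean_space set \<Rightarrow> real \<Rightarrow> (('a \<Rightarrow> complex) \<Rightarrow> complex) \<Rightarrow> ('a \<times> 'a) set" where
  "sobolev_WF \<Omega> \<alpha> u = {(x, \<xi>). x \<in> \<Omega> \<and> \<xi> \<noteq> 0 \<and> \<not> sobolev_smooth_at \<Omega> \<alpha> u x \<xi>}"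


section \<open>The generalized cone Radon transform\<close>

definition X_space :: "(real \<times> real) set" where
  "X_space = {(x1, x2). x2 > 0}"

definition Y_space :: "(real \<times> real) set" where
  "Y_space = {(E, x0). E > 0}"

text \<open>Arc length density, with respect to \<open>x1\<close>, of the curve \<open>x2 = E q(\<bar>x1 - x0\<bar>)\<close> at
  \<open>\<bar>x1 - x0\<bar> = r\<close>. It equals the norm of the \<open>x\<close>-gradient of \<open>\<Psi> = x2 - E q(\<bar>x1 - x0\<bar>)\<close>.\<close>

definition arc_density :: "(real \<Rightarrow> real) \<Rightarrow> real \<Rightarrow> real \<Rightarrow> real" where
  "arc_density q E r = sqrt (1 + (E * deriv q r)\<^sup>2)"

definition cone_radon :: "(real \<Rightarrow> real) \<Rightarrow> (real \<times> real \<Rightarrow> complex) \<Rightarrow> real \<times> real \<Rightarrow> complex" where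
  "cone_radon q f = (\<lambda>(E, x0). LINT x1 : - {x0} | lborel.
     complex_of_real (arc_density q E \<bar>x1 - x0\<bar>) * f (x1, E * q \<bar>x1 - x0\<bar>))"

text \<open>The formal adjoint with respect to \<open>dx1 dx2\<close> and \<open>dE dx0\<close>, that is, the integral of
  \<open>\<phi>(E, x0) \<parallel>\<nabla>\<Psi>\<parallel> \<delta>(\<Psi>)\<close> over \<open>(E, x0)\<close>. For fixed \<open>x0\<close> and \<open>x1\<close> substitute \<open>E = x2 / q(\<bar>x1 - x0\<bar>)\<close>
  in the integral of \<open>(R f) \<phi>\<close>; the factor \<open>1/q\<close> is the Jacobian.\<close>

definition cone_backprojection ::
    "(real \<Rightarrow> real) \<Rightarrow> (real \<times> real \<Rightarrow> complex) \<Rightarrow> real \<times> real \<Rightarrow> complex" where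
  "cone_backprojection q \<phi> = (\<lambda>(x1, x2). LINT x0 : - {x1} | lborel.
     complex_of_real (arc_density q (x2 / q \<bar>x1 - x0\<bar>) \<bar>x1 - x0\<bar> / q \<bar>x1 - x0\<bar>)
       * \<phi> (x2 / q \<bar>x1 - x0\<bar>, x0))"

text \<open>Extensions to compactly supported distributions by duality: the backprojection of a
  test function on \<open>Y\<close> is smooth on \<open>X\<close>, and the transform of a test function on \<open>X\<close> is smooth on \<open>Y\<close>
  (neither has compact support in general).\<close>

definition cone_radon_distr ::
    "(real \<Rightarrow> real) \<Rightarrow> ((real \<times> real \<Rightarrow> complex) \<Rightarrow> complex) \<Rightarrow> (real \<times> real \<Rightarrow> complex) \<Rightarrow> complex" where
  "cone_radon_distr q f = (\<lambda>\<phi>. f (cone_backprojection q \<phi>))"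

definition cone_backprojection_distr ::
    "(real \<Rightarrow> real) \<Rightarrow> ((real \<times> real \<Rightarrow> complex) \<Rightarrow> complex) \<Rightarrow> (real \<times> real \<Rightarrow> complex) \<Rightarrow> complex" where
  "cone_backprojection_distr q w = (\<lambda>\<psi>. w (cone_radon q \<psi>))"

text \<open>\<open>Lf = R\<^sup>*(\<chi>\<^sub>A \<partial>\<^sub>E\<^sup>2 R f)\<close>. This is a relation because of the product, see
  \<open>is_distr_product\<close>.\<close>

definition is_cone_reconstruction ::
    "(real \<Rightarrow> real) \<Rightarrow> (real \<times> real) set \<Rightarrow> ((real \<times> real \<Rightarrow> complex) \<Rightarrow> complex)
       \<Rightarrow> ((real \<times> real \<Rightarrow> complex) \<Rightarrow> complex) \<Rightarrow> bool" where
  "is_cone_reconstruction q A f Lf \<longleftrightarrow>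
     (\<exists>w. is_distr_product Y_space (indicator A)
            (distr_deriv (1, 0) (distr_deriv (1, 0) (cone_radon_distr q f))) w \<and>
          Lf = cone_backprojection_distr q w)"

end

theory Submission
  imports Defs "HOL-Probability.Sinc_Integral"
begin

text \<open>Let \<open>w\<close> be the product \<open>\<chi>\<^sub>A \<partial>\<^sub>E\<^sup>2 R f\<close>. It equals \<open>\<partial>\<^sub>E\<^sup>2 R f\<close> inside \<open>A\<close> and vanishes outside \<open>A\<close>.
 Let \<open>e\<^sub>\<xi>(x) = exp (-i x \<cdot> \<xi>)\<close>. Since \<open>g\<close> is injective, the integrals \<open>R (\<phi> e\<^sub>\<xi>) (E, y)\<close> have a stationary
 point over \<open>x\<close> for at most one \<open>(E, y)\<close>. If it lies off \<open>A\<close>, integration by parts in the single integration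
 variable shows that \<open>w (R (\<phi> e\<^sub>\<xi>))\<close> decays rapidly. If it lies inside \<open>A\<close>, let \<open>\<kappa>\<close> be a cutoff near it.
 Then \<open>R\<^sup>* \<partial>\<^sub>E\<^sup>2 \<kappa> R (\<psi> e\<^sub>\<xi>) = e\<^sub>\<xi> P\<close>, where \<open>P\<close> is an oscillatory integral of order 1 in \<open>\<xi>\<close>. Its leading
 coefficient is bounded below: by dominated convergence its limit is the integral of a Fourier transform,
 which is positive by comparison with Fejer kernels. Dividing by this coefficient inverts the operator up
 to order 0. The amplitudes of the remainders are expanded in Fourier series, and a Schur estimate for the
 resulting sums lets regularity pass from \<open>Lf\<close> to \<open>f\<close> by a bootstrap that gains one order per step.\<close>

text \<open>Two obstacles shape the proof. The function \<open>q\<close> is merely continuous at 0,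
  so the curves have no smooth parametrisation at the vertex. With \<open>x\<close> in a rectangle
  of X and \<open>(E, y)\<close> in a rectangle of Y, the relation
  \<open>x2 = E * q (abs (x1 - y))\<close> keeps \<open>abs (x1 - y)\<close> away from 0, and
  \<open>q (abs t)\<close> may be replaced by a positive smooth function \<open>Q\<close>; all
  operators become integrals over a fixed interval. Secondly, the inverse of the leading coefficient
  depends on the frequency \<open>xi\<close> in a way of which only bounds for
  \<open>x\<close>-derivatives are known. Hence amplitudes are families indexed by \<open>xi\<close>
  with uniform bounds, instead of symbols, and the norm estimates use neither derivatives nor
  measurability in \<open>xi\<close>. Only the leading coefficient of an operator of order 1 is
  inverted and the error has order 0, so one step turns regularity \<open>s\<close> of
  \<open>f\<close> into \<open>s + 1\<close>, at the price of a smaller cutoff and cone. The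
  iteration can start because a compactly supported distribution has finite order.\<close>

type_synonym R2 = "real \<times> real"

abbreviation smooth :: "('a::euclidean_space => 'b::real_normed_vector) => bool" where
 "smooth == smooth_on UNIV"

abbreviation dirs :: "'a::euclidean_space list => bool" where
 "dirs vs == set vs \<subseteq> Basis"

abbreviation fderiv :: "('a::real_normed_vector => 'b::real_normed_vector) => 'a => 'a => 'b" where
 "fderiv f x == frechet_derivative f (at x)"

section \<open>Families with uniformly bounded derivatives\<close>

text \<open>The open set \<open>Om\<close> carries differentiability and the set \<open>S\<close>
  the bounds, each constant being uniform over the index set. Keeping them apart lets
  \<open>S = {}\<close> express plain smoothness, so that closure rules are proved once for both
  notions.\<close>

primrec unif_Ck :: "nat => 'a::euclidean_space set => 'a set => 'i set => ('i => 'a => 'b::real_normed_vector) => bool" where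
 "unif_Ck 0 Om S I F \<longleftrightarrow> (\<exists>C. \<forall>i\<in>I. \<forall>x\<in>S. norm (F i x) <= C)"
| "unif_Ck (Suc n) Om S I F \<longleftrightarrow> (\<exists>C. \<forall>i\<in>I. \<forall>x\<in>S. norm (F i x) <= C) &
  (\<forall>i\<in>I. \<forall>x\<in>Om. F i differentiable at x) &
  (\<forall>v\<in>Basis. unif_Ck n Om S I (%i x. fderiv (F i) x v))"

lemma has_derivative_cong_open:
 assumes "open Om" "x \<in> Om" "!!y. y \<in> Om ==> f y = g y"
 shows "(f has_derivative D) (at x) \<longleftrightarrow> (g has_derivative D) (at x)"
 using assms has_derivative_transform_within_open[of f D x UNIV Om g]
  has_derivative_transform_within_open[of g D x UNIV Om f] by auto

lemma frechet_derivative_cong_open: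
 assumes "open Om" "x \<in> Om" "!!y. y \<in> Om ==> f y = g y"
 shows "fderiv f x = fderiv g x"
  and "f differentiable at x \<longleftrightarrow> g differentiable at x"
proof -
 show "fderiv f x = fderiv g x"
  unfolding frechet_derivative_def by (simp only: has_derivative_cong_open[OF assms])
 show "f differentiable at x \<longleftrightarrow> g differentiable at x"
  unfolding differentiable_def by (simp only: has_derivative_cong_open[OF assms])
qed

lemma has_derivative_frechet:
 "f differentiable at x ==> (f has_derivative fderiv f x) (at x)"
 by (simp add: frechet_derivative_works)

lemma unif_Ck_bounded: "unif_Ck n Om S I F ==> \<exists>C. \<forall>i\<in>I. \<forall>x\<in>S. norm (F i x) <= C"
 by (cases n) auto

lemma unif_Ck_cong:
 assumes "open Om" "S \<subseteq> Om" "!!i x. i \<in> I ==> x \<in> Om ==> F i x = G i x"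
 shows "unif_Ck n Om S I F \<longleftrightarrow> unif_Ck n Om S I G"
 using assms(3)
proof (induction n arbitrary: F G)
 case 0
 thus ?case using assms(2) by (auto simp: subset_eq)
next
 case (Suc n)
 have d: "fderiv (F i) x = fderiv (G i) x"
  "F i differentiable at x \<longleftrightarrow> G i differentiable at x" if "i \<in> I" "x \<in> Om" for i x
  using frechet_derivative_cong_open[OF assms(1) that(2), of "F i" "G i"] Suc.prems that(1) by blast+
 have "unif_Ck n Om S I (%i x. fderiv (F i) x v) \<longleftrightarrow>
    unif_Ck n Om S I (%i x. fderiv (G i) x v)" for v
  by (rule Suc.IH) (simp add: d)
 moreover have "(\<forall>i\<in>I. \<forall>x\<in>S. norm (F i x) <= C) \<longleftrightarrow> (\<forall>i\<in>I. \<forall>x\<in>S. norm (G i x) <= C)" for C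
  using Suc.prems assms(2) by (auto simp: subset_eq)
 ultimately show ?case using d by simp
qed

lemma unif_Ck_SucD: "unif_Ck (Suc n) Om S I F ==> unif_Ck n Om S I F"
proof (induction n arbitrary: F)
 case (Suc n)
 hence "unif_Ck n Om S I (%i x. fderiv (F i) x v)" if "v \<in> Basis" for v
  using that by auto
 with Suc.prems show ?case by auto
qed auto

lemma unif_Ck_le: "m <= n ==> unif_Ck n Om S I F ==> unif_Ck m Om S I F"
 by (induction rule: dec_induct) (blast dest: unif_Ck_SucD)+

lemma unif_Ck_mono:
 assumes "unif_Ck n Om S I F" "Om' \<subseteq> Om" "S' \<subseteq> S" "I' \<subseteq> I"
 shows "unif_Ck n Om' S' I' F"
 using assms(1)
proof (induction n arbitrary: F)
 case 0
 then obtain C where "\<forall>i\<in>I. \<forall>x\<in>S. norm (F i x) <= C" by auto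
 thus ?case using assms(2-) by (auto intro!: exI[of _ C])
next
 case (Suc n)
 then obtain C where "\<forall>i\<in>I. \<forall>x\<in>S. norm (F i x) <= C" by auto
 hence "\<exists>C. \<forall>i\<in>I'. \<forall>x\<in>S'. norm (F i x) <= C" using assms(2-) by (auto intro!: exI[of _ C])
 moreover have "\<forall>i\<in>I'. \<forall>x\<in>Om'. F i differentiable at x" using Suc.prems assms(2-)
  unfolding unif_Ck.simps by blast
 ultimately show ?case using Suc by auto
qed

lemma unif_Ck_reindex:
 assumes "unif_Ck n Om S I F" "!!j. j \<in> J ==> h j \<in> I"
 shows "unif_Ck n Om S J (%j. F (h j))"
 using assms(1)
proof (induction n arbitrary: F)
 case 0
 thus ?case using assms(2) by fastforce
next
 case (Suc n)
 then obtain C where "\<forall>i\<in>I. \<forall>x\<in>S. norm (F i x) <= C" by auto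
 hence "\<exists>C. \<forall>j\<in>J. \<forall>x\<in>S. norm (F (h j) x) <= C" using assms(2) by (auto intro!: exI[of _ C])
 moreover have "unif_Ck n Om S J (%j x. fderiv (F (h j)) x v)" if "v \<in> Basis" for v
  by (rule Suc.IH) (use Suc.prems that in auto)
 ultimately show ?case using Suc.prems assms(2) by auto
qed

text \<open>The recursion speaks of \<open>fderiv\<close>, which is awkward for a function given by
  a formula. An explicitly known derivative \<open>F'\<close> may take its place, since the two
  agree on the open set.\<close>

lemma unif_Ck_SucI:
 assumes "open Om" "S \<subseteq> Om" "unif_Ck 0 Om S I F"
  and D: "!!i x. i \<in> I ==> x \<in> Om ==> (F i has_derivative F' i x) (at x)"
  and n: "!!v. v \<in> Basis ==> unif_Ck n Om S I (%i x. F' i x v)"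
 shows "unif_Ck (Suc n) Om S I F"
proof -
 have "unif_Ck n Om S I (%i x. fderiv (F i) x v)" if "v \<in> Basis" for v
  by (rule unif_Ck_cong[THEN iffD1, OF assms(1,2) _ n[OF that]])
   (use frechet_derivative_at[OF D] in auto)
 moreover have "F i differentiable at x" if "i \<in> I" "x \<in> Om" for i x
  using D[OF that] unfolding differentiable_def by blast
 ultimately show ?thesis using assms(3) by simp
qed

lemma unif_Ck_const:
 assumes "\<exists>C. \<forall>i\<in>I. norm (c i) <= C"
 shows "unif_Ck n Om S I (%i x. c i)"
proof (cases n)
 case (Suc m)
 have "unif_Ck m Om S I (%i x. 0)" for m
  by (induction m) (auto simp: frechet_derivative_const intro!: exI[of _ 0])
 thus ?thesis using Suc assms by (auto simp: frechet_derivative_const)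
qed (use assms in auto)

lemma unif_Ck_const' [intro]: "unif_Ck n Om S I (%i x. c)"
 by (rule unif_Ck_const) auto

lemma unif_Ck_blinear:
 assumes L: "bounded_linear L" and "open Om" "S \<subseteq> Om" "unif_Ck n Om S I F"
 shows "unif_Ck n Om S I (%i x. L (F i x))"
 using assms(4)
proof (induction n arbitrary: F)
 case 0
 then obtain C where C: "\<forall>i\<in>I. \<forall>x\<in>S. norm (F i x) <= C" by auto
 obtain K where K: "K >= 0" "!!x. norm (L x) <= norm x * K" using bounded_linear.nonneg_bounded[OF L] by blast
 have "norm (L (F i x)) <= C * K" if "i \<in> I" "x \<in> S" for i x
  using K(2)[of "F i x"] C that mult_right_mono[OF _ K(1), of "norm (F i x)" C] by fastforce
 thus ?case by auto
next
 case (Suc n)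
 show ?case
 proof (rule unif_Ck_SucI[OF assms(2,3)])
  have "unif_Ck 0 Om S I F" using unif_Ck_le[OF _ Suc.prems] by blast
  then obtain C where C: "\<forall>i\<in>I. \<forall>x\<in>S. norm (F i x) <= C" by auto
  obtain K where K: "K >= 0" "!!x. norm (L x) <= norm x * K" using bounded_linear.nonneg_bounded[OF L] by blast
  have "norm (L (F i x)) <= C * K" if "i \<in> I" "x \<in> S" for i x
   using K(2)[of "F i x"] C that mult_right_mono[OF _ K(1), of "norm (F i x)" C] by fastforce
  thus "unif_Ck 0 Om S I (%i x. L (F i x))" by auto
  show "((%x. L (F i x)) has_derivative (%v. L (fderiv (F i) x v))) (at x)"
   if "i \<in> I" "x \<in> Om" for i x
   by (rule bounded_linear.has_derivative[OF L has_derivative_frechet]) (use Suc.prems that in auto)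
  show "unif_Ck n Om S I (%i x. L (fderiv (F i) x v))" if "v \<in> Basis" for v
   by (rule Suc.IH) (use Suc.prems that in auto)
 qed
qed

lemma unif_Ck_add:
 fixes F G :: "'i => 'a::euclidean_space => 'b::real_normed_vector"
 assumes "open Om" "S \<subseteq> Om" "unif_Ck n Om S I F" "unif_Ck n Om S I G"
 shows "unif_Ck n Om S I (%i x. F i x + G i x)"
proof -
 have b: "unif_Ck 0 Om S I (%i x. F i x + G i x)" if h: "unif_Ck n Om S I F" "unif_Ck n Om S I G" for n and F :: "'i => 'a => 'b" and G :: "'i => 'a => 'b"
 proof -
  obtain C D where "\<forall>i\<in>I. \<forall>x\<in>S. norm (F i x) <= C" "\<forall>i\<in>I. \<forall>x\<in>S. norm (G i x) <= D"
   using unif_Ck_bounded[OF h(1)] unif_Ck_bounded[OF h(2)] by blast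
  hence "\<forall>i\<in>I. \<forall>x\<in>S. norm (F i x + G i x) <= C + D"
   by (meson add_mono norm_triangle_ineq order_trans)
  thus ?thesis by auto
 qed
 show ?thesis using assms(3,4)
 proof (induction n arbitrary: F G)
  case 0 show ?case using b[OF 0] .
 next
  case (Suc n)
  show ?case
  proof (rule unif_Ck_SucI[OF assms(1,2) b[OF Suc.prems]])
   show "((%x. F i x + G i x) has_derivative
     (%v. fderiv (F i) x v + fderiv (G i) x v)) (at x)"
    if "i \<in> I" "x \<in> Om" for i x
    by (intro has_derivative_add has_derivative_frechet) (use Suc.prems that in auto)
   show "unif_Ck n Om S I (%i x. fderiv (F i) x v + fderiv (G i) x v)"
    if "v \<in> Basis" for v
    by (rule Suc.IH) (use Suc.prems that in auto)
  qed
 qed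
qed

text \<open>The Leibniz rule produces two products of the same kind, one with a derivative of
  \<open>F\<close> and one with a derivative of \<open>G\<close>; hence the induction generalises
  over both families and lowers the order of the undifferentiated factor by
  \<open>unif_Ck_SucD\<close>.\<close>

lemma unif_Ck_bilinear:
 fixes prod :: "'b::real_normed_vector => 'c::real_normed_vector => 'd::real_normed_vector"
  and F :: "'i => 'a::euclidean_space => 'b" and G :: "'i => 'a => 'c"
 assumes B: "bounded_bilinear prod" and "open Om" "S \<subseteq> Om" "unif_Ck n Om S I F" "unif_Ck n Om S I G"
 shows "unif_Ck n Om S I (%i x. prod (F i x) (G i x))"
proof -
 have b: "unif_Ck 0 Om S I (%i x. prod (F i x) (G i x))" if h: "unif_Ck n Om S I F" "unif_Ck n Om S I G" for n and F :: "'i => 'a => 'b" and G :: "'i => 'a => 'c"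
 proof -
  obtain C D where CD: "\<forall>i\<in>I. \<forall>x\<in>S. norm (F i x) <= C" "\<forall>i\<in>I. \<forall>x\<in>S. norm (G i x) <= D"
   using unif_Ck_bounded[OF h(1)] unif_Ck_bounded[OF h(2)] by blast
  obtain K where K: "K > 0" "!!x y. norm (prod x y) <= norm x * norm y * K"
   using bounded_bilinear.pos_bounded[OF B] by blast
  have "norm (prod (F i x) (G i x)) <= C * D * K" if "i \<in> I" "x \<in> S" for i x
  proof -
   have "norm (F i x) * norm (G i x) <= C * D"
    using CD that by (intro mult_mono) (auto intro: order_trans[OF norm_ge_zero])
   thus ?thesis using K(2)[of "F i x" "G i x"] K(1)
    by (meson dual_order.trans less_imp_le mult_right_mono)
  qed
  thus ?thesis by auto
 qed
 show ?thesis using assms(4,5)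
 proof (induction n arbitrary: F G)
  case 0 show ?case using b[OF 0] .
 next
  case (Suc n)
  show ?case
  proof (rule unif_Ck_SucI[OF assms(2,3) b[OF Suc.prems]])
   show "((%x. prod (F i x) (G i x)) has_derivative
     (%v. prod (F i x) (fderiv (G i) x v) + prod (fderiv (F i) x v) (G i x))) (at x)"
    if "i \<in> I" "x \<in> Om" for i x
    by (rule bounded_bilinear.FDERIV[OF B]; rule has_derivative_frechet) (use Suc.prems that in auto)
   show "unif_Ck n Om S I (%i x. prod (F i x) (fderiv (G i) x v) + prod (fderiv (F i) x v) (G i x))"
    if "v \<in> Basis" for v
    by (intro unif_Ck_add[OF assms(2,3)] Suc.IH)
     (use Suc.prems that unif_Ck_SucD[OF Suc.prems(1)] unif_Ck_SucD[OF Suc.prems(2)] in auto)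
  qed
 qed
qed

lemmas unif_Ck_mult = unif_Ck_bilinear[OF bounded_bilinear_mult]
lemmas unif_Ck_scaleR = unif_Ck_bilinear[OF bounded_bilinear_scaleR]

lemma unif_Ck_minus:
 assumes "open Om" "S \<subseteq> Om" "unif_Ck n Om S I F"
 shows "unif_Ck n Om S I (%i x. - F i x)"
 using unif_Ck_blinear[OF bounded_linear_minus[OF bounded_linear_ident] assms] .

lemma unif_Ck_diff:
 assumes "open Om" "S \<subseteq> Om" "unif_Ck n Om S I F" "unif_Ck n Om S I G"
 shows "unif_Ck n Om S I (%i x. F i x - G i x)"
 using unif_Ck_add[OF assms(1-3) unif_Ck_minus[OF assms(1,2,4)]] by simp

lemma unif_Ck_sum:
 assumes "open Om" "S \<subseteq> Om" "!!k. k \<in> A ==> unif_Ck n Om S I (F k)"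
 shows "unif_Ck n Om S I (%i x. \<Sum>k\<in>A. F k i x)"
 using assms(3)
 by (induction A rule: infinite_finite_induct) (auto intro!: unif_Ck_add[OF assms(1,2)])

lemma unif_Ck_linear:
 assumes L: "bounded_linear L" and "open Om" "S \<subseteq> Om" "bounded S"
 shows "unif_Ck n Om S I (%i x. L x)"
proof -
 obtain C where C: "!!x. x \<in> S ==> norm (L x) <= C"
  using bounded_linear_image[OF assms(4) L] by (auto simp: bounded_iff)
 show ?thesis
 proof (cases n)
  case (Suc m)
  show ?thesis unfolding Suc
  proof (rule unif_Ck_SucI[OF assms(2,3)])
   show "unif_Ck 0 Om S I (%i. L)" using C by auto
   show "(L has_derivative L) (at x)" for x by (rule bounded_linear_imp_has_derivative[OF L])
  qed auto
 qed (use C in auto)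
qed

text \<open>The derivative of \<open>1 / F\<close> is a polynomial in \<open>1 / F\<close> and the
  derivative of \<open>F\<close>, so the bound of order \<open>n\<close> for \<open>1 / F\<close>
  itself yields order \<open>n + 1\<close>.\<close>

lemma unif_Ck_inverse:
 fixes F :: "'i => 'a::euclidean_space => 'b::real_normed_field"
 assumes "open Om" "S \<subseteq> Om" "unif_Ck n Om S I F"
  and nz: "!!i x. i \<in> I ==> x \<in> Om ==> F i x ~= 0"
  and c: "c > 0" "!!i x. i \<in> I ==> x \<in> S ==> norm (F i x) >= c"
 shows "unif_Ck n Om S I (%i x. inverse (F i x))"
proof -
 have b: "unif_Ck 0 Om S I (%i x. inverse (F i x))"
  using c by (auto simp: norm_inverse intro!: exI[of _ "inverse c"] le_imp_inverse_le)
 show ?thesis using assms(3)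
 proof (induction n)
  case (Suc n)
  show ?case
  proof (rule unif_Ck_SucI[OF assms(1,2) b])
   show "((%x. inverse (F i x)) has_derivative
     (%v. - (inverse (F i x) * fderiv (F i) x v * inverse (F i x)))) (at x)"
    if "i \<in> I" "x \<in> Om" for i x
    by (rule Deriv.has_derivative_inverse[OF nz[OF that] has_derivative_frechet[of "F i"]]) (use Suc.prems that in auto)
   show "unif_Ck n Om S I (%i x. - (inverse (F i x) * fderiv (F i) x v * inverse (F i x)))"
    if "v \<in> Basis" for v
    by (intro unif_Ck_minus unif_Ck_mult assms Suc.IH) (use Suc.prems that unif_Ck_SucD[OF Suc.prems] in auto)
  qed
 qed (use b in auto)
qed

text \<open>The chain rule is written as a sum over basis vectors: each summand contains a partial
  derivative of \<open>F\<close> composed with the unchanged \<open>G\<close>, to which the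
  induction hypothesis applies.\<close>

lemma unif_Ck_compose:
 fixes G :: "'i => 'c::euclidean_space => 'a::euclidean_space"
 assumes "open Om" "S \<subseteq> Om" "open Om'" "S' \<subseteq> Om'" "unif_Ck n Om' S' I F" "unif_Ck n Om S I G"
  and "!!i x. i \<in> I ==> x \<in> Om ==> G i x \<in> Om'" and "!!i x. i \<in> I ==> x \<in> S ==> G i x \<in> S'"
 shows "unif_Ck n Om S I (%i x. F i (G i x))"
proof -
 have b: "unif_Ck 0 Om S I (%i x. F i (G i x))" if "unif_Ck n Om' S' I F" for n F
  using unif_Ck_bounded[OF that] assms(8) by fastforce
 show ?thesis using assms(5,6)
 proof (induction n arbitrary: F)
  case 0 show ?case using b[OF 0(1)] .
 next
  case (Suc n)
  show ?case
  proof (rule unif_Ck_SucI[OF assms(1,2) b[OF Suc.prems(1)]])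
   show "((%x. F i (G i x)) has_derivative
     (%v. \<Sum>b\<in>Basis. (fderiv (G i) x v \<bullet> b) *\<^sub>R fderiv (F i) (G i x) b)) (at x)"
    if "i \<in> I" "x \<in> Om" for i x
   proof -
    have F: "(F i has_derivative fderiv (F i) (G i x)) (at (G i x))"
     by (rule has_derivative_frechet) (use Suc.prems that assms(7) in auto)
    have *: "((%x. F i (G i x)) has_derivative
     (%v. fderiv (F i) (G i x) (fderiv (G i) x v))) (at x)"
     by (rule has_derivative_compose[OF has_derivative_frechet[of "G i"] F]) (use Suc.prems that in auto)
    have eq: "fderiv (F i) (G i x) w =
     (\<Sum>b\<in>Basis. (w \<bullet> b) *\<^sub>R fderiv (F i) (G i x) b)" for w
    proof -
     interpret linear "fderiv (F i) (G i x)"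
      using F has_derivative_linear by blast
     show ?thesis
      by (subst euclidean_representation[of w, symmetric], subst sum) (simp add: scaleR)
    qed
    show ?thesis by (rule has_derivative_eq_rhs[OF *]) (rule ext, rule eq)
   qed
   show "unif_Ck n Om S I (%i x. \<Sum>b\<in>Basis. (fderiv (G i) x v \<bullet> b) *\<^sub>R fderiv (F i) (G i x) b)"
    if "v \<in> Basis" for v
   proof (intro unif_Ck_sum assms unif_Ck_scaleR)
    fix b :: 'a assume "b \<in> Basis"
    show "unif_Ck n Om S I (%i x. fderiv (G i) x v \<bullet> b)"
     by (rule unif_Ck_blinear[OF bounded_linear_inner_left assms(1,2)]) (use Suc.prems that in auto)
    show "unif_Ck n Om S I (%i x. fderiv (F i) (G i x) b)"
     by (rule Suc.IH) (use Suc.prems \<open>b \<in> Basis\<close> unif_Ck_SucD[OF Suc.prems(2)] in auto)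
   qed
  qed
 qed
qed

section \<open>Iterated partial derivatives and smooth functions on open sets\<close>

lemma iter_deriv_append: "iter_deriv (us @ vs) f = iter_deriv us (iter_deriv vs f)"
 by (induction us) auto

lemma iter_deriv_cong_open:
 assumes "open Om" "x \<in> Om" "!!y. y \<in> Om ==> f y = g y"
 shows "iter_deriv vs f x = iter_deriv vs g x"
 using assms(2)
proof (induction vs arbitrary: x)
 case (Cons v vs)
 have "fderiv (iter_deriv vs f) x = fderiv (iter_deriv vs g) x"
  by (rule frechet_derivative_cong_open(1)[OF assms(1) Cons.prems Cons.IH])
 thus ?case by simp
qed (use assms(3) in simp)

text \<open>\<open>unif_Ck\<close> peels off the derivative that is applied first, which is the last
  entry of the list; therefore the induction runs from the end of \<open>vs\<close>.\<close>

lemma unif_Ck_iter_deriv: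
 assumes "unif_Ck n Om S I F" "length vs <= n" "dirs vs"
 shows "unif_Ck (n - length vs) Om S I (%i. iter_deriv vs (F i))"
 using assms
proof (induction vs arbitrary: n F rule: rev_induct)
 case (snoc v vs)
 then obtain m where n: "n = Suc m" by (cases n) auto
 have "unif_Ck (m - length vs) Om S I (%i. iter_deriv vs (%x. fderiv (F i) x v))"
  by (rule snoc.IH) (use snoc.prems n in auto)
 thus ?case by (simp add: iter_deriv_append n)
qed auto

lemma unif_Ck_iff:
 assumes "open Om"
 shows "unif_Ck n Om S I F \<longleftrightarrow>
  (\<forall>vs. dirs vs --> length vs < n --> (\<forall>i\<in>I. \<forall>x\<in>Om. iter_deriv vs (F i) differentiable at x)) &
  (\<forall>vs. dirs vs --> length vs <= n --> (\<exists>C. \<forall>i\<in>I. \<forall>x\<in>S. norm (iter_deriv vs (F i) x) <= C))"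
 (is "_ \<longleftrightarrow> ?R n F")
proof
 assume L: "unif_Ck n Om S I F"
 show "?R n F"
 proof (intro conjI allI impI)
  fix vs :: "'a list" assume vs: "dirs vs" "length vs < n"
  then obtain k where "n - length vs = Suc k" by (metis Suc_diff_Suc)
  with unif_Ck_iter_deriv[OF L, of vs] vs
  show "\<forall>i\<in>I. \<forall>x\<in>Om. iter_deriv vs (F i) differentiable at x" by auto
 next
  fix vs :: "'a list" assume vs: "dirs vs" "length vs <= n"
  from unif_Ck_bounded[OF unif_Ck_iter_deriv[OF L vs(2,1)]]
  show "\<exists>C. \<forall>i\<in>I. \<forall>x\<in>S. norm (iter_deriv vs (F i) x) <= C" .
 qed
next
 show "?R n F ==> unif_Ck n Om S I F"
 proof (induction n arbitrary: F)
  case 0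
  thus ?case by (metis iter_deriv.simps(1) list.size(3) order_refl set_empty2 empty_subsetI unif_Ck.simps(1))
 next
  case (Suc n)
  have "\<exists>C. \<forall>i\<in>I. \<forall>x\<in>S. norm (iter_deriv [] (F i) x) <= C"
   by (rule conjunct2[OF Suc.prems, rule_format]) auto
  moreover have "\<forall>i\<in>I. \<forall>x\<in>Om. iter_deriv [] (F i) differentiable at x"
   using conjunct1[OF Suc.prems, rule_format, of "[]"] by auto
  moreover have "unif_Ck n Om S I (%i x. fderiv (F i) x v)" if v: "v \<in> Basis" for v
  proof (rule Suc.IH, intro conjI allI impI)
   fix vs :: "'a list" assume vs: "dirs vs" "length vs < n"
   show "\<forall>i\<in>I. \<forall>x\<in>Om. iter_deriv vs (%x. fderiv (F i) x v) differentiable at x"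
    using conjunct1[OF Suc.prems, rule_format, of "vs @ [v]"] vs v by (auto simp: iter_deriv_append)
  next
   fix vs :: "'a list" assume vs: "dirs vs" "length vs <= n"
   show "\<exists>C. \<forall>i\<in>I. \<forall>x\<in>S. norm (iter_deriv vs (%x. fderiv (F i) x v) x) <= C"
    using conjunct2[OF Suc.prems, rule_format, of "vs @ [v]"] vs v by (auto simp: iter_deriv_append)
  qed
  ultimately show ?case by simp
 qed
qed

lemma smooth_on_differentiable:
 assumes "open Om"
 shows "smooth_on Om f \<longleftrightarrow> (\<forall>vs. dirs vs --> (\<forall>x\<in>Om. iter_deriv vs f differentiable at x))"
proof -
 have "h differentiable (at x within Om) \<longleftrightarrow> h differentiable (at x)" if "x \<in> Om" for x and h :: "'a => 'b"
  using at_within_open[OF that assms] by simp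
 thus ?thesis unfolding smooth_on_def differentiable_on_def by (metis (no_types, lifting))
qed

text \<open>With an empty set for the bounds only differentiability remains. The index type
  \<open>unit\<close> turns a single function into a family.\<close>

lemma smooth_on_iff_Ck:
 assumes "open Om"
 shows "smooth_on Om f \<longleftrightarrow> (\<forall>n. unif_Ck n Om {} UNIV (%i::unit. f))"
proof -
 have "(\<forall>n. unif_Ck n Om {} UNIV (%i::unit. f)) \<longleftrightarrow>
  (\<forall>n vs. dirs vs --> length vs < n --> (\<forall>x\<in>Om. iter_deriv vs f differentiable at x))"
  unfolding unif_Ck_iff[OF assms] by auto
 also have "... \<longleftrightarrow> smooth_on Om f"
  unfolding smooth_on_differentiable[OF assms] by (meson lessI)
 finally show ?thesis by simp
qed

lemma unif_Ck_imp_smooth_on: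
 assumes "open Om" "!!n. unif_Ck n Om S I F" "i \<in> I"
 shows "smooth_on Om (F i)"
 unfolding smooth_on_iff_Ck[OF assms(1)]
 using unif_Ck_reindex[OF unif_Ck_mono[OF assms(2) order_refl empty_subsetI order_refl], of "UNIV :: unit set" "%_. i"] assms(3) by simp

lemma smooth_on_iter_deriv:
 assumes "open Om" "smooth_on Om f" "dirs vs"
 shows "smooth_on Om (iter_deriv vs f)"
 using assms(2,3) unfolding smooth_on_differentiable[OF assms(1)]
 by (simp flip: iter_deriv_append)

lemma smooth_on_frechet:
 assumes "open Om" "smooth_on Om f" "v \<in> Basis"
 shows "smooth_on Om (%x. fderiv f x v)"
 using smooth_on_iter_deriv[OF assms(1,2), of "[v]"] assms(3) by simp

lemma smooth_on_imp_differentiable: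
 assumes "open Om" "smooth_on Om f" "x \<in> Om"
 shows "f differentiable at x"
 using assms(2,3) unfolding smooth_on_differentiable[OF assms(1)]
 by (metis iter_deriv.simps(1) set_empty2 empty_subsetI)

lemma smooth_on_imp_continuous_on:
 "open Om ==> smooth_on Om f ==> continuous_on Om f"
 by (auto simp: continuous_on_eq_continuous_at dest!: smooth_on_imp_differentiable
   intro!: differentiable_imp_continuous_within)

lemma smooth_on_cong:
 assumes "open Om" "!!x. x \<in> Om ==> f x = g x"
 shows "smooth_on Om f \<longleftrightarrow> smooth_on Om g"
 unfolding smooth_on_iff_Ck[OF assms(1)]
 by (intro iff_allI unif_Ck_cong[OF assms(1) empty_subsetI] assms(2))

lemma smooth_on_local:
 assumes "open Om"
  and "!!x. x \<in> Om ==> \<exists>U h. open U & x \<in> U & smooth_on U h & (\<forall>y\<in>U. f y = h y)"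
 shows "smooth_on Om f"
 unfolding smooth_on_differentiable[OF assms(1)]
proof (intro allI impI ballI)
 fix vs :: "'a list" and x assume vs: "dirs vs" "x \<in> Om"
 obtain U h where U: "open U" "x \<in> U" "smooth_on U h" "!!y. y \<in> U ==> f y = h y"
  using assms(2)[OF vs(2)] by auto
 have "iter_deriv vs h differentiable at x"
  using U vs smooth_on_differentiable by blast
 moreover have "iter_deriv vs f y = iter_deriv vs h y" if "y \<in> U" for y
  using iter_deriv_cong_open[OF U(1) that U(4)] .
 ultimately show "iter_deriv vs f differentiable at x"
  using frechet_derivative_cong_open(2)[OF U(1,2), of "iter_deriv vs f" "iter_deriv vs h"] by blast
qed

lemma smooth_on_subset: "open Om ==> open Om' ==> Om' \<subseteq> Om ==> smooth_on Om f ==> smooth_on Om' f"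
 unfolding smooth_on_def using differentiable_on_subset by blast

lemma smooth_on_imp_unif_Ck:
 assumes "open Om" "compact S" "S \<subseteq> Om" "smooth_on Om f"
 shows "unif_Ck n Om S I (%i. f)"
proof -
 have "\<exists>C. \<forall>x\<in>S. norm (iter_deriv vs f x) <= C" if "dirs vs" for vs
 proof -
  have "continuous_on S (iter_deriv vs f)"
   using smooth_on_imp_continuous_on[OF assms(1) smooth_on_iter_deriv[OF assms(1,4) that]] assms(3) continuous_on_subset by blast
  hence "bounded (iter_deriv vs f ` S)"
   by (intro compact_imp_bounded compact_continuous_image assms(2))
  thus ?thesis by (auto simp: bounded_iff)
 qed
 thus ?thesis unfolding unif_Ck_iff[OF assms(1)]
  using assms(4)[unfolded smooth_on_differentiable[OF assms(1)]] by blast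
qed

lemma smooth_on_const: "open Om ==> smooth_on Om (%x. c)"
 by (simp add: smooth_on_iff_Ck unif_Ck_const')

lemma smooth_on_blinear:
 assumes "open Om" "bounded_linear L" "smooth_on Om f"
 shows "smooth_on Om (%x. L (f x))"
 using assms(3) unfolding smooth_on_iff_Ck[OF assms(1)]
 by (intro allI unif_Ck_blinear[OF assms(2,1) empty_subsetI]) (rule spec)

lemma smooth_on_linear:
 assumes "open Om" "bounded_linear L"
 shows "smooth_on Om (%x. L x)"
 unfolding smooth_on_iff_Ck[OF assms(1)]
 by (intro allI unif_Ck_linear[OF assms(2,1)]) auto

lemma smooth_on_add:
 assumes "open Om" "smooth_on Om f" "smooth_on Om g"
 shows "smooth_on Om (%x. f x + g x)"
 using assms(2,3) unfolding smooth_on_iff_Ck[OF assms(1)]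
 by (auto intro: unif_Ck_add[OF assms(1) empty_subsetI])

lemma smooth_on_minus: "open Om ==> smooth_on Om f ==> smooth_on Om (%x. - f x)"
 by (rule smooth_on_blinear[OF _ bounded_linear_minus[OF bounded_linear_ident]])

lemma smooth_on_diff:
 assumes "open Om" "smooth_on Om f" "smooth_on Om g"
 shows "smooth_on Om (%x. f x - g x)"
 using smooth_on_add[OF assms(1,2) smooth_on_minus[OF assms(1,3)]] by simp

lemma smooth_on_bilinear:
 fixes prod :: "'b::real_normed_vector => 'c::real_normed_vector => 'd::real_normed_vector"
 assumes "open Om" "bounded_bilinear prod" "smooth_on Om f" "smooth_on Om g"
 shows "smooth_on Om (%x. prod (f x) (g x))"
 using assms(3,4) unif_Ck_bilinear[OF assms(2,1) empty_subsetI, of _ UNIV "%i::unit. f" "%i. g"]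
 unfolding smooth_on_iff_Ck[OF assms(1)] by auto

lemmas smooth_on_mult = smooth_on_bilinear[OF _ bounded_bilinear_mult]

lemma smooth_on_inverse:
 fixes f :: "'a::euclidean_space => 'b::real_normed_field"
 assumes "open Om" "smooth_on Om f" "!!x. x \<in> Om ==> f x ~= 0"
 shows "smooth_on Om (%x. inverse (f x))"
 using assms(2) unfolding smooth_on_iff_Ck[OF assms(1)]
 by (intro allI unif_Ck_inverse[OF assms(1) empty_subsetI, where c = 1]) (auto simp: assms(3))

lemma smooth_on_divide:
 fixes f :: "'a::euclidean_space => 'b::real_normed_field"
 assumes "open Om" "smooth_on Om f" "smooth_on Om g" "!!x. x \<in> Om ==> g x ~= 0"
 shows "smooth_on Om (%x. f x / g x)"
 unfolding divide_inverse by (intro smooth_on_mult smooth_on_inverse assms)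

lemma smooth_on_compose:
 assumes "open Om" "open Om'" "smooth_on Om' f" "smooth_on Om g" "!!x. x \<in> Om ==> g x \<in> Om'"
 shows "smooth_on Om (%x. f (g x))"
 using assms(3-) unif_Ck_compose[OF assms(1) empty_subsetI assms(2) empty_subsetI, of _ UNIV "%i::unit. f" "%i. g"]
 unfolding smooth_on_iff_Ck[OF assms(1)] smooth_on_iff_Ck[OF assms(2)] by auto

lemma unif_Ck_exp:
 fixes F :: "'i => 'a::euclidean_space => complex"
 assumes "open Om" "S \<subseteq> Om" "unif_Ck n Om S I F"
 shows "unif_Ck n Om S I (%i x. exp (F i x))"
proof -
 obtain C where C: "\<forall>i\<in>I. \<forall>x\<in>S. norm (F i x) <= C" using unif_Ck_bounded[OF assms(3)] by blast
 have b: "unif_Ck 0 Om S I (%i x. exp (F i x))"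
  using C by (auto intro!: exI[of _ "exp C"] order_trans[OF complex_Re_le_cmod])
 show ?thesis using assms(3)
 proof (induction n)
  case (Suc n)
  show ?case
  proof (rule unif_Ck_SucI[OF assms(1,2) b])
   show "((%x. exp (F i x)) has_derivative (%v. exp (F i x) * fderiv (F i) x v)) (at x)"
    if "i \<in> I" "x \<in> Om" for i x
   proof -
    have "(exp has_derivative (*) (exp (F i x))) (at (F i x))"
     using DERIV_exp[of "F i x"] by (simp add: has_field_derivative_def)
    from has_derivative_compose[OF has_derivative_frechet[of "F i"] this]
    show ?thesis using Suc.prems that by auto
   qed
   show "unif_Ck n Om S I (%i x. exp (F i x) * fderiv (F i) x v)"
    if "v \<in> Basis" for v
    by (intro unif_Ck_mult assms Suc.IH) (use Suc.prems that unif_Ck_SucD[OF Suc.prems] in auto)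
  qed
 qed (use b in auto)
qed

lemma smooth_on_exp:
 fixes f :: "'a::euclidean_space => complex"
 assumes "open Om" "smooth_on Om f"
 shows "smooth_on Om (%x. exp (f x))"
 using assms(2) unif_Ck_exp[OF assms(1) empty_subsetI, of _ UNIV "%i::unit. f"]
 unfolding smooth_on_iff_Ck[OF assms(1)] by auto

text \<open>Up to the factor 1/2 the derivative is the reciprocal of the function itself, so order
  \<open>n\<close> of \<open>sqrt\<close> passes through \<open>unif_Ck_inverse\<close> to order
  \<open>n\<close> of its derivative.\<close>

lemma smooth_on_sqrt: "smooth_on {0<..} sqrt"
proof -
 have "unif_Ck n {0<..} {} UNIV (%i::unit. sqrt)" for n
 proof (induction n)
  case (Suc n)
  show ?case
  proof (rule unif_Ck_SucI)
   show "(sqrt has_derivative (%v. v * (inverse (sqrt x) / 2))) (at x)" if "x \<in> {0<..}" for x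
    using DERIV_real_sqrt[of x] that by (auto simp: has_field_derivative_def mult.commute[of _ "inverse (sqrt x) / 2"] elim!: has_derivative_eq_rhs)
   have "unif_Ck n {0<..} {} UNIV (%(i::unit) x. inverse (sqrt x))"
    by (rule unif_Ck_inverse[OF _ _ Suc, of 1]) auto
   from unif_Ck_blinear[OF bounded_linear_mult_right[of "1/2"] _ _ this]
   show "unif_Ck n {0<..} {} UNIV (%(i::unit) x. v * (inverse (sqrt x) / 2))" if "v \<in> Basis" for v
    using that by simp
  qed auto
 qed simp
 thus ?thesis by (simp add: smooth_on_iff_Ck)
qed

lemma unif_Ck_Pair:
 assumes "open Om" "S \<subseteq> Om" "unif_Ck n Om S I F" "unif_Ck n Om S I G"
 shows "unif_Ck n Om S I (%i x. (F i x, G i x))"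
proof -
 have "unif_Ck n Om S I (%i x. (F i x, 0) + (0, G i x))"
  by (intro unif_Ck_add assms unif_Ck_blinear[OF _ assms(1,2), of "%x. (x, 0)"] unif_Ck_blinear[OF _ assms(1,2), of "%x. (0, x)"])
   (auto intro!: bounded_linear_Pair bounded_linear_zero bounded_linear_ident)
 thus ?thesis by simp
qed

lemma smooth_on_Pair:
 assumes "open Om" "smooth_on Om f" "smooth_on Om g"
 shows "smooth_on Om (%x. (f x, g x))"
 using assms(2,3) unfolding smooth_on_iff_Ck[OF assms(1)]
 by (auto intro: unif_Ck_Pair[OF assms(1) empty_subsetI])

lemma smooth_on_sum:
 assumes "open Om" "!!k. k \<in> A ==> smooth_on Om (f k)"
 shows "smooth_on Om (%x. \<Sum>k\<in>A. f k x)"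
 using assms(2)
 by (induction A rule: infinite_finite_induct) (auto intro!: smooth_on_add smooth_on_const assms(1))

lemma unif_Ck_smooth:
 assumes "!!i. i \<in> I ==> smooth (F i)" and "!!vs. dirs vs ==> length vs <= n ==> \<exists>C. \<forall>i\<in>I. \<forall>x\<in>S. norm (iter_deriv vs (F i) x) <= C"
 shows "unif_Ck n UNIV S I F"
 unfolding unif_Ck_iff[OF open_UNIV] using assms unfolding smooth_on_differentiable[OF open_UNIV] by blast

lemma smooth_comp:
 "smooth f ==> smooth_on Om g ==> open Om ==> smooth_on Om (%x. f (g x))"
 by (rule smooth_on_compose[OF _ open_UNIV]) auto

lemma smooth_unif_Ck: "compact S ==> smooth f ==> unif_Ck n UNIV S I (%i. f)"
 by (rule smooth_on_imp_unif_Ck[OF open_UNIV _ subset_UNIV])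

lemma smooth_continuous: "smooth f ==> continuous_on A f"
 by (rule continuous_on_subset[OF smooth_on_imp_continuous_on[OF open_UNIV] subset_UNIV])

lemma smooth_isCont: "smooth f ==> isCont f x"
 by (metis continuous_on_eq_continuous_at open_UNIV UNIV_I smooth_continuous)

lemma smooth_has_derivative: "smooth f ==> (f has_derivative fderiv f x) (at x)"
 by (rule has_derivative_frechet[OF smooth_on_imp_differentiable[OF open_UNIV _ UNIV_I]])

lemmas unif_Ck_comp = unif_Ck_compose[OF open_UNIV subset_UNIV open_UNIV subset_UNIV]
lemmas unif_Ck_times = unif_Ck_mult[OF open_UNIV subset_UNIV]
lemmas unif_Ck_imp_smooth = unif_Ck_imp_smooth_on[OF open_UNIV]
lemmas smooth_iter_deriv = smooth_on_iter_deriv[OF open_UNIV]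

lemma iter_deriv_add:
 assumes "open Om" "smooth_on Om f" "smooth_on Om g" "dirs vs" "x \<in> Om"
 shows "iter_deriv vs (%x. f x + g x) x = iter_deriv vs f x + iter_deriv vs g x"
 using assms(4,5)
proof (induction vs arbitrary: x)
 case (Cons v vs)
 have d: "iter_deriv vs f differentiable at x" "iter_deriv vs g differentiable at x"
  using Cons.prems assms smooth_on_differentiable[OF assms(1)] by (metis insert_subset list.simps(15))+
 have "fderiv (iter_deriv vs (%x. f x + g x)) x =
   fderiv (%x. iter_deriv vs f x + iter_deriv vs g x) x"
  by (rule frechet_derivative_cong_open(1)[OF assms(1) Cons.prems(2) Cons.IH]) (use Cons.prems in auto)
 also have "... = (%v. fderiv (iter_deriv vs f) x v + fderiv (iter_deriv vs g) x v)"
  by (rule frechet_derivative_at[symmetric]) (intro has_derivative_add has_derivative_frechet d)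
 finally show ?case by simp
qed simp

lemma iter_deriv_blinear:
 assumes "open Om" "smooth_on Om f" "dirs vs" "x \<in> Om" "bounded_linear L"
 shows "iter_deriv vs (%x. L (f x)) x = L (iter_deriv vs f x)"
 using assms(3,4)
proof (induction vs arbitrary: x)
 case (Cons v vs)
 have d: "iter_deriv vs f differentiable at x"
  using Cons.prems assms smooth_on_differentiable[OF assms(1)] by (metis insert_subset list.simps(15))
 have "fderiv (iter_deriv vs (%x. L (f x))) x =
   fderiv (%x. L (iter_deriv vs f x)) x"
  by (rule frechet_derivative_cong_open(1)[OF assms(1) Cons.prems(2) Cons.IH]) (use Cons.prems in auto)
 also have "... = (%v. L (fderiv (iter_deriv vs f) x v))"
  by (rule frechet_derivative_at[symmetric], rule bounded_linear.has_derivative[OF assms(5)], rule has_derivative_frechet[OF d])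
 finally show ?case by simp
qed simp

lemma iter_deriv_cmult:
 fixes f :: "'a::euclidean_space => complex"
 assumes "open Om" "smooth_on Om f" "dirs vs" "x \<in> Om"
 shows "iter_deriv vs (%x. c * f x) x = c * iter_deriv vs f x"
 using iter_deriv_blinear[OF assms bounded_linear_mult_right] .

lemma iter_deriv_diff:
 assumes "open Om" "smooth_on Om f" "smooth_on Om g" "dirs vs" "x \<in> Om"
 shows "iter_deriv vs (%x. f x - g x) x = iter_deriv vs f x - iter_deriv vs g x"
 using iter_deriv_add[OF assms(1,2) smooth_on_minus[OF assms(1,3)] assms(4,5)]
  iter_deriv_blinear[OF assms(1,3,4,5) bounded_linear_minus[OF bounded_linear_ident]] by simp

section \<open>Cutoff functions\<close>

text \<open>For \<open>k = 0\<close> this is the classical flat function. The powers of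
  \<open>1 / x\<close> make the family closed under differentiation up to linear combinations, so
  smoothness follows by one induction over the order for all \<open>k\<close> at once.\<close>

definition flat_fun :: "nat => real => real" where
 "flat_fun k x = (if x > 0 then inverse x ^ k * exp (- inverse x) else 0)"

lemma flat_fun_tendsto_0: "((%x. flat_fun k x) \<longlongrightarrow> 0) (at 0)"
proof -
 have "((%x::real. (inverse x) ^ k / exp (inverse x)) \<longlongrightarrow> 0) (at_right 0)"
  by (rule filterlim_compose[OF tendsto_power_div_exp_0 filterlim_inverse_at_top_right])
 hence r: "(flat_fun k \<longlongrightarrow> 0) (at_right 0)"
  by (rule filterlim_cong[THEN iffD1, rotated -1])
   (auto simp: eventually_at_right_field flat_fun_def exp_minus divide_inverse intro!: exI[of _ 1])
 have l: "(flat_fun k \<longlongrightarrow> 0) (at_left 0)"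
  by (rule tendsto_eventually) (auto simp: eventually_at_left_field flat_fun_def intro!: exI[of _ "-1"])
 from filterlim_split_at[OF l r] show ?thesis by simp
qed

lemma flat_fun_deriv:
 "(flat_fun k has_real_derivative (- real k * flat_fun (Suc k) x + flat_fun (Suc (Suc k)) x)) (at x)"
proof (cases x "0::real" rule: linorder_cases)
 case less
 have "((%x. 0::real) has_real_derivative 0) (at x)" by simp
 hence "(flat_fun k has_real_derivative 0) (at x)"
  by (rule DERIV_cong_ev[THEN iffD1, OF refl _ refl, rotated])
   (use less in \<open>auto simp: flat_fun_def eventually_nhds intro!: exI[of _ "{..<0}"]\<close>)
 thus ?thesis using less by (simp add: flat_fun_def)
next
 case equal
 \<comment> \<open>At 0 the difference quotient of \<open>flat_fun k\<close> is
   \<open>flat_fun (Suc k)\<close>, which tends to 0.\<close>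
 have "((%h. (flat_fun k (0 + h) - flat_fun k 0) / h) \<longlongrightarrow> 0) (at 0)"
  by (rule filterlim_cong[THEN iffD1, OF refl refl _ flat_fun_tendsto_0[of "Suc k"]])
   (auto simp: eventually_at flat_fun_def divide_inverse intro!: exI[of _ 1])
 hence "(flat_fun k has_real_derivative 0) (at 0)" by (simp add: DERIV_def)
 thus ?thesis using equal by (simp add: flat_fun_def)
next
 case greater
 have "((%x. inverse x ^ k * exp (- inverse x)) has_real_derivative
   (- real k * flat_fun (Suc k) x + flat_fun (Suc (Suc k)) x)) (at x)"
 proof -
  have "((%x. inverse x ^ k * exp (- inverse x)) has_real_derivative
   inverse x ^ k * (exp (- inverse x) * inverse x ^ 2) +
   (real k * (- (inverse x ^ 2) * inverse x ^ (k - 1))) * exp (- inverse x)) (at x)"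
   by (rule derivative_eq_intros refl | use greater in \<open>simp add: power2_eq_square\<close>)+
  also have "inverse x ^ k * (exp (- inverse x) * inverse x ^ 2) +
   (real k * (- (inverse x ^ 2) * inverse x ^ (k - 1))) * exp (- inverse x)
   = - real k * flat_fun (Suc k) x + flat_fun (Suc (Suc k)) x"
   using greater by (cases k) (auto simp: flat_fun_def power2_eq_square algebra_simps)
  finally show ?thesis .
 qed
 thus ?thesis
  by (rule DERIV_cong_ev[THEN iffD1, OF refl _ refl, rotated])
   (use greater in \<open>auto simp: flat_fun_def eventually_nhds intro!: exI[of _ "{0<..}"]\<close>)
qed

lemma smooth_on_flat_fun: "smooth (flat_fun k)"
proof -
 have "\<forall>k. unif_Ck n UNIV {} UNIV (%i::unit. flat_fun k)" for n
 proof (induction n)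
  case (Suc n)
  show ?case
  proof
   fix k
   show "unif_Ck (Suc n) UNIV {} UNIV (%i::unit. flat_fun k)"
   proof (rule unif_Ck_SucI)
    show "(flat_fun k has_derivative (%v. (- real k * flat_fun (Suc k) x + flat_fun (Suc (Suc k)) x) * v)) (at x)" for x
     using flat_fun_deriv[of k x] by (simp add: has_field_derivative_def)
    have "unif_Ck n UNIV {} UNIV (%(i::unit) x. - real k * flat_fun (Suc k) x + flat_fun (Suc (Suc k)) x)"
     by (intro unif_Ck_add unif_Ck_mult unif_Ck_const') (use Suc in auto)
    thus "unif_Ck n UNIV {} UNIV (%(i::unit) x. (- real k * flat_fun (Suc k) x + flat_fun (Suc (Suc k)) x) * v)" if "v \<in> Basis" for v
     using that by simp
   qed auto
  qed
 qed simp
 thus ?thesis by (simp add: smooth_on_iff_Ck)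
qed

definition smooth_step :: "real => real" where
 "smooth_step x = flat_fun 0 x / (flat_fun 0 x + flat_fun 0 (1 - x))"

lemma flat_fun_nonneg: "flat_fun k x >= 0" by (simp add: flat_fun_def)

lemma smooth_step_denom: "flat_fun 0 x + flat_fun 0 (1 - x) > 0"
 by (cases "x > 0") (auto simp: flat_fun_def add_pos_nonneg)

lemma smooth_step_simps: "x <= 0 ==> smooth_step x = 0" "x >= 1 ==> smooth_step x = 1"
 using smooth_step_denom[of x] by (auto simp: smooth_step_def flat_fun_def)

lemma smooth_step_range: "smooth_step x \<in> {0..1}"
 using smooth_step_denom[of x] flat_fun_nonneg[of 0 x] flat_fun_nonneg[of 0 "1 - x"]
 by (auto simp: smooth_step_def)

lemma smooth_on_smooth_step: "smooth smooth_step"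
 unfolding smooth_step_def[abs_def]
proof (rule smooth_on_divide[OF open_UNIV])
 have "smooth (%x. flat_fun 0 (1 - x))"
  by (intro smooth_comp[OF smooth_on_flat_fun] smooth_on_diff smooth_on_const smooth_on_linear) (auto intro: bounded_linear_ident)
 thus "smooth (%x. flat_fun 0 x + flat_fun 0 (1 - x))"
  by (intro smooth_on_add smooth_on_flat_fun) auto
 show "flat_fun 0 x + flat_fun 0 (1 - x) ~= 0" for x
  using smooth_step_denom[of x] by simp
qed (rule smooth_on_flat_fun)

definition plateau :: "real => real => real => real => real => real" where
 "plateau a' a b b' x = smooth_step ((x - a') / (a - a')) * smooth_step ((b' - x) / (b' - b))"

lemma plateau_range: "plateau a' a b b' x \<in> {0..1}"
 using smooth_step_range[of "(x - a') / (a - a')"] smooth_step_range[of "(b' - x) / (b' - b)"]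
 by (auto simp: plateau_def intro: mult_le_one)

lemma plateau_eq_1: "a' < a ==> b < b' ==> x \<in> {a..b} ==> plateau a' a b b' x = 1"
 by (simp add: plateau_def smooth_step_simps)

lemma plateau_eq_0: "a' < a ==> b < b' ==> x \<notin> {a'<..<b'} ==> plateau a' a b b' x = 0"
 by (auto simp: plateau_def smooth_step_simps not_less divide_nonpos_pos)

lemma smooth_on_plateau: "smooth (plateau a' a b b')"
 unfolding plateau_def[abs_def]
proof (rule smooth_on_mult[OF open_UNIV])
 show "smooth (%x. smooth_step ((x - a') / (a - a')))"
  unfolding divide_inverse
  by (intro smooth_comp[OF smooth_on_smooth_step] smooth_on_mult smooth_on_diff smooth_on_const smooth_on_linear) (auto intro: bounded_linear_ident)
 show "smooth (%x. smooth_step ((b' - x) / (b' - b)))"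
  unfolding divide_inverse
  by (intro smooth_comp[OF smooth_on_smooth_step] smooth_on_mult smooth_on_diff smooth_on_const smooth_on_linear) (auto intro: bounded_linear_ident)
qed

lemma unif_Ck_frechet:
 "unif_Ck (Suc n) Om S I F ==> v \<in> Basis ==> unif_Ck n Om S I (%i x. fderiv (F i) x v)"
 by simp

section \<open>Integrals depending on parameters\<close>

lemma Basis_prod_fst: "v \<in> Basis ==> (v, 0) \<in> (Basis :: ('a::euclidean_space \<times> 'b::euclidean_space) set)"
 by (simp add: Basis_prod_def)

lemma Basis_prod_snd1: "(0, 1) \<in> (Basis :: ('a::euclidean_space \<times> real) set)"
 by (simp add: Basis_prod_def)

lemma has_derivative_slice:
 assumes "(F has_derivative D) (at (z, t))"
 shows "((%z. F (z, t)) has_derivative (%v. D (v, 0))) (at z)"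
  and "((%t. F (z, t)) has_derivative (%h. D (0, h))) (at t)"
proof -
 have "((%z. (z, t)) has_derivative (%v. (v, 0))) (at z)"
  by (intro has_derivative_Pair has_derivative_ident has_derivative_const)
 from has_derivative_compose[OF this assms] show "((%z. F (z, t)) has_derivative (%v. D (v, 0))) (at z)" .
 have "((%t. (z, t)) has_derivative (%h. (0, h))) (at t)"
  by (intro has_derivative_Pair has_derivative_ident has_derivative_const)
 from has_derivative_compose[OF this assms] show "((%t. F (z, t)) has_derivative (%h. D (0, h))) (at t)" .
qed

lemma smooth_on_slice:
 fixes F :: "'z::euclidean_space \<times> real => 'b::real_normed_vector"
 assumes "smooth F"
 shows "smooth (%z. F (z, t))" and "continuous_on A (%t. F (z, t))"
proof -
 show "smooth (%z. F (z, t))"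
  by (intro smooth_comp[OF assms] smooth_on_Pair smooth_on_const smooth_on_linear) (auto intro: bounded_linear_ident)
 show "continuous_on A (%t. F (z, t))"
  by (rule continuous_on_compose2[OF smooth_continuous[OF assms]]) (auto intro!: continuous_intros)
qed

lemma iter_deriv_slice:
 fixes F :: "'z::euclidean_space \<times> real => 'b::real_normed_vector"
 assumes "smooth F" "dirs vs"
 shows "iter_deriv vs (%z. F (z, t)) = (%z. iter_deriv (map (%v. (v, 0)) vs) F (z, t))"
 using assms(2)
proof (induction vs)
 case (Cons v vs)
 have "smooth (iter_deriv (map (%v. (v, 0)) vs) F)"
  by (rule smooth_iter_deriv[OF assms(1)]) (use Cons.prems Basis_prod_fst in auto)
 from has_derivative_slice(1)[OF smooth_has_derivative[OF this]]
 have "fderiv (%z. iter_deriv (map (%v. (v, 0)) vs) F (z, t)) z v =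
   fderiv (iter_deriv (map (%v. (v, 0)) vs) F) (z, t) (v, 0)" for z
  by (metis frechet_derivative_at UNIV_I)
 thus ?case using Cons by simp
qed simp

lemma has_derivative_integral_param:
 fixes F :: "'z::euclidean_space \<times> real => complex"
 assumes F: "smooth F"
 shows "((%z. integral {a..b} (%t. F (z, t))) has_derivative
  (%v. integral {a..b} (%t. fderiv F (z, t) (v, 0)))) (at z)"
proof -
 \<comment> \<open>The Leibniz rule for integrals wants a continuous derivative with values in the
   bounded linear maps; continuity is then checked on basis vectors, where it is smoothness of
   \<open>F\<close>.\<close>
 define D where "D z t = Blinfun (%v. fderiv F (z, t) (v, 0))" for z t
 have d: "((%z. F (z, t)) has_derivative (%v. fderiv F (z, t) (v, 0))) (at z)" for z t
  by (rule has_derivative_slice(1)[OF smooth_has_derivative[OF F]])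
 have D: "blinfun_apply (D z t) = (%v. fderiv F (z, t) (v, 0))" for z t
  unfolding D_def by (rule bounded_linear_Blinfun_apply has_derivative_bounded_linear d)+
 have cont: "continuous_on A (%(z, t). D z t)" for A
 proof (rule continuous_on_blinfun_componentwise)
  fix i :: 'z assume "i \<in> Basis"
  have "smooth (%p. fderiv F p (i, 0))"
   by (rule smooth_on_frechet[OF open_UNIV F Basis_prod_fst[OF \<open>i \<in> Basis\<close>]])
  from smooth_continuous[OF this]
  show "continuous_on A (%p. blinfun_apply (case p of (z, t) => D z t) i)"
   using continuous_on_subset by (auto simp: case_prod_unfold D)
 qed
 have Dt: "D z integrable_on cbox a b"
  by (rule integrable_continuous) (rule continuous_on_compose2[OF cont[of UNIV], of _ "%t. (z, t)", simplified], auto intro!: continuous_intros)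
 have "((%z. integral (cbox a b) (%t. F (z, t))) has_derivative integral (cbox a b) (D z)) (at z within UNIV)"
 proof (rule leibniz_rule)
  show "(%t. F (z, t)) integrable_on cbox a b" for z
   by (rule integrable_continuous smooth_on_slice(2) F)+
 qed (use d cont D in auto)
 moreover have "blinfun_apply (integral (cbox a b) (D z)) = (%v. integral {a..b} (%t. fderiv F (z, t) (v, 0)))"
 proof
  fix v
  have "blinfun_apply (integral (cbox a b) (D z)) v = integral (cbox a b) (%t. blinfun_apply (D z t) v)"
   using integral_linear[OF Dt, of "%f. blinfun_apply f v"] by (simp add: o_def blinfun.bounded_linear_left)
  thus "blinfun_apply (integral (cbox a b) (D z)) v = integral {a..b} (%t. fderiv F (z, t) (v, 0))"
   by (simp add: D)
 qed
 ultimately show ?thesis by simp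
qed

lemma norm_integral_le_const:
 fixes f :: "real => complex"
 assumes "continuous_on {a..b} f" "!!t. t \<in> {a..b} ==> norm (f t) <= C" "C >= 0"
 shows "norm (integral {a..b} f) <= C * abs (b - a)"
proof (cases "a <= b")
 case True
 thus ?thesis using integral_bound[OF True assms(1,2)] by simp
qed (use assms(3) in auto)

lemma unif_Ck_integral:
 fixes F :: "'i => 'z::euclidean_space \<times> real => complex"
 assumes "unif_Ck n UNIV (S \<times> {a..b}) I F" "!!i. i \<in> I ==> smooth (F i)"
 shows "unif_Ck n UNIV S I (%i z. integral {a..b} (%t. F i (z, t)))"
proof -
 have b: "unif_Ck 0 UNIV S I (%i z. integral {a..b} (%t. F i (z, t)))"
  if h: "unif_Ck n UNIV (S \<times> {a..b}) I F" "!!i. i \<in> I ==> smooth (F i)"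
  for n and F :: "'i => 'z \<times> real => complex"
 proof -
  obtain C where C: "\<forall>i\<in>I. \<forall>p\<in>S \<times> {a..b}. norm (F i p) <= C" using unif_Ck_bounded[OF h(1)] by blast
  have "norm (integral {a..b} (%t. F i (z, t))) <= abs C * abs (b - a)" if "i \<in> I" "z \<in> S" for i z
   by (rule norm_integral_le_const)
    (use C that smooth_on_slice(2)[OF h(2)] in \<open>auto intro: order_trans[OF _ abs_ge_self]\<close>)
  thus ?thesis by auto
 qed
 show ?thesis using assms
 proof (induction n arbitrary: F)
  case 0 show ?case using b[OF 0] .
 next
  case (Suc n)
  show ?case
  proof (rule unif_Ck_SucI[OF open_UNIV subset_UNIV b[OF Suc.prems]])
   show "((%z. integral {a..b} (%t. F i (z, t))) has_derivative
    (%v. integral {a..b} (%t. fderiv (F i) (z, t) (v, 0)))) (at z)" if "i \<in> I" for i z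
    by (rule has_derivative_integral_param) (use Suc.prems that in auto)
   show "unif_Ck n UNIV S I (%i z. integral {a..b} (%t. fderiv (F i) (z, t) (v, 0)))"
    if "v \<in> Basis" for v
    by (rule Suc.IH) (use Suc.prems Basis_prod_fst[OF that] smooth_on_frechet[OF open_UNIV] in auto)
  qed
 qed
qed

lemma smooth_on_integral:
 fixes F :: "'z::euclidean_space \<times> real => complex"
 assumes "smooth F"
 shows "smooth (%z. integral {a..b} (%t. F (z, t)))"
 using assms unif_Ck_integral[of _ "{}" a b "UNIV :: unit set" "%_. F"]
 unfolding smooth_on_iff_Ck[OF open_UNIV] by simp

lemma iter_deriv_integral:
 fixes F :: "'z::euclidean_space \<times> real => complex"
 assumes "smooth F" "dirs vs"
 shows "iter_deriv vs (%z. integral {a..b} (%t. F (z, t))) z = integral {a..b} (%t. iter_deriv vs (%z. F (z, t)) z)"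
proof -
 have "iter_deriv vs (%z. integral {a..b} (%t. F (z, t))) =
   (%z. integral {a..b} (%t. iter_deriv (map (%v. (v, 0)) vs) F (z, t)))"
  using assms(2)
 proof (induction vs)
  case (Cons v vs)
  have "smooth (iter_deriv (map (%v. (v, 0)) vs) F)"
   by (rule smooth_iter_deriv[OF assms(1)]) (use Cons.prems Basis_prod_fst in auto)
  from has_derivative_integral_param[OF this, of a b]
  have "fderiv (%z. integral {a..b} (%t. iter_deriv (map (%v. (v, 0)) vs) F (z, t))) z v =
   integral {a..b} (%t. fderiv (iter_deriv (map (%v. (v, 0)) vs) F) (z, t) (v, 0))" for z
   by (metis frechet_derivative_at)
  thus ?case using Cons by simp
 qed simp
 thus ?thesis using iter_deriv_slice[OF assms] by simp
qed

text \<open>A family vanishing at \<open>s = 0\<close> may be divided by \<open>s\<close> without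
  loss of uniformity: the mean value theorem bounds the quotient by the \<open>s\<close>-derivative,
  and derivatives in \<open>z\<close> again vanish at \<open>s = 0\<close>. Each bound costs one
  more derivative of \<open>F\<close>, hence the hypothesis for all orders. This removes the zero of
  the phase, and of differences of amplitudes, on the diagonal.\<close>

lemma unif_Ck_divide_param:
 fixes F :: "'i => 'z::euclidean_space \<times> real => 'b::real_normed_vector"
 assumes "!!n. unif_Ck n UNIV (S \<times> {-a..a}) I F" "!!i z. i \<in> I ==> F i (z, 0) = 0"
 shows "unif_Ck n UNIV S (I \<times> ({-a..a} - {0})) (%(i, s) z. F i (z, s) /\<^sub>R s)"
proof -
 have b: "unif_Ck 0 UNIV S (I \<times> ({-a..a} - {0})) (%(i, s) z. F i (z, s) /\<^sub>R s)"
  if h: "!!n. unif_Ck n UNIV (S \<times> {-a..a}) I F" "!!i z. i \<in> I ==> F i (z, 0) = 0" for F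
 proof -
  from h(1)[of "Suc 0"] have "unif_Ck 0 UNIV (S \<times> {-a..a}) I (%i p. fderiv (F i) p (0, 1))"
   and dif: "!!i p. i \<in> I ==> F i differentiable at p"
   using Basis_prod_snd1 by auto
  then obtain C where C: "\<forall>i\<in>I. \<forall>p\<in>S \<times> {-a..a}. norm (fderiv (F i) p (0, 1)) <= C"
   by auto
  have "norm (F i (z, s) /\<^sub>R s) <= C" if "i \<in> I" "z \<in> S" "s \<in> {-a..a} - {0}" for i z s
  proof -
   have "norm (F i (z, s) - F i (z, 0)) <= C * norm (s - 0)"
   proof (rule differentiable_bound[of "{-a..a}"])
    fix t assume t: "t \<in> {-a..a}"
    have D: "((%t. F i (z, t)) has_derivative (%h. fderiv (F i) (z, t) (0, h))) (at t)"
     by (rule has_derivative_slice has_derivative_frechet dif that)+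
    thus "((%t. F i (z, t)) has_derivative (%h. fderiv (F i) (z, t) (0, h))) (at t within {-a..a})"
     by (rule has_derivative_at_withinI)
    show "onorm (%h. fderiv (F i) (z, t) (0, h)) <= C"
    proof (rule onorm_le)
     fix h :: real
     have "linear (%h. fderiv (F i) (z, t) (0, h))" using D has_derivative_linear by blast
     hence "fderiv (F i) (z, t) (0, h) = h *\<^sub>R fderiv (F i) (z, t) (0, 1)"
      using linear_cmul[of "%h. fderiv (F i) (z, t) (0, h)" h 1] by simp
     hence "norm (fderiv (F i) (z, t) (0, h)) = norm (fderiv (F i) (z, t) (0, 1)) * norm h"
      by simp
     moreover have "norm (fderiv (F i) (z, t) (0, 1)) <= C" using C that t by auto
     ultimately show "norm (fderiv (F i) (z, t) (0, h)) <= C * norm h"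
      by (simp add: mult_right_mono)
    qed
   qed (use that in auto)
   thus ?thesis using that h(2)[of i z] by (simp add: divide_simps mult.commute)
  qed
  thus ?thesis unfolding unif_Ck.simps by (intro exI[of _ C]) (simp add: split_beta)
 qed
 show ?thesis using assms
 proof (induction n arbitrary: F)
  case 0 show ?case using b[OF 0] .
 next
  case (Suc n)
  have dif: "F i differentiable at p" if "i \<in> I" for i p
   using Suc.prems(1)[of "Suc 0"] that unfolding unif_Ck.simps by blast
  show ?case
  proof (rule unif_Ck_SucI[OF open_UNIV subset_UNIV b[OF Suc.prems]])
   show "((case j of (i, s) => %z. F i (z, s) /\<^sub>R s) has_derivative
    (case j of (i, s) => %v. fderiv (F i) (z, s) (v, 0) /\<^sub>R s)) (at z)"
    if "j \<in> I \<times> ({-a..a} - {0})" for j z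
    using that by (auto intro!: derivative_intros has_derivative_slice has_derivative_frechet dif)
   fix v :: 'z assume v: "v \<in> Basis"
   have "unif_Ck n UNIV S (I \<times> ({-a..a} - {0})) (%(i, s) z. fderiv (F i) (z, s) (v, 0) /\<^sub>R s)"
   proof (rule Suc.IH)
    show "unif_Ck n UNIV (S \<times> {-a..a}) I (%i p. fderiv (F i) p (v, 0))" for n
     using Suc.prems(1)[of "Suc n"] Basis_prod_fst[OF v] by auto
    fix i and z :: 'z assume i: "i \<in> I"
    have "((%z. F i (z, 0)) has_derivative (%v. fderiv (F i) (z, 0) (v, 0))) (at z)"
     by (rule has_derivative_slice has_derivative_frechet dif i)+
    moreover have "((%z. F i (z, 0)) has_derivative (%v. 0)) (at z)"
     using Suc.prems(2)[OF i] by simp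
    ultimately show "fderiv (F i) (z, 0) (v, 0) = 0"
     by (metis has_derivative_unique)
   qed
   thus "unif_Ck n UNIV S (I \<times> ({-a..a} - {0})) (%j z. (case j of (i, s) => %v. fderiv (F i) (z, s) (v, 0) /\<^sub>R s) v)"
    by (simp add: case_prod_unfold)
  qed
 qed
qed

section \<open>Non-stationary phase\<close>

definition osc :: "('i => 'z::euclidean_space \<times> real => real) => ('i => real) => 'i => 'z \<times> real => complex" where
 "osc Phi mu i p = exp (- \<i> * of_real (mu i * Phi i p))"

locale nonstationary =
 fixes I :: "'i set" and S :: "'z::euclidean_space set" and a b :: real
  and Phi :: "'i => 'z \<times> real => real" and n :: "'i => 'z \<times> real => real" and mu :: "'i => real"
 assumes Phi: "unif_Ck k UNIV (S \<times> {a..b}) I Phi" and n: "unif_Ck k UNIV (S \<times> {a..b}) I n"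
  and ab: "a <= b"
begin

text \<open>The support in \<open>t\<close> stays in one compact subinterval of the open interval,
  so boundary terms vanish. The last condition says that \<open>n\<close> inverts the phase
  derivative where \<open>B\<close> does not vanish; written as an equation it survives
  differentiation of \<open>B\<close>.\<close>

definition amp :: "('i => 'z \<times> real => complex) => bool" where
 "amp B \<longleftrightarrow> (\<forall>k. unif_Ck k UNIV (S \<times> {a..b}) I B) &
  (\<exists>a' b'. a < a' & b' < b & (\<forall>i\<in>I. \<forall>z t. t \<notin> {a'..b'} --> B i (z, t) = 0)) &
  (\<forall>i\<in>I. \<forall>p. (n i p * fderiv (Phi i) p (0, 1) - 1) *\<^sub>R B i p = 0)"

definition osc_int :: "('i => 'z \<times> real => complex) => 'i => 'z => complex" where
 "osc_int B i z = integral {a..b} (%t. B i (z, t) * osc Phi mu i (z, t))"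

lemma smooth_Phi: "i \<in> I ==> smooth (Phi i)"
 and smooth_n: "i \<in> I ==> smooth (n i)"
 and smooth_amp: "amp B ==> i \<in> I ==> smooth (B i)"
 using unif_Ck_imp_smooth[OF Phi] unif_Ck_imp_smooth[OF n]
  unif_Ck_imp_smooth[of "S \<times> {a..b}" I B] by (auto simp: amp_def)

lemma osc_has_derivative:
 assumes "i \<in> I"
 shows "(osc Phi mu i has_derivative
  (%v. osc Phi mu i p * (- \<i> * of_real (mu i * fderiv (Phi i) p v)))) (at p)"
proof -
 have d: "(Phi i has_derivative fderiv (Phi i) p) (at p)"
  by (rule smooth_has_derivative smooth_Phi assms UNIV_I)+
 have "((%p. - \<i> * of_real (mu i * Phi i p)) has_derivative
  (%v. - \<i> * of_real (mu i * fderiv (Phi i) p v))) (at p)"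
  by (intro has_derivative_mult_right has_derivative_of_real d)
 moreover have "(exp has_derivative (*) (osc Phi mu i p)) (at (- \<i> * of_real (mu i * Phi i p)))"
  using DERIV_exp by (simp add: has_field_derivative_def osc_def)
 ultimately have "((%p. exp (- \<i> * of_real (mu i * Phi i p))) has_derivative
  (%v. osc Phi mu i p * (- \<i> * of_real (mu i * fderiv (Phi i) p v)))) (at p)"
  by (rule has_derivative_compose)
 thus ?thesis by (simp add: osc_def[abs_def])
qed

lemma smooth_osc: "i \<in> I ==> smooth (osc Phi mu i)"
 unfolding osc_def[abs_def]
 by (intro smooth_on_exp smooth_on_mult smooth_on_const open_UNIV smooth_on_blinear[OF open_UNIV bounded_linear_of_real] smooth_Phi)

lemma norm_osc: "norm (osc Phi mu i p) = 1"
 by (simp add: osc_def)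

lemma smooth_integrand: "amp B ==> i \<in> I ==> smooth (%p. B i p * osc Phi mu i p)"
 by (intro smooth_on_mult smooth_amp smooth_osc open_UNIV)

lemma amp_mult:
 assumes "amp B" "!!k. unif_Ck k UNIV (S \<times> {a..b}) I G"
 shows "amp (%i p. B i p * of_real (G i p))"
 unfolding amp_def
proof (intro conjI allI)
 show "unif_Ck k UNIV (S \<times> {a..b}) I (%i p. B i p * of_real (G i p))" for k
  by (intro unif_Ck_mult unif_Ck_blinear[OF bounded_linear_of_real] assms(2)) (use assms(1) in \<open>auto simp: amp_def\<close>)
qed (use assms(1) in \<open>fastforce simp: amp_def\<close>)+

lemma amp_deriv:
 assumes "amp B" "v \<in> Basis"
 shows "amp (%i p. fderiv (B i) p v)"
 unfolding amp_def
proof (intro conjI allI ballI)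
 show "unif_Ck k UNIV (S \<times> {a..b}) I (%i p. fderiv (B i) p v)" for k
  by (rule unif_Ck_frechet[OF _ assms(2)]) (use assms(1) in \<open>simp only: amp_def\<close>)
 obtain a' b' where ab': "a < a'" "b' < b" "\<forall>i\<in>I. \<forall>z t. t \<notin> {a'..b'} --> B i (z, t) = 0"
  using assms(1) by (auto simp: amp_def)
 have "fderiv (B i) (z, t) v = 0" if "i \<in> I" "t \<notin> {a'..b'}" for i z t
 proof -
  have "fderiv (B i) (z, t) = fderiv (%p. 0) (z, t)"
   by (rule frechet_derivative_cong_open(1)[of "UNIV \<times> (- {a'..b'})"])
    (use that ab' in \<open>auto intro!: open_Times\<close>)
  thus ?thesis by (simp add: frechet_derivative_const)
 qed
 thus "\<exists>a' b'. a < a' & b' < b & (\<forall>i\<in>I. \<forall>z t. t \<notin> {a'..b'} --> fderiv (B i) (z, t) v = 0)"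
  using ab' by blast
 fix i p assume i: "i \<in> I"
 define G where "G p = n i p * fderiv (Phi i) p (0, 1) - 1" for p
 have G0: "G p *\<^sub>R B i p = 0" for p using assms(1) i unfolding amp_def G_def by blast
 have sG: "smooth G" unfolding G_def
  by (intro smooth_on_diff smooth_on_mult smooth_n smooth_on_frechet smooth_Phi smooth_on_const open_UNIV i Basis_prod_snd1)
 have d: "(G has_derivative fderiv G p) (at p)"
   "(B i has_derivative fderiv (B i) p) (at p)"
  by (rule smooth_has_derivative sG smooth_amp[OF assms(1) i] UNIV_I)+
 have "((%p. G p *\<^sub>R B i p) has_derivative (%h. G p *\<^sub>R fderiv (B i) p h + fderiv G p h *\<^sub>R B i p)) (at p)"
  by (rule has_derivative_scaleR[OF d])
 moreover have "((%p. G p *\<^sub>R B i p) has_derivative (%h. 0)) (at p)" unfolding G0 by simp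
 ultimately have "G p *\<^sub>R fderiv (B i) p v + fderiv G p v *\<^sub>R B i p = 0"
  by (rule has_derivative_unique[THEN fun_cong])
 \<comment> \<open>Either \<open>B\<close> vanishes at \<open>p\<close>, and with it the second
   summand, or \<open>G\<close> vanishes there.\<close>
 hence "G p *\<^sub>R fderiv (B i) p v = 0"
  using G0[of p] by (cases "B i p = 0") simp_all
 thus "(n i p * fderiv (Phi i) p (0, 1) - 1) *\<^sub>R fderiv (B i) p v = 0"
  by (simp add: G_def)
qed

lemma smooth_osc_int: "amp B ==> i \<in> I ==> smooth (osc_int B i)"
 unfolding osc_int_def[abs_def] by (rule smooth_on_integral smooth_integrand)+

lemma osc_int_frechet:
 assumes "amp B" "i \<in> I" "v \<in> Basis"
 shows "fderiv (osc_int B i) z v =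
  osc_int (%i p. fderiv (B i) p (v, 0)) i z +
  (- \<i> * of_real (mu i)) * osc_int (%i p. B i p * of_real (fderiv (Phi i) p (v, 0))) i z"
proof -
 have D: "((%p. B i p * osc Phi mu i p) has_derivative (%v. B i p * (osc Phi mu i p * (- \<i> * of_real (mu i * fderiv (Phi i) p v)))
  + fderiv (B i) p v * osc Phi mu i p)) (at p)" for p
  by (intro has_derivative_mult osc_has_derivative assms smooth_has_derivative[OF smooth_amp] UNIV_I)
 have a1: "amp (%i p. fderiv (B i) p (v, 0))"
  by (rule amp_deriv[OF assms(1) Basis_prod_fst[OF assms(3)]])
 have a2: "amp (%i p. B i p * of_real (fderiv (Phi i) p (v, 0)))"
  by (rule amp_mult[OF assms(1)]) (rule unif_Ck_frechet[OF Phi Basis_prod_fst[OF assms(3)]])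
 have int: "(%t. B i (z, t) * osc Phi mu i (z, t)) integrable_on {a..b}" if "amp B" for B
  by (rule integrable_continuous_interval smooth_on_slice smooth_integrand[OF that assms(2)])+
 have "fderiv (osc_int B i) z v =
  integral {a..b} (%t. fderiv (%p. B i p * osc Phi mu i p) (z, t) (v, 0))"
  unfolding osc_int_def[abs_def]
  by (rule fun_cong[OF frechet_derivative_at[symmetric]], rule has_derivative_integral_param, rule smooth_integrand[OF assms(1,2)])
 also have "... = integral {a..b} (%t. fderiv (B i) (z, t) (v, 0) * osc Phi mu i (z, t) +
   (- \<i> * of_real (mu i)) * (B i (z, t) * of_real (fderiv (Phi i) (z, t) (v, 0)) * osc Phi mu i (z, t)))"
  by (intro integral_cong) (simp add: frechet_derivative_at[OF D, symmetric] algebra_simps)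
 also have "... = osc_int (%i p. fderiv (B i) p (v, 0)) i z +
  (- \<i> * of_real (mu i)) * osc_int (%i p. B i p * of_real (fderiv (Phi i) p (v, 0))) i z"
  unfolding osc_int_def
  by (subst integral_add[OF int[OF a1] integrable_on_mult_right[OF int[OF a2]]]) simp
 finally show ?thesis .
qed

text \<open>Integration by parts in the integration variable: \<open>n\<close> inverts the derivative of the phase on the
 support of the amplitude.\<close>

lemma osc_int_parts:
 assumes "amp B"
 obtains D where "amp D" "!!i z. i \<in> I ==> osc_int D i z = \<i> * of_real (mu i) * osc_int B i z"
proof -
 define N where "N i p = B i p * of_real (n i p)" for i p
 have aN: "amp N" unfolding N_def[abs_def] by (rule amp_mult[OF assms n])
 define D where "D i p = fderiv (N i) p (0, 1)" for i p
 have aD: "amp D" unfolding D_def[abs_def] by (rule amp_deriv[OF aN Basis_prod_snd1])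
 show ?thesis
 proof (rule that[OF aD])
  fix i z assume i: "i \<in> I"
  have B: "B i p * of_real (n i p * fderiv (Phi i) p (0, 1)) = B i p" for p
  proof -
   have "(n i p * fderiv (Phi i) p (0, 1) - 1) *\<^sub>R B i p = 0" using assms i unfolding amp_def by blast
   thus ?thesis by (auto simp: scaleR_conv_of_real algebra_simps)
  qed
  have D: "((%p. N i p * osc Phi mu i p) has_derivative (%v. N i p * (osc Phi mu i p * (- \<i> * of_real (mu i * fderiv (Phi i) p v)))
  + fderiv (N i) p v * osc Phi mu i p)) (at p)" for p
   by (intro has_derivative_mult osc_has_derivative i smooth_has_derivative[OF smooth_amp] aN UNIV_I)
  have "((%t. N i (z, t) * osc Phi mu i (z, t)) has_vector_derivative
   D i (z, t) * osc Phi mu i (z, t) - \<i> * of_real (mu i) * (B i (z, t) * osc Phi mu i (z, t))) (at t)" for t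
  proof -
   have l: "linear (%h. N i (z, t) * (osc Phi mu i (z, t) * (- \<i> * of_real (mu i * fderiv (Phi i) (z, t) (0, h))))
    + fderiv (N i) (z, t) (0, h) * osc Phi mu i (z, t))"
    by (rule has_derivative_linear[OF has_derivative_slice(2)[OF D]])
   have "N i (z, t) * (osc Phi mu i (z, t) * (- \<i> * of_real (mu i * fderiv (Phi i) (z, t) (0, 1))))
    = - \<i> * of_real (mu i) * (B i (z, t) * of_real (n i (z, t) * fderiv (Phi i) (z, t) (0, 1)) * osc Phi mu i (z, t))"
    by (simp add: N_def algebra_simps)
   hence eq: "D i (z, t) * osc Phi mu i (z, t) - \<i> * of_real (mu i) * (B i (z, t) * osc Phi mu i (z, t)) =
    N i (z, t) * (osc Phi mu i (z, t) * (- \<i> * of_real (mu i * fderiv (Phi i) (z, t) (0, 1))))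
    + fderiv (N i) (z, t) (0, 1) * osc Phi mu i (z, t)"
    by (simp only: B D_def) simp
   show ?thesis unfolding has_vector_derivative_def eq
    by (rule has_derivative_eq_rhs[OF has_derivative_slice(2)[OF D]], rule ext, subst linear_cmul[OF l, symmetric]) simp
  qed
  hence "((%t. D i (z, t) * osc Phi mu i (z, t) - \<i> * of_real (mu i) * (B i (z, t) * osc Phi mu i (z, t))) has_integral
   N i (z, b) * osc Phi mu i (z, b) - N i (z, a) * osc Phi mu i (z, a)) {a..b}"
   by (intro fundamental_theorem_of_calculus ab) (auto intro: has_vector_derivative_at_within)
  moreover have "N i (z, b) = 0" "N i (z, a) = 0"
  proof -
   obtain a' b' where "a < a'" "b' < b" "\<forall>i\<in>I. \<forall>z t. t \<notin> {a'..b'} --> N i (z, t) = 0"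
    using aN by (auto simp: amp_def)
   thus "N i (z, b) = 0" "N i (z, a) = 0" using i by auto
  qed
  ultimately have "integral {a..b} (%t. D i (z, t) * osc Phi mu i (z, t) - \<i> * of_real (mu i) * (B i (z, t) * osc Phi mu i (z, t))) = 0"
   by (simp add: integral_unique)
  moreover have int: "(%t. B i (z, t) * osc Phi mu i (z, t)) integrable_on {a..b}" if "amp B" for B
   by (rule integrable_continuous_interval smooth_on_slice smooth_integrand[OF that i])+
  ultimately show "osc_int D i z = \<i> * of_real (mu i) * osc_int B i z"
   using integral_diff[OF int[OF aD] integrable_on_mult_right[OF int[OF assms]]] by (simp add: osc_int_def)
 qed
qed

text \<open>An integration by parts absorbs a factor \<open>mu i\<close> into another amplitude of
  the same class. Splitting \<open>1 + abs (mu i)\<close> into its summands trades one power of it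
  for one such step.\<close>

lemma osc_int_decay:
 assumes "amp B"
 shows "\<exists>C. \<forall>i\<in>I. \<forall>z\<in>S. (1 + abs (mu i)) ^ N * norm (osc_int B i z) <= C"
 using assms
proof (induction N arbitrary: B)
 case 0
 then obtain C where C: "\<forall>i\<in>I. \<forall>p\<in>S \<times> {a..b}. norm (B i p) <= C"
  using unif_Ck_bounded[of 0 UNIV "S \<times> {a..b}" I B] unfolding amp_def by blast
 have "norm (osc_int B i z) <= abs C * abs (b - a)" if "i \<in> I" "z \<in> S" for i z unfolding osc_int_def
 proof (rule norm_integral_le_const)
  show "continuous_on {a..b} (%t. B i (z, t) * osc Phi mu i (z, t))"
   by (rule smooth_on_slice smooth_integrand 0 that)+
 qed (use C that in \<open>auto simp: norm_mult norm_osc intro: order_trans[OF _ abs_ge_self]\<close>)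
 thus ?case by auto
next
 case (Suc N)
 obtain D where D: "amp D" "!!i z. i \<in> I ==> osc_int D i z = \<i> * of_real (mu i) * osc_int B i z"
  using osc_int_parts[OF Suc.prems] by blast
 obtain C1 C2 where C: "\<forall>i\<in>I. \<forall>z\<in>S. (1 + abs (mu i)) ^ N * norm (osc_int B i z) <= C1"
  "\<forall>i\<in>I. \<forall>z\<in>S. (1 + abs (mu i)) ^ N * norm (osc_int D i z) <= C2"
  using Suc.IH[OF Suc.prems] Suc.IH[OF D(1)] by blast
 have "(1 + abs (mu i)) ^ Suc N * norm (osc_int B i z) <= C1 + C2" if "i \<in> I" "z \<in> S" for i z
 proof -
  have "(1 + abs (mu i)) ^ Suc N * norm (osc_int B i z) =
   (1 + abs (mu i)) ^ N * norm (osc_int B i z) + (1 + abs (mu i)) ^ N * norm (osc_int D i z)"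
   using D(2)[OF that(1), of z] by (simp add: norm_mult algebra_simps)
  thus ?thesis using C that by (fastforce intro: add_mono)
 qed
 thus ?case by blast
qed

text \<open>Differentiation in \<open>z\<close> brings down a factor \<open>mu i\<close> from the
  phase. It is absorbed because the induction hypothesis holds for every amplitude and every
  exponent, in particular for \<open>Suc N\<close>.\<close>

lemma iter_deriv_osc_int_decay:
 assumes "amp B" "dirs vs"
 shows "\<exists>C. \<forall>i\<in>I. \<forall>z\<in>S. (1 + abs (mu i)) ^ N * norm (iter_deriv vs (osc_int B i) z) <= C"
 using assms
proof (induction vs arbitrary: B N rule: rev_induct)
 case Nil
 thus ?case using osc_int_decay by simp
next
 case (snoc v vs)
 define B1 where "B1 i p = fderiv (B i) p (v, 0)" for i p
 define B2 where "B2 i p = B i p * of_real (fderiv (Phi i) p (v, 0))" for i p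
 have v: "v \<in> Basis" "dirs vs" using snoc.prems by auto
 have a1: "amp B1" unfolding B1_def[abs_def]
  by (rule amp_deriv[OF snoc.prems(1) Basis_prod_fst[OF v(1)]])
 have a2: "amp B2" unfolding B2_def[abs_def]
  by (rule amp_mult[OF snoc.prems(1)]) (rule unif_Ck_frechet[OF Phi Basis_prod_fst[OF v(1)]])
 obtain C1 C2 where C: "\<forall>i\<in>I. \<forall>z\<in>S. (1 + abs (mu i)) ^ N * norm (iter_deriv vs (osc_int B1 i) z) <= C1"
  "\<forall>i\<in>I. \<forall>z\<in>S. (1 + abs (mu i)) ^ Suc N * norm (iter_deriv vs (osc_int B2 i) z) <= C2"
  using snoc.IH[OF a1 v(2)] snoc.IH[OF a2 v(2)] by blast
 have "(1 + abs (mu i)) ^ N * norm (iter_deriv (vs @ [v]) (osc_int B i) z) <= C1 + C2" if "i \<in> I" "z \<in> S" for i z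
 proof -
  have s: "smooth (osc_int B1 i)" "smooth (osc_int B2 i)"
   using smooth_osc_int a1 a2 that by blast+
  have "iter_deriv (vs @ [v]) (osc_int B i) z = iter_deriv vs (%z. osc_int B1 i z + (- \<i> * of_real (mu i)) * osc_int B2 i z) z"
   using osc_int_frechet[OF snoc.prems(1) that(1) v(1)]
   by (simp add: iter_deriv_append B1_def[abs_def] B2_def[abs_def])
  also have "... = iter_deriv vs (osc_int B1 i) z + (- \<i> * of_real (mu i)) * iter_deriv vs (osc_int B2 i) z"
   by (simp only: iter_deriv_add[OF open_UNIV s(1) smooth_on_mult[OF open_UNIV smooth_on_const[OF open_UNIV] s(2)] v(2) UNIV_I]
     iter_deriv_cmult[OF open_UNIV s(2) v(2) UNIV_I])
  finally have "norm (iter_deriv (vs @ [v]) (osc_int B i) z) <=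
   norm (iter_deriv vs (osc_int B1 i) z) + (1 + abs (mu i)) * norm (iter_deriv vs (osc_int B2 i) z)"
   by (simp add: norm_mult) (rule order_trans[OF norm_triangle_ineq4], simp add: norm_mult algebra_simps)
  hence "(1 + abs (mu i)) ^ N * norm (iter_deriv (vs @ [v]) (osc_int B i) z) <= (1 + abs (mu i)) ^ N *
   (norm (iter_deriv vs (osc_int B1 i) z) + (1 + abs (mu i)) * norm (iter_deriv vs (osc_int B2 i) z))"
   by (intro mult_left_mono) auto
  also have "... <= C1 + C2" using C that by (simp add: algebra_simps) (fastforce intro: add_mono)
  finally show ?thesis .
 qed
 thus ?case by blast
qed

end

section \<open>Fourier series of test functions\<close>

definition fwave :: "'a::euclidean_space => 'a => complex" where
 "fwave xi x = exp (- \<i> * complex_of_real (x \<bullet> xi))"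

lemma norm_fwave [simp]: "norm (fwave xi x) = 1"
 by (simp add: fwave_def)

lemma fwave_add: "fwave (xi + eta) x = fwave xi x * fwave eta x"
 by (simp add: fwave_def inner_add_right algebra_simps flip: exp_add)

lemma fwave_has_derivative:
 "(fwave xi has_derivative (%v. (- \<i> * complex_of_real (v \<bullet> xi)) * fwave xi x)) (at x)"
proof -
 have "((%x. - \<i> * complex_of_real (x \<bullet> xi)) has_derivative (%v. - \<i> * complex_of_real (v \<bullet> xi))) (at x)"
  by (intro has_derivative_mult_right has_derivative_of_real has_derivative_inner_left has_derivative_ident)
 moreover have "(exp has_derivative (*) (fwave xi x)) (at (- \<i> * complex_of_real (x \<bullet> xi)))"
  using DERIV_exp by (simp add: has_field_derivative_def fwave_def)
 ultimately have "((%x. exp (- \<i> * complex_of_real (x \<bullet> xi))) has_derivative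
   (%v. fwave xi x * (- \<i> * complex_of_real (v \<bullet> xi)))) (at x)"
  by (rule has_derivative_compose)
 thus ?thesis by (simp add: fwave_def[abs_def] mult.commute)
qed

lemma iter_deriv_fwave:
 "iter_deriv vs (fwave xi) = (%x. (\<Prod>v\<leftarrow>vs. - \<i> * complex_of_real (v \<bullet> xi)) * fwave xi x)"
proof (induction vs)
 case (Cons v vs)
 have "((%x. (\<Prod>v\<leftarrow>vs. - \<i> * complex_of_real (v \<bullet> xi)) * fwave xi x) has_derivative
  (%w. (\<Prod>v\<leftarrow>vs. - \<i> * complex_of_real (v \<bullet> xi)) * ((- \<i> * complex_of_real (w \<bullet> xi)) * fwave xi x))) (at x)" for x
  by (intro has_derivative_mult_right fwave_has_derivative)
 from frechet_derivative_at[OF this, symmetric] show ?case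
  by (simp only: iter_deriv.simps Cons.IH) (simp add: fun_eq_iff)
qed simp

lemma smooth_on_fwave: "smooth (fwave xi)"
proof -
 have "(%x. (\<Prod>v\<leftarrow>vs. - \<i> * complex_of_real (v \<bullet> xi)) * fwave xi x) differentiable (at x)" for vs x
  using has_derivative_mult_right[OF fwave_has_derivative] unfolding differentiable_def by blast
 thus ?thesis unfolding smooth_on_differentiable[OF open_UNIV] iter_deriv_fwave by blast
qed

lemma norm_iter_deriv_fwave:
 assumes "dirs vs"
 shows "norm (iter_deriv vs (fwave xi) x) <= norm xi ^ length vs"
 using assms
proof (induction vs)
 case (Cons v vs)
 have "abs (v \<bullet> xi) <= norm xi" using Cons.prems Basis_le_norm[of v xi] by (simp add: inner_commute)
 with Cons show ?case by (simp add: iter_deriv_fwave norm_mult mult_mono)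
qed (simp add: iter_deriv_fwave)

section \<open>Integration by parts and the Riemann-Lebesgue lemma\<close>

lemma integral_fwave_parts:
 fixes m :: "real => complex"
 assumes "a <= b" "!!x. (m has_vector_derivative m' x) (at x)" "continuous_on {a..b} m'"
 shows "integral {a..b} (%x. m' x * fwave xi x) =
  m b * fwave xi b - m a * fwave xi a + \<i> * of_real xi * integral {a..b} (%x. m x * fwave xi x)"
proof -
 have f: "(fwave xi has_vector_derivative - \<i> * of_real xi * fwave xi x) (at x)" for x :: real
  using fwave_has_derivative[of xi x] unfolding has_vector_derivative_def
  by (simp add: scaleR_conv_of_real algebra_simps)
 have d: "((%x. m x * fwave xi x) has_vector_derivative (m x * (- \<i> * of_real xi * fwave xi x) + m' x * fwave xi x)) (at x)" for x
  by (rule has_vector_derivative_mult[OF assms(2) f])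
 have "((%x. m x * (- \<i> * of_real xi * fwave xi x) + m' x * fwave xi x) has_integral m b * fwave xi b - m a * fwave xi a) {a..b}"
  by (intro fundamental_theorem_of_calculus assms(1)) (use d has_vector_derivative_at_within in blast)
 moreover have c: "continuous_on {a..b} m" "continuous_on {a..b} (fwave xi)"
  using has_vector_derivative_continuous[OF assms(2)] has_vector_derivative_continuous[OF f]
  by (auto intro!: continuous_at_imp_continuous_on)
 have i: "(%x. m x * fwave xi x) integrable_on {a..b}" "(%x. m' x * fwave xi x) integrable_on {a..b}"
  by (intro integrable_continuous_interval continuous_on_mult c assms)+
 have "integral {a..b} (%x. - \<i> * of_real xi * (m x * fwave xi x) + m' x * fwave xi x) =
   - \<i> * of_real xi * integral {a..b} (%x. m x * fwave xi x) + integral {a..b} (%x. m' x * fwave xi x)"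
  by (subst integral_add[OF integrable_on_mult_right[OF i(1)] i(2)]) simp
 ultimately show ?thesis by (simp add: integral_unique algebra_simps)
qed

text \<open>A continuous function has no derivative to integrate by parts, hence the approximation
  by a polynomial function: its integral is of order \<open>1 / abs xi\<close>, and the
  approximation error is small uniformly in \<open>xi\<close>.\<close>

lemma Riemann_Lebesgue:
 fixes gam :: "real => complex"
 assumes "a < b" "continuous_on {a..b} gam"
 shows "((%xi. integral {a..b} (%x. gam x * fwave xi x)) \<longlongrightarrow> 0) at_infinity"
proof (rule tendstoI)
 fix e :: real assume "e > 0"
 \<comment> \<open>With this choice the approximation error contributes at most \<open>e / 2\<close>
   to the integral.\<close>
 define e' where "e' = e / (2 * (b - a))"
 have "e' > 0" using \<open>e > 0\<close> assms by (simp add: e'_def)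
 obtain g where g: "polynomial_function g" "\<forall>x\<in>{a..b}. norm (gam x - g x) < e'"
  using Stone_Weierstrass_polynomial_function[OF compact_Icc assms(2) \<open>e' > 0\<close>] by blast
 obtain g' where g': "polynomial_function g'" "!!x. (g has_vector_derivative g' x) (at x)"
  using has_vector_derivative_polynomial_function[OF g(1)] by blast
 have cg: "continuous_on {a..b} g" "continuous_on {a..b} g'"
  using g(1) g'(1) continuous_on_polymonial_function by blast+
 have cw: "continuous_on {a..b} (fwave xi)" for xi :: real
  using smooth_continuous[OF smooth_on_fwave] continuous_on_subset by blast
 obtain C where C: "!!x. x \<in> {a..b} ==> norm (g' x) <= C" "C >= 0"
  using compact_imp_bounded[OF compact_continuous_image[OF cg(2) compact_Icc]]
  unfolding bounded_pos by (metis image_eqI less_imp_le)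
 define B where "B = C * (b - a) + norm (g a) + norm (g b)"
 have bd: "norm (integral {a..b} (%x. gam x * fwave xi x)) <= e / 2 + B / abs xi" if "xi ~= 0" for xi
 proof -
  have "integral {a..b} (%x. gam x * fwave xi x) =
   integral {a..b} (%x. (gam x - g x) * fwave xi x) + integral {a..b} (%x. g x * fwave xi x)"
   by (subst integral_add[symmetric])
    (auto intro!: integrable_continuous_interval continuous_intros cg cw assms(2) simp: algebra_simps)
  moreover have "norm (integral {a..b} (%x. (gam x - g x) * fwave xi x)) <= e' * abs (b - a)"
   by (rule norm_integral_le_const)
    (use g(2) \<open>e' > 0\<close> in \<open>auto intro!: continuous_intros cg cw assms(2) simp: norm_mult less_imp_le\<close>)
  moreover have "abs xi * norm (integral {a..b} (%x. g x * fwave xi x)) <= B"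
  proof -
   have "abs xi * norm (integral {a..b} (%x. g x * fwave xi x)) = norm (\<i> * of_real xi * integral {a..b} (%x. g x * fwave xi x))"
    by (simp add: norm_mult)
   also have "\<i> * of_real xi * integral {a..b} (%x. g x * fwave xi x) =
    integral {a..b} (%x. g' x * fwave xi x) - (g b * fwave xi b - g a * fwave xi a)"
    using integral_fwave_parts[OF _ g'(2) cg(2), of xi] assms by simp
   also have "norm ... <= norm (integral {a..b} (%x. g' x * fwave xi x)) + (norm (g b) + norm (g a))"
    by (rule order_trans[OF norm_triangle_ineq4] add_left_mono)+ (simp add: norm_mult)
   also have "norm (integral {a..b} (%x. g' x * fwave xi x)) <= C * abs (b - a)"
    by (rule norm_integral_le_const) (use C in \<open>auto intro!: continuous_intros cg cw simp: norm_mult\<close>)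
   finally show ?thesis using assms by (simp add: B_def)
  qed
  moreover have "e' * abs (b - a) = e / 2" using assms(1) by (simp add: e'_def field_simps)
  moreover have "norm (integral {a..b} (%x. g x * fwave xi x)) <= B / abs xi"
   using that calculation(3) by (simp add: pos_le_divide_eq mult.commute)
  ultimately show ?thesis by (smt (verit, ccfv_threshold) norm_triangle_ineq)
 qed
 have "eventually (%xi::real. abs xi > max 1 (2 * B / e + 1)) at_infinity"
  unfolding eventually_at_infinity by (intro exI[of _ "max 1 (2 * B / e + 1) + 1"]) auto
 thus "eventually (%xi. dist (integral {a..b} (%x. gam x * fwave xi x)) 0 < e) at_infinity"
 proof eventually_elim
  case (elim xi)
  hence "2 * B / e < abs xi" "xi ~= 0" by auto
  hence "B / abs xi < e / 2" using \<open>e > 0\<close> by (simp add: field_simps)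
  with bd[OF \<open>xi ~= 0\<close>] show ?case unfolding dist_norm diff_zero by linarith
 qed
qed

text \<open>An element vanishes outside a prescribed set, so that bounds can be uniform over the
  whole class and no closure of a support has to be computed.\<close>

definition smooth_supp :: "'a::euclidean_space set => ('a => complex) set" where
 "smooth_supp K = {phi. smooth phi & (\<forall>x. x \<notin> K --> phi x = 0)}"

lemma smooth_suppD: "f \<in> smooth_supp K ==> smooth f"
 by (simp add: smooth_supp_def)

lemma smooth_supp_mult:
 assumes "phi \<in> smooth_supp K" "smooth r"
 shows "(%x. phi x * r x) \<in> smooth_supp K"
 using assms by (auto simp: smooth_supp_def intro!: smooth_on_mult)

lemma smooth_supp_iter_deriv_0:
 assumes "phi \<in> smooth_supp K" "closed K" "x \<notin> K"
 shows "iter_deriv vs phi x = 0"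
proof -
 have z: "iter_deriv vs (%x. 0) = (%x. 0)" for vs :: "'a list"
  by (induction vs) (auto simp: frechet_derivative_const)
 have "iter_deriv vs phi x = iter_deriv vs (%x. 0) x"
  by (rule iter_deriv_cong_open[of "- K"]) (use assms in \<open>auto simp: smooth_supp_def\<close>)
 thus ?thesis by (simp add: z)
qed

lemma finite_deriv_lists: "finite {vs :: 'a::euclidean_space list. dirs vs & length vs <= N}"
 using finite_lists_length_le[OF finite_Basis] .

text \<open>Only finitely many lists of basis vectors have length at most \<open>N\<close>, so the
  separate constants can be summed into one.\<close>

lemma unif_Ck_uniform_bound:
 assumes "unif_Ck N UNIV S I F"
 shows "\<exists>C\<ge>0. \<forall>vs. dirs vs --> length vs <= N --> (\<forall>i\<in>I. \<forall>x\<in>S. norm (iter_deriv vs (F i) x) <= C)"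
proof -
 have "\<forall>vs. \<exists>C. dirs vs --> length vs <= N --> (\<forall>i\<in>I. \<forall>x\<in>S. norm (iter_deriv vs (F i) x) <= C)"
  using assms unfolding unif_Ck_iff[OF open_UNIV] by blast
 then obtain C where C: "!!vs i x. dirs vs ==> length vs <= N ==> i \<in> I ==> x \<in> S ==> norm (iter_deriv vs (F i) x) <= C vs"
  by metis
 let ?A = "{vs :: 'a list. dirs vs & length vs <= N}"
 have "C vs <= (\<Sum>vs\<in>?A. abs (C vs))" if "vs \<in> ?A" for vs
  using member_le_sum[OF that _ finite_deriv_lists, of "%vs. abs (C vs)"] by auto
 thus ?thesis using C by (intro exI[of _ "\<Sum>vs\<in>?A. abs (C vs)"]) (fastforce intro: sum_nonneg order_trans)
qed

lemma has_vector_derivative_quotient_tendsto: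
 fixes f :: "real => complex"
 assumes "(f has_vector_derivative D) (at x)"
 shows "((%y. (f y - f x) / of_real (y - x)) \<longlongrightarrow> D) (at x within A)"
proof -
 have "((%y. norm ((f y - f x) - (y - x) *\<^sub>R D) / norm (y - x)) \<longlongrightarrow> 0) (at x within A)"
  using has_vector_derivative_at_within[OF assms, of A]
  by (simp add: has_vector_derivative_def has_derivative_iff_norm)
 moreover have "eventually (%y. norm ((f y - f x) - (y - x) *\<^sub>R D) / norm (y - x) = norm ((f y - f x) / of_real (y - x) - D)) (at x within A)"
  unfolding eventually_at_filter
 proof (rule always_eventually, intro allI impI)
  fix y assume "y ~= x"
  hence "(f y - f x) / of_real (y - x) - D = ((f y - f x) - (y - x) *\<^sub>R D) / of_real (y - x)"
   by (simp add: diff_divide_distrib scaleR_conv_of_real del: of_real_diff)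
  thus "norm ((f y - f x) - (y - x) *\<^sub>R D) / norm (y - x) = norm ((f y - f x) / of_real (y - x) - D)"
   by (simp only: norm_divide norm_of_real real_norm_def)
 qed
 ultimately have "((%y. norm ((f y - f x) / of_real (y - x) - D)) \<longlongrightarrow> 0) (at x within A)"
  using tendsto_cong by fast
 thus ?thesis using Lim_null tendsto_norm_zero_iff by blast
qed

section \<open>Fourier series of smooth functions supported inside a square\<close>

locale fourier_box =
 fixes L :: real assumes L: "L > 0"
begin

text \<open>The fundamental frequency belonging to the period \<open>2 * L\<close>.\<close>

definition h :: real where "h = pi / L"

lemma h: "h > 0" "h * L = pi" using L by (auto simp: h_def)

definition coef :: "(real => complex) => int => complex" where
 "coef m k = of_real (1 / (2 * L)) * integral {-L..L} (%y. m y * fwave (h * real_of_int k) y)"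

lemma coef_shift: "coef (%y. m y * fwave (- h) y) k = coef m (k - 1)"
proof -
 have "fwave (- h) y * fwave (h * real_of_int k) y = fwave (h * real_of_int (k - 1)) y" for y
  by (simp flip: fwave_add add: algebra_simps)
 thus ?thesis unfolding coef_def by (simp add: mult.assoc)
qed

lemma coef_norm_le:
 assumes "!!t. t \<in> {-L..L} ==> norm (m t) <= C"
 shows "norm (coef m k) <= C"
proof -
 let ?f = "%y. m y * fwave (h * real_of_int k) y"
 have C: "C >= 0" using assms[of 0] L by (auto intro: order_trans[OF norm_ge_zero])
 have "norm (integral {-L..L} ?f) <= C * (2 * L)"
 proof (cases "?f integrable_on {-L..L}")
  case True
  from has_integral_bound_real[OF C finite.emptyI integrable_integral[OF True]] show ?thesis
   using assms L by (simp add: norm_mult)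
 qed (use C L in \<open>simp add: not_integrable_integral\<close>)
 thus ?thesis using L by (simp add: coef_def norm_mult norm_divide pos_divide_le_eq)
qed

lemma coef_const: "coef (%y. c) k = (if k = 0 then c else 0)"
proof (cases "k = 0")
 case True
 thus ?thesis using L by (simp add: coef_def fwave_def scaleR_conv_of_real)
next
 case False
 let ?xi = "h * real_of_int k"
 have e: "fwave ?xi L = fwave ?xi (- L)"
 proof -
  have "fwave ?xi L = cis (- (of_int k * pi))" "fwave ?xi (- L) = cis (of_int k * pi)"
  proof -
   have "L * ?xi = of_int k * pi" using h(2) by (simp add: algebra_simps flip: h(2))
   thus "fwave ?xi L = cis (- (of_int k * pi))" "fwave ?xi (- L) = cis (of_int k * pi)"
    unfolding fwave_def inner_real_def cis_conv_exp by (simp_all only: mult_minus_left) simp_all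
  qed
  moreover have "cis (of_int k * pi) = cis (- (of_int k * pi)) * cis (2 * pi * of_int k)"
   by (simp add: cis_mult algebra_simps)
  moreover have "cis (2 * pi * of_int k) = 1" by (intro cis_multiple_2pi) auto
  ultimately show ?thesis by simp
 qed
 have "0 = \<i> * of_real ?xi * integral {-L..L} (%x. c * fwave ?xi x)"
  using integral_fwave_parts[of "-L" L "%x. c" "%x. 0" ?xi] L e by simp
 hence "integral {-L..L} (%x. c * fwave ?xi x) = 0" using False h(1) by simp
 thus ?thesis using False by (simp add: coef_def)
qed

lemma coef_diff_cmult:
 assumes "continuous_on {-L..L} m" "continuous_on {-L..L} m'"
 shows "coef (%y. m y - c * m' y) k = coef m k - c * coef m' k"
proof -
 have cw: "continuous_on {-L..L} (fwave xi)" for xi :: real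
  using smooth_continuous[OF smooth_on_fwave] continuous_on_subset by blast
 have "integral {-L..L} (%y. m y * fwave (h * real_of_int k) y - c * (m' y * fwave (h * real_of_int k) y)) =
  integral {-L..L} (%y. m y * fwave (h * real_of_int k) y) - c * integral {-L..L} (%y. m' y * fwave (h * real_of_int k) y)"
  by (subst integral_diff) (auto intro!: integrable_continuous_interval continuous_intros assms cw)
 moreover have "(%y. (m y - c * m' y) * fwave (h * real_of_int k) y) = (%y. m y * fwave (h * real_of_int k) y - c * (m' y * fwave (h * real_of_int k) y))"
  by (simp add: fun_eq_iff algebra_simps)
 ultimately show ?thesis unfolding coef_def by (simp only: right_diff_distrib) (simp add: mult.left_commute)
qed

lemma symmetric_intervals: "filterlim (%n. {- int n..int n}) (finite_subsets_at_top UNIV) sequentially"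
 unfolding filterlim_finite_subsets_at_top
proof (intro allI impI)
 fix X :: "int set" assume "finite X & X \<subseteq> UNIV"
 then obtain N where N: "!!x. x \<in> X ==> abs x <= N"
  by (metis Max_ge abs_ge_self finite_imageI imageI order_trans)
 show "eventually (%n. finite {- int n..int n} & X \<subseteq> {- int n..int n} & {- int n..int n} \<subseteq> UNIV) sequentially"
  using eventually_ge_at_top[of "nat N"]
 proof eventually_elim
  case (elim n)
  thus ?case using N by fastforce
 qed
qed

text \<open>The quotient \<open>gam\<close> of \<open>m y - m x\<close> by
  \<open>exp (\<i> * h * y) - exp (\<i> * h * x)\<close> is continuous because \<open>m\<close> is
  differentiable at \<open>x\<close>. Multiplication by \<open>exp (\<i> * h * y)\<close> shifts the
  coefficients, so the partial sums telescope to \<open>m x\<close> plus two coefficients of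
  \<open>gam\<close>, up to factors of modulus 1, which vanish in the limit. Summability is a
  hypothesis; it identifies the limit of the symmetric partial sums with the unordered sum.\<close>

lemma fourier_inversion:
 assumes m: "continuous_on {-L..L} m" "(m has_vector_derivative d) (at x)" and x: "abs x < L"
  and s: "(%k. coef m k * fwave (- h * real_of_int k) x) summable_on UNIV"
 shows "((%k. coef m k * fwave (- h * real_of_int k) x) has_sum m x) UNIV"
proof -
 define E where "E y = fwave (- h) y" for y :: real
 have Ev: "(E has_vector_derivative \<i> * of_real h * E y) (at y)" for y
  using fwave_has_derivative[of "- h" y] unfolding has_vector_derivative_def E_def
  by (simp add: scaleR_conv_of_real algebra_simps)
 \<comment> \<open>\<open>E\<close> has period \<open>2 * L\<close> and \<open>x\<close> is
   interior, so no other point of the interval differs from \<open>x\<close> by a multiple of the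
   period.\<close>
 have E0: "E y ~= E x" if "y \<in> {-L..L}" "y ~= x" for y
 proof
  assume "E y = E x"
  hence "cis (h * y) = cis (h * x)" by (simp add: E_def fwave_def cis_conv_exp algebra_simps)
  hence "cis (h * y - h * x) = 1" by (simp add: cis_divide[symmetric])
  then obtain n :: int where n: "h * y - h * x = 2 * pi * of_int n"
   by (auto simp: cis_conv_exp exp_eq_1 algebra_simps)
  have "abs (y - x) < 2 * L" using that x by auto
  hence "h * abs (y - x) < 2 * pi" using h by (metis mult.left_commute mult_less_cancel_left_pos)
  moreover have "h * abs (y - x) = abs (2 * pi * of_int n)"
   using n h(1) by (metis abs_mult abs_of_pos right_diff_distrib')
  ultimately have "abs (of_int n) < (1::real)" by (simp add: abs_mult)
  hence "n = 0" by linarith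
  with n that h(1) show False by simp
 qed
 \<comment> \<open>At \<open>x\<close> the quotient gets its limit, the ratio of the two
   derivatives.\<close>
 define gam where "gam y = (if y = x then d / (\<i> * of_real h * E x) else (m y - m x) / (E y - E x))" for y
 have E_nz: "E x ~= 0" by (simp add: E_def fwave_def)
 have "continuous_on {-L..L} gam"
 proof (rule continuous_on_eq_continuous_within[THEN iffD2], rule ballI)
  fix y assume y: "y \<in> {-L..L}"
  have cE: "continuous_on A E" for A
   unfolding E_def[abs_def] using smooth_continuous[OF smooth_on_fwave] continuous_on_subset by blast
  show "continuous (at y within {-L..L}) gam"
  proof (cases "y = x")
   case False
   have "continuous (at y within {-L..L}) (%y. (m y - m x) / (E y - E x))"
    using m(1) cE[of "{-L..L}"] y E0[OF y False]
    by (intro continuous_intros) (auto simp: continuous_on_eq_continuous_within)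
   moreover have "eventually (%z. (m z - m x) / (E z - E x) = gam z) (at y within {-L..L})"
    unfolding eventually_at using False by (intro exI[of _ "dist x y"]) (auto simp: gam_def dist_commute)
   moreover have "(m y - m x) / (E y - E x) = gam y" using False by (simp add: gam_def)
   ultimately show ?thesis unfolding continuous_within using tendsto_cong[of "%z. (m z - m x) / (E z - E x)" gam] by simp
  next
   case True
   have "((%y. ((m y - m x) / of_real (y - x)) / ((E y - E x) / of_real (y - x))) \<longlongrightarrow> d / (\<i> * of_real h * E x)) (at x within {-L..L})"
    by (intro tendsto_divide has_vector_derivative_quotient_tendsto m Ev) (use E_nz h(1) in auto)
   moreover have "eventually (%y. ((m y - m x) / of_real (y - x)) / ((E y - E x) / of_real (y - x)) = gam y) (at x within {-L..L})"
    unfolding eventually_at_filter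
    by (rule always_eventually) (auto simp: gam_def)
   moreover have "gam x = d / (\<i> * of_real h * E x)" by (simp add: gam_def)
   ultimately show ?thesis unfolding continuous_within True using tendsto_cong[of "%y. ((m y - m x) / of_real (y - x)) / ((E y - E x) / of_real (y - x))" gam] by simp
  qed
 qed
 hence cgam: "continuous_on {-L..L} gam" .
 have eq: "m y - m x = gam y * E y - E x * gam y" if "y \<in> {-L..L}" for y
 proof -
  have "m y - m x = gam y * (E y - E x)" using E0[OF that] by (cases "y = x") (auto simp: gam_def)
  thus ?thesis by (simp add: algebra_simps)
 qed
 \<comment> \<open>The telescoping terms: the shift of the coefficient matches the shift of the
   exponential.\<close>
 define a where "a k = coef gam (k - 1) * fwave (- h * real_of_int k) x" for k
 have tm: "coef m k * fwave (- h * real_of_int k) x = (if k = 0 then m x else 0) + (a k - a (k + 1))" for k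
 proof -
  have "coef m k - (if k = 0 then m x else 0) = coef (%y. m y - 1 * m x) k"
   using coef_diff_cmult[OF m(1) continuous_on_const, of 1 "m x" k] coef_const by simp
  also have "... = coef (%y. gam y * E y - E x * gam y) k"
   unfolding coef_def by (intro arg_cong2[of _ _ _ _ "(*)"] refl integral_cong) (simp add: eq)
  also have "... = coef gam (k - 1) - E x * coef gam k"
   using coef_diff_cmult[of "%y. gam y * E y" gam "E x" k] cgam continuous_on_mult[OF cgam, of E] coef_shift[of gam k]
    smooth_continuous[OF smooth_on_fwave[of "-h"]] continuous_on_subset
   by (force simp: E_def[abs_def])
  finally have "coef m k = (if k = 0 then m x else 0) + (coef gam (k - 1) - E x * coef gam k)" by (simp add: algebra_simps)
  moreover have "E x * fwave (- h * real_of_int k) x = fwave (- h * real_of_int (k + 1)) x"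
   by (simp add: E_def algebra_simps flip: fwave_add)
  moreover have "fwave (- h * real_of_int 0) x = 1" by (simp add: fwave_def)
  moreover have "E x * coef gam k * fwave (- h * real_of_int k) x = coef gam k * fwave (- h * real_of_int (k + 1)) x"
   by (metis calculation(2) mult.assoc mult.commute)
  ultimately show ?thesis by (auto simp: a_def left_diff_distrib distrib_right)
 qed
 have sum: "(\<Sum>k\<in>{- int n..int n}. coef m k * fwave (- h * real_of_int k) x) = m x + (a (- int n) - a (int n + 1))" for n
 proof (induction n)
  case 0
  thus ?case using tm[of 0] by simp
 next
  case (Suc n)
  let ?F = "%k. coef m k * fwave (- h * real_of_int k) x"
  have "{- int (Suc n)..int (Suc n)} = insert (- int (Suc n)) (insert (int (Suc n)) {- int n..int n})" by auto
  hence "sum ?F {- int (Suc n)..int (Suc n)} = ?F (- int (Suc n)) + (?F (int (Suc n)) + sum ?F {- int n..int n})"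
   by simp
  moreover have "?F (- int (Suc n)) = a (- int (Suc n)) - a (- int n)" using tm[of "- int (Suc n)"] by simp
  moreover have "?F (int (Suc n)) = a (int n + 1) - a (int (Suc n) + 1)"
   using tm[of "int (Suc n)"] by (simp add: add.commute)
  ultimately show ?case using Suc by simp
 qed
 have lim: "((%n. coef gam (f n)) \<longlongrightarrow> 0) sequentially" if f: "!!n. abs (f n) >= int n" for f
 proof -
  have "filterlim (%n. h * real_of_int (f n)) at_infinity sequentially"
   unfolding filterlim_at_infinity[OF order_refl]
  proof (intro allI impI)
   fix r :: real assume "r > 0"
   show "eventually (%n. r <= norm (h * real_of_int (f n))) sequentially"
    using eventually_ge_at_top[of "nat \<lceil>r / h\<rceil>"]
   proof eventually_elim
    case (elim n)
    hence "r / h <= real n" by linarith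
    also have "... <= abs (real_of_int (f n))" using f[of n] by linarith
    finally show ?case using h(1) by (simp add: field_simps abs_mult)
   qed
  qed
  from filterlim_compose[OF Riemann_Lebesgue[OF _ cgam] this] have
   "((%n. integral {-L..L} (%y. gam y * fwave (h * real_of_int (f n)) y)) \<longlongrightarrow> 0) sequentially" using L by simp
  from tendsto_mult_left[OF this, of "complex_of_real (1 / (2 * L))"] show ?thesis unfolding coef_def by simp
 qed
 have lim': "((%n. a (f n + 1)) \<longlongrightarrow> 0) sequentially" if f: "!!n. abs (f n) >= int n" for f
  by (rule Lim_null_comparison[OF always_eventually tendsto_norm_zero[OF lim[OF f]]]) (simp add: a_def norm_mult)
 have "((%n. a (- int n)) \<longlongrightarrow> 0) sequentially" using lim'[of "%n. - int n - 1"] by simp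
 moreover have "((%n. a (int n + 1)) \<longlongrightarrow> 0) sequentially" using lim'[of int] by simp
 ultimately have "((%n. m x + (a (- int n) - a (int n + 1))) \<longlongrightarrow> m x + (0 - 0)) sequentially"
  by (intro tendsto_intros)
 moreover have "((%n. \<Sum>k\<in>{- int n..int n}. coef m k * fwave (- h * real_of_int k) x) \<longlongrightarrow>
  infsum (%k. coef m k * fwave (- h * real_of_int k) x) UNIV) sequentially"
  using filterlim_compose[OF has_sum_infsum[OF s, unfolded has_sum_def] symmetric_intervals] .
 ultimately have "infsum (%k. coef m k * fwave (- h * real_of_int k) x) UNIV = m x"
  unfolding sum using LIMSEQ_unique by fastforce
 with has_sum_infsum[OF s] show ?thesis by simp
qed

definition freq :: "int \<times> int => R2" where
 "freq = (%(j, k). (h * of_int j, h * of_int k))"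

text \<open>In product form the sum of the inverse squares factors into two one-dimensional sums,
  while the weight still dominates \<open>1 + norm (freq kappa)\<close>.\<close>

definition weight :: "int \<times> int => real" where
 "weight = (%(j, k). (1 + abs (h * of_int j)) * (1 + abs (h * of_int k)))"

definition coef2 :: "(R2 => complex) => int \<times> int => complex" where
 "coef2 m = (%(j, k). coef (%s. coef (%t. m (s, t)) k) j)"

lemma weight_ge_1: "weight kappa >= 1"
 by (auto simp: weight_def case_prod_unfold intro: order_trans[OF _ mult_mono[of 1 _ 1]])

lemma norm_freq_le: "1 + norm (freq kappa) <= weight kappa"
proof -
 obtain j k where k: "kappa = (j, k)" by force
 have "norm (freq kappa) <= abs (h * of_int j) + abs (h * of_int k)"
  unfolding k freq_def using norm_Pair_le[of "h * of_int j" "h * of_int k"] by simp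
 thus ?thesis unfolding k weight_def by (simp add: algebra_simps) (smt (verit) abs_ge_zero mult_nonneg_nonneg)
qed

definition box :: "real => R2 set" where
 "box r = {-r..r} \<times> {-r..r}"

lemma closed_box: "closed (box r)"
 by (auto simp: box_def intro!: closed_Times)

lemma coef_deriv:
 assumes "!!x. (m has_vector_derivative m' x) (at x)" "continuous_on UNIV m'" "m L = 0" "m (- L) = 0"
 shows "coef m' k = \<i> * of_real (h * of_int k) * coef m k"
 unfolding coef_def
 using integral_fwave_parts[OF _ assms(1), of "-L" L "h * of_int k"] continuous_on_subset[OF assms(2), of "{-L..L}"] assms(3,4) L
 by simp

text \<open>By Fubini either variable may be integrated first. For a derivative in the first
  variable the other order is needed, so that the integration by parts happens in the inner
  integral.\<close>

lemma coef2_swap: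
 assumes "smooth m"
 shows "coef2 m (j, k) = coef (%t. coef (%s. m (s, t)) j) k"
proof -
 let ?f = "%s t. m (s, t) * (fwave (h * of_int k) t * fwave (h * of_int j) s)"
 have "continuous_on UNIV (%p. m p * (fwave (h * of_int k) (snd p) * fwave (h * of_int j) (fst p)))"
  by (intro smooth_continuous smooth_on_mult open_UNIV assms smooth_comp[OF smooth_on_fwave] smooth_on_linear bounded_linear_fst bounded_linear_snd)
 hence "continuous_on (cbox (-L, -L) (L, L)) (%(s, t). ?f s t)"
  unfolding case_prod_unfold by (auto intro: continuous_on_subset)
 from integral_swap_continuous[OF this] show ?thesis
  by (simp add: coef2_def coef_def mult_ac flip: integral_mult_right integral_mult_left)
qed

lemma coef2_deriv:
 assumes m: "smooth m" and supp: "!!x. x \<notin> box L0 ==> m x = 0" "L0 < L" and v: "v \<in> Basis"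
 shows "coef2 (%x. fderiv m x v) kappa = \<i> * of_real (v \<bullet> freq kappa) * coef2 m kappa"
proof -
 obtain j k where kappa: "kappa = (j, k)" by force
 have cm: "coef (%t. c * f t) j = c * coef f j" for c f j by (simp add: coef_def mult.assoc)
 have D: "(m has_derivative fderiv m x) (at x)" for x
  by (rule smooth_has_derivative[OF m] UNIV_I)+
 have lin: "fderiv m x (c *\<^sub>R w) = c *\<^sub>R fderiv m x w" for x c w
  using linear_cmul[OF has_derivative_linear[OF D]] .
 have sm: "smooth (%x. fderiv m x v)" by (rule smooth_on_frechet[OF open_UNIV m v])
 from v consider "v = (1, 0)" | "v = (0, 1)" by (auto simp: Basis_prod_def)
 thus ?thesis
 proof cases
  case 1
  have "coef (%s. fderiv m (s, t) v) j = \<i> * of_real (h * of_int j) * coef (%s. m (s, t)) j" for t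
  proof (rule coef_deriv)
   show "((%s. m (s, t)) has_vector_derivative fderiv m (s, t) v) (at s)" for s
    unfolding has_vector_derivative_def 1
   proof (rule has_derivative_eq_rhs[OF has_derivative_slice(1)[OF D]], rule ext)
    show "fderiv m (s, t) (w, 0) = w *\<^sub>R fderiv m (s, t) (1, 0)" for w
     using lin[of "(s, t)" w "(1, 0)"] by simp
   qed
   show "continuous_on UNIV (%s. fderiv m (s, t) v)"
    by (rule smooth_continuous[OF smooth_on_slice(1)[OF sm]])
   show "m (L, t) = 0" "m (- L, t) = 0" using supp L by (auto simp: box_def)
  qed
  thus ?thesis by (simp add: kappa coef2_swap[OF sm[unfolded 1]] coef2_swap[OF m] freq_def 1 cm)
 next
  case 2
  have "coef (%t. fderiv m (s, t) v) k = \<i> * of_real (h * of_int k) * coef (%t. m (s, t)) k" for s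
  proof (rule coef_deriv)
   show "((%t. m (s, t)) has_vector_derivative fderiv m (s, t) v) (at t)" for t
    unfolding has_vector_derivative_def 2
   proof (rule has_derivative_eq_rhs[OF has_derivative_slice(2)[OF D]], rule ext)
    show "fderiv m (s, t) (0, w) = w *\<^sub>R fderiv m (s, t) (0, 1)" for w
     using lin[of "(s, t)" w "(0, 1)"] by simp
   qed
   show "continuous_on UNIV (%t. fderiv m (s, t) v)"
    using smooth_on_slice(2)[OF sm] .
   show "m (s, L) = 0" "m (s, - L) = 0" using supp L by (auto simp: box_def)
  qed
  thus ?thesis by (simp add: coef2_def kappa freq_def 2 cm)
 qed
qed

lemma coef2_iter_deriv:
 assumes m: "smooth m" "!!x. x \<notin> box L0 ==> m x = 0" "L0 < L" and vs: "dirs vs"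
 shows "coef2 (iter_deriv vs m) kappa = (\<Prod>v\<leftarrow>vs. \<i> * of_real (v \<bullet> freq kappa)) * coef2 m kappa"
 using vs
proof (induction vs)
 case (Cons v vs)
 have s: "smooth (iter_deriv vs m)" by (rule smooth_iter_deriv[OF m(1)]) (use Cons.prems in simp)
 have "iter_deriv vs m x = 0" if "x \<notin> box L0" for x
  by (rule smooth_supp_iter_deriv_0[OF _ closed_box that]) (use m in \<open>simp add: smooth_supp_def\<close>)
 from coef2_deriv[OF s this m(3), of v kappa] Cons show ?case by simp
qed simp

text \<open>The coefficient of a derivative is the coefficient times a monomial in the frequency.
  Taking \<open>N\<close> derivatives in each variable whose frequency has modulus at least 1, and
  none in the others, controls the power of the weight. The constant comes from derivative bounds
  only and is therefore uniform in \<open>i\<close>.\<close>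

lemma coef2_decay:
 fixes m :: "'i => R2 => complex"
 assumes m: "!!k. unif_Ck k UNIV (box L) I m" and L0: "L0 < L"
  and supp: "!!i x. i \<in> I ==> x \<notin> box L0 ==> m i x = 0"
 shows "\<exists>C. \<forall>i\<in>I. \<forall>kappa. weight kappa ^ N * norm (coef2 (m i) kappa) <= C"
proof -
 obtain D where D: "!!vs i x. dirs vs ==> length vs <= N + N ==> i \<in> I ==> x \<in> box L ==> norm (iter_deriv vs (m i) x) <= D"
  using unif_Ck_uniform_bound[OF m] by metis
 \<comment> \<open>Compares \<open>1 + abs a\<close> with the power of \<open>abs a\<close> that the
   derivatives supply; below 1 no derivative is taken.\<close>
 have one: "(1 + abs a) ^ N <= 2 ^ N * (if abs a < 1 then 1 else abs a ^ N)" for a :: real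
  using power_mono[of "1 + abs a" 2 N] power_mono[of "1 + abs a" "2 * abs a" N] by (auto simp: power_mult_distrib)
 have "weight kappa ^ N * norm (coef2 (m i) kappa) <= 2 ^ N * 2 ^ N * D" if i: "i \<in> I" for i kappa
 proof -
  obtain j k where kappa: "kappa = (j, k)" by force
  define a b where "a = h * of_int j" and "b = h * of_int k"
  define vs :: "R2 list" where "vs = (if abs a < 1 then [] else replicate N (1, 0)) @ (if abs b < 1 then [] else replicate N (0, 1))"
  have vs: "dirs vs" "length vs <= N + N" by (auto simp: vs_def Basis_prod_def)
  have p: "norm (\<Prod>v\<leftarrow>vs. \<i> * complex_of_real (v \<bullet> freq kappa)) = (if abs a < 1 then 1 else abs a ^ N) * (if abs b < 1 then 1 else abs b ^ N)"
   by (simp add: vs_def kappa freq_def a_def[symmetric] b_def[symmetric] map_replicate_const[symmetric] prod_list_replicate norm_mult norm_power)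
  have "norm (coef2 (iter_deriv vs (m i)) kappa) <= D"
   unfolding coef2_def kappa prod.case by (intro coef_norm_le D[OF vs i]) (simp add: box_def)
  also have "norm (coef2 (iter_deriv vs (m i)) kappa) = norm (\<Prod>v\<leftarrow>vs. \<i> * complex_of_real (v \<bullet> freq kappa)) * norm (coef2 (m i) kappa)"
   by (subst coef2_iter_deriv[OF unif_Ck_imp_smooth[OF m i] supp[OF i] L0 vs(1)]) (simp_all only: norm_mult not_False_eq_True)
  also note p
  finally have *: "(if abs a < 1 then 1 else abs a ^ N) * (if abs b < 1 then 1 else abs b ^ N) * norm (coef2 (m i) kappa) <= D" .
  have "weight kappa ^ N = (1 + abs a) ^ N * (1 + abs b) ^ N" by (simp add: kappa weight_def a_def b_def power_mult_distrib)
  also have "... <= (2 ^ N * (if abs a < 1 then 1 else abs a ^ N)) * (2 ^ N * (if abs b < 1 then 1 else abs b ^ N))"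
   by (intro mult_mono one) auto
  finally have "weight kappa ^ N * norm (coef2 (m i) kappa) <= ... * norm (coef2 (m i) kappa)" by (rule mult_right_mono) simp
  also have "... <= 2 ^ N * 2 ^ N * D" using mult_left_mono[OF *, of "2 ^ N * 2 ^ N"] by (simp only: mult_ac) simp
  finally show ?thesis .
 qed
 thus ?thesis by blast
qed

lemma summable_weight: "(%kappa. inverse (weight kappa ^ 2)) summable_on UNIV"
proof -
 define w where "w j = inverse ((1 + abs (h * of_int j)) ^ 2)" for j :: int
 have nat: "(%n::nat. inverse ((1 + abs (h * real n)) ^ 2)) summable_on UNIV"
 proof (rule summable_nonneg_imp_summable_on)
  have s: "summable (%n. inverse (h ^ 2) * inverse (real (Suc n) ^ 2))"
   by (intro summable_mult) (subst summable_Suc_iff, rule inverse_power_summable, simp)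
  have "summable (%n. inverse ((1 + abs (h * real (Suc n))) ^ 2))"
  proof (rule summable_comparison_test'[OF s])
   fix n :: nat
   have "(h * real (Suc n)) ^ 2 <= (1 + abs (h * real (Suc n))) ^ 2"
    using h(1) by (intro power_mono) auto
   hence "inverse ((1 + abs (h * real (Suc n))) ^ 2) <= inverse ((h * real (Suc n)) ^ 2)"
    using h(1) by (intro le_imp_inverse_le) auto
   thus "norm (inverse ((1 + abs (h * real (Suc n))) ^ 2)) <= inverse (h ^ 2) * inverse (real (Suc n) ^ 2)"
    by (simp add: power_mult_distrib)
  qed
  thus "summable (%n. inverse ((1 + abs (h * real n)) ^ 2))"
   using summable_Suc_iff[of "%n. inverse ((1 + abs (h * real n)) ^ 2)"] by simp
 qed auto
 have "w summable_on (range int)"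
  by (subst summable_on_reindex) (use nat in \<open>auto simp: o_def w_def\<close>)
 moreover have "w summable_on (range (%n. - int (Suc n)))"
 proof (subst summable_on_reindex)
  have "(%n::nat. inverse ((1 + abs (h * real n)) ^ 2)) summable_on (range Suc)"
   using summable_on_subset_banach[OF nat] by blast
  hence "((%n::nat. inverse ((1 + abs (h * real n)) ^ 2)) \<circ> Suc) summable_on UNIV"
   by (subst (asm) summable_on_reindex) auto
  moreover have "abs (h * real (Suc n)) = abs (h * of_int (- int (Suc n)))" for n
   by (simp only: of_int_minus of_int_of_nat_eq mult_minus_right abs_minus_cancel)
  ultimately show "(w \<circ> (%n. - int (Suc n))) summable_on UNIV"
   unfolding o_def w_def by simp
 qed (auto simp: inj_on_def)
 ultimately have "w summable_on (range int \<union> range (%n. - int (Suc n)))"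
  by (intro summable_on_Un_disjoint) auto
 moreover have "range int \<union> range (%n. - int (Suc n)) = UNIV"
  by (metis (no_types, lifting) UNIV_eq_I UnCI int_cases rangeI)
 ultimately have w: "w summable_on UNIV" by simp
 have "(%(j, k). w j * w k) summable_on (UNIV \<times> UNIV)"
 proof (rule summable_on_SigmaI)
  show "((%y. case (x, y) of (j, k) => w j * w k) has_sum w x * infsum w UNIV) UNIV" for x
   using has_sum_cmult_right[OF has_sum_infsum[OF w]] by simp
  show "(%x. w x * infsum w UNIV) summable_on UNIV" by (rule summable_on_cmult_left[OF w])
 qed (auto simp: w_def)
 thus ?thesis by (simp add: w_def weight_def power_mult_distrib case_prod_unfold)
qed

lemma coef2_norm_le:
 assumes "smooth m" "!!x. x \<notin> box L0 ==> m x = 0" "L0 < L"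
 shows "\<exists>C. \<forall>kappa. norm (coef2 m kappa) <= C * inverse (weight kappa ^ N)"
proof -
 have "compact (box L)" by (auto simp: box_def intro!: compact_Times)
 hence "!!k. unif_Ck k UNIV (box L) UNIV (%i::unit. m)"
  using smooth_unif_Ck[OF _ assms(1)] by blast
 from coef2_decay[OF this assms(3,2), of N] obtain C where C: "!!kappa. weight kappa ^ N * norm (coef2 m kappa) <= C" by blast
 have "norm (coef2 m kappa) <= C * inverse (weight kappa ^ N)" for kappa
  using weight_ge_1[of kappa] C[of kappa] by (simp add: divide_simps mult.commute)
 thus ?thesis by blast
qed

text \<open>Decay of order \<open>N + 2\<close> of the coefficients pays for the growth of
  \<open>g\<close> and leaves the summable inverse square of the weight.\<close>

lemma coef2_summable:
 assumes "smooth m" "!!x. x \<notin> box L0 ==> m x = 0" "L0 < L" "!!kappa. norm (g kappa) <= C * weight kappa ^ N"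
 shows "(%kappa. norm (coef2 m kappa * g kappa)) summable_on UNIV"
proof -
 obtain D where D: "!!kappa. norm (coef2 m kappa) <= D * inverse (weight kappa ^ (N + 2))"
  using coef2_norm_le[OF assms(1-3)] by blast
 have "norm (coef2 m kappa * g kappa) <= D * C * inverse (weight kappa ^ 2)" for kappa
 proof -
  have "norm (coef2 m kappa * g kappa) <= (D * inverse (weight kappa ^ (N + 2))) * (C * weight kappa ^ N)"
   unfolding norm_mult using D[of kappa] assms(4)[of kappa] by (intro mult_mono) (auto intro: order_trans[OF norm_ge_zero])
  thus ?thesis using weight_ge_1[of kappa] by (simp add: power_add field_simps power2_eq_square)
 qed
 thus ?thesis
  by (intro summable_on_comparison_test[OF summable_on_cmult_right[OF summable_weight, of "D * C"]]) auto
qed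

text \<open>Two one-dimensional inversions: for fixed \<open>k\<close> in the first variable, then
  in the second. Absolute summability of the double series provides the summability that each of
  them requires and justifies the iterated summation.\<close>

lemma fourier_inversion2:
 assumes m: "smooth m" "!!x. x \<notin> box L0 ==> m x = 0" "L0 < L" and x: "abs (fst x) < L" "abs (snd x) < L"
 shows "((%kappa. coef2 m kappa * fwave (- freq kappa) x) has_sum m x) UNIV"
proof -
 obtain s t where st: "x = (s, t)" by force
 have abs: "(%kappa. norm (coef2 m kappa * fwave (- freq kappa) x)) summable_on UNIV"
  by (rule coef2_summable[OF m, where C = 1 and N = 0]) auto
 have w: "fwave (- freq (j, k)) x = fwave (- h * of_int j) s * fwave (- h * of_int k) t" for j k
  by (simp add: st freq_def fwave_def algebra_simps flip: exp_add)
 have D: "(m has_derivative fderiv m x) (at x)" for x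
  by (rule smooth_has_derivative[OF m(1)] UNIV_I)+
 have sm: "smooth (%s. coef (%t. m (s, t)) k)" for k
 proof -
  have "smooth (%p. m p * fwave (h * of_int k) (snd p))"
   by (intro smooth_on_mult open_UNIV m smooth_comp[OF smooth_on_fwave] smooth_on_linear) (auto intro: bounded_linear_snd)
  from smooth_on_mult[OF open_UNIV smooth_on_const[OF open_UNIV, of "of_real (1 / (2 * L))"] smooth_on_integral[OF this, of "-L" L]]
  show ?thesis unfolding coef_def snd_conv .
 qed
 have vd: "(f has_vector_derivative (fderiv f y 1)) (at y)" if "smooth f" for f :: "real => complex" and y
 proof -
  have d: "(f has_derivative fderiv f y) (at y)"
   by (rule smooth_has_derivative[OF that] UNIV_I)+
  show ?thesis unfolding has_vector_derivative_def
   by (rule has_derivative_eq_rhs[OF d], rule ext, subst linear_cmul[OF has_derivative_linear[OF d], symmetric]) simp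
 qed
 have abs': "(%p. norm ((%(k, j). coef2 m (j, k) * fwave (- freq (j, k)) x) p)) summable_on UNIV \<times> UNIV"
  using abs summable_on_reindex_bij_betw[OF bij_swap, of "%kappa. norm (coef2 m kappa * fwave (- freq kappa) x)"]
  by (simp add: case_prod_unfold prod.swap_def)
 have inner: "((%j. coef2 m (j, k) * fwave (- freq (j, k)) x) has_sum (coef (%t. m (s, t)) k * fwave (- h * of_int k) t)) UNIV" for k
 proof -
  have s1: "(%j. norm (coef2 m (j, k) * fwave (- freq (j, k)) x)) summable_on UNIV"
  proof -
   have "(%p. norm ((%(k, j). coef2 m (j, k) * fwave (- freq (j, k)) x) p)) summable_on (Pair k ` UNIV)"
    by (rule summable_on_subset_banach[OF abs']) auto
   moreover have "inj_on (Pair k) (UNIV :: int set)" by (simp add: inj_on_def)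
   ultimately show ?thesis by (simp only: summable_on_reindex o_def prod.case)
  qed
  have s2: "(%j. coef (%s. coef (%t. m (s, t)) k) j * fwave (- h * of_int j) s) summable_on UNIV"
   by (rule abs_summable_summable) (use s1 in \<open>simp add: w coef2_def norm_mult\<close>)
  have "((%j. coef (%s. coef (%t. m (s, t)) k) j * fwave (- h * of_int j) s) has_sum coef (%t. m (s, t)) k) UNIV"
   by (rule fourier_inversion[OF _ vd[OF sm] _ s2])
    (use x st smooth_continuous[OF sm] in auto)
  from has_sum_cmult_left[OF this, of "fwave (- h * of_int k) t"] show ?thesis
   by (simp add: w coef2_def mult.assoc)
 qed
 have sl: "smooth (%t. m (s, t))"
  by (intro smooth_comp[OF m(1)] smooth_on_Pair smooth_on_const smooth_on_linear open_UNIV bounded_linear_ident)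
 have "(%k. coef (%t. m (s, t)) k * fwave (- h * of_int k) t) summable_on UNIV"
  using summable_on_Sigma_banach[OF abs_summable_summable[OF abs'[unfolded UNIV_Times_UNIV[symmetric]]]] infsumI[OF inner] by simp
 hence "((%k. coef (%t. m (s, t)) k * fwave (- h * of_int k) t) has_sum m (s, t)) UNIV"
  by (intro fourier_inversion[OF _ vd[OF sl]])
   (use x st smooth_continuous[OF sl] in auto)
 hence "((%(k, j). coef2 m (j, k) * fwave (- freq (j, k)) x) has_sum m x) (UNIV \<times> UNIV)"
  unfolding st by (intro has_sum_SigmaI[where g = "%k. coef (%t. m (s, t)) k * fwave (- h * of_int k) t"])
   (use inner abs_summable_summable[OF abs'] in \<open>simp_all add: st\<close>)
 thus ?thesis
  using has_sum_reindex_bij_betw[OF bij_swap, of "%kappa. coef2 m kappa * fwave (- freq kappa) x"]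
  by (simp add: case_prod_unfold prod.swap_def)
qed

lemma fourier_inversion2_deriv:
 assumes m: "smooth m" "!!x. x \<notin> box L0 ==> m x = 0" "L0 < L" and x: "abs (fst x) < L" "abs (snd x) < L"
  and vs: "dirs vs"
 shows "((%kappa. coef2 m kappa * iter_deriv vs (fwave (- freq kappa)) x) has_sum iter_deriv vs m x) UNIV"
proof -
 have "iter_deriv vs m x = 0" if "x \<notin> box L0" for x
  by (rule smooth_supp_iter_deriv_0[OF _ closed_box that]) (use m in \<open>simp add: smooth_supp_def\<close>)
 from fourier_inversion2[OF smooth_iter_deriv[OF m(1) vs] this m(3) x] show ?thesis
  by (simp add: coef2_iter_deriv[OF m vs] iter_deriv_fwave mult_ac)
qed

text \<open>One summable majorant \<open>w\<close> serves all derivatives up to order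
  \<open>n\<close>, so a single finite set of frequencies works for all of them. Functionals of
  finite order can therefore be evaluated on partial sums.\<close>

lemma fourier_approximation:
 assumes m: "smooth m" "!!x. x \<notin> box L0 ==> m x = 0" "L0 < L" and eps: "eps > 0"
 shows "\<exists>F. finite F & (\<forall>vs x. dirs vs --> length vs <= n --> abs (fst x) < L --> abs (snd x) < L -->
  norm (iter_deriv vs (%x. m x - (\<Sum>kappa\<in>F. coef2 m kappa * fwave (- freq kappa) x)) x) <= eps)"
proof -
 obtain D where D: "!!kappa. norm (coef2 m kappa) <= D * inverse (weight kappa ^ (n + 2))"
  using coef2_norm_le[OF m] by blast
 define w where "w kappa = D * inverse (weight kappa ^ 2)" for kappa
 have w: "w summable_on UNIV" unfolding w_def by (rule summable_on_cmult_right[OF summable_weight])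
 have t: "norm (coef2 m kappa * iter_deriv vs (fwave (- freq kappa)) x) <= w kappa" if "dirs vs" "length vs <= n" for vs x kappa
 proof -
  have "norm (iter_deriv vs (fwave (- freq kappa)) x) <= norm (freq kappa) ^ length vs"
   using norm_iter_deriv_fwave[OF that(1), of "- freq kappa" x] by simp
  also have "... <= weight kappa ^ length vs" using norm_freq_le[of kappa] by (intro power_mono) auto
  also have "... <= weight kappa ^ n" using weight_ge_1 that(2) by (intro power_increasing) auto
  finally have "norm (coef2 m kappa * iter_deriv vs (fwave (- freq kappa)) x) <= (D * inverse (weight kappa ^ (n + 2))) * weight kappa ^ n"
   unfolding norm_mult using D[of kappa] by (intro mult_mono) (auto intro: order_trans[OF norm_ge_zero])
  thus ?thesis using weight_ge_1[of kappa] by (simp add: w_def power_add field_simps power2_eq_square)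
 qed
 obtain F where F: "finite F" "dist (sum w F) (infsum w UNIV) <= eps"
  using has_sum_finite_approximation[OF has_sum_infsum[OF w] eps] by blast
 have tail: "infsum w (- F) <= eps"
 proof -
  have "infsum w UNIV = infsum w F + infsum w (- F)"
   using infsum_Un_disjoint[of w F "- F"] w F(1) summable_on_subset_banach by fastforce
  thus ?thesis using F by (simp add: dist_real_def)
 qed
 have "norm (iter_deriv vs (%x. m x - (\<Sum>kappa\<in>F. coef2 m kappa * fwave (- freq kappa) x)) x) <= eps"
  if vs: "dirs vs" "length vs <= n" and x: "abs (fst x) < L" "abs (snd x) < L" for vs x
 proof -
  let ?g = "%kappa. coef2 m kappa * iter_deriv vs (fwave (- freq kappa)) x"
  have sF: "iter_deriv vs (%x. \<Sum>kappa\<in>F. coef2 m kappa * fwave (- freq kappa) x) x = sum ?g F"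
   using F(1)
  proof (induction F rule: finite_induct)
   case empty
   have "iter_deriv vs (%x. 0 * (0::complex)) x = 0 * iter_deriv vs (%x. 0) x"
    by (rule iter_deriv_cmult[OF open_UNIV smooth_on_const[OF open_UNIV] vs(1) UNIV_I])
   thus ?case by simp
  next
   case (insert kappa F)
   thus ?case
    by (simp add: iter_deriv_add[OF open_UNIV _ _ vs(1)] iter_deriv_cmult[OF open_UNIV smooth_on_fwave vs(1)]
      smooth_on_mult smooth_on_const smooth_on_sum smooth_on_fwave)
  qed
  have hs: "(?g has_sum iter_deriv vs m x) UNIV" by (rule fourier_inversion2_deriv[OF m x vs(1)])
  have wF: "w summable_on (- F)" using summable_on_subset_banach[OF w] by blast
  have "(?g has_sum (iter_deriv vs m x - sum ?g F)) (UNIV - F)"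
   by (rule has_sum_Diff[OF hs has_sum_finite[OF F(1)]]) auto
  moreover have ab: "(%kappa. norm (?g kappa)) summable_on (- F)"
   by (rule summable_on_comparison_test[OF wF]) (use t vs in auto)
  ultimately have "norm (iter_deriv vs m x - sum ?g F) <= infsum w (- F)"
   by (metis (mono_tags, lifting) Compl_eq_Diff_UNIV infsumI norm_infsum_le t vs has_sum_infsum wF)
  hence "norm (iter_deriv vs m x - sum ?g F) <= eps" using tail by simp
  moreover have "iter_deriv vs (%x. m x - (\<Sum>kappa\<in>F. coef2 m kappa * fwave (- freq kappa) x)) x = iter_deriv vs m x - sum ?g F"
   by (subst iter_deriv_diff[OF open_UNIV m(1) _ vs(1)])
    (auto simp: sF intro!: smooth_on_sum smooth_on_mult smooth_on_const smooth_on_fwave)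
  ultimately show ?thesis by simp
 qed
 with F(1) show ?thesis by blast
qed

end

section \<open>Functionals of finite order\<close>

text \<open>The seminorm of order \<open>N\<close> enters through an arbitrary bound
  \<open>M\<close> of the derivatives, which avoids a supremum. Linearity is demanded on functions
  supported in \<open>K\<close>, where the values of the functional are meaningful.\<close>

locale finite_order =
 fixes K :: "R2 set" and v :: "(R2 => complex) => complex" and N :: nat and C :: real
 assumes K: "compact K"
  and add: "phi \<in> smooth_supp K ==> psi \<in> smooth_supp K ==> v (%x. phi x + psi x) = v phi + v psi"
  and cmult: "phi \<in> smooth_supp K ==> v (%x. c * phi x) = c * v phi"
  and bound: "phi \<in> smooth_supp K ==> (!!vs x. dirs vs ==> length vs <= N ==> norm (iter_deriv vs phi x) <= M) ==> norm (v phi) <= C * M"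
begin

lemma zero: "v (%x. 0) = 0"
 using cmult[of "%x. 0" 0] by (simp add: smooth_supp_def smooth_on_const)

lemma diff:
 assumes "phi \<in> smooth_supp K" "psi \<in> smooth_supp K"
 shows "v (%x. phi x - psi x) = v phi - v psi"
proof -
 have "(%x. -1 * psi x) \<in> smooth_supp K"
  using assms(2) by (auto simp: smooth_supp_def intro!: smooth_on_minus)
 from add[OF assms(1) this] cmult[OF assms(2), of "-1"] show ?thesis by simp
qed

lemma sum:
 assumes "!!k. k \<in> F ==> phi k \<in> smooth_supp K"
 shows "v (%x. \<Sum>k\<in>F. c k * phi k x) = (\<Sum>k\<in>F. c k * v (phi k))"
 using assms
proof (induction F rule: infinite_finite_induct)
 case (insert k F)
 have "(%x. c k * phi k x) \<in> smooth_supp K" "(%x. \<Sum>k\<in>F. c k * phi k x) \<in> smooth_supp K"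
  using insert.prems by (auto simp: smooth_supp_def intro!: smooth_on_sum smooth_on_mult smooth_on_const sum.neutral)
 from add[OF this] insert cmult[of "phi k"] show ?case by simp
qed (simp_all add: zero)

text \<open>After multiplication by a cutoff the functional accepts every smooth function, such as
  an exponential, and is controlled by derivatives on \<open>K\<close>. The strict sign of
  \<open>M\<close> permits rescaling.\<close>

definition mult_const :: "(R2 => complex) => real => bool" where
 "mult_const theta D \<longleftrightarrow> D >= 0 & (\<forall>r M. smooth r --> M > 0 -->
  (\<forall>vs. dirs vs --> length vs <= N --> (\<forall>x\<in>K. norm (iter_deriv vs r x) <= M)) --> norm (v (%x. theta x * r x)) <= D * M)"

lemma mult_constD:
 assumes "mult_const theta D" "smooth r" "M > 0"
  "!!vs x. dirs vs ==> length vs <= N ==> x \<in> K ==> norm (iter_deriv vs r x) <= M"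
 shows "norm (v (%x. theta x * r x)) <= D * M"
 using assms unfolding mult_const_def by simp

lemma mult_bound:
 assumes "theta \<in> smooth_supp K"
 shows "\<exists>D. mult_const theta D"
proof -
 \<comment> \<open>The unit ball of the seminorm, used as an index set: the uniform Leibniz rule for
   families then gives one constant for all \<open>r\<close>.\<close>
 define I where "I = {r :: R2 => complex. smooth r &
  (\<forall>vs. dirs vs --> length vs <= N --> (\<forall>x\<in>K. norm (iter_deriv vs r x) <= 1))}"
 have stheta: "smooth theta" using assms by (rule smooth_suppD)
 have "unif_Ck N UNIV K I (%r. r)" by (rule unif_Ck_smooth) (auto simp: I_def intro!: exI[of _ 1])
 hence "unif_Ck N UNIV K I (%r x. theta x * r x)"
  by (intro unif_Ck_mult open_UNIV subset_UNIV smooth_unif_Ck[OF K stheta])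
 from unif_Ck_uniform_bound[OF this] obtain D where D: "D >= 0"
  "\<forall>vs. dirs vs --> length vs <= N --> (\<forall>r\<in>I. \<forall>x\<in>K. norm (iter_deriv vs (%x. theta x * r x) x) <= D)"
  by blast
 have C: "norm (v (%x. theta x * r x)) <= abs C * D" if r: "r \<in> I" for r
 proof -
  have s: "(%x. theta x * r x) \<in> smooth_supp K" using assms r by (auto simp: I_def intro: smooth_supp_mult)
  have "norm (iter_deriv vs (%x. theta x * r x) x) <= D" if "dirs vs" "length vs <= N" for vs x
   using D(1) D(2)[rule_format, OF that r] smooth_supp_iter_deriv_0[OF s compact_imp_closed[OF K], of x vs]
   by (cases "x \<in> K") auto
  from bound[OF s this] have "norm (v (%x. theta x * r x)) <= C * D" by blast
  also have "... <= abs C * D" using D(1) by (intro mult_right_mono) auto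
  finally show ?thesis .
 qed
 have "norm (v (%x. theta x * r x)) <= (abs C * D) * M"
  if r: "smooth r" "M > 0" "\<forall>vs. dirs vs --> length vs <= N --> (\<forall>x\<in>K. norm (iter_deriv vs r x) <= M)" for r M
 proof -
  define r' where "r' x = of_real (inverse M) * r x" for x
  have "r' \<in> I" unfolding I_def r'_def
  proof (intro CollectI conjI allI impI ballI)
   fix vs :: "R2 list" and x assume vs: "dirs vs" "length vs <= N" "x \<in> K"
   have "norm (iter_deriv vs r x) <= M" using r(3) vs by blast
   thus "norm (iter_deriv vs (%x. of_real (inverse M) * r x) x) <= 1"
    unfolding iter_deriv_cmult[OF open_UNIV r(1) vs(1) UNIV_I] norm_mult norm_of_real
    using r(2) by (simp add: divide_simps)
  qed (intro smooth_on_mult smooth_on_const open_UNIV r)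
  have "v (%x. theta x * r x) = v (%x. of_real M * (theta x * r' x))"
   using r(2) by (simp add: r'_def field_simps)
  also have "... = of_real M * v (%x. theta x * r' x)"
   using \<open>r' \<in> I\<close> assms by (intro cmult smooth_supp_mult) (auto simp: I_def)
  finally have "norm (v (%x. theta x * r x)) = M * norm (v (%x. theta x * r' x))" using r(2) by (simp add: norm_mult)
  also have "... <= M * (abs C * D)" using C[OF \<open>r' \<in> I\<close>] r(2) by simp
  finally show ?thesis by (simp add: mult.commute)
 qed
 thus ?thesis using D(1) unfolding mult_const_def by (intro exI[of _ "abs C * D"]) auto
qed

text \<open>The Fourier transform of the compactly supported distribution
  \<open>theta * v\<close>.\<close>

definition hat :: "(R2 => complex) => R2 => complex" where
 "hat theta eta = v (%x. theta x * fwave eta x)"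

text \<open>Derivatives of the exponential of order at most \<open>N\<close> cost at most
  \<open>N\<close> powers of the frequency.\<close>

lemma hat_growth:
 assumes "theta \<in> smooth_supp K"
 shows "\<exists>D\<ge>0. \<forall>eta. norm (hat theta eta) <= D * (1 + norm eta) ^ N"
proof -
 obtain D where mc: "mult_const theta D" using mult_bound[OF assms] by blast
 hence D: "D >= 0" by (simp add: mult_const_def)
 have "norm (hat theta eta) <= D * (1 + norm eta) ^ N" for eta unfolding hat_def
 proof (rule mult_constD[OF mc smooth_on_fwave])
  fix vs :: "R2 list" and x assume vs: "dirs vs" "length vs <= N"
  have "norm (iter_deriv vs (fwave eta) x) <= norm eta ^ length vs" by (rule norm_iter_deriv_fwave[OF vs(1)])
  also have "... <= (1 + norm eta) ^ length vs" by (intro power_mono) auto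
  also have "... <= (1 + norm eta) ^ N" using vs(2) by (intro power_increasing) auto
  finally show "norm (iter_deriv vs (fwave eta) x) <= (1 + norm eta) ^ N" .
 qed (simp add: add_pos_nonneg)
 thus ?thesis using D by blast
qed

lemma unif_Ck_inner_family:
 assumes "\<exists>B. \<forall>i\<in>I. norm (zeta i) <= B" "bounded S" "bounded_linear L"
 shows "unif_Ck n UNIV S I (%i x. L x \<bullet> (zeta i :: 'b::euclidean_space))"
proof -
 obtain B where B: "\<forall>i\<in>I. norm (zeta i) <= B" using assms(1) by blast
 have "unif_Ck n UNIV S I (%i x. \<Sum>b\<in>Basis. (L x \<bullet> b) * (zeta i \<bullet> b))"
 proof (intro unif_Ck_sum unif_Ck_mult open_UNIV subset_UNIV unif_Ck_linear unif_Ck_const assms(2))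
  fix b :: 'b assume "b \<in> Basis"
  show "bounded_linear (%x. L x \<bullet> b)" by (rule bounded_linear_compose[OF bounded_linear_inner_left assms(3)])
  show "\<exists>C. \<forall>i\<in>I. norm (zeta i \<bullet> b) <= C" using B Basis_le_norm[OF \<open>b \<in> Basis\<close>] by (auto intro!: exI[of _ B] intro: order_trans)
 qed
 moreover have "(%i x. L x \<bullet> zeta i) = (%i x. \<Sum>b\<in>Basis. (L x \<bullet> b) * (zeta i \<bullet> b))" by (intro ext euclidean_inner)
 ultimately show ?thesis by simp
qed

text \<open>Continuity supplies measurability. The difference of two exponentials is a family
  vanishing at \<open>s = 0\<close>, where \<open>s\<close> is the distance of the frequencies;
  division by \<open>s\<close> keeps the derivatives bounded, which gives a Lipschitz estimate near
  each \<open>eta\<close>.\<close>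

lemma hat_continuous:
 assumes "theta \<in> smooth_supp K"
 shows "continuous_on UNIV (hat theta)"
proof -
 obtain D where mc: "mult_const theta D" using mult_bound[OF assms] by blast
 hence D: "D >= 0" by (simp add: mult_const_def)
 have "isCont (hat theta) eta" for eta
 proof -
  define I where "I = {zeta :: R2. norm zeta <= 1}"
  define F where "F zeta p = exp (- \<i> * complex_of_real (fst p \<bullet> eta + snd p * (fst p \<bullet> zeta))) - exp (- \<i> * complex_of_real (fst p \<bullet> eta))"
   for zeta and p :: "R2 \<times> real"
  have bd: "bounded (K \<times> {-1..1::real})" using K by (intro bounded_Times) (auto intro: compact_imp_bounded)
  have "unif_Ck n UNIV (K \<times> {-1..1}) I F" for n
   unfolding F_def[abs_def]
   by (intro unif_Ck_diff unif_Ck_exp unif_Ck_mult unif_Ck_const' unif_Ck_blinear[OF bounded_linear_of_real] unif_Ck_add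
     unif_Ck_inner_family unif_Ck_linear[OF bounded_linear_snd] bd bounded_linear_fst open_UNIV subset_UNIV)
    (auto simp: I_def)
  hence "unif_Ck N UNIV K (I \<times> ({-1..1} - {0})) (%(zeta, s) x. F zeta (x, s) /\<^sub>R s)"
   by (rule unif_Ck_divide_param) (simp add: F_def)
  from unif_Ck_uniform_bound[OF this] obtain B where B0: "B >= 0" "\<forall>vs. dirs vs --> length vs <= N -->
    (\<forall>i\<in>I \<times> ({-1..1} - {0}). \<forall>x\<in>K. norm (iter_deriv vs (case i of (zeta, s) => %x. F zeta (x, s) /\<^sub>R s) x) <= B)"
   by blast
  have B: "B >= 0" "norm (iter_deriv vs (%x. F zeta (x, s) /\<^sub>R s) x) <= B"
   if "dirs vs" "length vs <= N" "zeta \<in> I" "s \<in> {-1..1} - {0}" "x \<in> K" for vs zeta s x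
   using B0(1) B0(2)[rule_format, of vs "(zeta, s)" x] that by auto
  have lip: "norm (hat theta eta' - hat theta eta) <= (D * (B + 1)) * norm (eta' - eta)" if "norm (eta' - eta) <= 1" for eta'
  proof (cases "eta' = eta")
   case False
   define s where "s = norm (eta' - eta)"
   define zeta where "zeta = (eta' - eta) /\<^sub>R s"
   have s: "s \<in> {-1..1} - {0}" "s > 0" "zeta \<in> I" using that False norm_ge_zero[of "eta' - eta"] by (auto simp: s_def zeta_def I_def simp del: norm_ge_zero)
   have F: "F zeta (x, s) = fwave eta' x - fwave eta x" for x
   proof -
    have "x \<bullet> eta + s * (x \<bullet> zeta) = x \<bullet> eta'" using s(2) by (simp add: zeta_def inner_diff_right mult.assoc[symmetric])
    thus ?thesis by (simp add: F_def fwave_def)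
   qed
   have sF: "smooth (%x. F zeta (x, s))"
    unfolding F by (intro smooth_on_diff smooth_on_fwave open_UNIV)
   have "norm (v (%x. theta x * F zeta (x, s))) <= D * ((B + 1) * s)"
   proof (rule mult_constD[OF mc sF])
    fix vs :: "R2 list" and x assume vs: "dirs vs" "length vs <= N" "x \<in> K"
    have "norm (iter_deriv vs (%x. F zeta (x, s) /\<^sub>R s) x) <= B" using B(2) vs s by blast
    moreover have "iter_deriv vs (%x. F zeta (x, s) /\<^sub>R s) x = iter_deriv vs (%x. F zeta (x, s)) x /\<^sub>R s"
     by (rule iter_deriv_blinear[OF open_UNIV sF vs(1) UNIV_I bounded_linear_scaleR_right])
    ultimately have "norm (iter_deriv vs (%x. F zeta (x, s)) x) <= B * s" using s(2) by (simp add: field_simps)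
    thus "norm (iter_deriv vs (%x. F zeta (x, s)) x) <= (B + 1) * s" using s(2) by (simp add: algebra_simps)
   qed (rule mult_pos_pos; use s(2) B0(1) in linarith)
   moreover have "v (%x. theta x * F zeta (x, s)) = hat theta eta' - hat theta eta"
    unfolding F hat_def using diff[OF smooth_supp_mult[OF assms smooth_on_fwave] smooth_supp_mult[OF assms smooth_on_fwave]]
    by (simp add: algebra_simps)
   ultimately show ?thesis by (simp add: s_def mult.assoc)
  qed simp
  have "((%eta'. (D * (B + 1)) * norm (eta' - eta)) \<longlongrightarrow> (D * (B + 1)) * norm (eta - eta)) (at eta)"
   by (intro tendsto_intros)
  hence "((%eta'. (D * (B + 1)) * norm (eta' - eta)) \<longlongrightarrow> 0) (at eta)" by simp
  moreover have "eventually (%eta'. norm (hat theta eta' - hat theta eta) <= (D * (B + 1)) * norm (eta' - eta)) (at eta)"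
   unfolding eventually_at by (intro exI[of _ 1]) (auto intro!: lip simp: dist_norm)
  ultimately have "((%eta'. hat theta eta' - hat theta eta) \<longlongrightarrow> 0) (at eta)" by (rule Lim_null_comparison[rotated])
  thus ?thesis unfolding isCont_def using LIM_zero_cancel by blast
 qed
 thus ?thesis by (simp add: continuous_at_imp_continuous_on)
qed

lemma hat_measurable: "theta \<in> smooth_supp K ==> hat theta \<in> borel_measurable borel"
 by (intro borel_measurable_continuous_onI hat_continuous)

end

locale finite_order_box = finite_order + fourier_box +
 fixes L0 assumes KL: "K \<subseteq> box L0" and L0: "L0 < L"
begin

text \<open>The Fourier series of \<open>m\<close> may be inserted termwise into the functional,
  since finite partial sums approximate \<open>m\<close> with all derivatives up to order
  \<open>N\<close> on \<open>K\<close>. Only a bound uniform over finite sums is carried over, so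
  the resulting series of numbers is never formed.\<close>

lemma fourier_expansion_bound:
 assumes theta: "theta \<in> smooth_supp K" and m: "smooth m" "!!x. x \<notin> box L0 ==> m x = 0"
  and B: "!!F. finite F ==> (\<Sum>kappa\<in>F. norm (coef2 m kappa) * norm (hat theta (- freq kappa))) <= B"
 shows "norm (v (%x. theta x * m x)) <= B"
proof (rule field_le_epsilon)
 fix eps :: real assume "eps > 0"
 obtain D where mc: "mult_const theta D" using mult_bound[OF theta] by blast
 hence D: "D >= 0" by (simp add: mult_const_def)
 \<comment> \<open>The denominator is \<open>D + 1\<close> because \<open>D\<close> may be
   0.\<close>
 have "eps / (D + 1) > 0" using \<open>eps > 0\<close> D by simp
 from fourier_approximation[OF m L0 this, of N] obtain F where F: "finite F"
  "!!vs x. dirs vs ==> length vs <= N ==> abs (fst x) < L ==> abs (snd x) < L ==>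
   norm (iter_deriv vs (%x. m x - (\<Sum>kappa\<in>F. coef2 m kappa * fwave (- freq kappa) x)) x) <= eps / (D + 1)" by blast
 define S where "S x = (\<Sum>kappa\<in>F. coef2 m kappa * fwave (- freq kappa) x)" for x
 have sS: "smooth S" unfolding S_def[abs_def]
  by (intro smooth_on_sum smooth_on_mult smooth_on_const smooth_on_fwave open_UNIV)
 have "norm (v (%x. theta x * (m x - S x))) <= D * (eps / (D + 1))"
 proof (rule mult_constD[OF mc])
  show "smooth (%x. m x - S x)" by (intro smooth_on_diff m sS open_UNIV)
  fix vs :: "R2 list" and x assume "dirs vs" "length vs <= N" "x \<in> K"
  moreover have "abs (fst x) < L" "abs (snd x) < L"
   using subsetD[OF KL \<open>x \<in> K\<close>] L0 by (auto simp: box_def)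
  ultimately show "norm (iter_deriv vs (%x. m x - S x) x) <= eps / (D + 1)" using F(2) by (simp add: S_def)
 qed fact
 also have "... <= eps" using D \<open>eps > 0\<close> by (simp add: field_simps)
 finally have 1: "norm (v (%x. theta x * (m x - S x))) <= eps" .
 have "v (%x. theta x * (m x - S x)) = v (%x. theta x * m x) - v (%x. theta x * S x)"
  using diff[OF smooth_supp_mult[OF theta m(1)] smooth_supp_mult[OF theta sS]] by (simp add: algebra_simps)
 moreover have "v (%x. theta x * S x) = (\<Sum>kappa\<in>F. coef2 m kappa * hat theta (- freq kappa))"
  unfolding hat_def using sum[of F "%kappa x. theta x * fwave (- freq kappa) x" "coef2 m"] smooth_supp_mult[OF theta smooth_on_fwave]
  by (simp add: S_def sum_distrib_left mult.left_commute)
 moreover have "norm (\<Sum>kappa\<in>F. coef2 m kappa * hat theta (- freq kappa)) <= B"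
  using B[OF F(1)] norm_sum[of "%kappa. coef2 m kappa * hat theta (- freq kappa)" F] by (simp add: norm_mult)
 ultimately show "norm (v (%x. theta x * m x)) <= B + eps"
  using 1 norm_triangle_ineq2[of "v (%x. theta x * m x)" "v (%x. theta x * S x)"] by simp
qed

lemma hat_shift:
 assumes "theta \<in> smooth_supp K"
 shows "v (%x. theta x * fwave xi x * fwave (- freq kappa) x) = hat theta (xi - freq kappa)"
 by (simp add: hat_def mult.assoc flip: fwave_add)

end

section \<open>Sobolev weights and Peetre's inequality\<close>

definition jb :: "real => 'a::real_normed_vector => real" where
 "jb s eta = (1 + (norm eta)^2) powr s"

lemma jb_pos: "jb s eta > 0"
 by (simp add: jb_def add_nonneg_eq_0_iff)

lemma jb_measurable [measurable]: "jb s \<in> borel_measurable (borel :: 'a::{real_normed_vector, second_countable_topology} measure)"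
 unfolding jb_def by measurable

lemma borel_measurable_nn_integral_count_space:
 fixes f :: "'i::countable => 'a => ennreal"
 assumes "!!i. f i \<in> borel_measurable M"
 shows "(%x. \<integral>\<^sup>+ i. f i x \<partial>count_space UNIV) \<in> borel_measurable M"
proof (rule sigma_finite_measure.borel_measurable_nn_integral[OF sigma_finite_measure_count_space])
 have "(%p. f (fst p) (snd p)) \<in> borel_measurable (count_space UNIV \<Otimes>\<^sub>M M)"
  by (rule measurable_pair_measure_countable1) (use assms in auto)
 from measurable_pair_swap[OF this] show "case_prod (%x i. f i x) \<in> borel_measurable (M \<Otimes>\<^sub>M count_space UNIV)"
  by (simp add: case_prod_unfold)
qed

text \<open>The measurable majorant allows families depending on the frequency in an unspecified way.\<close>

definition weighted_L2 :: "R2 set => real => (R2 => complex) => bool" where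
 "weighted_L2 V s F \<longleftrightarrow> (\<exists>G\<in>borel_measurable borel. (\<forall>xi\<in>V. ennreal ((norm (F xi))^2 * jb s xi) <= G xi) & (\<integral>\<^sup>+ xi. G xi \<partial>lborel) < \<infinity>)"

lemma weighted_L2_integral:
 assumes "weighted_L2 V s F"
 shows "(\<integral>\<^sup>+ xi\<in>V. ennreal ((norm (F xi))^2 * jb s xi) \<partial>lborel) < \<infinity>"
proof -
 obtain G where G: "\<forall>xi\<in>V. ennreal ((norm (F xi))^2 * jb s xi) <= G xi" "(\<integral>\<^sup>+ xi. G xi \<partial>lborel) < \<infinity>"
  using assms unfolding weighted_L2_def by blast
 have "(\<integral>\<^sup>+ xi\<in>V. ennreal ((norm (F xi))^2 * jb s xi) \<partial>lborel) <= (\<integral>\<^sup>+ xi. G xi \<partial>lborel)"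
  using G(1) by (intro nn_integral_mono) (simp add: indicator_def)
 thus ?thesis using G(2) by (rule le_less_trans)
qed

lemma peetre0: "1 + (norm (x :: 'a::real_normed_vector))^2 <= 2 * (1 + (norm (x - y))^2) * (1 + (norm y)^2)"
proof -
 have "norm x <= norm (x - y) + norm y" using norm_triangle_ineq[of "x - y" y] by simp
 hence "(norm x)^2 <= (norm (x - y) + norm y)^2" by (intro power_mono) auto
 also have "... <= 2 * (norm (x - y))^2 + 2 * (norm y)^2"
  using sum_squares_bound[of "norm (x - y)" "norm y"] by (simp add: power2_sum)
 finally have "(norm x)^2 <= 2 * (norm (x - y))^2 + 2 * (norm y)^2" .
 moreover have "2 * (1 + (norm (x - y))^2) * (1 + (norm y)^2) =
   2 * (norm (x - y))^2 + 2 * (norm y)^2 + (2 + 2 * ((norm (x - y))^2 * (norm y)^2))"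
  by (simp add: algebra_simps)
 moreover have "1 <= 2 + 2 * ((norm (x - y))^2 * (norm y)^2)" by (intro add_increasing2) auto
 ultimately show ?thesis by linarith
qed

text \<open>For negative \<open>s\<close> this is \<open>peetre0\<close> with the two points
  exchanged. The inequality moves the weight from one frequency to a shifted one at the price of a
  power of the shift.\<close>

lemma peetre: "jb s x <= (2 * (1 + (norm (x - y))^2)) powr (abs s) * jb s (y :: 'a::real_normed_vector)"
proof -
 let ?a = "1 + (norm x)^2" and ?b = "1 + (norm y)^2" and ?c = "2 * (1 + (norm (x - y))^2)"
 have pos: "?a > 0" "?b > 0" "?c > 0" by (simp_all add: add_pos_nonneg)
 show ?thesis
 proof (cases "s >= 0")
  case True
  have "?a powr s <= (?c * ?b) powr s" using peetre0[of x y] True pos by (intro powr_mono2) auto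
  thus ?thesis using True pos by (simp add: jb_def powr_mult)
 next
  case False
  have "?b <= ?c * ?a" using peetre0[of y x] by (simp add: norm_minus_commute)
  hence "(?c * ?a) powr s <= ?b powr s" using False pos by (intro powr_mono2') auto
  hence "?c powr s * ?a powr s <= ?b powr s" using pos by (simp add: powr_mult)
  hence "?c powr (- s) * (?c powr s * ?a powr s) <= ?c powr (- s) * ?b powr s"
   by (rule mult_left_mono) simp
  moreover have "?c powr (- s) * ?c powr s = 1" using pos by (simp flip: powr_add)
  ultimately have "?a powr s <= ?c powr (- s) * ?b powr s" by (simp add: mult.assoc[symmetric])
  thus ?thesis using False by (simp add: jb_def)
 qed
qed

lemma powr_le_power_nat: "(x::real) >= 1 ==> x powr (abs s) <= x ^ nat \<lceil>abs s\<rceil>"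
 using powr_mono[of "abs s" "real (nat \<lceil>abs s\<rceil>)" x] powr_realpow[of x "nat \<lceil>abs s\<rceil>"] real_nat_ceiling_ge[of "abs s"] by simp

lemma nn_integral_shift:
 fixes g :: "'a::euclidean_space => ennreal"
 assumes [measurable]: "g \<in> borel_measurable borel"
 shows "(\<integral>\<^sup>+ x. g (x - k) \<partial>lborel) = (\<integral>\<^sup>+ x. g x \<partial>lborel)"
proof -
 have "(\<integral>\<^sup>+ x. g x \<partial>lborel) = (\<integral>\<^sup>+ x. g x \<partial>distr lborel borel ((+) (- k)))"
  by (simp add: lborel_distr_plus)
 also have "... = (\<integral>\<^sup>+ x. g (- k + x) \<partial>lborel)" by (intro nn_integral_distr) auto
 finally show ?thesis by simp
qed

lemma integrable_inverse_square: "integrable lborel (%u::real. inverse (1 + u^2))"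
 using integrable_inverse_1_plus_square by (simp add: set_integrable_def einterval_eq)

lemma jb_add: "jb (s + t) xi = jb s xi * jb t xi"
 by (simp add: jb_def powr_add)

lemma jb_mono: "s <= t ==> jb s xi <= jb t xi"
 unfolding jb_def by (intro powr_mono) auto

lemma jb_le_power: "jb s xi <= (1 + (norm xi)^2) ^ nat \<lceil>abs s\<rceil>"
proof -
 have "jb s xi <= jb (abs s) xi" by (rule jb_mono) simp
 also have "... <= (1 + (norm xi)^2) ^ nat \<lceil>abs s\<rceil>"
  unfolding jb_def by (rule powr_le_power_nat) simp
 finally show ?thesis .
qed

text \<open>In the plane the weight of order -2 is integrable, by comparison with a product of two
  functions \<open>1 / (1 + u^2)\<close>. Two spare orders therefore turn a pointwise bound into
  weighted square integrability.\<close>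

lemma jb_nn_integral: "(\<integral>\<^sup>+ xi. ennreal (jb (-2) (xi :: R2)) \<partial>lborel) < \<infinity>"
proof -
 have le: "jb (-2) xi <= inverse (1 + (fst xi)^2) * inverse (1 + (snd xi)^2)" for xi :: "R2"
 proof -
  obtain u v where xi: "xi = (u, v)" by force
  have n: "(norm xi)^2 = u^2 + v^2" by (simp add: xi norm_prod_def)
  have p: "1 + (u^2 + v^2) > 0" "1 + u^2 > 0" "1 + v^2 > 0" by (auto simp: add_pos_nonneg)
  have "(1 + u^2) * (1 + v^2) <= (1 + (u^2 + v^2))^2"
   unfolding power2_eq_square[of "1 + (u^2 + v^2)"] by (intro mult_mono) auto
  hence "inverse ((1 + (u^2 + v^2))^2) <= inverse ((1 + u^2) * (1 + v^2))" using p by (intro le_imp_inverse_le) auto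
  moreover have "jb (-2) xi = inverse ((1 + (u^2 + v^2))^2)"
   using p by (simp add: jb_def n powr_minus powr_numeral)
  ultimately show ?thesis by (simp add: xi divide_inverse)
 qed
 have "(\<integral>\<^sup>+ xi. ennreal (jb (-2) (xi :: R2)) \<partial>lborel) <=
   (\<integral>\<^sup>+ xi. ennreal (inverse (1 + (fst xi)^2)) * ennreal (inverse (1 + (snd xi)^2)) \<partial>(lborel \<Otimes>\<^sub>M lborel))"
  unfolding lborel_prod
  by (intro nn_integral_mono) (subst ennreal_mult[symmetric], simp, simp, rule ennreal_leI, rule le)
 also have "... = (\<integral>\<^sup>+ u. ennreal (inverse (1 + u^2)) \<partial>lborel) * (\<integral>\<^sup>+ u. ennreal (inverse (1 + u^2)) \<partial>lborel)"
  by (subst lborel.nn_integral_fst[symmetric]) (auto simp: nn_integral_cmult nn_integral_multc)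
 also have "... < \<infinity>" using integrable_inverse_square by (simp add: integrable_iff_bounded ennreal_mult_less_top)
 finally show ?thesis .
qed

section \<open>A Schur estimate for families of amplitudes\<close>

context finite_order_box
begin

text \<open>The Fourier series of \<open>m xi\<close> turns the functional into a sum of
  \<open>hat theta (xi - freq kappa)\<close> with rapidly decreasing coefficients. Half of the decay
  of order \<open>2 * P\<close> stays with \<open>hat theta\<close>, where every single term is at
  most the root of the square sum; the other half is summable because \<open>P >= 2\<close>. This
  takes the place of the Cauchy-Schwarz inequality.\<close>

lemma schur_bound:
 assumes theta: "theta \<in> smooth_supp K" and m: "!!k. unif_Ck k UNIV (box L) V' m"
  and supp: "!!xi x. xi \<in> V' ==> x \<notin> box L0 ==> m xi x = 0" and P: "P >= 2"
 shows "\<exists>A\<ge>0. \<forall>xi\<in>V'. ennreal ((norm (v (%x. theta x * m xi x * fwave xi x)))^2) <=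
  ennreal A * (\<integral>\<^sup>+ kappa. ennreal (inverse (weight kappa ^ (2 * P)) * (norm (hat theta (xi - freq kappa)))^2) \<partial>count_space UNIV)"
proof -
 obtain D where D: "!!xi kappa. xi \<in> V' ==> weight kappa ^ (2 * P) * norm (coef2 (m xi) kappa) <= D"
  using coef2_decay[OF m L0 supp, of "2 * P"] by blast
 have sm: "smooth (m xi)" if "xi \<in> V'" for xi using unif_Ck_imp_smooth[OF m that] .
 define W where "W = infsum (%kappa. inverse (weight kappa ^ 2)) UNIV"
 have W: "(\<Sum>kappa\<in>F. inverse (weight kappa ^ P)) <= W" if "finite F" for F
 proof -
  have "(\<Sum>kappa\<in>F. inverse (weight kappa ^ P)) <= (\<Sum>kappa\<in>F. inverse (weight kappa ^ 2))"
  proof (intro sum_mono le_imp_inverse_le)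
   fix kappa show "weight kappa ^ 2 <= weight kappa ^ P" "0 < weight kappa ^ 2"
    using power_increasing[OF P weight_ge_1] weight_ge_1[of kappa] by (auto intro: zero_less_power)
  qed
  also have "... <= W" unfolding W_def
   using finite_sum_le_infsum[OF summable_weight that] weight_ge_1 by auto
  finally show ?thesis .
 qed
 have W0: "W >= 0" using W[of "{}"] by simp
 define D' where "D' = abs D + 1"
 have "ennreal ((norm (v (%x. theta x * m xi x * fwave xi x)))^2) <= ennreal ((D' * (W + 1))^2) *
  (\<integral>\<^sup>+ kappa. ennreal (inverse (weight kappa ^ (2 * P)) * (norm (hat theta (xi - freq kappa)))^2) \<partial>count_space UNIV)" (is "_ <= _ * ?T")
  if xi: "xi \<in> V'" for xi
 proof (cases "?T = \<infinity>")
  case True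
  \<comment> \<open>An infinite square sum makes the bound trivial provided the constant is
    positive; this is why 1 is added to \<open>W\<close> and to \<open>abs D\<close>.\<close>
  have "(D' * (W + 1))^2 > 0" using W0 by (auto simp: D'_def intro!: mult_pos_pos)
  thus ?thesis unfolding True by (simp add: ennreal_mult_top)
 next
  case False
  define T where "T = enn2real ?T"
  have T: "?T = ennreal T" "T >= 0" using False by (auto simp: T_def less_top)
  let ?w = "%kappa. inverse (weight kappa ^ P)" and ?H = "%kappa. norm (hat theta (xi - freq kappa))"
  have t: "?w kappa * ?H kappa <= sqrt T" for kappa
  proof -
   have "ennreal (inverse (weight kappa ^ (2 * P)) * (?H kappa)^2) <= ?T"
    using nn_integral_ge_point[of kappa UNIV "%kappa. ennreal (inverse (weight kappa ^ (2 * P)) * (?H kappa)^2)"] by simp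
   hence "inverse (weight kappa ^ (2 * P)) * (?H kappa)^2 <= T" using T by (simp add: ennreal_le_iff)
   moreover have "inverse (weight kappa ^ (2 * P)) * (?H kappa)^2 = (?w kappa * ?H kappa)^2"
    by (simp add: power_mult_distrib power_inverse power_mult mult.commute[of 2])
   ultimately show ?thesis by (simp add: real_le_rsqrt)
  qed
  have "norm (v (%x. (theta x * fwave xi x) * m xi x)) <= D' * (W + 1) * sqrt T"
  proof (rule fourier_expansion_bound[OF smooth_supp_mult[OF theta smooth_on_fwave] sm[OF xi] supp[OF xi]])
   fix F :: "(int \<times> int) set" assume F: "finite F"
   have "(\<Sum>kappa\<in>F. norm (coef2 (m xi) kappa) * norm (hat (%x. theta x * fwave xi x) (- freq kappa))) <= (\<Sum>kappa\<in>F. D' * ?w kappa * sqrt T)"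
   proof (intro sum_mono)
    fix kappa
    have w: "weight kappa ^ P > 0" using weight_ge_1[of kappa] by (intro zero_less_power) auto
    have "weight kappa ^ P * (weight kappa ^ P * norm (coef2 (m xi) kappa)) <= D'"
     using D[OF xi, of kappa] by (simp add: D'_def mult_2 power_add mult.assoc)
    hence "norm (coef2 (m xi) kappa) <= D' * ?w kappa * ?w kappa" using w by (simp add: field_simps)
    moreover have "hat (%x. theta x * fwave xi x) (- freq kappa) = hat theta (xi - freq kappa)"
     using hat_shift[OF theta] by (simp add: hat_def)
    ultimately have "norm (coef2 (m xi) kappa) * norm (hat (%x. theta x * fwave xi x) (- freq kappa)) <= (D' * ?w kappa * ?w kappa) * ?H kappa"
     by (simp add: mult_right_mono)
    also have "... = (D' * ?w kappa) * (?w kappa * ?H kappa)" by simp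
    also have "... <= (D' * ?w kappa) * sqrt T" using t w by (intro mult_left_mono) (auto simp: D'_def)
    finally show "norm (coef2 (m xi) kappa) * norm (hat (%x. theta x * fwave xi x) (- freq kappa)) <= D' * ?w kappa * sqrt T" .
   qed
   also have "... = D' * (\<Sum>kappa\<in>F. ?w kappa) * sqrt T" by (simp add: sum_distrib_left sum_distrib_right)
   also have "... <= D' * (W + 1) * sqrt T" using W[OF F] T(2) by (intro mult_right_mono mult_left_mono) (auto simp: D'_def)
   finally show "(\<Sum>kappa\<in>F. norm (coef2 (m xi) kappa) * norm (hat (%x. theta x * fwave xi x) (- freq kappa))) <= D' * (W + 1) * sqrt T" .
  qed
  hence "norm (v (%x. theta x * m xi x * fwave xi x)) <= D' * (W + 1) * sqrt T" by (simp add: mult.commute mult.left_commute)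
  hence "(norm (v (%x. theta x * m xi x * fwave xi x)))^2 <= (D' * (W + 1) * sqrt T)^2" by (intro power_mono) auto
  also have "... = (D' * (W + 1))^2 * T" using T(2) by (simp add: power_mult_distrib)
  finally show ?thesis unfolding T(1) using T(2) by (simp add: ennreal_leI flip: ennreal_mult)
 qed
 thus ?thesis by (intro exI[of _ "(D' * (W + 1))^2"]) auto
qed

text \<open>If \<open>xi - freq kappa\<close> lies in \<open>V\<close>, Peetre's inequality
  transfers the weight. Otherwise the separation of \<open>V'\<close> from the complement of
  \<open>V\<close> forces \<open>freq kappa\<close> to be at least of the order of
  \<open>xi\<close>; the polynomial growth of \<open>hat theta\<close> and two spare orders of the
  weight are then paid for by powers of \<open>weight kappa\<close>.\<close>

lemma schur_pointwise:
 assumes theta: "theta \<in> smooth_supp K" and eps: "eps > 0"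
  and sep: "!!xi eta. xi \<in> V' ==> eta \<notin> V ==> eps * norm xi <= norm (xi - eta)"
  and G: "!!eta. eta \<in> V ==> ennreal ((norm (hat theta eta))^2 * jb s eta) <= G eta"
 obtains A M where "A >= 0" "!!kappa xi. xi \<in> V' ==> ennreal ((norm (hat theta (xi - freq kappa)))^2 * jb s xi) <=
  ennreal (A * weight kappa ^ M) * (G (xi - freq kappa) + ennreal (jb (-2) xi))"
proof -
 define n where "n = nat \<lceil>abs s\<rceil>"
 define l where "l = nat \<lceil>abs (s + 2)\<rceil>"
 obtain D where D: "D >= 0" "!!eta. norm (hat theta eta) <= D * (1 + norm eta) ^ N" using hat_growth[OF theta] by blast
 \<comment> \<open>In the second case both \<open>norm xi\<close> and
   \<open>1 + norm (xi - freq kappa)\<close> are at most \<open>E * weight kappa\<close>.\<close>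
 define E where "E = 1 + 1 / eps"
 have E: "E >= 1" using eps by (auto simp: E_def)
 define A1 where "A1 = (4::real) ^ n"
 define A2 where "A2 = (D * E ^ N)^2 * (2 * E^2) ^ l"
 have A: "A1 >= 0" "A2 >= 0" by (simp_all add: A1_def A2_def)
 have "ennreal ((norm (hat theta (xi - freq kappa)))^2 * jb s xi) <=
  ennreal ((A1 + A2) * weight kappa ^ (2 * n + (2 * N + 2 * l))) * (G (xi - freq kappa) + ennreal (jb (-2) xi))" if xi: "xi \<in> V'" for kappa xi
 proof -
  let ?k = "freq kappa" and ?w = "weight kappa"
  let ?c = "(A1 + A2) * ?w ^ (2 * n + (2 * N + 2 * l))"
  have w: "?w >= 1" "norm ?k <= ?w" using weight_ge_1 norm_freq_le[of kappa] by auto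
  have c: "A1 * ?w ^ (2 * n) <= ?c" "A2 * ?w ^ (2 * N + 2 * l) <= ?c"
   using A w(1) by (auto intro!: mult_mono power_increasing)
  show ?thesis
  proof (cases "xi - ?k \<in> V")
   case True
   have "1 + (norm ?k)^2 <= 2 * ?w^2" using power_mono[OF w(1), of 2] power_mono[OF w(2), of 2] by simp
   hence "(2 * (1 + (norm ?k)^2)) ^ n <= (4 * ?w^2) ^ n" by (intro power_mono) auto
   moreover have "(2 * (1 + (norm ?k)^2)) powr (abs s) <= (2 * (1 + (norm ?k)^2)) ^ n"
    unfolding n_def by (rule powr_le_power_nat) (simp add: add_increasing2)
   ultimately have "(2 * (1 + (norm ?k)^2)) powr (abs s) <= ?c"
    using c(1) by (simp add: A1_def power_mult_distrib power_mult)
   hence "jb s xi <= ?c * jb s (xi - ?k)"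
    using peetre[of s xi "xi - ?k"] jb_pos[of s "xi - ?k"] by (auto intro: order_trans mult_right_mono)
   hence "(norm (hat theta (xi - ?k)))^2 * jb s xi <= ?c * ((norm (hat theta (xi - ?k)))^2 * jb s (xi - ?k))"
    using mult_left_mono[of "jb s xi" _ "(norm (hat theta (xi - ?k)))^2"] by (simp add: mult.left_commute)
   hence "ennreal ((norm (hat theta (xi - ?k)))^2 * jb s xi) <= ennreal ?c * ennreal ((norm (hat theta (xi - ?k)))^2 * jb s (xi - ?k))"
    using A w(1) jb_pos[of s "xi - ?k"] by (simp add: ennreal_leI flip: ennreal_mult)
   also have "... <= ennreal ?c * (G (xi - ?k) + ennreal (jb (-2) xi))"
    using G[OF True] by (intro mult_left_mono add_increasing2) auto
   finally show ?thesis .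
  next
   case False
   from sep[OF xi this] have x: "norm xi <= norm ?k / eps" using eps by (simp add: field_simps)
   have "E * norm ?k = norm ?k + norm ?k / eps" by (simp add: E_def algebra_simps)
   moreover have "E * (1 + norm ?k) <= E * ?w" using E norm_freq_le[of kappa] by (intro mult_left_mono) auto
   ultimately have xw: "norm xi <= E * ?w" and h: "1 + norm (xi - ?k) <= E * ?w"
    using x norm_triangle_ineq4[of xi ?k] norm_ge_zero[of ?k] E unfolding distrib_left mult_1_right by linarith+
   have "D * (1 + norm (xi - ?k)) ^ N <= D * (E * ?w) ^ N" using D(1) h by (intro mult_left_mono power_mono) auto
   hence 1: "(norm (hat theta (xi - ?k)))^2 <= (D * (E * ?w) ^ N)^2"
    using D(2)[of "xi - ?k"] by (intro power_mono) auto
   have "1 <= E * ?w" using mult_mono[OF E w(1)] E by simp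
   hence "1 + (norm xi)^2 <= 2 * (E * ?w)^2"
    using power_mono[OF xw norm_ge_zero, of 2] one_le_power[of "E * ?w" 2] by linarith
   hence "(1 + (norm xi)^2) ^ l <= (2 * (E * ?w)^2) ^ l" by (intro power_mono) auto
   hence "jb (s + 2) xi <= (2 * (E * ?w)^2) ^ l" using jb_le_power[of "s + 2" xi] by (simp add: l_def)
   hence "(norm (hat theta (xi - ?k)))^2 * jb (s + 2) xi <= (D * (E * ?w) ^ N)^2 * (2 * (E * ?w)^2) ^ l"
    using 1 jb_pos[of "s + 2" xi] by (intro mult_mono) auto
   also have "... = A2 * ?w ^ (2 * N + 2 * l)"
   proof -
    have "(D * (E * ?w) ^ N)^2 = (D * E ^ N)^2 * ?w ^ (2 * N)"
     by (simp add: power_mult_distrib power_mult[symmetric] mult.commute[of N 2])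
    moreover have "(2 * (E * ?w)^2) ^ l = (2 * E^2) ^ l * ?w ^ (2 * l)"
     by (simp only: power_mult_distrib power_mult mult.assoc)
    ultimately show ?thesis unfolding A2_def by (simp only: power_add ac_simps)
   qed
   also note c(2)
   finally have "(norm (hat theta (xi - ?k)))^2 * jb (s + 2) xi * jb (-2) xi <= ?c * jb (-2) xi"
    using jb_pos[of "-2" xi] by (intro mult_right_mono) auto
   moreover have "jb s xi = jb (s + 2) xi * jb (-2) xi" using jb_add[of "s + 2" "-2" xi] by simp
   ultimately have "ennreal ((norm (hat theta (xi - ?k)))^2 * jb s xi) <= ennreal ?c * ennreal (jb (-2) xi)"
    using A w(1) jb_pos[of "-2" xi] by (simp add: ennreal_leI mult.assoc flip: ennreal_mult)
   also have "... <= ennreal ?c * (G (xi - ?k) + ennreal (jb (-2) xi))" by (intro mult_left_mono add_increasing) auto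
   finally show ?thesis .
  qed
 qed
 from that[OF _ this] show ?thesis using A by simp
qed

text \<open>The pointwise bound is summed over \<open>kappa\<close> and integrated; by translation
  invariance the integral of the shifted majorant is the same for every \<open>kappa\<close>. The
  choice \<open>P = M + 2\<close> beats the growth of order \<open>M\<close> in the pointwise bound
  and leaves the summable inverse square of the weight.\<close>

lemma schur:
 assumes theta: "theta \<in> smooth_supp K" and m: "!!k. unif_Ck k UNIV (box L) V' m"
  and supp: "!!xi x. xi \<in> V' ==> x \<notin> box L0 ==> m xi x = 0" and eps: "eps > 0"
  and sep: "!!xi eta. xi \<in> V' ==> eta \<notin> V ==> eps * norm xi <= norm (xi - eta)"
  and L2: "weighted_L2 V s (hat theta)"
 shows "weighted_L2 V' s (%xi. v (%x. theta x * m xi x * fwave xi x))"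
proof -
 obtain G where G [measurable]: "G \<in> borel_measurable borel" and le: "!!eta. eta \<in> V ==> ennreal ((norm (hat theta eta))^2 * jb s eta) <= G eta"
  and fin: "(\<integral>\<^sup>+ xi. G xi \<partial>lborel) < \<infinity>"
  using L2 unfolding weighted_L2_def by blast
 obtain B M where B: "B >= 0" "!!kappa xi. xi \<in> V' ==> ennreal ((norm (hat theta (xi - freq kappa)))^2 * jb s xi) <=
   ennreal (B * weight kappa ^ M) * (G (xi - freq kappa) + ennreal (jb (-2) xi))"
  by (rule schur_pointwise[OF theta eps, where V = V and V' = V' and s = s and G = G, OF _ _ that]) (erule (1) sep | erule le)+
 define P where "P = M + 2"
 let ?w = "%kappa. inverse (weight kappa ^ (2 * P))" and ?u = "%kappa. inverse (weight kappa ^ 2)"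
 obtain A where A: "A >= 0" "!!xi. xi \<in> V' ==> ennreal ((norm (v (%x. theta x * m xi x * fwave xi x)))^2) <=
  ennreal A * (\<integral>\<^sup>+ kappa. ennreal (?w kappa * (norm (hat theta (xi - freq kappa)))^2) \<partial>count_space UNIV)"
  using schur_bound[OF theta m supp, of P] by (auto simp: P_def)
 let ?g = "%xi kappa. ennreal (A * B * ?u kappa) * (G (xi - freq kappa) + ennreal (jb (-2) xi))"
 let ?G = "%xi. \<integral>\<^sup>+ kappa. ?g xi kappa \<partial>count_space UNIV"
 have "ennreal ((norm (v (%x. theta x * m xi x * fwave xi x)))^2 * jb s xi) <= ?G xi" if xi: "xi \<in> V'" for xi
 proof -
  have "ennreal ((norm (v (%x. theta x * m xi x * fwave xi x)))^2 * jb s xi) <=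
   ennreal A * (\<integral>\<^sup>+ kappa. ennreal (?w kappa * (norm (hat theta (xi - freq kappa)))^2) \<partial>count_space UNIV) * ennreal (jb s xi)"
   using A(2)[OF xi] jb_pos[of s xi] by (simp add: ennreal_mult mult_right_mono)
  also have "... = (\<integral>\<^sup>+ kappa. ennreal A * ennreal (?w kappa * (norm (hat theta (xi - freq kappa)))^2) * ennreal (jb s xi) \<partial>count_space UNIV)"
   by (simp add: nn_integral_cmult nn_integral_multc)
  also have "... <= ?G xi"
  proof (intro nn_integral_mono)
   fix kappa
   have w: "weight kappa >= 1" by (rule weight_ge_1)
   have "weight kappa ^ (M + 2) <= weight kappa ^ (2 * P)" using w by (intro power_increasing) (auto simp: P_def)
   hence u: "?w kappa * weight kappa ^ M <= ?u kappa" using w by (simp add: field_simps power_add power2_eq_square)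
   have "ennreal A * ennreal (?w kappa * (norm (hat theta (xi - freq kappa)))^2) * ennreal (jb s xi) =
     ennreal (A * ?w kappa) * ennreal ((norm (hat theta (xi - freq kappa)))^2 * jb s xi)"
    using A(1) w jb_pos[of s xi] by (simp add: ennreal_mult mult_ac)
   also have "... <= ennreal (A * ?w kappa) * (ennreal (B * weight kappa ^ M) * (G (xi - freq kappa) + ennreal (jb (-2) xi)))"
    by (intro mult_left_mono B(2) xi) simp
   also have "... = ennreal (A * ?w kappa * (B * weight kappa ^ M)) * (G (xi - freq kappa) + ennreal (jb (-2) xi))"
    using A(1) B(1) w by (simp add: ennreal_mult mult.assoc)
   also have "... <= ?g xi kappa"
    using mult_left_mono[OF u, of "A * B"] A(1) B(1) by (intro mult_right_mono ennreal_leI) (auto simp: mult_ac)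
   finally show "ennreal A * ennreal (?w kappa * (norm (hat theta (xi - freq kappa)))^2) * ennreal (jb s xi) <= ?g xi kappa" .
  qed
  finally show ?thesis .
 qed
 moreover have "(\<integral>\<^sup>+ xi. ?G xi \<partial>lborel) < \<infinity>"
 proof -
  let ?I = "(\<integral>\<^sup>+ xi. G xi \<partial>lborel) + (\<integral>\<^sup>+ xi. ennreal (jb (-2) (xi :: R2)) \<partial>lborel)"
  have "(\<integral>\<^sup>+ xi. ?G xi \<partial>lborel) = (\<integral>\<^sup>+ kappa. (\<integral>\<^sup>+ xi. ?g xi kappa \<partial>lborel) \<partial>count_space UNIV)"
   by (rule nn_integral_count_space_nn_integral) auto
  also have "... = (\<integral>\<^sup>+ kappa. ennreal (A * B) * ennreal (?u kappa) * ?I \<partial>count_space UNIV)"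
   using A(1) B(1) by (intro nn_integral_cong) (simp add: nn_integral_cmult nn_integral_add nn_integral_shift ennreal_mult')
  also have "... = ennreal (A * B) * (\<integral>\<^sup>+ kappa. ennreal (?u kappa) \<partial>count_space UNIV) * ?I"
   by (simp add: nn_integral_cmult nn_integral_multc)
  also have "... < \<infinity>"
  proof -
   have "(%kappa. norm (?u kappa)) summable_on UNIV" using summable_weight by simp
   hence "integrable (count_space UNIV) ?u"
    using abs_summable_equivalent[of ?u UNIV] by (simp only: abs_summable_on_def)
   hence "(\<integral>\<^sup>+ kappa. ennreal (?u kappa) \<partial>count_space UNIV) < \<infinity>" by (simp add: integrable_iff_bounded)
   thus ?thesis using fin jb_nn_integral by (simp add: ennreal_mult_less_top)
  qed
  finally show ?thesis .
 qed
 moreover have "?G \<in> borel_measurable borel" by (rule borel_measurable_nn_integral_count_space) measurable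
 ultimately show ?thesis unfolding weighted_L2_def by (intro bexI[of _ ?G] conjI ballI)
qed

end

section \<open>The cone Radon transform and its regularisation\<close>

lemma frechet_derivative_real:
 fixes f :: "real => real"
 assumes "f differentiable at x"
 shows "fderiv f x v = deriv f x * v"
proof -
 have "(f has_field_derivative deriv f x) (at x)"
  using assms by (simp add: DERIV_deriv_iff_real_differentiable)
 thus ?thesis
  using frechet_derivative_at[of f "(*) (deriv f x)" x] by (simp add: has_field_derivative_def)
qed

lemma smooth_on_deriv:
 fixes f :: "real => real"
 assumes "open Om" "smooth_on Om f"
 shows "smooth_on Om (deriv f)"
proof -
 have "smooth_on Om (%x. fderiv f x 1)" by (rule smooth_on_frechet[OF assms]) simp
 thus ?thesis
  by (rule smooth_on_cong[OF assms(1), THEN iffD1, rotated])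
   (use frechet_derivative_real smooth_on_imp_differentiable[OF assms] in simp)
qed

lemma DERIV_smooth:
 fixes f :: "real => real"
 assumes "open Om" "smooth_on Om f" "x \<in> Om"
 shows "(f has_real_derivative deriv f x) (at x)"
 using smooth_on_imp_differentiable[OF assms] by (simp add: DERIV_deriv_iff_real_differentiable)

lemma smooth_supp_mono: "K \<subseteq> K' ==> phi \<in> smooth_supp K ==> phi \<in> smooth_supp K'"
 by (auto simp: smooth_supp_def)

lemma smooth_supp_test_functions:
 assumes "phi \<in> smooth_supp K" "compact K" "K \<subseteq> Om"
 shows "phi \<in> test_functions Om"
proof -
 have "closure {x. phi x ~= 0} \<subseteq> K"
  using assms by (intro closure_minimal compact_imp_closed) (auto simp: smooth_supp_def)
 moreover from this have "compact (closure {x. phi x ~= 0})"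
  using compact_Int_closed[OF assms(2) closed_closure, of "{x. phi x ~= 0}"] by (simp add: inf.absorb2)
 ultimately show ?thesis using assms by (auto simp: test_functions_def smooth_supp_def)
qed

text \<open>A smooth function on an open set, multiplied by a cutoff supported in that set, is smooth
 everywhere, whatever its junk values outside the set are.\<close>

lemma smooth_on_mult_cutoff:
 fixes psi :: "'a::euclidean_space => complex"
 assumes "open Om" "theta \<in> smooth_supp K" "closed K" "K \<subseteq> Om" "smooth_on Om psi"
 shows "(%x. theta x * psi x) \<in> smooth_supp K"
proof -
 have "smooth (%x. theta x * psi x)"
 proof (rule smooth_on_local[OF open_UNIV])
  fix x :: 'a
  show "\<exists>U h. open U & x \<in> U & smooth_on U h & (\<forall>y\<in>U. theta y * psi y = h y)"
  proof (cases "x \<in> Om")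
   case True
   have "smooth_on Om theta" using assms by (auto simp: smooth_supp_def intro: smooth_on_subset)
   thus ?thesis using True assms by (intro exI[of _ Om] exI[of _ "%x. theta x * psi x"]) (auto intro: smooth_on_mult)
  next
   case False
   thus ?thesis using assms
    by (intro exI[of _ "- K"] exI[of _ "%x. 0"]) (auto simp: smooth_supp_def intro: smooth_on_const)
  qed
 qed
 thus ?thesis using assms(2) by (auto simp: smooth_supp_def)
qed

lemma lborel_integral_compact:
 fixes k :: "real => 'b::euclidean_space"
 assumes "continuous_on UNIV k" "!!t. t \<notin> {a..b} ==> k t = 0"
 shows "(LINT t|lborel. k t) = integral {a..b} k"
proof -
 have "(LINT t|lborel. k t) = (LINT t:{a..b}|lborel. k t)"
  unfolding set_lebesgue_integral_def using assms(2) by (intro Bochner_Integration.integral_cong) (auto simp: indicator_def)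
 also have "... = integral {a..b} k"
 proof (rule set_borel_integral_eq_integral)
  show "set_integrable lborel {a..b} k"
   unfolding set_integrable_def using borel_integrable_compact[OF compact_Icc continuous_on_subset[OF assms(1) subset_UNIV]] .
 qed
 finally show ?thesis .
qed

text \<open>A point has measure zero, so the puncture of the domain and the value of the integrand
  at the vertex disappear together.\<close>

lemma set_integral_punctured:
 fixes F h :: "real => complex"
 assumes "continuous_on UNIV h" "!!x. x ~= y ==> F x = h x"
 shows "(LINT x:-{y}|lborel. F x) = (LINT x|lborel. h x)"
proof -
 have [measurable]: "h \<in> borel_measurable borel" using assms(1) by (rule borel_measurable_continuous_onI)
 have "(LINT x:-{y}|lborel. F x) = (LINT x:-{y}|lborel. h x)"
  unfolding set_lebesgue_integral_def using assms(2) by (intro Bochner_Integration.integral_cong) (auto simp: indicator_def)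
 also have "... = (LINT x|lborel. h x)"
  unfolding set_lebesgue_integral_def
  by (intro integral_cong_AE) (auto intro!: eventually_mono[OF AE_lborel_singleton[of y]])
 finally show ?thesis .
qed

locale cone =
 fixes q g :: "real => real"
 assumes q_cont: "continuous_on {0..} q" and q_smooth: "smooth_on {0<..} q" and q_0: "q 0 = 0"
  and q_pos: "r > 0 ==> q r > 0" and g_def: "g = (%r. deriv q r / q r)"
  and g_pos: "r > 0 ==> g r > 0" and g'_nz: "r > 0 ==> deriv g r ~= 0"
begin

lemma g_smooth: "smooth_on {0<..} g"
 unfolding g_def by (intro smooth_on_divide smooth_on_deriv q_smooth) (auto dest: q_pos)

text \<open>Two equal values would give a zero of the derivative of \<open>g\<close> by Rolle's
  theorem.\<close>

lemma g_inj: "inj_on g {0<..}"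
proof -
 have "g u ~= g v" if "0 < u" "u < v" for u v
 proof
  assume "g u = g v"
  have d: "(g has_real_derivative deriv g x) (at x)" if "0 < x" for x
   by (rule DERIV_smooth[OF _ g_smooth]) (use that in auto)
  have "\<exists>z. u < z & z < v & (g has_real_derivative 0) (at z)"
  proof (rule Rolle[OF that(2) \<open>g u = g v\<close>])
   show "continuous_on {u..v} g"
    using that by (intro continuous_at_imp_continuous_on ballI DERIV_isCont[OF d]) auto
   show "g differentiable at x" if "u < x" "x < v" for x
    using d[of x] \<open>0 < u\<close> that by (auto simp: real_differentiable_def)
  qed
  then obtain z where "u < z" "(g has_real_derivative 0) (at z)" by blast
  hence "deriv g z = 0" by (simp add: DERIV_imp_deriv)
  thus False using g'_nz[of z] \<open>u < z\<close> that by simp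
 qed
 thus ?thesis by (metis (no_types, lifting) greaterThan_iff inj_onI linorder_less_linear)
qed

text \<open>The function \<open>q (abs t)\<close> vanishes at 0 and need not be smooth there. Near 0
  it is blended with the positive constant \<open>e / 2\<close>, which keeps \<open>Q\<close>
  positive everywhere and below \<open>e\<close> where it may differ from \<open>q\<close>. The
  smallness later shows that the changed part of a curve misses the relevant rectangle of X.\<close>

lemma regularisation:
 assumes e: "e > 0"
 obtains tau Q where "tau > 0" "smooth Q" "!!t. Q t > 0" "!!t. abs t > tau ==> Q t = q (abs t)"
  "!!t. abs t <= tau ==> Q t < e" "!!t. abs t <= tau ==> q (abs t) < e"
proof -
 have "continuous (at 0 within {0..}) q" using q_cont by (simp add: continuous_on_eq_continuous_within)
 then obtain d where d: "d > 0" "!!r. r >= 0 ==> r < d ==> q r < e"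
  unfolding continuous_within_eps_delta using e q_0
  by (metis abs_of_nonneg atLeast_iff dist_real_def diff_zero abs_less_iff)
 define tau where "tau = d / 2"
 have tau: "tau > 0" "tau < d" using d by (auto simp: tau_def)
 define theta where "theta t = 1 - plateau (- tau) (- tau / 2) (tau / 2) tau t" for t
 have theta: "theta t \<in> {0..1}" "abs t >= tau ==> theta t = 1" "abs t <= tau / 2 ==> theta t = 0" for t
 proof -
  show "theta t \<in> {0..1}" using plateau_range[of "- tau" "- tau / 2" "tau / 2" tau t] by (auto simp: theta_def)
  show "abs t >= tau ==> theta t = 1" unfolding theta_def using tau by (subst plateau_eq_0) auto
  show "abs t <= tau / 2 ==> theta t = 0" unfolding theta_def using tau by (subst plateau_eq_1) auto
 qed
 have thetas: "smooth_on Om theta" if "open Om" for Om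
  unfolding theta_def[abs_def] by (intro smooth_on_diff smooth_on_const that smooth_on_subset[OF open_UNIV that _ smooth_on_plateau]) auto
 define Q where "Q t = theta t * q (abs t) + (1 - theta t) * (e / 2)" for t
 have Qs: "smooth Q"
 proof (rule smooth_on_local[OF open_UNIV])
  fix t :: real
  \<comment> \<open>Near 0 only the constant remains, and on each half-line \<open>abs\<close> is
    linear; these three open sets cover the line.\<close>
  consider "abs t < tau / 2" | "t > 0" | "t < 0" using tau by linarith
  thus "\<exists>U h. open U & t \<in> U & smooth_on U h & (\<forall>y\<in>U. Q y = h y)"
  proof cases
   case 1
   thus ?thesis
    by (intro exI[of _ "{- (tau/2)<..<tau/2}"] exI[of _ "%_. e / 2"]) (auto simp: Q_def theta(3) intro: smooth_on_const)
  next
   case 2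
   have "smooth_on {0<..} (%t. theta t * q t + (1 - theta t) * (e / 2))"
    by (intro smooth_on_add smooth_on_mult smooth_on_diff smooth_on_const thetas q_smooth open_greaterThan)
   thus ?thesis using 2
    by (intro exI[of _ "{0<..}"] exI[of _ "%t. theta t * q t + (1 - theta t) * (e / 2)"] conjI ballI)
     (simp_all only: Q_def open_greaterThan greaterThan_iff abs_of_pos)
  next
   case 3
   have "smooth_on {..<0} (%t. q (- t))"
    by (rule smooth_on_compose[OF _ _ q_smooth]) (auto intro!: smooth_on_linear[OF _ bounded_linear_minus[OF bounded_linear_ident]])
   hence "smooth_on {..<0} (%t. theta t * q (- t) + (1 - theta t) * (e / 2))"
    by (intro smooth_on_add smooth_on_mult smooth_on_diff smooth_on_const thetas open_lessThan)
   thus ?thesis using 3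
    by (intro exI[of _ "{..<0}"] exI[of _ "%t. theta t * q (- t) + (1 - theta t) * (e / 2)"] conjI ballI)
     (simp_all only: Q_def open_lessThan lessThan_iff abs_of_neg)
  qed
 qed
 have Qp: "Q t > 0" for t
 proof (cases "theta t = 0")
  case False
  hence "t ~= 0" using theta(3)[of 0] tau by auto
  hence "theta t * q (abs t) > 0" using q_pos[of "abs t"] False theta(1)[of t] by auto
  moreover have "(1 - theta t) * (e / 2) >= 0" using theta(1)[of t] e by auto
  ultimately show ?thesis by (simp add: Q_def)
 qed (use e in \<open>simp add: Q_def\<close>)
 have Qe: "Q t < e" if "abs t <= tau" for t
 proof -
  have "q (abs t) < e" using d(2)[of "abs t"] that tau by auto
  hence "Q t <= max (q (abs t)) (e / 2)" unfolding Q_def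
   using theta(1)[of t] convex_bound_le[of "q (abs t)" "max (q (abs t)) (e / 2)" "e / 2" "theta t" "1 - theta t"] by auto
  also have "... < e" using \<open>q (abs t) < e\<close> e by simp
  finally show ?thesis .
 qed
 show ?thesis
  by (rule that[OF tau(1) Qs Qp _ Qe]) (use theta(2) d(2) tau in \<open>auto simp: Q_def\<close>)
qed

end

text \<open>The numbers describe a rectangle of X and one of Y. The threshold
  \<open>eta / b1\<close> is chosen so that for \<open>abs t <= tau\<close> and
  \<open>0 < E <= b1\<close> the points of height \<open>E * Q t\<close> and
  \<open>E * q (abs t)\<close> lie below the rectangle of X, which starts at height
  \<open>eta\<close>.\<close>

locale cone_reg = cone +
 fixes X0 eta X2 a1 b1 Y0 tau :: real and Q :: "real => real"
 assumes params: "X0 > 0" "0 < eta" "eta < X2" "0 < a1" "a1 < b1" "Y0 > 0" "tau > 0"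
  and Q_smooth: "smooth Q" and Q_pos: "Q t > 0" and Q_eq: "abs t > tau ==> Q t = q (abs t)"
  and Q_small: "abs t <= tau ==> Q t < eta / b1" and q_small: "abs t <= tau ==> q (abs t) < eta / b1"
begin

definition KX :: "R2 set" where "KX = {-X0..X0} \<times> {eta..X2}"
definition KY :: "R2 set" where "KY = {a1..b1} \<times> {-Y0..Y0}"
text \<open>For a point of \<open>KX\<close> and a vertex position from \<open>KY\<close> the
  difference of the horizontal coordinates is at most \<open>X0 + Y0\<close> in modulus. The added 1
  leaves a margin, so that amplitudes vanish near the ends of the interval.\<close>

definition T :: real where "T = X0 + Y0 + 1"

text \<open>\<open>Dn\<close>, \<open>Wn\<close> and \<open>G\<close> are the arc length density,
  the weight of the backprojection and the logarithmic derivative formed with \<open>Q\<close> in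
  the variable \<open>t = x1 - y\<close>. For \<open>abs t > tau\<close>, \<open>G\<close> is the
  odd extension of \<open>g\<close>.\<close>

definition Dn :: "real => real => real" where "Dn E t = sqrt (1 + (E * deriv Q t)^2)"
definition Wn :: "real => real => real" where "Wn x2 t = Dn (x2 / Q t) t / Q t"
definition G :: "real => real" where "G t = deriv Q t / Q t"

definition Rt :: "(R2 => complex) => R2 => complex" where
 "Rt psi = (%p. integral {-T..T} (%t. of_real (Dn (fst p) t) * psi (snd p + t, fst p * Q t)))"

definition Rst :: "(R2 => complex) => R2 => complex" where
 "Rst phi = (%x. integral {-T..T} (%t. of_real (Wn (snd x) t) * phi (snd x / Q t, fst x - t)))"

lemma compact_KX: "compact KX" and compact_KY: "compact KY"
 by (auto simp: KX_def KY_def intro!: compact_Times)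

lemma Q_deriv: "(Q has_real_derivative deriv Q t) (at t)"
 by (rule DERIV_smooth[OF open_UNIV Q_smooth UNIV_I])

lemma Q'_smooth: "smooth (deriv Q)"
 by (rule smooth_on_deriv[OF open_UNIV Q_smooth])

lemma Q_cont: "continuous_on UNIV Q" "continuous_on UNIV (deriv Q)"
 using smooth_continuous Q_smooth Q'_smooth by auto

lemma q_deriv: "r > 0 ==> (q has_real_derivative deriv q r) (at r)"
 by (rule DERIV_smooth[OF _ q_smooth]) auto

lemma Q'_eq:
 assumes "abs t > tau"
 shows "deriv Q t = sgn t * deriv q (abs t)"
proof (cases "t > 0")
 case True
 have "(q has_real_derivative deriv q t) (at t)" using True by (rule q_deriv)
 hence "(Q has_real_derivative deriv q t) (at t)"
  by (rule DERIV_cong_ev[THEN iffD1, OF refl _ refl, rotated])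
   (use assms True params in \<open>auto simp: eventually_nhds Q_eq intro!: exI[of _ "{tau<..}"]\<close>)
 thus ?thesis using True by (simp add: DERIV_imp_deriv)
next
 case False
 hence t: "t < - tau" "t < 0" using assms params by auto
 have "(q has_real_derivative deriv q (- t)) (at (- t))" using t by (intro q_deriv) auto
 from DERIV_chain'[OF DERIV_minus[OF DERIV_ident] this]
 have "((%t. q (- t)) has_real_derivative - deriv q (- t)) (at t)" by simp
 hence "(Q has_real_derivative - deriv q (- t)) (at t)"
  by (rule DERIV_cong_ev[THEN iffD1, OF refl _ refl, rotated])
   (use t params in \<open>auto simp: eventually_nhds Q_eq intro!: exI[of _ "{..<-tau}"]\<close>)
 thus ?thesis using t by (simp add: DERIV_imp_deriv)
qed

lemma G_eq: "abs t > tau ==> G t = sgn t * g (abs t)"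
 using Q'_eq Q_eq by (simp add: G_def g_def)

lemma Dn_eq: "abs t > tau ==> Dn E t = arc_density q E (abs t)"
 using params by (auto simp: Dn_def arc_density_def Q'_eq power_mult_distrib sgn_if)

lemma Dn_pos: "Dn E t > 0"
 unfolding Dn_def by (simp add: add_pos_nonneg)

text \<open>Here the smallness of \<open>Q\<close> near 0 pays: within the rectangles only
  parameters with \<open>abs t > tau\<close> occur, and there \<open>Q\<close> agrees with
  \<open>q\<close>.\<close>

lemma Q_large: "E * Q t >= eta ==> E <= b1 ==> abs t > tau"
proof (rule ccontr)
 assume h: "E * Q t >= eta" "E <= b1" "\<not> abs t > tau"
 hence "E * Q t <= b1 * Q t" using Q_pos[of t] by (intro mult_right_mono) auto
 also have "... < eta" using Q_small[of t] h params by (simp add: field_simps)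
 finally show False using h by simp
qed

lemma q_large: "E * q (abs t) >= eta ==> E <= b1 ==> abs t > tau"
proof (rule ccontr)
 assume h: "E * q (abs t) >= eta" "E <= b1" "\<not> abs t > tau"
 have "q (abs t) >= 0" using q_pos[of "abs t"] q_0 by (cases "t = 0") auto
 hence "E * q (abs t) <= b1 * q (abs t)" using h by (intro mult_right_mono) auto
 also have "... < eta" using q_small[of t] h params by (simp add: field_simps)
 finally show False using h by simp
qed

lemma smooth_Dn:
 assumes "smooth f" "smooth h"
 shows "smooth (%p. Dn (f p) (h p))"
 unfolding Dn_def
proof (rule smooth_on_compose[OF open_UNIV _ smooth_on_sqrt])
 show "smooth (%p. 1 + (f p * deriv Q (h p))^2)"
  unfolding power2_eq_square
  by (intro smooth_on_add smooth_on_mult smooth_on_const open_UNIV assms smooth_comp[OF Q'_smooth])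
qed (auto simp: add_pos_nonneg)

lemma smooth_Wn:
 assumes "smooth f" "smooth h"
 shows "smooth (%p. Wn (f p) (h p))"
 unfolding Wn_def
 by (intro smooth_on_divide smooth_Dn open_UNIV assms smooth_comp[OF Q_smooth])
  (metis less_irrefl Q_pos)+

lemma smooth_on_fst: "open Om ==> smooth_on Om f ==> smooth_on Om (%p. fst (f p))"
 and smooth_on_snd: "open Om ==> smooth_on Om f ==> smooth_on Om (%p. snd (f p))"
 by (auto intro: smooth_on_blinear bounded_linear_fst bounded_linear_snd)

lemma smooth_on_id: "open Om ==> smooth_on Om (%p. p)"
 by (rule smooth_on_linear[OF _ bounded_linear_ident])

lemma smooth_on_of_real: "open Om ==> smooth_on Om f ==> smooth_on Om (%p. complex_of_real (f p))"
 by (rule smooth_on_blinear[OF _ bounded_linear_of_real])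

lemmas smooth_intros = smooth_on_fst smooth_on_snd smooth_on_id smooth_on_of_real open_UNIV smooth_on_mult
 smooth_on_add smooth_on_diff smooth_on_Pair smooth_on_const smooth_comp[OF Q_smooth] smooth_Dn smooth_Wn

lemma smooth_Rt_integrand:
 fixes psi :: "R2 => complex"
 assumes "smooth psi"
 shows "smooth (%p. of_real (Dn (fst (fst p)) (snd p)) * psi (snd (fst p) + snd p, fst (fst p) * Q (snd p)))"
 by (intro smooth_intros smooth_comp[OF assms])

lemma smooth_Rt: "smooth psi ==> smooth (Rt psi)"
 unfolding Rt_def using smooth_on_integral[OF smooth_Rt_integrand, of psi "-T" T] by simp

lemma smooth_Rst_integrand:
 fixes phi :: "R2 => complex"
 assumes "smooth phi"
 shows "smooth (%p. of_real (Wn (snd (fst p)) (snd p)) * phi (snd (fst p) / Q (snd p), fst (fst p) - snd p))"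
 by (intro smooth_intros smooth_comp[OF assms] smooth_on_divide) (metis less_irrefl Q_pos)

lemma smooth_Rst: "smooth phi ==> smooth (Rst phi)"
 unfolding Rst_def using smooth_on_integral[OF smooth_Rst_integrand, of phi "-T" T] by simp

text \<open>For \<open>abs t > tau\<close> the integrands coincide; for smaller \<open>t\<close>
  both evaluate \<open>psi\<close> below \<open>KX\<close>, where it vanishes. The support of
  \<open>psi\<close> also confines \<open>t\<close> to the interval of integration.\<close>

lemma cone_radon_eq:
 assumes psi: "psi \<in> smooth_supp KX" and "0 < E" "E <= b1" "abs y <= Y0"
 shows "cone_radon q psi (E, y) = Rt psi (E, y)"
proof -
 have spsi: "smooth psi" using psi by (rule smooth_suppD)
 define k where "k t = of_real (Dn E t) * psi (y + t, E * Q t)" for t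
 have ks: "smooth k" unfolding k_def[abs_def] by (intro smooth_intros smooth_comp[OF spsi])
 hence kc: "continuous_on UNIV k" by (rule smooth_continuous)
 have k0: "k t = 0" if "t \<notin> {-T..T}" for t
 proof -
  have "(y + t, E * Q t) \<notin> KX" using that assms by (auto simp: KX_def T_def)
  thus ?thesis using psi by (simp add: k_def smooth_supp_def)
 qed
 have "cone_radon q psi (E, y) = (LINT x1|lborel. k (x1 - y))"
  unfolding cone_radon_def prod.case
 proof (rule set_integral_punctured)
  show "continuous_on UNIV (%x1. k (x1 - y))"
   by (rule continuous_on_compose2[OF kc]) (auto intro!: continuous_intros)
  fix x1
  show "complex_of_real (arc_density q E (abs (x1 - y))) * psi (x1, E * q (abs (x1 - y))) = k (x1 - y)"
  proof (cases "abs (x1 - y) > tau")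
   case True
   thus ?thesis by (simp add: k_def Dn_eq Q_eq)
  next
   case False
   have "(x1, E * q (abs (x1 - y))) \<notin> KX" "(x1, E * Q (x1 - y)) \<notin> KX"
    using q_large[of E "x1 - y"] Q_large[of E "x1 - y"] False assms by (auto simp: KX_def)
   thus ?thesis using psi by (simp add: k_def smooth_supp_def)
  qed
 qed
 also have "... = (LINT t|lborel. k t)"
  using lborel_integral_real_affine[of 1 "%x1. k (x1 - y)" y] by simp
 also have "... = integral {-T..T} k" by (rule lborel_integral_compact[OF kc k0])
 finally show ?thesis by (simp add: Rt_def k_def[abs_def])
qed

text \<open>As for the transform: small \<open>t\<close> would give a quotient
  \<open>x2 / Q t\<close> or \<open>x2 / q (abs t)\<close> above \<open>b1\<close>, outside the
  support of \<open>phi\<close>.\<close>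

lemma cone_backprojection_eq:
 assumes phi: "phi \<in> smooth_supp KY" and "eta <= x2" "abs x1 <= X0"
 shows "cone_backprojection q phi (x1, x2) = Rst phi (x1, x2)"
proof -
 have sphi: "smooth phi" using phi by (rule smooth_suppD)
 define k where "k t = of_real (Wn x2 t) * phi (x2 / Q t, x1 - t)" for t
 have ks: "smooth k" unfolding k_def[abs_def]
  by (intro smooth_intros smooth_comp[OF sphi] smooth_on_divide) (metis less_irrefl Q_pos)
 hence kc: "continuous_on UNIV k" by (rule smooth_continuous)
 have k0: "k t = 0" if "t \<notin> {-T..T}" for t
 proof -
  have "(x2 / Q t, x1 - t) \<notin> KY" using that assms by (auto simp: KY_def T_def)
  thus ?thesis using phi by (simp add: k_def smooth_supp_def)
 qed
 have "cone_backprojection q phi (x1, x2) = (LINT y|lborel. k (x1 - y))"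
  unfolding cone_backprojection_def prod.case
 proof (rule set_integral_punctured)
  show "continuous_on UNIV (%y. k (x1 - y))"
   by (rule continuous_on_compose2[OF kc]) (auto intro!: continuous_intros)
  fix y assume "y ~= x1"
  show "complex_of_real (arc_density q (x2 / q (abs (x1 - y))) (abs (x1 - y)) / q (abs (x1 - y))) * phi (x2 / q (abs (x1 - y)), y) = k (x1 - y)"
  proof (cases "abs (x1 - y) > tau")
   case True
   thus ?thesis by (simp add: k_def Wn_def Dn_eq Q_eq)
  next
   case False
   have q: "q (abs (x1 - y)) > 0" using \<open>y ~= x1\<close> by (intro q_pos) auto
   have "(x2 / q (abs (x1 - y)), y) \<notin> KY"
    using q_large[of "x2 / q (abs (x1 - y))" "x1 - y"] False assms q by (auto simp: KY_def)
   moreover have "(x2 / Q (x1 - y), y) \<notin> KY"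
    using Q_large[of "x2 / Q (x1 - y)" "x1 - y"] False assms Q_pos[of "x1 - y"] by (auto simp: KY_def)
   ultimately show ?thesis using phi by (simp add: k_def smooth_supp_def)
  qed
 qed
 also have "... = (LINT t|lborel. k t)"
  using lborel_integral_real_affine[of "-1" "%y. k (x1 - y)" x1] by simp
 also have "... = integral {-T..T} k" by (rule lborel_integral_compact[OF kc k0])
 finally show ?thesis by (simp add: Rst_def k_def[abs_def])
qed

lemma G_smooth: "smooth G"
 unfolding G_def[abs_def] by (intro smooth_on_divide Q'_smooth Q_smooth open_UNIV) (metis less_irrefl Q_pos)

text \<open>The quantitative form of the injectivity of \<open>G\<close>. For parameters of equal
  sign it follows from the mean value theorem and the minimum of the modulus of \<open>g'\<close> on
  a compact interval. For opposite signs the values of \<open>G\<close> have opposite signs as well,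
  so their distance is at least twice the minimum of \<open>g\<close>, while
  \<open>abs (t - t') <= 2 * T\<close>.\<close>

lemma G_separation:
 obtains c where "c > 0" "!!t t'. tau < abs t ==> abs t <= T ==> tau < abs t' ==> abs t' <= T ==> abs (G t - G t') >= c * abs (t - t')"
proof (cases "tau <= T")
 case True
 have sub: "{tau..T} \<subseteq> {0<..}" using params by auto
 have g': "continuous_on {tau..T} (deriv g)" and gc: "continuous_on {tau..T} g"
  using continuous_on_subset[OF smooth_on_imp_continuous_on[OF open_greaterThan smooth_on_deriv[OF open_greaterThan g_smooth]] sub]
   continuous_on_subset[OF smooth_on_imp_continuous_on[OF open_greaterThan g_smooth] sub] by auto
 obtain m where m: "m \<in> {tau..T}" "!!r. r \<in> {tau..T} ==> abs (deriv g m) <= abs (deriv g r)"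
  using continuous_attains_inf[of "{tau..T}" "%r. abs (deriv g r)"] continuous_on_rabs[OF g'] True by auto
 obtain n where n: "n \<in> {tau..T}" "!!r. r \<in> {tau..T} ==> g n <= g r"
  using continuous_attains_inf[of "{tau..T}" g] gc True by auto
 have Tp: "T > 0" using params by (simp add: T_def)
 define c where "c = min (abs (deriv g m)) (g n / T)"
 have "c > 0" using m(1) n(1) params g'_nz[of m] g_pos[of n] Tp by (auto simp: c_def)
 moreover have same: "c * abs (u - v) <= abs (g u - g v)" if "tau <= u" "u < v" "v <= T" for u v
 proof -
  have "\<exists>z>u. z < v & g v - g u = (v - u) * deriv g z"
   by (rule MVT2[OF that(2)]) (rule DERIV_smooth[OF open_greaterThan g_smooth], use that params in auto)
  then obtain z where z: "u < z" "z < v" "g v - g u = (v - u) * deriv g z" by blast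
  hence "abs (g u - g v) = abs (u - v) * abs (deriv g z)" by (simp add: abs_minus_commute[of "g u"] abs_mult abs_minus_commute[of u])
  moreover have "c <= abs (deriv g z)" using m(2)[of z] z that by (auto simp: c_def)
  ultimately show ?thesis by (simp add: mult.commute[of "abs (u - v)"] mult_right_mono)
 qed
 hence same': "c * abs (u - v) <= abs (g u - g v)" if "tau <= u" "tau <= v" "u <= T" "v <= T" for u v
  using that same[of u v] same[of v u] by (cases u v rule: linorder_cases) (auto simp: abs_minus_commute)
 moreover have "abs (G t - G t') >= c * abs (t - t')" if t: "tau < abs t" "abs t <= T" "tau < abs t'" "abs t' <= T" for t t'
 proof (cases "sgn t = sgn t'")
  case True
  hence "\<bar>t - t'\<bar> = \<bar>\<bar>t\<bar> - \<bar>t'\<bar>\<bar>" using t params by (auto simp: sgn_if split: if_splits)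
  moreover have "\<bar>G t - G t'\<bar> = \<bar>g \<bar>t\<bar> - g \<bar>t'\<bar>\<bar>"
   using True t params by (auto simp: G_eq sgn_if abs_minus_commute split: if_splits)
  ultimately show ?thesis using same'[of "abs t" "abs t'"] t by simp
 next
  case False
  have "abs (G t - G t') = g (abs t) + g (abs t')"
   using False t params g_pos[of "abs t"] g_pos[of "abs t'"] by (auto simp: G_eq sgn_if split: if_splits)
  moreover have "g n <= g (abs t)" "g n <= g (abs t')" using n(2) t by auto
  moreover have "c * abs (t - t') <= (g n / T) * (2 * T)"
   using t Tp g_pos[of n] n params \<open>c > 0\<close> by (intro mult_mono) (auto simp: c_def)
  ultimately show ?thesis using Tp by simp
 qed
 ultimately show ?thesis using that by blast
qed (rule that[of 1], auto)

end

section \<open>Compactly supported distributions and products\<close>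

text \<open>Built from the rectangle with sides \<open>{l1..u1}\<close> and \<open>{l2..u2}\<close>:
  the value is 1 up to distance \<open>delta\<close> from it in the maximum norm and 0 from distance
  \<open>2 * delta\<close> on. Being constant on a neighbourhood is what the locality arguments
  require.\<close>

definition cutoff :: "real => real => real => real => real => R2 => real" where
 "cutoff delta l1 u1 l2 u2 p = plateau (l1 - 2 * delta) (l1 - delta) (u1 + delta) (u1 + 2 * delta) (fst p) *
  plateau (l2 - 2 * delta) (l2 - delta) (u2 + delta) (u2 + 2 * delta) (snd p)"

lemma cutoff_range: "cutoff delta l1 u1 l2 u2 p \<in> {0..1}"
 unfolding cutoff_def
 using plateau_range[of "l1 - 2 * delta" "l1 - delta" "u1 + delta" "u1 + 2 * delta" "fst p"]
  plateau_range[of "l2 - 2 * delta" "l2 - delta" "u2 + delta" "u2 + 2 * delta" "snd p"]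
 by (auto intro: mult_le_one)

lemma cutoff_eq_1: "delta > 0 ==> p \<in> {l1 - delta..u1 + delta} \<times> {l2 - delta..u2 + delta} ==> cutoff delta l1 u1 l2 u2 p = 1"
 unfolding cutoff_def by (subst (1 2) plateau_eq_1) auto

lemma cutoff_eq_0: "delta > 0 ==> p \<notin> {l1 - 2 * delta<..<u1 + 2 * delta} \<times> {l2 - 2 * delta<..<u2 + 2 * delta} ==> cutoff delta l1 u1 l2 u2 p = 0"
 unfolding cutoff_def by (cases p) (auto simp: plateau_eq_0)

lemma smooth_cutoff: "smooth (cutoff delta l1 u1 l2 u2)"
 unfolding cutoff_def[abs_def]
 by (intro smooth_on_mult open_UNIV smooth_comp[OF smooth_on_plateau] smooth_on_linear bounded_linear_fst bounded_linear_snd)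

lemma cutoff_smooth_supp:
 assumes "delta > 0" "{l1 - 2 * delta..u1 + 2 * delta} \<times> {l2 - 2 * delta..u2 + 2 * delta} \<subseteq> K"
 shows "(%p. complex_of_real (cutoff delta l1 u1 l2 u2 p)) \<in> smooth_supp K"
 unfolding smooth_supp_def
proof (intro CollectI conjI allI impI)
 show "smooth (%p. complex_of_real (cutoff delta l1 u1 l2 u2 p))"
  by (rule smooth_on_blinear[OF open_UNIV bounded_linear_of_real smooth_cutoff])
 fix p assume "p \<notin> K"
 moreover have "{l1 - 2 * delta<..<u1 + 2 * delta} \<times> {l2 - 2 * delta<..<u2 + 2 * delta} \<subseteq> {l1 - 2 * delta..u1 + 2 * delta} \<times> {l2 - 2 * delta..u2 + 2 * delta}"
  by (intro Sigma_mono) auto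
 ultimately have "p \<notin> {l1 - 2 * delta<..<u1 + 2 * delta} \<times> {l2 - 2 * delta<..<u2 + 2 * delta}" using assms(2) by blast
 thus "complex_of_real (cutoff delta l1 u1 l2 u2 p) = 0" by (simp add: cutoff_eq_0[OF assms(1)])
qed

text \<open>The definition of the product quantifies over all mollifiers; at least one must exist
  for the product to be determined.\<close>

lemma mollifier_exists: "\<exists>rho\<in>test_functions (UNIV :: R2 set). (LINT z|lborel. rho z) = 1"
proof -
 define r where "r = cutoff 1 0 0 0 0"
 have rc: "continuous_on UNIV r" unfolding r_def by (rule smooth_continuous[OF smooth_cutoff])
 have r0: "r p = 0" if "p \<notin> cbox (-2, -2) (2, 2)" for p
  unfolding r_def by (rule cutoff_eq_0) (use that in \<open>cases p; auto\<close>)+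
 have ri: "integrable lborel r"
 proof -
  have "integrable lborel (%p. indicator (cbox (-2, -2) (2, 2)) p *\<^sub>R r p)"
   by (rule borel_integrable_compact[OF compact_cbox continuous_on_subset[OF rc subset_UNIV]])
  moreover have "(%p. indicator (cbox (-2, -2) (2, 2)) p *\<^sub>R r p) = r"
  proof
   show "indicator (cbox (-2, -2) (2, 2)) p *\<^sub>R r p = r p" for p
    using r0[of p] by (cases "p \<in> cbox (-2, -2) (2, 2)") simp_all
  qed
  ultimately show ?thesis by simp
 qed
 have "1 <= measure lborel (cbox (-1, -1) (1, 1) :: R2 set)"
  by (subst measure_lborel_cbox_eq) (auto simp: Basis_prod_def prod.union_disjoint)
 also have "... = (LINT p|lborel. indicator (cbox (-1, -1) (1, 1) :: R2 set) p)" by simp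
 also have "... <= (LINT p|lborel. r p)"
 proof (rule integral_mono[OF _ ri])
  show "integrable lborel (indicator (cbox (-1, -1) (1, 1)) :: R2 => real)"
   by (rule integrable_real_indicator) (auto simp: emeasure_lborel_cbox_eq)
  show "indicator (cbox (-1, -1) (1, 1) :: R2 set) p <= r p" for p
   using cutoff_eq_1[of 1 p 0 0 0 0] cutoff_range[of 1 0 0 0 0 p] by (cases p) (auto simp: indicator_def r_def)
 qed
 finally have I: "(LINT p|lborel. r p) ~= 0" by linarith
 define rho where "rho p = complex_of_real (r p) * of_real (inverse (LINT p|lborel. r p))" for p
 have "rho \<in> smooth_supp (cbox (-2, -2) (2, 2))"
  unfolding smooth_supp_def
 proof (intro CollectI conjI allI impI)
  show "smooth rho" unfolding rho_def[abs_def] r_def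
   by (intro smooth_on_mult open_UNIV smooth_on_const smooth_on_blinear[OF open_UNIV bounded_linear_of_real] smooth_cutoff)
  show "rho p = 0" if "p \<notin> cbox (-2, -2) (2, 2)" for p
   unfolding rho_def r0[OF that] by simp
 qed
 hence "rho \<in> test_functions UNIV" by (rule smooth_supp_test_functions) auto
 moreover have "(LINT z|lborel. rho z) = 1"
  unfolding rho_def using I ri by (simp flip: of_real_mult)
 ultimately show ?thesis by blast
qed

text \<open>Where the function is constant, so are its regularisations near the support of the test function.\<close>

lemma distr_product_on_const:
 fixes h :: "'a::euclidean_space => complex"
 assumes "open W" "!!y. y \<in> W ==> h y = k"
 shows "distr_product_on W h u (%phi. u (%y. k * phi y))"
 unfolding distr_product_on_def
proof (intro ballI impI)
 fix phi rho :: "'a => complex" assume phi: "phi \<in> test_functions W" and rho: "rho \<in> test_functions UNIV" "(LINT z|lborel. rho z) = 1"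
 let ?S = "closure {x. phi x ~= 0}"
 have "compact ?S" "?S \<subseteq> W" using phi by (auto simp: test_functions_def)
 then obtain d where d0: "d > 0" "(\<Union>x\<in>?S. ball x d) \<subseteq> W"
  using compact_subset_open_imp_ball_epsilon_subset[of ?S W] assms(1) by metis
 have d: "y \<in> W" if "x \<in> ?S" "dist x y < d" for x y
  by (rule subsetD[OF d0(2)], rule UN_I[OF that(1)]) (simp add: that(2))
 have "bounded (closure {x. rho x ~= 0})" using rho by (auto simp: test_functions_def compact_imp_bounded)
 then obtain R where R: "R > 0" "!!z. rho z ~= 0 ==> norm z <= R"
  unfolding bounded_pos using subsetD[OF closure_subset[of "{x. rho x ~= 0}"]] by (metis (mono_tags) mem_Collect_eq)
 have "eventually (%eps. u (%y. mollify rho h eps y * phi y) = u (%y. k * phi y)) (at_right 0)"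
  unfolding eventually_at_right_field
 proof (intro exI[of _ "d / R"] conjI allI impI)
  fix eps :: real assume eps: "0 < eps" "eps < d / R"
  have "mollify rho h eps y * phi y = k * phi y" for y
  proof (cases "phi y = 0")
   case False
   hence y: "y \<in> ?S" using subsetD[OF closure_subset[of "{x. phi x ~= 0}"]] by blast
   have "h (y - eps *\<^sub>R z) * rho z = k * rho z" for z
   proof (cases "rho z = 0")
    case False
    have "dist y (y - eps *\<^sub>R z) = eps * norm z" using eps by (simp add: dist_norm)
    also have "... <= eps * R" using R(2)[OF False] eps by (intro mult_left_mono) auto
    also have "... < d" using eps R(1) by (simp add: field_simps)
    finally show ?thesis using assms(2) d[OF y] by simp
   qed simp
   hence "mollify rho h eps y = (LINT z|lborel. k * rho z)"
    unfolding mollify_def by (intro Bochner_Integration.integral_cong) auto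
   also have "... = k" using rho(2) by simp
   finally show ?thesis by simp
  qed simp
  thus "u (%y. mollify rho h eps y * phi y) = u (%y. k * phi y)" by (simp only:)
 qed (use d0(1) R(1) in simp)
 thus "((%eps. u (%y. mollify rho h eps y * phi y)) \<longlongrightarrow> u (%y. k * phi y)) (at_right 0)"
  by (rule tendsto_eventually)
qed

text \<open>On a set where \<open>h\<close> is constant the product exists, so by definition
  \<open>w\<close> is a product there too, and limits are unique.\<close>

lemma is_distr_product_const:
 fixes w :: "(R2 => complex) => complex"
 assumes "is_distr_product Om h u w" "open W" "W \<subseteq> Om" "!!y. y \<in> W ==> h y = k" "phi \<in> test_functions W"
 shows "w phi = u (%y. k * phi y)"
proof -
 have v: "distr_product_on W h u (%phi. u (%y. k * phi y))" by (rule distr_product_on_const[OF assms(2,4)])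
 hence w: "distr_product_on W h u w" using assms(1-3) unfolding is_distr_product_def by blast
 obtain rho :: "R2 => complex" where rho: "rho \<in> test_functions UNIV" "(LINT z|lborel. rho z) = 1"
  using mollifier_exists by blast
 have "((%eps. u (%y. mollify rho h eps y * phi y)) \<longlongrightarrow> w phi) (at_right 0)"
  "((%eps. u (%y. mollify rho h eps y * phi y)) \<longlongrightarrow> u (%y. k * phi y)) (at_right 0)"
  using v w assms(5) rho unfolding distr_product_on_def by blast+
 thus ?thesis by (rule tendsto_unique[rotated]) simp
qed

locale compact_distr =
 fixes Om K :: "R2 set" and u :: "(R2 => complex) => complex" and N :: nat and C :: real
 assumes Om: "open Om" and K: "compact K" "K \<subseteq> Om"
  and add: "smooth_on Om phi ==> smooth_on Om psi ==> u (%x. phi x + psi x) = u phi + u psi"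
  and cmult: "smooth_on Om phi ==> u (%x. c * phi x) = c * u phi"
  and bound: "smooth_on Om phi ==> (!!x vs. x \<in> K ==> dirs vs ==> length vs <= N ==> norm (iter_deriv vs phi x) <= M) ==> norm (u phi) <= C * M"
begin

lemma zero: "u (%x. 0) = 0"
 using cmult[of "%x. 0" 0] Om by (simp add: smooth_on_const)

text \<open>If two functions agree near \<open>K\<close>, all derivatives of their difference vanish
  on \<open>K\<close>, and the continuity estimate applies with \<open>M = 0\<close>.\<close>

lemma local_eq:
 assumes "smooth_on Om phi" "smooth_on Om psi" "open U" "K \<subseteq> U" "!!x. x \<in> U ==> phi x = psi x"
 shows "u phi = u psi"
proof -
 have s: "smooth_on Om (%x. - 1 * psi x)" by (intro smooth_on_mult smooth_on_const assms Om)
 have z: "iter_deriv vs (%x. 0) = (%x. 0)" for vs :: "R2 list"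
  by (induction vs) (auto simp: frechet_derivative_const)
 have "norm (u (%x. phi x + - 1 * psi x)) <= C * 0"
 proof (rule bound)
  fix x and vs :: "R2 list" assume "x \<in> K"
  hence "iter_deriv vs (%x. phi x + - 1 * psi x) x = iter_deriv vs (%x. 0) x"
   by (intro iter_deriv_cong_open[OF assms(3)]) (use assms(4,5) in auto)
  thus "norm (iter_deriv vs (%x. phi x + - 1 * psi x) x) <= 0" by (simp add: z)
 qed (intro smooth_on_add s assms Om)
 hence "u (%x. phi x + - 1 * psi x) = 0" by simp
 thus ?thesis using add[OF assms(1) s] cmult[OF assms(2), of "-1"] by simp
qed

lemma diff:
 assumes "smooth_on Om phi" "smooth_on Om psi"
 shows "u (%x. phi x - psi x) = u phi - u psi"
proof -
 have s: "smooth_on Om (%x. - 1 * psi x)" by (intro smooth_on_mult smooth_on_const assms Om)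
 from add[OF assms(1) s] cmult[OF assms(2), of "-1"] show ?thesis by simp
qed

lemma finite_order: "compact K' ==> finite_order K' u N C"
proof
 fix phi M assume "phi \<in> smooth_supp K'" "!!vs x. dirs vs ==> length vs <= N ==> norm (iter_deriv vs phi x) <= M"
 thus "norm (u phi) <= C * M"
  by (intro bound) (auto simp: smooth_supp_def intro: smooth_on_subset[OF open_UNIV Om])
qed (auto simp: smooth_supp_def intro!: add cmult intro: smooth_on_subset[OF open_UNIV Om])

end

lemma compact_distr_obtain:
 assumes "u \<in> compactly_supported_distributions Om" "open Om"
 obtains K N C where "compact_distr Om K u N C"
proof -
 obtain K C N where "compact K & K \<subseteq> Om &
   (\<forall>phi M. smooth_on Om phi -->
     (\<forall>x\<in>K. \<forall>vs. dirs vs & length vs <= N --> norm (iter_deriv vs phi x) <= M) -->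
     norm (u phi) <= C * M)"
  using assms(1) unfolding compactly_supported_distributions_def by blast
 hence "compact_distr Om K u N C"
  using assms unfolding compactly_supported_distributions_def by unfold_locales auto
 thus ?thesis by (rule that)
qed

lemma open_Y_space: "open Y_space"
proof -
 have eq: "Y_space = {0<..} \<times> UNIV" by (auto simp: Y_space_def)
 show ?thesis unfolding eq by (intro open_Times) auto
qed

lemma open_X_space: "open X_space"
proof -
 have eq: "X_space = UNIV \<times> {0<..}" by (auto simp: X_space_def)
 show ?thesis unfolding eq by (intro open_Times) auto
qed

lemma compact_Y_bounds:
 assumes "compact K" "K \<subseteq> Y_space"
 obtains e M where "e > 0" "M > e" "K \<subseteq> {e<..<M} \<times> {-M<..<M}"
proof -
 obtain B where B: "B > 0" "!!x. x \<in> K ==> norm x <= B"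
  using compact_imp_bounded[OF assms(1)] unfolding bounded_pos by blast
 obtain e where e: "e > 0" "!!x. x \<in> K ==> e <= fst x"
 proof (cases "K = {}")
  case False
  from continuous_attains_inf[OF assms(1) False continuous_on_fst[OF continuous_on_id]]
  obtain x where "x \<in> K" "!!y. y \<in> K ==> fst x <= fst y" by blast
  thus ?thesis using that[of "fst x"] assms(2) by (auto simp: Y_space_def)
 qed (use that[of 1] in auto)
 have "K \<subseteq> {e / 2<..<B + e} \<times> {-(B + e)<..<B + e}"
 proof
  fix x assume x: "x \<in> K"
  have "abs (fst x) <= norm x" "abs (snd x) <= norm x"
   using norm_fst_le[of "fst x" "snd x"] norm_snd_le[of "snd x" "fst x"] by auto
  thus "x \<in> {e / 2<..<B + e} \<times> {-(B + e)<..<B + e}"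
   using B(2)[OF x] e(2)[OF x] e(1) by (cases x) auto
 qed
 thus ?thesis using that[of "e / 2" "B + e"] e(1) B(1) by auto
qed

lemma compact_X_bounds:
 assumes "compact K" "K \<subseteq> X_space"
 obtains e M where "e > 0" "M > e" "K \<subseteq> {-M<..<M} \<times> {e<..<M}"
proof -
 have "compact (prod.swap ` K)" by (intro compact_continuous_image assms continuous_on_swap)
 moreover have "prod.swap ` K \<subseteq> Y_space" using assms(2) by (auto simp: X_space_def Y_space_def)
 ultimately obtain e M where "e > 0" "M > e" "prod.swap ` K \<subseteq> {e<..<M} \<times> {-M<..<M}" by (rule compact_Y_bounds)
 thus ?thesis using that[of e M] by (force simp: image_subset_iff)
qed

text \<open>\<open>Psi\<close> may lack compact support, so the vanishing of \<open>u\<close> off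
  \<open>A\<close> does not apply directly. \<open>Psi\<close> is cut off near the compact set
  \<open>K\<close> of the continuity estimate, which may be larger than \<open>A\<close>; the
  difference from the cutoff by \<open>theta\<close> is then a test function supported off
  \<open>A\<close>.\<close>

lemma (in compact_distr) localise:
 assumes Y: "Om = Y_space" and A: "compact A" "A \<subseteq> Y_space" and v: "!!phi. phi \<in> test_functions (Y_space - A) ==> u phi = 0"
  and theta: "theta \<in> smooth_supp K'" "compact K'" "K' \<subseteq> Y_space" "open U" "A \<subseteq> U" "!!p. p \<in> U ==> theta p = 1"
  and Psi: "smooth_on Y_space Psi"
 shows "u Psi = u (%p. theta p * Psi p)"
proof -
 obtain e M where eM: "e > 0" "M > e" "K \<union> A \<union> K' \<subseteq> {e<..<M} \<times> {-M<..<M}"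
 proof -
  have "compact (K \<union> A \<union> K')" "K \<union> A \<union> K' \<subseteq> Y_space" using K A theta(2,3) Y by (auto intro: compact_Un)
  thus ?thesis using compact_Y_bounds that by metis
 qed
 \<comment> \<open>The support of the cutoff then stays in the region \<open>E >= e / 2\<close>,
   inside \<open>Y_space\<close>.\<close>
 define delta where "delta = e / 4"
 define kappa where "kappa p = complex_of_real (cutoff delta e M (-M) M p)" for p
 define R where "R = {e - 2 * delta..M + 2 * delta} \<times> {-M - 2 * delta..M + 2 * delta}"
 have delta: "delta > 0" using eM by (simp add: delta_def)
 have kappa: "kappa \<in> smooth_supp R" unfolding kappa_def[abs_def] by (rule cutoff_smooth_supp[OF delta]) (simp add: R_def)
 have R: "compact R" "R \<subseteq> Y_space" using eM by (auto simp: R_def delta_def Y_space_def intro!: compact_Times)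
 have kappa1: "kappa p = 1" if "p \<in> {e<..<M} \<times> {-M<..<M}" for p
  unfolding kappa_def by (subst cutoff_eq_1[OF delta]) (use that delta in auto)
 have s1: "(%p. kappa p * Psi p) \<in> smooth_supp R"
  by (rule smooth_on_mult_cutoff[OF open_Y_space kappa compact_imp_closed[OF R(1)] R(2) Psi])
 have s2: "(%p. theta p * Psi p) \<in> smooth_supp K'"
  by (rule smooth_on_mult_cutoff[OF open_Y_space theta(1) compact_imp_closed[OF theta(2)] theta(3) Psi])
 have ss: "smooth_on Om (%p. kappa p * Psi p)" "smooth_on Om (%p. theta p * Psi p)"
  using s1 s2 Om by (auto simp: smooth_supp_def intro: smooth_on_subset[OF open_UNIV])
 have "u Psi = u (%p. kappa p * Psi p)"
  by (rule local_eq[of _ _ "{e<..<M} \<times> {-M<..<M}"]) (use Psi Y ss eM kappa1 in \<open>auto intro: open_Times\<close>)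
 also have "... - u (%p. theta p * Psi p) = u (%p. kappa p * Psi p - theta p * Psi p)"
  by (rule diff[OF ss, symmetric])
 also have "... = 0"
 proof (rule v)
  \<comment> \<open>On this neighbourhood of \<open>A\<close> both cutoffs are 1, so the difference
    vanishes.\<close>
  define U' where "U' = U \<inter> {e<..<M} \<times> {-M<..<M}"
  have U': "open U'" "A \<subseteq> U'" "!!p. p \<in> U' ==> kappa p * Psi p - theta p * Psi p = 0"
   using theta(4-6) eM(3) kappa1 by (auto simp: U'_def intro!: open_Int open_Times)
  have "(%p. kappa p * Psi p - theta p * Psi p) \<in> smooth_supp ((R \<union> K') - U')"
   unfolding smooth_supp_def
  proof (intro CollectI conjI allI impI)
   show "smooth (%p. kappa p * Psi p - theta p * Psi p)" using s1 s2 by (auto simp: smooth_supp_def intro!: smooth_on_diff)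
   fix p assume p: "p \<notin> (R \<union> K') - U'"
   have "kappa p * Psi p = 0" if "p \<notin> R" using s1 that unfolding smooth_supp_def by blast
   moreover have "theta p * Psi p = 0" if "p \<notin> K'" using s2 that unfolding smooth_supp_def by blast
   ultimately show "kappa p * Psi p - theta p * Psi p = 0" using p U'(3)[of p] by fastforce
  qed
  moreover have "compact ((R \<union> K') - U')" using R(1) theta(2) U'(1) by (intro compact_diff compact_Un)
  moreover have "(R \<union> K') - U' \<subseteq> Y_space - A" using R(2) theta(3) U'(2) by auto
  ultimately show "(%p. kappa p * Psi p - theta p * Psi p) \<in> test_functions (Y_space - A)"
   by (rule smooth_supp_test_functions)
 qed
 finally show ?thesis by simp
qed

text \<open>By homogeneity it suffices to treat functions whose derivatives are bounded by 1. A
  bound \<open>M = 0\<close> cannot be normalised and is reached as a limit of positive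
  ones.\<close>

lemma finite_orderI:
 fixes v :: "(R2 => complex) => complex"
 assumes K: "compact K"
  and add: "!!phi psi. phi \<in> smooth_supp K ==> psi \<in> smooth_supp K ==> v (%x. phi x + psi x) = v phi + v psi"
  and cmult: "!!phi c. phi \<in> smooth_supp K ==> v (%x. c * phi x) = c * v phi"
  and bd: "!!phi. phi \<in> smooth_supp K ==> (!!vs x. dirs vs ==> length vs <= N ==> norm (iter_deriv vs phi x) <= 1) ==> norm (v phi) <= C"
 shows "finite_order K v N C"
proof
 have C0: "C >= 0"
 proof -
  have z: "iter_deriv vs (%x. 0) = (%x. 0)" for vs :: "R2 list"
   by (induction vs) (auto simp: frechet_derivative_const)
  have "norm (v (%x. 0)) <= C" by (rule bd) (auto simp: smooth_supp_def smooth_on_const z)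
  thus ?thesis using norm_ge_zero order_trans by blast
 qed
 fix phi M assume phi: "phi \<in> smooth_supp K" and M: "!!vs x. dirs vs ==> length vs <= N ==> norm (iter_deriv vs phi x) <= M"
 have M0: "M >= 0" by (rule order_trans[OF norm_ge_zero M[of "[]" undefined]]) auto
 have *: "norm (v phi) <= C * M'" if "M' > 0" "M' >= M" for M'
 proof -
  define phi' where "phi' x = of_real (inverse M') * phi x" for x
  have s: "smooth phi" using phi by (rule smooth_suppD)
  have phi': "phi' \<in> smooth_supp K" using phi by (auto simp: smooth_supp_def phi'_def[abs_def] intro!: smooth_on_mult smooth_on_const)
  have "norm (v phi') <= C"
  proof (rule bd[OF phi'])
   fix vs :: "R2 list" and x assume vs: "dirs vs" "length vs <= N"
   show "norm (iter_deriv vs phi' x) <= 1"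
    unfolding phi'_def iter_deriv_cmult[OF open_UNIV s vs(1) UNIV_I] norm_mult norm_of_real
    using M[OF vs, of x] that by (simp add: divide_simps)
  qed
  moreover have "v phi' = of_real (inverse M') * v phi" unfolding phi'_def by (rule cmult[OF phi])
  ultimately have "norm (of_real (inverse M') * v phi) <= C" by simp
  thus ?thesis using that(1) unfolding norm_mult norm_of_real by (simp add: field_simps)
 qed
 show "norm (v phi) <= C * M"
 proof (rule field_le_epsilon)
  fix e :: real assume "e > 0"
  have "C * (e / (C + 1)) <= e" using C0 \<open>e > 0\<close> by (simp add: field_simps)
  moreover have "norm (v phi) <= C * (M + e / (C + 1))" using C0 \<open>e > 0\<close> M0 by (intro *) (auto intro: add_nonneg_pos divide_pos_pos)
  ultimately show "norm (v phi) <= C * M + e" by (simp add: algebra_simps)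
 qed
qed (use assms in auto)

context cone
begin

lemma cone_reg_exists:
 assumes "X0 > 0" "0 < eta" "eta < X2" "0 < a1" "a1 < b1" "Y0 > 0"
 obtains tau Q where "cone_reg q g X0 eta X2 a1 b1 Y0 tau Q"
proof -
 obtain tau Q where "tau > 0" "smooth Q" "!!t. Q t > 0" "!!t. abs t > tau ==> Q t = q (abs t)"
  "!!t. abs t <= tau ==> Q t < eta / b1" "!!t. abs t <= tau ==> q (abs t) < eta / b1"
  using regularisation[of "eta / b1"] assms by auto
 hence "cone_reg q g X0 eta X2 a1 b1 Y0 tau Q"
  using assms cone_axioms by (intro cone_reg.intro cone_reg_axioms.intro) auto
 thus ?thesis by (rule that)
qed

text \<open>Smoothness is local, and near a given point of Y the transform coincides with a
  regularised one. The parameters of the regularisation may depend on the point.\<close>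

lemma smooth_cone_radon:
 assumes "psi \<in> smooth_supp ({-X0..X0} \<times> {eta..X2})" "X0 > 0" "eta > 0" "eta < X2"
 shows "smooth_on Y_space (cone_radon q psi)"
proof (rule smooth_on_local[OF open_Y_space])
 fix p assume "p \<in> Y_space"
 then obtain E y where p: "p = (E, y)" "E > 0" by (auto simp: Y_space_def)
 obtain tau Q where "cone_reg q g X0 eta X2 (E / 2) (E + 1) (abs y + 1) tau Q"
  by (rule cone_reg_exists[of X0 eta X2 "E / 2" "E + 1" "abs y + 1"]) (use assms p in auto)
 then interpret cone_reg q g X0 eta X2 "E / 2" "E + 1" "abs y + 1" tau Q .
 have psi: "psi \<in> smooth_supp KX" using assms(1) by (simp add: KX_def)
 have "smooth (Rt psi)" using psi by (intro smooth_Rt) (simp add: smooth_supp_def)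
 hence "smooth_on ({0<..<E + 1} \<times> {-(abs y + 1)<..<abs y + 1}) (Rt psi)"
  by (rule smooth_on_subset[OF open_UNIV _ subset_UNIV, rotated]) (auto intro: open_Times)
 moreover have "cone_radon q psi p' = Rt psi p'" if "p' \<in> {0<..<E + 1} \<times> {-(abs y + 1)<..<abs y + 1}" for p'
  using cone_radon_eq[OF psi, of "fst p'" "snd p'"] that by (cases p') auto
 ultimately show "\<exists>U h. open U & p \<in> U & smooth_on U h & (\<forall>y\<in>U. cone_radon q psi y = h y)"
  using p by (intro exI[of _ "{0<..<E + 1} \<times> {-(abs y + 1)<..<abs y + 1}"] exI[of _ "Rt psi"]) (auto intro: open_Times)
qed

lemma smooth_cone_backprojection:
 assumes "phi \<in> smooth_supp ({a1..b1} \<times> {-Y0..Y0})" "a1 > 0" "a1 < b1" "Y0 > 0"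
 shows "smooth_on X_space (cone_backprojection q phi)"
proof (rule smooth_on_local[OF open_X_space])
 fix p assume "p \<in> X_space"
 then obtain x1 x2 where p: "p = (x1, x2)" "x2 > 0" by (auto simp: X_space_def)
 obtain tau Q where "cone_reg q g (abs x1 + 1) (x2 / 2) (x2 + 1) a1 b1 Y0 tau Q"
  by (rule cone_reg_exists[of "abs x1 + 1" "x2 / 2" "x2 + 1" a1 b1 Y0]) (use assms p in auto)
 then interpret cone_reg q g "abs x1 + 1" "x2 / 2" "x2 + 1" a1 b1 Y0 tau Q .
 have phi: "phi \<in> smooth_supp KY" using assms(1) by (simp add: KY_def)
 define V where "V = {-(abs x1 + 1)<..<abs x1 + 1} \<times> {x2 / 2<..}"
 have V: "open V" "p \<in> V" using p by (auto simp: V_def intro: open_Times)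
 have "smooth (Rst phi)" using phi by (intro smooth_Rst) (simp add: smooth_supp_def)
 hence "smooth_on V (Rst phi)"
  by (rule smooth_on_subset[OF open_UNIV V(1) subset_UNIV])
 moreover have "cone_backprojection q phi p' = Rst phi p'" if "p' \<in> V" for p'
  using cone_backprojection_eq[OF phi, of "snd p'" "fst p'"] that by (cases p') (auto simp: V_def)
 ultimately show "\<exists>U h. open U & p \<in> U & smooth_on U h & (\<forall>y\<in>U. cone_backprojection q phi y = h y)"
  using V by blast
qed

end

context cone_reg
begin

lemma unif_Ck_Rt:
 assumes "unif_Ck n UNIV UNIV I psi" "!!i. i \<in> I ==> smooth (psi i)"
 shows "unif_Ck n UNIV KY I (%i. Rt (psi i))"
proof -
 have c: "compact (KY \<times> {-T..T})" by (intro compact_Times compact_KY compact_Icc)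
 have s1: "smooth (%p :: R2 \<times> real. complex_of_real (Dn (fst (fst p)) (snd p)))" by (intro smooth_intros)
 have s2: "smooth (%p :: R2 \<times> real. (snd (fst p) + snd p, fst (fst p) * Q (snd p)))" by (intro smooth_intros)
 have "unif_Ck n UNIV (KY \<times> {-T..T}) I (%i p. of_real (Dn (fst (fst p)) (snd p)) * psi i (snd (fst p) + snd p, fst (fst p) * Q (snd p)))"
  by (intro unif_Ck_mult open_UNIV subset_UNIV smooth_unif_Ck[OF c s1]
    unif_Ck_comp[OF assms(1) smooth_unif_Ck[OF c s2]]) auto
 hence "unif_Ck n UNIV KY I (%i z. integral {-T..T} (%t. of_real (Dn (fst (fst (z, t))) (snd (z, t))) * psi i (snd (fst (z, t)) + snd (z, t), fst (fst (z, t)) * Q (snd (z, t)))))"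
  by (rule unif_Ck_integral) (rule smooth_Rt_integrand[OF assms(2)])
 thus ?thesis by (simp add: Rt_def)
qed

lemma Rt_linear:
 assumes "smooth phi" "smooth psi"
 shows "Rt (%x. phi x + psi x) p = Rt phi p + Rt psi p" "Rt (%x. c * phi x) p = c * Rt phi p"
proof -
 have i: "(%t. of_real (Dn (fst p) t) * f (snd p + t, fst p * Q t)) integrable_on {-T..T}" if "smooth f" for f :: "R2 => complex"
  using integrable_continuous_interval[OF smooth_on_slice(2)[OF smooth_Rt_integrand[OF that], of "{-T..T}" p]] by simp
 show "Rt (%x. phi x + psi x) p = Rt phi p + Rt psi p"
  unfolding Rt_def using integral_add[OF i[OF assms(1)] i[OF assms(2)]] by (simp add: distrib_left)
 show "Rt (%x. c * phi x) p = c * Rt phi p"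
  unfolding Rt_def by (simp add: mult.left_commute)
qed

text \<open>The regularised transform integrates compositions with fixed smooth maps, so derivatives
  of order at most \<open>N\<close> of the image are controlled by those of the argument and the
  order does not grow.\<close>

lemma finite_order_radon:
 assumes "finite_order KY w N C" "theta \<in> smooth_supp KY"
 shows "\<exists>C'. finite_order KX (%psi. w (%p. theta p * Rt psi p)) N C'"
proof -
 interpret w: finite_order KY w N C by fact
 have stheta: "smooth theta" using assms(2) by (rule smooth_suppD)
 define I where "I = {psi \<in> smooth_supp KX. \<forall>vs x. dirs vs --> length vs <= N --> norm (iter_deriv vs psi x) <= 1}"
 have sI: "smooth psi" if "psi \<in> I" for psi using that by (auto simp: I_def smooth_supp_def)
 have "unif_Ck N UNIV UNIV I (%psi. psi)"
  by (rule unif_Ck_smooth) (use sI in \<open>auto simp: I_def intro!: exI[of _ 1]\<close>)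
 hence "unif_Ck N UNIV KY I Rt" using unif_Ck_Rt[of N I "%psi. psi"] sI by simp
 from unif_Ck_uniform_bound[OF this] obtain D where D: "D >= 0"
  "\<forall>vs. dirs vs --> length vs <= N --> (\<forall>i\<in>I. \<forall>x\<in>KY. norm (iter_deriv vs (Rt i) x) <= D)" by blast
 obtain B where B: "w.mult_const theta B" using w.mult_bound[OF assms(2)] by blast
 have "finite_order KX (%psi. w (%p. theta p * Rt psi p)) N (B * (D + 1))"
 proof (rule finite_orderI[OF compact_KX])
  fix phi psi :: "R2 => complex" and c assume "phi \<in> smooth_supp KX"
  hence s: "smooth phi" by (simp add: smooth_supp_def)
  have m: "(%p. theta p * Rt f p) \<in> smooth_supp KY" if "smooth f" for f
   by (rule smooth_supp_mult[OF assms(2) smooth_Rt[OF that]])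
  show "w (%p. theta p * Rt (%x. c * phi x) p) = c * w (%p. theta p * Rt phi p)"
   using w.cmult[OF m[OF s], of c] by (simp add: Rt_linear(2)[OF s s] mult.left_commute)
  show "w (%p. theta p * Rt (%x. phi x + psi x) p) = w (%p. theta p * Rt phi p) + w (%p. theta p * Rt psi p)" if "psi \<in> smooth_supp KX"
  proof -
   have s': "smooth psi" using that by (rule smooth_suppD)
   show ?thesis using w.add[OF m[OF s] m[OF s']] by (simp add: Rt_linear(1)[OF s s'] distrib_left)
  qed
  assume bd: "!!vs x. dirs vs ==> length vs <= N ==> norm (iter_deriv vs phi x) <= 1"
  hence "phi \<in> I" using \<open>phi \<in> smooth_supp KX\<close> by (auto simp: I_def)
  hence "norm (iter_deriv vs (Rt phi) x) <= D + 1" if "dirs vs" "length vs <= N" "x \<in> KY" for vs x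
   using D(2) that by fastforce
  thus "norm (w (%p. theta p * Rt phi p)) <= B * (D + 1)"
   using D(1) by (intro w.mult_constD[OF B smooth_Rt[OF s]]) auto
 qed
 thus ?thesis by blast
qed

end

section \<open>Oscillatory integrals of the cone transform\<close>

text \<open>A smooth function of \<open>v\<close> that equals \<open>1 / v\<close> for \<open>abs v >= c\<close>.\<close>

definition recip :: "real => real => real" where
 "recip c v = v / (v^2 + c^2 * plateau (-1) (-1/2) (1/2) 1 (v / c))"

lemma recip_mult: "c > 0 ==> abs v >= c ==> recip c v * v = 1"
 unfolding recip_def by (subst plateau_eq_0) (auto simp: field_simps power2_eq_square abs_if split: if_splits)

lemma smooth_recip:
 assumes "c > 0"
 shows "smooth (recip c)"
 unfolding recip_def[abs_def]
proof (rule smooth_on_divide[OF open_UNIV])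
 show "smooth (%v. v)" by (rule smooth_on_linear[OF open_UNIV bounded_linear_ident])
 show "smooth (%v. v^2 + c^2 * plateau (-1) (-1/2) (1/2) 1 (v / c))"
  unfolding power2_eq_square divide_inverse[of _ c]
  by (intro smooth_on_add smooth_on_mult smooth_on_const smooth_on_linear[OF open_UNIV bounded_linear_ident]
    smooth_comp[OF smooth_on_plateau] open_UNIV)
 show "v^2 + c^2 * plateau (-1) (-1/2) (1/2) 1 (v / c) ~= 0" for v
 proof (cases "v = 0")
  case True
  thus ?thesis using assms by (simp add: plateau_eq_1)
 next
  case False
  hence "v^2 > 0" by simp
  moreover have "c^2 * plateau (-1) (-1/2) (1/2) 1 (v / c) >= 0"
   using plateau_range[of "-1" "-1/2" "1/2" 1 "v / c"] by (intro mult_nonneg_nonneg) auto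
  ultimately show ?thesis by linarith
 qed
qed

lemma unif_Ck_extend:
 assumes "unif_Ck n UNIV S I F" "!!i. i \<in> I ==> F i \<in> smooth_supp S" "closed S"
 shows "unif_Ck n UNIV UNIV I F"
proof (rule unif_Ck_smooth)
 fix vs :: "'a list" assume vs: "dirs vs" "length vs <= n"
 then obtain C where C: "\<forall>i\<in>I. \<forall>x\<in>S. norm (iter_deriv vs (F i) x) <= C"
  using assms(1) unfolding unif_Ck_iff[OF open_UNIV] by blast
 have "norm (iter_deriv vs (F i) x) <= abs C" if "i \<in> I" for i x
  using C that smooth_supp_iter_deriv_0[OF assms(2)[OF that] assms(3), of x vs]
  by (cases "x \<in> S") (auto intro: order_trans[OF _ abs_ge_self])
 thus "\<exists>C. \<forall>i\<in>I. \<forall>x\<in>UNIV. norm (iter_deriv vs (F i) x) <= C" by blast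
qed (use assms(2) in \<open>auto simp: smooth_supp_def\<close>)

lemma smooth_supp_unif_Ck: "phi \<in> smooth_supp K ==> compact K ==> unif_Ck n UNIV UNIV I (%i. phi)"
 by (intro unif_Ck_extend[OF smooth_unif_Ck]) (auto simp: compact_imp_closed smooth_suppD)

lemma unif_Ck_recip:
 assumes "!!n. unif_Ck n UNIV S I (F :: 'i => 'a::euclidean_space => real)" "c > 0"
 shows "unif_Ck n UNIV S I (%i x. recip c (F i x))"
proof -
 obtain B where "\<forall>i\<in>I. \<forall>x\<in>S. norm (F i x) <= B" using unif_Ck_bounded[OF assms(1)] by blast
 hence "F i x \<in> {-B..B}" if "i \<in> I" "x \<in> S" for i x using that by (auto simp: abs_le_iff) (smt (verit))
 thus ?thesis
  by (intro unif_Ck_compose[OF open_UNIV subset_UNIV open_UNIV subset_UNIV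
    smooth_unif_Ck[OF compact_Icc smooth_recip[OF assms(2)]] assms(1)]) auto
qed

text \<open>On the positive half-line an antiderivative is \<open>s / (1 + mu * s)\<close>. The
  value is of order \<open>1 / mu\<close>; this is the power of the frequency that the composed
  operator gains.\<close>

lemma decay_integral:
 fixes mu A :: real
 assumes "mu > 0" "A >= 0"
 shows "((%s. 1 / (1 + mu * abs s)^2) has_integral 2 * (A / (1 + mu * A))) {-A..A}"
proof -
 have 1: "((%s. 1 / (1 + mu * abs s)^2) has_integral A / (1 + mu * A)) {0..A}"
 proof -
  have "((%s. s / (1 + mu * s)) has_real_derivative 1 / (1 + mu * s)^2) (at s)" if "s >= 0" for s
  proof -
   have "1 + mu * s > 0" using assms that by (simp add: add_pos_nonneg)
   thus ?thesis by (auto intro!: derivative_eq_intros simp: power2_eq_square)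
  qed
  hence "((%s. s / (1 + mu * s)) has_vector_derivative 1 / (1 + mu * s)^2) (at s within {0..A})" if "s \<in> {0..A}" for s
   using that by (auto simp flip: has_real_derivative_iff_has_vector_derivative intro: has_field_derivative_at_within)
  from fundamental_theorem_of_calculus[OF assms(2) this]
  have "((%s. 1 / (1 + mu * s)^2) has_integral A / (1 + mu * A)) {0..A}" by simp
  thus ?thesis by (rule has_integral_eq[rotated]) auto
 qed
 have "((%s. 1 / (1 + mu * abs s)^2) has_integral A / (1 + mu * A)) {-A..0}"
  using has_integral_reflect_real[of "%s. 1 / (1 + mu * abs s)^2" "A / (1 + mu * A)" A 0] 1 by simp
 from has_integral_combine[OF _ _ this 1] show ?thesis using assms by simp
qed

lemma decay_integrable: "integrable lborel (%u::real. 1 / (1 + abs u)^2)"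
proof (rule Bochner_Integration.integrable_bound[OF integrable_inverse_square])
 have "1 / (1 + abs u)^2 <= inverse (1 + u^2)" for u :: real
  unfolding divide_inverse mult_1 by (intro le_imp_inverse_le) (auto simp: power2_sum add_pos_nonneg)
 thus "AE u::real in lborel. norm (1 / (1 + abs u)^2) <= norm (inverse (1 + u^2))" by simp
qed simp

section \<open>Decay off the stationary points, and the composition of the transform with its
  adjoint\<close>

context cone_reg
begin

text \<open>At \<open>(E, y)\<close> the phase of the transform of \<open>phi xi * fwave xi\<close>
  has the \<open>t\<close>-derivative \<open>fst xi + snd xi * (E * deriv Q t)\<close>. Division by
  the scale \<open>l xi\<close>, which dominates \<open>norm xi\<close> up to a constant, gives a
  uniformly smooth phase with large parameter \<open>l xi\<close> and derivative at least
  \<open>c\<close> on the support. As \<open>w\<close> has finite order, decay of all derivatives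
  carries over to its values.\<close>

lemma radon_decay:
 assumes w: "finite_order KY w N C" and theta: "theta \<in> smooth_supp KY"
  and phi: "!!k. unif_Ck k UNIV UNIV V phi" "!!xi. xi \<in> V ==> phi xi \<in> smooth_supp KX"
  and l: "!!xi. xi \<in> V ==> l xi > 0" "!!xi. xi \<in> V ==> norm xi <= C1 * l xi"
  and c: "c > 0" "!!xi E y t. xi \<in> V ==> theta (E, y) ~= 0 ==> phi xi (y + t, E * Q t) ~= 0 ==>
    c * l xi <= abs (fst xi + snd xi * (E * deriv Q t))"
 shows "\<exists>C. \<forall>xi\<in>V. (1 + l xi) ^ M * norm (w (%p. theta p * Rt (%x. phi xi x * fwave xi x) p)) <= C"
proof -
 interpret w: finite_order KY w N C by (rule w)
 define Phi where "Phi xi p = (snd (fst p) + snd p) * (fst xi / l xi) + (fst (fst p) * Q (snd p)) * (snd xi / l xi)"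
  for xi :: "R2" and p :: "R2 \<times> real"
 have cS: "compact (KY \<times> {-T..T})" by (intro compact_Times compact_KY compact_Icc)
 have b: "\<exists>C. \<forall>xi\<in>V. norm (fst xi / l xi) <= C" "\<exists>C. \<forall>xi\<in>V. norm (snd xi / l xi) <= C"
 proof -
  have "abs (fst xi) <= C1 * l xi" "abs (snd xi) <= C1 * l xi" if "xi \<in> V" for xi
   using l(2)[OF that] norm_fst_le[of "fst xi" "snd xi"] norm_snd_le[of "snd xi" "fst xi"] by auto
  thus "\<exists>C. \<forall>xi\<in>V. norm (fst xi / l xi) <= C" "\<exists>C. \<forall>xi\<in>V. norm (snd xi / l xi) <= C"
   using l(1) by (auto intro!: exI[of _ C1] simp: divide_le_eq abs_of_pos)
 qed
 have Phik: "unif_Ck k UNIV (KY \<times> {-T..T}) V Phi" for k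
 proof -
  have s: "smooth (%p :: R2 \<times> real. snd (fst p) + snd p)"
   "smooth (%p :: R2 \<times> real. fst (fst p) * Q (snd p))" by (intro smooth_intros)+
  show ?thesis unfolding Phi_def[abs_def]
   by (intro unif_Ck_add unif_Ck_mult unif_Ck_const b open_UNIV subset_UNIV
     smooth_unif_Ck[OF cS] s)
 qed
 have Phit: "fderiv (Phi xi) p (0, 1) = (fst xi + snd xi * (fst (fst p) * deriv Q (snd p))) / l xi" if "xi \<in> V" for xi p
 proof -
  have "((%t. (snd (fst p) + t) * (fst xi / l xi) + (fst (fst p) * Q t) * (snd xi / l xi)) has_real_derivative
   (fst xi / l xi) + (fst (fst p) * deriv Q (snd p)) * (snd xi / l xi)) (at (snd p))"
   using l(1)[OF that] by (auto intro!: derivative_eq_intros Q_deriv)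
  moreover have "(Phi xi has_derivative fderiv (Phi xi) (fst p, snd p)) (at (fst p, snd p))"
   by (intro smooth_has_derivative unif_Ck_imp_smooth[OF Phik that] UNIV_I)
  from has_derivative_slice(2)[OF this]
  have "((%t. Phi xi (fst p, t)) has_derivative (%h. fderiv (Phi xi) p (0, h))) (at (snd p))" by simp
  ultimately have "(%h. fderiv (Phi xi) p (0, h)) = (*) ((fst xi / l xi) + (fst (fst p) * deriv Q (snd p)) * (snd xi / l xi))"
   by (intro has_derivative_unique) (auto simp: Phi_def has_field_derivative_def)
  from fun_cong[OF this, of 1] show ?thesis by (simp add: add_divide_distrib mult_ac)
 qed
 \<comment> \<open>On the support of the amplitude \<open>recip c\<close> yields the true reciprocal
   of the phase derivative; elsewhere it only has to be smooth.\<close>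
 interpret nonstationary V KY "-T" T Phi "%xi p. recip c (fderiv (Phi xi) p (0, 1))" l
 proof
  show "unif_Ck k UNIV (KY \<times> {-T..T}) V (%xi p. recip c (fderiv (Phi xi) p (0, 1)))" for k
   by (intro unif_Ck_recip c unif_Ck_frechet[OF Phik] Basis_prod_snd1)
 qed (use Phik params in \<open>auto simp: T_def\<close>)
 define B where "B xi p = theta (fst p) * (of_real (Dn (fst (fst p)) (snd p)) * phi xi (snd (fst p) + snd p, fst (fst p) * Q (snd p)))"
  for xi and p :: "R2 \<times> real"
 have stheta: "smooth theta" using theta by (rule smooth_suppD)
 have aB: "amp B"
  unfolding amp_def
 proof (intro conjI allI ballI)
  have s: "smooth (%p :: R2 \<times> real. theta (fst p))" "smooth (%p :: R2 \<times> real. complex_of_real (Dn (fst (fst p)) (snd p)))"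
   "smooth (%p :: R2 \<times> real. (snd (fst p) + snd p, fst (fst p) * Q (snd p)))"
   by (intro smooth_intros smooth_comp[OF stheta])+
  show "unif_Ck k UNIV (KY \<times> {-T..T}) V B" for k unfolding B_def[abs_def]
   by (intro unif_Ck_mult open_UNIV subset_UNIV smooth_unif_Ck[OF cS] s
    unif_Ck_comp[OF phi(1) smooth_unif_Ck[OF cS s(3)]]) auto
  have "B xi (z, t) = 0" if "xi \<in> V" "t \<notin> {-(X0 + Y0)..X0 + Y0}" for xi z t
  proof (cases "theta z = 0")
   case False
   hence "z \<in> KY" using theta unfolding smooth_supp_def by blast
   hence "(snd z + t, fst z * Q t) \<notin> KX" using that by (auto simp: KX_def KY_def)
   thus ?thesis using phi(2)[OF that(1)] by (simp add: B_def smooth_supp_def)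
  qed (simp add: B_def)
  thus "\<exists>a' b'. - T < a' & b' < T & (\<forall>i\<in>V. \<forall>z t. t \<notin> {a'..b'} --> B i (z, t) = 0)"
   by (intro exI[of _ "-(X0 + Y0)"] exI[of _ "X0 + Y0"]) (auto simp: T_def)
  fix xi p assume xi: "xi \<in> V"
  show "(recip c (fderiv (Phi xi) p (0, 1)) * fderiv (Phi xi) p (0, 1) - 1) *\<^sub>R B xi p = 0"
  proof (cases "B xi p = 0")
   case False
   hence "theta (fst (fst p), snd (fst p)) ~= 0" "phi xi (snd (fst p) + snd p, fst (fst p) * Q (snd p)) ~= 0"
    by (auto simp: B_def)
   from c(2)[OF xi this] have "c <= abs (fderiv (Phi xi) p (0, 1))"
    unfolding Phit[OF xi] using l(1)[OF xi] by (simp add: pos_le_divide_eq)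
   from recip_mult[OF c(1) this] show ?thesis by simp
  qed simp
 qed
 have eq: "osc_int B xi = (%p. theta p * Rt (%x. phi xi x * fwave xi x) p)" if "xi \<in> V" for xi
 proof
  fix p
  have "osc Phi l xi (p, t) = fwave xi (snd p + t, fst p * Q t)" for t
  proof -
   have "l xi * Phi xi (p, t) = (snd p + t, fst p * Q t) \<bullet> xi"
    using l(1)[OF that] by (cases xi) (simp add: Phi_def field_simps)
   thus ?thesis by (simp add: osc_def fwave_def)
  qed
  thus "osc_int B xi p = theta p * Rt (%x. phi xi x * fwave xi x) p"
   unfolding osc_int_def Rt_def B_def by (simp add: mult.assoc)
 qed
 obtain D where mc: "w.mult_const (%x. of_real (cutoff 1 a1 b1 (-Y0) Y0 x) * 0 + theta x) D"
  using w.mult_bound[of theta] theta by auto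
 have "\<forall>vs. \<exists>E. dirs vs --> (\<forall>xi\<in>V. \<forall>z\<in>KY. (1 + abs (l xi)) ^ M * norm (iter_deriv vs (osc_int B xi) z) <= E)"
  using iter_deriv_osc_int_decay[OF aB] by blast
 then obtain E where E: "!!vs xi z. dirs vs ==> xi \<in> V ==> z \<in> KY ==> (1 + abs (l xi)) ^ M * norm (iter_deriv vs (osc_int B xi) z) <= E vs"
  by metis
 define F where "F = (\<Sum>vs\<in>{vs. dirs vs & length vs <= N}. abs (E vs))"
 have F: "E vs <= F" if "dirs vs" "length vs <= N" for vs
  using member_le_sum[of vs "{vs. dirs vs & length vs <= N}" "%vs. abs (E vs)"] finite_deriv_lists[of N, where 'a = "R2"] that by (simp add: F_def)
 have "(1 + l xi) ^ M * norm (w (%p. theta p * Rt (%x. phi xi x * fwave xi x) p)) <= C * F" if xi: "xi \<in> V" for xi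
 proof -
  let ?P = "(1 + l xi) ^ M"
  have P: "?P > 0" using l(1)[OF xi] by (simp add: add_pos_pos)
  have ss: "osc_int B xi \<in> smooth_supp KY"
   using smooth_osc_int[OF aB xi] theta unfolding smooth_supp_def eq[OF xi] by auto
  have "norm (w (osc_int B xi)) <= C * (F / ?P)"
  proof (rule w.bound[OF ss])
   fix vs :: "R2 list" and x assume vs: "dirs vs" "length vs <= N"
   have F0: "F >= 0" by (simp add: F_def sum_nonneg)
   show "norm (iter_deriv vs (osc_int B xi) x) <= F / ?P"
   proof (cases "x \<in> KY")
    case True
    from E[OF vs(1) xi True] F[OF vs] l(1)[OF xi] have "?P * norm (iter_deriv vs (osc_int B xi) x) <= F" by simp
    thus ?thesis using P by (simp add: field_simps)
   next
    case False
    thus ?thesis using smooth_supp_iter_deriv_0[OF ss compact_imp_closed[OF compact_KY]] F0 P by simp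
   qed
  qed
  thus ?thesis using P unfolding eq[OF xi] by (simp add: field_simps)
 qed
 thus ?thesis by blast
qed

text \<open>The composition leads from \<open>x\<close> along the curve with
  \<open>(E, y) = (x2 / Q t, x1 - t)\<close> to a second point of the same curve. If
  \<open>s\<close> is the displacement in the first coordinate, this is the displacement in the
  second.\<close>

definition Mphase :: "(R2 \<times> real) \<times> real => real" where
 "Mphase p = snd (fst (fst p)) * (Q (snd p + snd (fst p)) - Q (snd p)) / Q (snd p)"

definition owave :: "R2 => (R2 \<times> real) \<times> real => complex" where
 "owave xi p = exp (- \<i> * of_real (snd (fst p) * fst xi + snd xi * Mphase p))"

text \<open>The displacement \<open>s\<close> is integrated last because the inner integral decays
  in \<open>snd xi * s\<close>. Its range contains all differences of two parameters from
  \<open>{-T..T}\<close>.\<close>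

definition OI :: "R2 => ((R2 \<times> real) \<times> real => complex) => R2 => complex" where
 "OI xi B x = integral {-2*T..2*T} (%s. integral {-T..T} (%t. B ((x, s), t) * owave xi ((x, s), t)))"

text \<open>The starting point, the curve and the second point of the composition all lie in their
  rectangles.\<close>

definition good :: "(R2 \<times> real) \<times> real => bool" where
 "good p \<longleftrightarrow> fst (fst p) \<in> KX & (snd (fst (fst p)) / Q (snd p), fst (fst (fst p)) - snd p) \<in> KY &
  (fst (fst (fst p)) + snd (fst p), snd (fst (fst p)) / Q (snd p) * Q (snd p + snd (fst p))) \<in> KX"

lemma smooth_Mphase: "smooth Mphase"
 unfolding Mphase_def[abs_def] by (intro smooth_on_divide smooth_intros) (metis less_irrefl Q_pos)

lemma smooth_owave: "smooth (owave xi)"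
 unfolding owave_def[abs_def]
 by (intro smooth_on_exp smooth_intros smooth_Mphase)

lemma norm_owave: "norm (owave xi p) = 1"
 by (simp add: owave_def)

lemma smooth_OI_inner:
 assumes "smooth B"
 shows "smooth (%z. integral {-T..T} (%t. B (z, t) * owave xi (z, t)))"
 by (rule smooth_on_integral) (intro smooth_on_mult open_UNIV assms smooth_owave)

lemma smooth_OI: "smooth B ==> smooth (OI xi B)"
 unfolding OI_def[abs_def] using smooth_on_integral[OF smooth_OI_inner, of B "-2*T" "2*T" xi] by simp

lemma OI_smooth_supp:
 assumes "smooth B" "!!p. B p ~= 0 ==> good p"
 shows "OI xi B \<in> smooth_supp KX"
proof -
 have "OI xi B x = 0" if "x \<notin> KX" for x
 proof -
  have "B ((x, s), t) = 0" for s t using assms(2)[of "((x, s), t)"] that by (auto simp: good_def)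
  thus ?thesis by (simp add: OI_def)
 qed
 thus ?thesis using smooth_OI[OF assms(1)] by (auto simp: smooth_supp_def)
qed

lemma good_bounds:
 assumes "good ((x, s), t)"
 shows "tau < abs t" "abs t <= X0 + Y0" "tau < abs (t + s)" "abs (t + s) <= X0 + Y0" "x \<in> KX" "eta * Q t <= b1 * (Q t * Q (t + s))"
proof -
 obtain x1 x2 where x: "x = (x1, x2)" by force
 have g: "abs x1 <= X0" "x2 >= eta" "a1 <= x2 / Q t" "x2 / Q t <= b1" "abs (x1 - t) <= Y0" "abs (x1 + s) <= X0" "eta <= x2 / Q t * Q (t + s)"
  using assms by (auto simp: good_def KX_def KY_def x)
 show "x \<in> KX" using assms by (simp add: good_def)
 show "tau < abs t" by (rule Q_large[of "x2 / Q t"]) (use g Q_pos[of t] in auto)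
 show "tau < abs (t + s)" by (rule Q_large[of "x2 / Q t"]) (use g in auto)
 show "abs t <= X0 + Y0" "abs (t + s) <= X0 + Y0" using g by auto
 have "eta <= b1 * Q (t + s)" using g Q_pos[of "t + s"] by (meson mult_right_mono less_imp_le order_trans)
 hence "eta * Q t <= b1 * Q (t + s) * Q t" using Q_pos[of t] by (intro mult_right_mono) auto
 thus "eta * Q t <= b1 * (Q t * Q (t + s))" by (simp add: mult_ac)
qed

text \<open>For fixed \<open>s ~= 0\<close> the inner integral is non-stationary with large parameter \<open>xi\<^sub>2 s\<close>: the
 \<open>t\<close>-derivative of the phase is proportional to \<open>G (t + s) - G t\<close>, and \<open>G\<close> is injective.\<close>

lemma OI_inner_decay:
 fixes B :: "R2 \<times> real => R2 \<times> real => complex"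
 assumes B: "!!k. unif_Ck k UNIV (KX \<times> {-T..T}) (V \<times> ({-2*T..2*T} - {0})) B"
  and supp: "!!xi s x t. xi \<in> V ==> s \<in> {-2*T..2*T} - {0} ==> B (xi, s) (x, t) ~= 0 ==> good ((x, s), t)"
  and vs: "dirs vs"
 shows "\<exists>C. \<forall>xi\<in>V. \<forall>s\<in>{-2*T..2*T} - {0}. \<forall>x\<in>KX. (1 + abs (snd xi * s)) ^ N *
  norm (iter_deriv vs (%x. integral {-T..T} (%t. B (xi, s) (x, t) * exp (- \<i> * of_real (snd xi * Mphase ((x, s), t))))) x) <= C"
proof -
 define I where "I = V \<times> ({-2*T..2*T} - {0})"
 \<comment> \<open>The displacement is moved to the last coordinate, the one by which
   \<open>unif_Ck_divide_param\<close> divides.\<close>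
 define F where "F u p = snd (fst (fst p)) * (Q (snd (fst p) + snd p) - Q (snd (fst p))) / Q (snd (fst p))"
  for u :: unit and p :: "(R2 \<times> real) \<times> real"
 have sF: "smooth (F u)" for u
  unfolding F_def[abs_def] by (intro smooth_on_divide smooth_intros) (metis less_irrefl Q_pos)
 have "compact ((KX \<times> {-T..T}) \<times> {-(2*T)..2*T})" by (intro compact_Times compact_KX compact_Icc)
 hence "unif_Ck k UNIV ((KX \<times> {-T..T}) \<times> {-(2*T)..2*T}) UNIV F" for k
  using smooth_unif_Ck[OF _ sF[of "()"], of "(KX \<times> {-T..T}) \<times> {-(2*T)..2*T}" k UNIV]
  by (simp add: F_def[abs_def])
 hence "unif_Ck k UNIV (KX \<times> {-T..T}) (UNIV \<times> ({-(2*T)..2*T} - {0})) (%(u, s) z. F u (z, s) /\<^sub>R s)" for k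
  by (rule unif_Ck_divide_param) (simp add: F_def)
 from unif_Ck_reindex[OF this, of I "%i. ((), snd i)"]
 have Phik0: "unif_Ck k UNIV (KX \<times> {-T..T}) I (%i z. F () (z, snd i) /\<^sub>R snd i)" for k
  by (auto simp: I_def)
 define Phi where "Phi i z = Mphase ((fst z, snd i), snd z) / snd i" for i :: "R2 \<times> real" and z
 have "Phi = (%i z. F () (z, snd i) /\<^sub>R snd i)" by (auto simp: Phi_def Mphase_def F_def divide_inverse fun_eq_iff)
 hence Phik: "unif_Ck k UNIV (KX \<times> {-T..T}) I Phi" for k using Phik0 by simp
 have Phit: "fderiv (Phi i) p (0, 1) =
   snd (fst p) * (Q (snd p + snd i) / Q (snd p)) * ((G (snd p + snd i) - G (snd p)) / snd i)" if "i \<in> I" for i p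
 proof -
  let ?s = "snd i" and ?t = "snd p"
  have s0: "?s ~= 0" using that by (auto simp: I_def)
  have "((%t. snd (fst p) * (Q (t + ?s) - Q t) / Q t / ?s) has_real_derivative
   snd (fst p) * ((deriv Q (?t + ?s) - deriv Q ?t) * Q ?t - (Q (?t + ?s) - Q ?t) * deriv Q ?t) / (Q ?t * Q ?t) / ?s) (at ?t)"
  proof -
   have "((%t. Q (t + ?s)) has_real_derivative deriv Q (?t + ?s)) (at ?t)"
    using DERIV_chain'[OF DERIV_add[OF DERIV_ident DERIV_const[of ?s]] Q_deriv, of ?t] by simp
   hence "((%t. snd (fst p) * (Q (t + ?s) - Q t) / Q t) has_real_derivative
    (snd (fst p) * (deriv Q (?t + ?s) - deriv Q ?t) * Q ?t - snd (fst p) * (Q (?t + ?s) - Q ?t) * deriv Q ?t) / (Q ?t * Q ?t)) (at ?t)"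
    using Q_pos[of ?t] by (intro DERIV_divide DERIV_cmult DERIV_diff Q_deriv) auto
   from DERIV_cdivide[OF this, of ?s] show ?thesis by (simp add: algebra_simps)
  qed
  also have "snd (fst p) * ((deriv Q (?t + ?s) - deriv Q ?t) * Q ?t - (Q (?t + ?s) - Q ?t) * deriv Q ?t) / (Q ?t * Q ?t) / ?s =
   snd (fst p) * (Q (?t + ?s) / Q ?t) * ((G (?t + ?s) - G ?t) / ?s)"
   using Q_pos[of ?t] Q_pos[of "?t + ?s"] s0 by (simp add: G_def field_simps)
  finally have 1: "((%t. Phi i (fst p, t)) has_derivative (*) (snd (fst p) * (Q (?t + ?s) / Q ?t) * ((G (?t + ?s) - G ?t) / ?s))) (at ?t)"
   by (simp add: Phi_def Mphase_def has_field_derivative_def)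
  have "(Phi i has_derivative fderiv (Phi i) (fst p, snd p)) (at (fst p, snd p))"
   by (intro smooth_has_derivative unif_Ck_imp_smooth[OF Phik that] UNIV_I)
  from has_derivative_slice(2)[OF this]
  have 2: "((%t. Phi i (fst p, t)) has_derivative (%h. fderiv (Phi i) p (0, h))) (at ?t)" by simp
  from fun_cong[OF has_derivative_unique[OF 2 1], of 1] show ?thesis by simp
 qed
 obtain c0 where c0: "c0 > 0" "!!t t'. tau < abs t ==> abs t <= T ==> tau < abs t' ==> abs t' <= T ==> abs (G t - G t') >= c0 * abs (t - t')"
  by (rule G_separation) (rule that)
 obtain qm where qm: "qm > 0" "!!t. t \<in> {-T..T} ==> Q t <= qm"
 proof -
  have "compact (Q ` {-T..T})" by (intro compact_continuous_image continuous_on_subset[OF Q_cont(1)] compact_Icc) auto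
  from compact_imp_bounded[OF this] obtain B where B: "B > 0" "\<forall>y\<in>Q ` {-T..T}. norm y <= B" unfolding bounded_pos by (elim exE conjE)
  show ?thesis
  proof (rule that[OF B(1)])
   fix t assume "t \<in> {-T..T}"
   hence "norm (Q t) <= B" using B(2) by blast
   thus "Q t <= B" by simp
  qed
 qed
 \<comment> \<open>Product of the lower bounds for \<open>x2\<close>, for
   \<open>Q (t + s) / Q t\<close> and for the difference quotient of \<open>G\<close>.\<close>
 define c where "c = eta * (eta / b1 / qm) * c0"
 have c: "c > 0" using params qm(1) c0(1) by (simp add: c_def)
 interpret nonstationary I KX "-T" T Phi "%i p. recip c (fderiv (Phi i) p (0, 1))" "%i. snd (fst i) * snd i"
 proof
  show "unif_Ck k UNIV (KX \<times> {-T..T}) I (%i p. recip c (fderiv (Phi i) p (0, 1)))" for k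
   by (intro unif_Ck_recip c unif_Ck_frechet[OF Phik] Basis_prod_snd1)
 qed (use Phik params in \<open>auto simp: T_def\<close>)
 have aB: "amp B" unfolding amp_def
 proof (intro conjI allI ballI)
  show "unif_Ck k UNIV (KX \<times> {-T..T}) I B" for k using B by (simp add: I_def)
  have "B i (z, t) = 0" if "i \<in> I" "t \<notin> {-(X0 + Y0)..X0 + Y0}" for i z t
  proof (rule ccontr)
   assume nz: "B i (z, t) ~= 0"
   have i: "fst i \<in> V" "snd i \<in> {-2*T..2*T} - {0}" using that(1) unfolding I_def by (simp_all add: mem_Times_iff)
   have "good ((z, snd i), t)" by (rule supp[OF i]) (use nz in simp)
   from good_bounds(2)[OF this] that(2) show False by auto
  qed
  thus "\<exists>a' b'. - T < a' & b' < T & (\<forall>i\<in>I. \<forall>z t. t \<notin> {a'..b'} --> B i (z, t) = 0)"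
   by (intro exI[of _ "-(X0 + Y0)"] exI[of _ "X0 + Y0"]) (auto simp: T_def)
  fix i and p :: "R2 \<times> real" assume i: "i \<in> I"
  show "(recip c (fderiv (Phi i) p (0, 1)) * fderiv (Phi i) p (0, 1) - 1) *\<^sub>R B i p = 0"
  proof (cases "B i p = 0")
   case False
   let ?s = "snd i" and ?t = "snd p"
   have s: "?s ~= 0" using i by (auto simp: I_def)
   have i': "fst i \<in> V" "?s \<in> {-2*T..2*T} - {0}" using i unfolding I_def by (simp_all add: mem_Times_iff)
   have g: "good ((fst p, ?s), ?t)" by (rule supp[OF i']) (use False in simp)
   note gb = good_bounds[OF g]
   have t: "abs (?t) <= T" "abs (?t + ?s) <= T" using gb by (auto simp: T_def)
   have 1: "snd (fst p) >= eta" using gb(5) by (auto simp: KX_def)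
   have 2: "Q (?t + ?s) / Q ?t >= eta / b1 / qm"
   proof -
    have "eta / b1 <= Q (?t + ?s)" using gb(6) Q_pos[of ?t] params by (simp add: field_simps)
    moreover have "Q ?t <= qm" by (rule qm(2)) (use t(1) in \<open>simp add: abs_le_iff\<close>)
    ultimately show ?thesis using params Q_pos[of ?t] Q_pos[of "?t + ?s"] by (intro frac_le) auto
   qed
   have 3: "abs ((G (?t + ?s) - G ?t) / ?s) >= c0"
    using c0(2)[of "?t + ?s" ?t] gb t s by (simp add: pos_le_divide_eq)
   have "c <= snd (fst p) * (Q (?t + ?s) / Q ?t) * abs ((G (?t + ?s) - G ?t) / ?s)"
    unfolding c_def using 1 2 3 params qm(1) c0(1) Q_pos[of ?t] Q_pos[of "?t + ?s"]
    by (intro mult_mono) (auto intro!: divide_nonneg_nonneg mult_nonneg_nonneg)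
   also have "... = abs (fderiv (Phi i) p (0, 1))"
    unfolding Phit[OF i] abs_mult using 1 params Q_pos[of ?t] Q_pos[of "?t + ?s"] by simp
   finally show ?thesis using recip_mult[OF c] by simp
  qed simp
 qed
 have eq: "osc_int B (xi, s) = (%x. integral {-T..T} (%t. B (xi, s) (x, t) * exp (- \<i> * of_real (snd xi * Mphase ((x, s), t)))))"
  if "s ~= 0" for xi s
 proof -
  have "osc Phi (%i. snd (fst i) * snd i) (xi, s) (x, t) = exp (- \<i> * of_real (snd xi * Mphase ((x, s), t)))" for x t
   using that by (simp add: osc_def Phi_def)
  thus ?thesis unfolding osc_int_def by simp
 qed
 from iter_deriv_osc_int_decay[OF aB vs, of N] obtain C where
  "\<forall>i\<in>I. \<forall>z\<in>KX. (1 + abs (snd (fst i) * snd i)) ^ N * norm (iter_deriv vs (osc_int B i) z) <= C" by blast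
 thus ?thesis by (intro exI[of _ C]) (auto simp: I_def eq)
qed

lemma OI_inner_split:
 assumes "s ~= 0" "s \<in> {-2*T..2*T}" "!!t. B ((x, s), t) = of_real (s ^ j) * B' (x, t)"
 shows "integral {-T..T} (%t. B ((x, s), t) * owave xi ((x, s), t)) =
  (exp (- \<i> * of_real (s * fst xi)) * of_real (s ^ j)) *
  integral {-T..T} (%t. B' (x, t) * exp (- \<i> * of_real (snd xi * Mphase ((x, s), t))))"
proof -
 have "B ((x, s), t) * owave xi ((x, s), t) = (exp (- \<i> * of_real (s * fst xi)) * of_real (s ^ j)) *
  (B' (x, t) * exp (- \<i> * of_real (snd xi * Mphase ((x, s), t))))" for t
  unfolding owave_def assms(3) by (simp add: exp_add[symmetric] algebra_simps)
 thus ?thesis by simp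
qed

text \<open>After the inner integration the integrand is of size
  \<open>abs s ^ j / (1 + mu * abs s) ^ (j + 2)\<close> with \<open>mu = 1 + abs (snd xi)\<close>.
  The powers of \<open>abs s\<close> turn into \<open>j\<close> inverse powers of \<open>mu\<close>
  and the remaining integral contributes one more: an amplitude vanishing to order \<open>j\<close>
  on the diagonal gains \<open>j + 1\<close> orders.\<close>

lemma OI_bound:
 assumes B: "!!xi. xi \<in> V ==> smooth (B xi)" "!!xi p. xi \<in> V ==> B xi p ~= 0 ==> good p"
  and B': "!!k. unif_Ck k UNIV (KX \<times> {-T..T}) (V \<times> ({-2*T..2*T} - {0})) B'"
  and eq: "!!xi s x t. xi \<in> V ==> s \<in> {-2*T..2*T} - {0} ==> B xi ((x, s), t) = of_real (s ^ j) * B' (xi, s) (x, t)"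
  and n: "n <= j + 1" and vs: "dirs vs"
 shows "\<exists>C. \<forall>xi\<in>V. \<forall>x. (1 + abs (snd xi)) ^ n * norm (iter_deriv vs (OI xi (B xi)) x) <= C"
proof -
 let ?S = "{-2*T..2*T} - {0::real}"
 have supp: "good ((x, s), t)" if "xi \<in> V" "s \<in> ?S" "B' (xi, s) (x, t) ~= 0" for xi s x t
  using B(2)[OF that(1), of "((x, s), t)"] eq[OF that(1,2), of x t] that by simp
 define H where "H xi s x = integral {-T..T} (%t. B' (xi, s) (x, t) * exp (- \<i> * of_real (snd xi * Mphase ((x, s), t))))" for xi s x
 have "\<exists>C0. \<forall>xi\<in>V. \<forall>s\<in>?S. \<forall>x\<in>KX. (1 + abs (snd xi * s)) ^ (j + 2) * norm (iter_deriv vs (H xi s) x) <= C0"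
  unfolding H_def by (rule OI_inner_decay[OF B' _ vs]) (rule supp)
 then obtain C0 where
  C0: "\<forall>xi\<in>V. \<forall>s\<in>?S. \<forall>x\<in>KX. (1 + abs (snd xi * s)) ^ (j + 2) * norm (iter_deriv vs (H xi s) x) <= C0"
  by blast
 have T0: "T > 0" using params by (simp add: T_def)
 \<comment> \<open>For \<open>abs s <= 2 * T\<close> decay in \<open>1 + abs (snd xi * s)\<close>
   may be replaced, up to the factor \<open>K\<close>, by decay in
   \<open>1 + mu * abs s\<close>.\<close>
 define K where "K = 1 + 2 * T"
 define C where "C = K ^ (j + 2) * abs C0"
 have C: "C >= 0" using T0 by (simp add: C_def K_def)
 have "(1 + abs (snd xi)) ^ n * norm (iter_deriv vs (OI xi (B xi)) x) <= 2 * C" if xi: "xi \<in> V" for xi x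
 proof (cases "x \<in> KX")
  case False
  have "OI xi (B xi) \<in> smooth_supp KX" by (rule OI_smooth_supp[OF B(1)[OF xi] B(2)[OF xi]])
  thus ?thesis using smooth_supp_iter_deriv_0[OF _ compact_imp_closed[OF compact_KX] False] C by simp
 next
  case x: True
  define F where "F z = integral {-T..T} (%t. B xi (z, t) * owave xi (z, t))" for z
  have sF: "smooth F" unfolding F_def by (rule smooth_OI_inner[OF B(1)[OF xi]])
  define f where "f s = iter_deriv vs (%x. F (x, s)) x" for s
  have D: "iter_deriv vs (OI xi (B xi)) x = integral {-2*T..2*T} f"
   unfolding OI_def[abs_def] f_def using iter_deriv_integral[OF sF vs, of "-2*T" "2*T" x] by (simp add: F_def)
  have fc: "continuous_on {-2*T..2*T} f"
  proof -
   have "smooth (iter_deriv (map (%v. (v, 0)) vs) F)"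
    by (rule smooth_iter_deriv[OF sF]) (use vs Basis_prod_fst in auto)
   from smooth_on_slice(2)[OF this] show ?thesis unfolding f_def iter_deriv_slice[OF sF vs] .
  qed
  define mu where "mu = 1 + abs (snd xi)"
  have mu: "mu > 0" "mu >= 1" by (simp_all add: mu_def)
  have fb: "mu ^ j * norm (f s) <= C * (1 / (1 + mu * abs s)^2)" if s: "s \<in> ?S" for s
  proof -
   have "(%x. F (x, s)) = (%x. (exp (- \<i> * of_real (s * fst xi)) * of_real (s ^ j)) * H xi s x)"
    unfolding F_def H_def using OI_inner_split[of s "B xi" _ j "B' (xi, s)" xi] s eq[OF xi s] by auto
   moreover have "smooth (H xi s)"
   proof -
    have "smooth (%p :: R2 \<times> real. exp (- \<i> * of_real (snd xi * Mphase ((fst p, s), snd p))))"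
     by (intro smooth_on_exp smooth_intros smooth_comp[OF smooth_Mphase])
    moreover have "smooth (B' (xi, s))" by (rule unif_Ck_imp_smooth[OF B']) (use xi s in auto)
    ultimately have "smooth (%p. B' (xi, s) p * exp (- \<i> * of_real (snd xi * Mphase ((fst p, s), snd p))))"
     by (rule smooth_on_mult[OF open_UNIV, rotated])
    from smooth_on_integral[OF this, of "-T" T] show ?thesis by (simp add: H_def[abs_def])
   qed
   ultimately have "f s = (exp (- \<i> * of_real (s * fst xi)) * of_real (s ^ j)) * iter_deriv vs (H xi s) x"
    unfolding f_def using iter_deriv_cmult[OF open_UNIV _ vs UNIV_I] by simp
   hence n: "norm (f s) = abs s ^ j * norm (iter_deriv vs (H xi s) x)" by (simp add: norm_mult norm_power power_abs)
   have p: "1 + mu * abs s > 0" using mu by (simp add: add_pos_nonneg)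
   have "1 + mu * abs s <= K * (1 + abs (snd xi * s))"
   proof -
    have "abs s <= 2 * T" "0 <= abs s * (abs (snd xi) * (2 * T))" using s T0 by auto
    moreover have "K * (1 + abs (snd xi * s)) - (1 + mu * abs s) = 2 * T - abs s + abs s * (abs (snd xi) * (2 * T))"
     by (simp add: mu_def K_def abs_mult algebra_simps)
    ultimately show ?thesis by linarith
   qed
   hence "(1 + mu * abs s) ^ (j + 2) * norm (iter_deriv vs (H xi s) x) <=
     K ^ (j + 2) * ((1 + abs (snd xi * s)) ^ (j + 2) * norm (iter_deriv vs (H xi s) x))"
    using p unfolding mult.assoc[symmetric] power_mult_distrib[symmetric] by (intro mult_right_mono power_mono) auto
   also have "... <= C" unfolding C_def using C0 xi s x T0
    by (intro mult_left_mono) (auto simp: K_def intro: order_trans[OF _ abs_ge_self])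
   finally have "norm (iter_deriv vs (H xi s) x) <= C / (1 + mu * abs s) ^ (j + 2)"
    using zero_less_power[OF p, of "j + 2"] by (simp only: pos_le_divide_eq mult.commute)
   hence "mu ^ j * norm (f s) <= (mu * abs s) ^ j * (C / (1 + mu * abs s) ^ (j + 2))"
    unfolding n power_mult_distrib mult.assoc using mu by (intro mult_left_mono) auto
   also have "... <= (1 + mu * abs s) ^ j * (C / (1 + mu * abs s) ^ (j + 2))"
    using mu p C by (intro mult_right_mono power_mono) auto
   also have "... = C * (1 / (1 + mu * abs s)^2)" using p by (simp add: power_add power2_eq_square)
   finally show ?thesis .
  qed
  define h0 where "h0 s = C * (1 / (1 + mu * abs s)^2)" for s
  \<comment> \<open>The estimate of the inner integral excludes \<open>s = 0\<close>; a single point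
    does not change the integral of the majorant.\<close>
  define h where "h s = (if s = 0 then mu ^ j * norm (f 0) else h0 s)" for s
  have h0: "(h0 has_integral C * (2 * (2 * T / (1 + mu * (2 * T))))) {-2*T..2*T}"
   unfolding h0_def using has_integral_mult_right[OF decay_integral[OF mu(1), of "2 * T"], of C] T0 by simp
  have h: "(h has_integral C * (2 * (2 * T / (1 + mu * (2 * T))))) {-2*T..2*T}"
   by (rule has_integral_spike[OF _ _ h0, of "{0}"]) (auto simp: h_def)
  have "mu ^ j * norm (integral {-2*T..2*T} f) = norm (integral {-2*T..2*T} (%s. of_real (mu ^ j) * f s))"
   using mu by (simp add: norm_mult norm_power)
  also have "... <= integral {-2*T..2*T} h"
  proof (rule integral_norm_bound_integral)
   show "(%s. of_real (mu ^ j) * f s) integrable_on {-2*T..2*T}"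
    by (intro integrable_continuous_interval continuous_intros fc)
   show "h integrable_on {-2*T..2*T}" using h by blast
   show "norm (of_real (mu ^ j) * f s) <= h s" if "s \<in> {-2*T..2*T}" for s
    using fb[of s] that mu by (auto simp: h_def h0_def norm_mult norm_power)
  qed
  also have "... = C * (2 * (2 * T / (1 + mu * (2 * T))))" using h by (rule integral_unique)
  also have "... <= C * (2 * (1 / mu))"
  proof (intro mult_left_mono C)
   have "0 < mu * (T * 2)" using mu T0 by simp
   thus "2 * T / (1 + mu * (2 * T)) <= 1 / mu"
    using mu by (simp add: frac_le_eq divide_le_0_iff)
  qed auto
  finally have "mu ^ (j + 1) * norm (iter_deriv vs (OI xi (B xi)) x) <= 2 * C"
   unfolding D using mu by (simp add: field_simps)
  moreover have "mu ^ n * norm (iter_deriv vs (OI xi (B xi)) x) <= mu ^ (j + 1) * norm (iter_deriv vs (OI xi (B xi)) x)"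
   using mu n by (intro mult_right_mono power_increasing) auto
  ultimately show ?thesis unfolding mu_def by linarith
 qed
 thus ?thesis by blast
qed

definition admissible :: "(R2 \<times> real => complex) => bool" where
 "admissible beta \<longleftrightarrow> smooth beta & (\<forall>z t. beta (z, t) ~= 0 --> z \<in> KY & (snd z + t, fst z * Q t) \<in> KX)"

lemma admissible_D:
 "admissible beta ==> beta (z, t) ~= 0 ==> z \<in> KY" "admissible beta ==> beta (z, t) ~= 0 ==> (snd z + t, fst z * Q t) \<in> KX"
 unfolding admissible_def by blast+

definition compose_amp :: "(R2 => complex) => (R2 \<times> real => complex) => (R2 \<times> real) \<times> real => complex" where
 "compose_amp theta beta p = theta (fst (fst p)) * of_real (Wn (snd (fst (fst p))) (snd p)) *
  beta ((snd (fst (fst p)) / Q (snd p), fst (fst (fst p)) - snd p), snd p + snd (fst p))"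

lemma smooth_amp_map: "smooth (%p :: (R2 \<times> real) \<times> real.
  ((snd (fst (fst p)) / Q (snd p), fst (fst (fst p)) - snd p), snd p + snd (fst p)))"
 by (intro smooth_intros smooth_on_divide) (metis less_irrefl Q_pos)

lemma smooth_compose_amp:
 assumes "smooth theta" "smooth beta"
 shows "smooth (compose_amp theta beta)"
 unfolding compose_amp_def[abs_def]
 by (intro smooth_intros smooth_comp[OF assms(1)] smooth_comp[OF assms(2) smooth_amp_map])

lemma compose_amp_good:
 assumes "theta \<in> smooth_supp KX" "admissible beta" "compose_amp theta beta p ~= 0"
 shows "good p"
proof -
 obtain x1 x2 s t where p: "p = (((x1, x2), s), t)" by (metis prod.exhaust)
 have "theta (x1, x2) ~= 0" "beta ((x2 / Q t, x1 - t), t + s) ~= 0" using assms(3) by (auto simp: compose_amp_def p)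
 hence "(x1, x2) \<in> KX" "(x2 / Q t, x1 - t) \<in> KY" "(x1 - t + (t + s), x2 / Q t * Q (t + s)) \<in> KX"
  using admissible_D[OF assms(2), of "(x2 / Q t, x1 - t)" "t + s"] assms(1) unfolding smooth_supp_def by auto
 thus ?thesis by (simp add: good_def p)
qed

text \<open>The inner variable is replaced by its difference \<open>s\<close> from the outer one and
  the order of integration is exchanged. Then \<open>fwave xi x\<close> splits off, because the
  remaining phase depends only on the displacement from \<open>x\<close>.\<close>

lemma Rst_osc:
 assumes beta: "admissible beta" and theta: "theta \<in> smooth_supp KX"
 shows "theta x * Rst (%z. integral {-T..T} (%t. beta (z, t) * fwave xi (snd z + t, fst z * Q t))) x = fwave xi x * OI xi (compose_amp theta beta) x"
proof -
 obtain x1 x2 where x: "x = (x1, x2)" by force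
 have sbeta: "smooth beta" using beta by (simp add: admissible_def)
 have T0: "T > 0" using params by (simp add: T_def)
 define k where "k t t' = of_real (Wn x2 t) * (beta ((x2 / Q t, x1 - t), t') * fwave xi (x1 - t + t', x2 / Q t * Q t'))" for t t'
 have sk: "smooth (%p. k (fst p) (snd p))" unfolding k_def
  by (intro smooth_intros smooth_comp[OF sbeta] smooth_comp[OF smooth_on_fwave] smooth_on_divide) (metis less_irrefl Q_pos)+
 have kc: "continuous_on UNIV (k t)" for t
  using smooth_on_slice(2)[OF sk, of UNIV t] by simp
 have k0: "k t t' = 0" if "t' \<notin> {-T..T}" for t t'
 proof (cases "beta ((x2 / Q t, x1 - t), t') = 0")
  case False
  hence "(x2 / Q t, x1 - t) \<in> KY" "(x1 - t + t', x2 / Q t * Q t') \<in> KX" using admissible_D[OF beta False] by auto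
  thus ?thesis using that by (auto simp: KX_def KY_def T_def)
 qed (simp add: k_def)
 have inner: "integral {-T..T} (k t) = integral {-2*T..2*T} (%s. k t (t + s))" if t: "t \<in> {-T..T}" for t
 proof -
  have "integral {-T..T} (k t) = (LINT t'|lborel. k t t')" by (rule lborel_integral_compact[OF kc k0, symmetric])
  also have "... = (LINT s|lborel. k t (t + s))"
   using lborel_integral_real_affine[of 1 "k t" t] by simp
  also have "... = integral {-2*T..2*T} (%s. k t (t + s))"
  proof (rule lborel_integral_compact)
   show "continuous_on UNIV (%s. k t (t + s))"
    by (rule continuous_on_compose2[OF kc]) (auto intro!: continuous_intros)
   show "k t (t + s) = 0" if "s \<notin> {-2*T..2*T}" for s using k0[of "t + s" t] that t by auto
  qed
  finally show ?thesis .
 qed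
 have "Rst (%z. integral {-T..T} (%t. beta (z, t) * fwave xi (snd z + t, fst z * Q t))) x = integral {-T..T} (%t. integral {-T..T} (k t))"
  unfolding Rst_def k_def[abs_def] by (simp add: x)
 also have "... = integral {-T..T} (%t. integral {-2*T..2*T} (%s. k t (t + s)))"
  by (intro integral_cong inner)
 also have "... = integral {-2*T..2*T} (%s. integral {-T..T} (%t. k t (t + s)))"
 proof -
  have "continuous_on (cbox (-T, -2*T) (T, 2*T)) (%p. k (fst p) (fst p + snd p))"
   by (rule continuous_on_compose2[OF smooth_continuous[OF sk], of _ "%p. (fst p, fst p + snd p)", simplified])
    (auto intro!: continuous_intros)
  thus ?thesis using integral_swap_continuous[of "-T" "-2*T" T "2*T" "%t s. k t (t + s)"] by (simp add: case_prod_unfold)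
 qed
 finally have R: "Rst (%z. integral {-T..T} (%t. beta (z, t) * fwave xi (snd z + t, fst z * Q t))) x =
  integral {-2*T..2*T} (%s. integral {-T..T} (%t. k t (t + s)))" .
 have "theta x * k t (t + s) = fwave xi x * (compose_amp theta beta ((x, s), t) * owave xi ((x, s), t))" for s t
 proof -
  obtain xi1 xi2 where xi: "xi = (xi1, xi2)" by force
  have "x2 / Q t * Q (t + s) = x2 + Mphase ((x, s), t)"
   using Q_pos[of t] by (simp add: Mphase_def x field_simps)
  hence "(x1 - t + (t + s), x2 / Q t * Q (t + s)) \<bullet> xi = x \<bullet> xi + (s * xi1 + xi2 * Mphase ((x, s), t))"
   unfolding xi by (simp add: x algebra_simps)
  hence "fwave xi (x1 - t + (t + s), x2 / Q t * Q (t + s)) = fwave xi x * owave xi ((x, s), t)"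
   unfolding fwave_def owave_def xi by (simp only: of_real_add distrib_left exp_add fst_conv snd_conv)
  thus ?thesis by (simp add: k_def compose_amp_def x mult_ac)
 qed
 hence "theta x * integral {-2*T..2*T} (%s. integral {-T..T} (%t. k t (t + s))) = fwave xi x * OI xi (compose_amp theta beta) x"
  unfolding OI_def by (simp flip: integral_mult_right)
 thus ?thesis unfolding R .
qed

end

section \<open>Fejer kernels and the total mass of a Fourier transform\<close>

lemma has_integral_even:
 fixes f :: "real => real"
 assumes "(f has_integral I) {0..A}" "A >= 0" "!!u. f (- u) = f u"
 shows "(f has_integral 2 * I) {-A..A}"
proof -
 have "(f has_integral I) {-A..0}"
  using has_integral_reflect_real[of f I A 0] assms by simp
 from has_integral_combine[OF _ _ this assms(1)] show ?thesis using assms(2) by simp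
qed

text \<open>The closed form of the Fejer kernel makes its sign visible.\<close>

lemma fejer_has_integral:
 fixes A v :: real
 assumes "A > 0" "v ~= 0"
 shows "((%u. (1 - abs u / A) * cos (u * v)) has_integral 2 * ((1 - cos (A * v)) / (A * v^2))) {-A..A}"
proof (rule has_integral_even)
 let ?H = "%u. (1 - u / A) * sin (u * v) / v - cos (u * v) / (A * v^2)"
 have "(?H has_real_derivative (1 - u / A) * cos (u * v)) (at u)" for u
  using assms by (auto intro!: derivative_eq_intros simp: field_simps power2_eq_square)
 hence "((%u. (1 - u / A) * cos (u * v)) has_integral ?H A - ?H 0) {0..A}"
  using assms by (intro fundamental_theorem_of_calculus)
   (auto simp flip: has_real_derivative_iff_has_vector_derivative intro: has_field_derivative_at_within)
 also have "?H A - ?H 0 = (1 - cos (A * v)) / (A * v^2)" using assms by (simp add: diff_divide_distrib)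
 finally show "((%u. (1 - abs u / A) * cos (u * v)) has_integral (1 - cos (A * v)) / (A * v^2)) {0..A}"
  by (rule has_integral_eq[rotated]) auto
qed (use assms in auto)

lemma tent_has_integral:
 fixes A :: real
 assumes "A > 0"
 shows "((%u. 1 - abs u / A) has_integral A) {-A..A}"
proof -
 have "((%u. u - u^2 / (2 * A)) has_real_derivative 1 - u / A) (at u)" for u
  using assms by (auto intro!: derivative_eq_intros)
 hence "((%u. 1 - u / A) has_integral (A - A^2 / (2 * A)) - (0 - 0^2 / (2 * A))) {0..A}"
  using assms by (intro fundamental_theorem_of_calculus)
   (auto simp flip: has_real_derivative_iff_has_vector_derivative intro: has_field_derivative_at_within)
 hence "((%u. 1 - u / A) has_integral A / 2) {0..A}" using assms by (simp add: power2_eq_square field_simps)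
 hence "((%u. 1 - abs u / A) has_integral A / 2) {0..A}" by (rule has_integral_eq[rotated]) auto
 from has_integral_even[OF this] show ?thesis using assms by simp
qed

lemma fejer_nonneg:
 fixes A v :: real
 assumes "A > 0"
 shows "integral {-A..A} (%u. (1 - abs u / A) * cos (u * v)) >= 0"
proof (cases "v = 0")
 case True
 thus ?thesis using integral_unique[OF tent_has_integral[OF assms]] assms by simp
next
 case False
 thus ?thesis using integral_unique[OF fejer_has_integral[OF assms False]] assms by simp
qed

lemma cos_ge_half: "abs (x::real) <= 1 ==> cos x >= 1 / 2"
proof -
 assume "abs x <= 1"
 hence "cos (pi / 3) <= cos (abs x)" using pi_gt3 by (intro cos_monotone_0_pi_le) auto
 thus ?thesis by (simp add: cos_60)
qed

text \<open>The tent function has integral \<open>A\<close>, and the cosine is at least 1/2 where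
  the modulus of its argument is at most 1.\<close>

lemma fejer_lower:
 fixes A v :: real
 assumes "A > 0" "abs v * A <= 1"
 shows "integral {-A..A} (%u. (1 - abs u / A) * cos (u * v)) >= A / 2"
proof -
 have 1: "((%u. (1 - abs u / A) * (1 / 2)) has_integral A * (1 / 2)) {-A..A}"
  by (rule has_integral_mult_left[OF tent_has_integral[OF assms(1)]])
 have 2: "(%u. (1 - abs u / A) * cos (u * v)) integrable_on {-A..A}"
  by (intro integrable_continuous_interval continuous_intros) (use assms in auto)
 have "A * (1 / 2) <= integral {-A..A} (%u. (1 - abs u / A) * cos (u * v))"
 proof (rule has_integral_le[OF 1 integrable_integral[OF 2]])
  fix u assume u: "u \<in> {-A..A}"
  have "abs (u * v) <= A * abs v" unfolding abs_mult using u by (intro mult_right_mono) auto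
  hence "1 / 2 <= cos (u * v)" using assms by (intro cos_ge_half) (simp add: mult.commute)
  moreover have "1 - abs u / A >= 0" using u assms by (auto simp: divide_le_eq)
  ultimately show "(1 - abs u / A) * (1 / 2) <= (1 - abs u / A) * cos (u * v)" by (rule mult_left_mono)
 qed
 thus ?thesis by simp
qed

text \<open>By dominated convergence the total mass of \<open>F\<close> is the limit of its Fejer
  means. Each mean is the integral of \<open>b\<close> against a nonnegative kernel evaluated at
  \<open>v t\<close>; near \<open>t0\<close>, where \<open>v\<close> is small, the kernel has height
  of order \<open>A\<close> on an interval of length of order \<open>1 / A\<close>. This leaves a
  positive lower bound independent of \<open>A\<close>.\<close>

lemma fourier_mass_positive:
 fixes b v :: "real => real"
 assumes b: "continuous_on {-T..T} b" "!!t. t \<in> {-T..T} ==> b t >= 0"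
  and v: "continuous_on {-T..T} v" "!!t. t \<in> {-T..T} ==> abs (v t) <= K * abs (t - t0)"
  and t0: "t0 \<in> {-T<..<T}" "b t0 > 0" and K: "K > 0"
  and F: "!!u. F u = integral {-T..T} (%t. b t * cos (u * v t))" "integrable lborel F" "continuous_on UNIV F"
 shows "(LINT u|lborel. F u) > 0"
proof -
 define W where "W n u = max 0 (1 - abs u / real (Suc n))" for n u
 have Wc: "continuous_on S (W n)" for n S unfolding W_def by (intro continuous_intros) auto
 have lim: "(%n. LINT u|lborel. W n u * F u) \<longlonglongrightarrow> (LINT u|lborel. F u)"
 proof (rule integral_dominated_convergence)
  show "F \<in> borel_measurable lborel" using F(2) by auto
  show "(%u. W n u * F u) \<in> borel_measurable lborel" for n
   using borel_measurable_continuous_onI[OF Wc[of UNIV n]] F(2) by measurable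
  show "integrable lborel (%u. norm (F u))" using F(2) by simp
  show "AE u in lborel. (%n. W n u * F u) \<longlonglongrightarrow> F u"
  proof (rule AE_I2)
   fix u
   have "(%n. abs u / real (Suc n)) \<longlonglongrightarrow> 0" using LIMSEQ_Suc[OF lim_const_over_n[of "abs u"]] by simp
   hence "(%n. max 0 (1 - abs u / real (Suc n)) * F u) \<longlonglongrightarrow> max 0 (1 - 0) * F u"
    by (intro tendsto_intros)
   thus "(%n. W n u * F u) \<longlonglongrightarrow> F u" by (simp add: W_def)
  qed
  show "AE u in lborel. norm (W n u * F u) <= norm (F u)" for n
  proof (rule AE_I2)
   fix u
   have "abs (W n u) <= 1" by (auto simp: W_def)
   thus "norm (W n u * F u) <= norm (F u)" using mult_right_mono[of "abs (W n u)" 1 "abs (F u)"] by (simp add: abs_mult)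
  qed
 qed
 define k where "k n w = integral {-real (Suc n)..real (Suc n)} (%u. (1 - abs u / real (Suc n)) * cos (u * w))" for n w
 have swap: "(LINT u|lborel. W n u * F u) = integral {-T..T} (%t. b t * k n (v t))"
  and kint: "(%t. b t * k n (v t)) integrable_on {-T..T}" for n
 proof -
  let ?A = "real (Suc n)"
  have "(LINT u|lborel. W n u * F u) = integral {-?A..?A} (%u. W n u * F u)"
  proof (rule lborel_integral_compact)
   show "continuous_on UNIV (%u. W n u * F u)" by (intro continuous_on_mult Wc F(3))
  qed (auto simp: W_def max_def divide_le_eq)
  also have "... = integral {-?A..?A} (%u. integral {-T..T} (%t. (1 - abs u / ?A) * (b t * cos (u * v t))))"
   by (rule integral_cong) (auto simp: W_def F(1) divide_le_eq max_def)
  also have "... = integral {-T..T} (%t. integral {-?A..?A} (%u. (1 - abs u / ?A) * (b t * cos (u * v t))))"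
  proof -
   have sub: "snd ` cbox (-?A, -T) (?A, T) \<subseteq> {-T..T}" by (auto simp: cbox_Pair_eq)
   have c: "continuous_on (cbox (-?A, -T) (?A, T)) (%p. b (snd p))" "continuous_on (cbox (-?A, -T) (?A, T)) (%p. v (snd p))"
    by (rule continuous_on_compose2[OF b(1) continuous_on_snd[OF continuous_on_id] sub])
     (rule continuous_on_compose2[OF v(1) continuous_on_snd[OF continuous_on_id] sub])
   have "continuous_on (cbox (-?A, -T) (?A, T)) (%(u, t). (1 - abs u / ?A) * (b t * cos (u * v t)))"
    unfolding case_prod_unfold by (intro continuous_intros c) auto
   from integral_swap_continuous[OF this] show ?thesis by simp
  qed
  also have "... = integral {-T..T} (%t. b t * k n (v t))"
   unfolding k_def by (simp add: mult_ac flip: integral_mult_right)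
  finally show "(LINT u|lborel. W n u * F u) = integral {-T..T} (%t. b t * k n (v t))" .
  have "continuous_on UNIV (%w. integral (cbox (-?A) ?A) (%u. (1 - abs u / ?A) * cos (u * w)))"
   by (rule integral_continuous_on_param) (auto intro!: continuous_intros simp: case_prod_unfold)
  hence "continuous_on UNIV (k n)" by (simp add: k_def[abs_def])
  hence "continuous_on {-T..T} (%t. b t * k n (v t))"
   by (intro continuous_intros b continuous_on_compose2[OF _ v(1)]) auto
  thus "(%t. b t * k n (v t)) integrable_on {-T..T}" by (rule integrable_continuous_interval)
 qed
 obtain d where d: "d > 0" "{t0 - d..t0 + d} \<subseteq> {-T..T}" "!!t. t \<in> {t0 - d..t0 + d} ==> b t >= b t0 / 2"
 proof -
  have "isCont b t0" using continuous_on_interior[OF b(1), of t0] t0(1) by (simp add: interior_atLeastAtMost_real)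
  hence "\<exists>d>0. \<forall>t. dist t t0 < d --> dist (b t) (b t0) < b t0 / 2"
   unfolding continuous_at_eps_delta using half_gt_zero[OF t0(2)] by (elim allE[of _ "b t0 / 2"] impE)
  then obtain d where d: "d > 0" "!!t. dist t t0 < d ==> dist (b t) (b t0) < b t0 / 2" by blast
  define d' where "d' = min (d / 2) (min (T - t0) (T + t0))"
  have "d' > 0" using d(1) t0(1) by (auto simp: d'_def)
  moreover have "{t0 - d'..t0 + d'} \<subseteq> {-T..T}" by (auto simp: d'_def)
  moreover have "b t >= b t0 / 2" if "t \<in> {t0 - d'..t0 + d'}" for t
  proof -
   have "dist t t0 < d" using that d(1) by (auto simp: d'_def dist_real_def)
   from d(2)[OF this] show ?thesis by (simp add: dist_real_def abs_if split: if_splits)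
  qed
  ultimately show ?thesis by (rule that)
 qed
 have "b t0 / (2 * K) <= (LINT u|lborel. W n u * F u)" if n: "real n >= 1 / (d * K)" for n
 proof -
  let ?A = "real (Suc n)"
  \<comment> \<open>On \<open>abs (t - t0) <= e\<close> the hypothesis on \<open>v\<close> gives
    \<open>abs (v t) * ?A <= 1\<close>, the range in which the kernel is large.\<close>
  define e where "e = 1 / (?A * K)"
  have e: "e > 0" using K by (simp add: e_def)
  have ed: "e <= d"
  proof -
   have "1 / (d * K) <= ?A" using n by simp
   hence "1 <= ?A * (d * K)" using d(1) K by (simp add: pos_divide_le_eq)
   thus ?thesis unfolding e_def using K by (simp add: pos_divide_le_eq mult_ac)
  qed
  have sub: "{t0 - e..t0 + e} \<subseteq> {-T..T}" using d(2) ed by auto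
  have k0: "k n w >= 0" for w unfolding k_def by (rule fejer_nonneg) simp
  have "b t0 / (2 * K) = integral {t0 - e..t0 + e} (%t. b t0 / 2 * (?A / 2))"
  proof -
   have eA: "e * ?A = 1 / K" using K unfolding e_def by (simp del: of_nat_Suc)
   have "b t0 / (2 * K) = b t0 / 2 * (1 / K)" by simp
   also have "... = 2 * e * (b t0 / 2 * (?A / 2))" unfolding eA[symmetric] by simp
   also have "... = integral {t0 - e..t0 + e} (%t. b t0 / 2 * (?A / 2))" using e by (simp del: of_nat_Suc)
   finally show ?thesis .
  qed
  also have "... <= integral {t0 - e..t0 + e} (%t. b t * k n (v t))"
  proof (rule integral_le)
   show "(%t. b t * k n (v t)) integrable_on {t0 - e..t0 + e}" by (rule integrable_subinterval_real[OF kint sub])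
   fix t assume t: "t \<in> {t0 - e..t0 + e}"
   have "abs (t - t0) <= e" using t by auto
   hence "abs (v t) <= K * e" using v(2)[of t] t sub K by (meson mult_left_mono less_imp_le order_trans subsetD)
   hence "abs (v t) * ?A <= (K * e) * ?A" by (intro mult_right_mono) auto
   hence "?A / 2 <= k n (v t)" unfolding k_def using K by (intro fejer_lower) (auto simp: e_def)
   moreover have "b t0 / 2 <= b t" using d(3)[of t] t ed by auto
   ultimately show "b t0 / 2 * (?A / 2) <= b t * k n (v t)" using t0(2) by (intro mult_mono) auto
  qed auto
  also have "... <= integral {-T..T} (%t. b t * k n (v t))"
  proof (rule integral_subset_le[OF sub _ kint])
   show "(%t. b t * k n (v t)) integrable_on {t0 - e..t0 + e}" by (rule integrable_subinterval_real[OF kint sub])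
  qed (use b(2) k0 in auto)
  finally show ?thesis by (simp add: swap)
 qed
 hence "\<forall>\<^sub>F n in sequentially. b t0 / (2 * K) <= (LINT u|lborel. W n u * F u)"
  by (rule eventually_mono[OF eventually_ge_at_top[of "nat \<lceil>1 / (d * K)\<rceil>"]]) linarith
 hence "b t0 / (2 * K) <= (LINT u|lborel. F u)"
  by (rule tendsto_lowerbound[OF lim]) simp
 moreover have "b t0 / (2 * K) > 0" using t0 K by simp
 ultimately show ?thesis by linarith
qed

section \<open>A lower bound for the leading coefficient\<close>

context cone_reg
begin

lemma unif_Ck_fix_s:
 assumes "!!k. unif_Ck k UNIV ((KX \<times> {-2*T..2*T}) \<times> {-T..T}) V B"
 shows "unif_Ck k UNIV (KX \<times> {-T..T}) (V \<times> ({-2*T..2*T} - {0})) (%i p. B (fst i) ((fst p, snd i), snd p))"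
proof (rule unif_Ck_comp)
 let ?I = "V \<times> ({-2*T..2*T} - {0})"
 show "unif_Ck k UNIV ((KX \<times> {-2*T..2*T}) \<times> {-T..T}) ?I (%i. B (fst i))"
  by (rule unif_Ck_reindex[OF assms]) auto
 have c: "compact (KX \<times> {-T..T})" by (intro compact_Times compact_KX compact_Icc)
 have "unif_Ck k UNIV (KX \<times> {-T..T}) ?I (%i p. fst p)" "unif_Ck k UNIV (KX \<times> {-T..T}) ?I (%i p. snd p)"
  by (intro smooth_unif_Ck[OF c] smooth_intros)+
 moreover have "unif_Ck k UNIV (KX \<times> {-T..T}) ?I (%i p. snd i)"
  by (rule unif_Ck_const) (auto intro!: exI[of _ "2 * T"])
 ultimately show "unif_Ck k UNIV (KX \<times> {-T..T}) ?I (%i p. ((fst p, snd i), snd p))"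
  by (intro unif_Ck_Pair open_UNIV subset_UNIV)
qed auto

text \<open>The substitution \<open>u = snd xi * s\<close> rescales the outer variable. The
  amplitude vanishes for \<open>s\<close> beyond \<open>2 * T\<close>, so the integral may be taken
  over the whole line.\<close>

lemma OI_substitution:
 assumes sB: "smooth B" and good: "!!p. B p ~= 0 ==> good p" and xi: "snd xi ~= 0"
 shows "abs (snd xi) * norm (OI xi B x) =
  norm (LINT u|lborel. integral {-T..T} (%t. B ((x, u / snd xi), t) * owave xi ((x, u / snd xi), t)))"
proof -
 define h where "h s = integral {-T..T} (%t. B ((x, s), t) * owave xi ((x, s), t))" for s
 have "OI xi B x = integral {-2*T..2*T} h" by (simp add: OI_def h_def[abs_def])
 also have "... = (LINT s|lborel. h s)"
 proof (rule lborel_integral_compact[symmetric])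
  show "continuous_on UNIV h" unfolding h_def by (rule smooth_on_slice(2)[OF smooth_OI_inner[OF sB]])
  fix s assume s: "s \<notin> {-2*T..2*T}"
  have "B ((x, s), t) = 0" for t
  proof (rule ccontr)
   assume "B ((x, s), t) ~= 0"
   from good_bounds(2,4)[OF good[OF this]] s show False by (auto simp: T_def)
  qed
  thus "h s = 0" by (simp add: h_def)
 qed
 also have "... = abs (1 / snd xi) *\<^sub>R (LINT u|lborel. h (0 + 1 / snd xi * u))"
  by (rule lborel_integral_real_affine) (use xi in simp)
 finally show ?thesis using xi by (simp add: h_def)
qed

text \<open>Otherwise there are points tending to \<open>x0\<close> and frequencies tending to
  infinity with slope tending to \<open>rho\<close> along which the rescaled integrals tend to 0. By
  dominated convergence they also tend to the integral of \<open>F0\<close>, whose real part is the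
  cosine transform of \<open>b\<close> along \<open>v t = snd x0 * G t + rho\<close>. That integral
  is positive because \<open>v\<close> vanishes at \<open>t0\<close>, where \<open>b\<close> is
  positive.\<close>

lemma OI_lower_bound:
 assumes sB: "smooth B" and good: "!!p. B p ~= 0 ==> good p"
  and b: "!!t. B ((x0, 0), t) = of_real (b t)" "!!t. b t >= 0" "b t0 > 0" and rho: "snd x0 * G t0 + rho = 0"
 shows "\<exists>delta>0. \<forall>x xi. norm (x - x0) < delta & snd xi ~= 0 & abs (fst xi / snd xi - rho) < delta & 1 / delta < abs (snd xi) -->
  delta <= abs (snd xi) * norm (OI xi B x)"
proof (rule ccontr)
 assume "\<not> ?thesis"
 hence ex: "\<exists>x xi. norm (x - x0) < delta & snd xi ~= 0 & abs (fst xi / snd xi - rho) < delta & 1 / delta < abs (snd xi) &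
  (abs (snd xi)) * norm (OI xi B x) < delta" if "delta > 0" for delta
  using that by (auto simp: not_le)
 have "\<exists>x xi. norm (x - x0) < 1 / real (Suc n) & snd xi ~= 0 & abs (fst xi / snd xi - rho) < 1 / real (Suc n) &
  real (Suc n) < abs (snd xi) & abs (snd xi) * norm (OI xi B x) < 1 / real (Suc n)" for n
  using ex[of "1 / real (Suc n)"] by simp
 then obtain X Xi where X: "!!n. norm (X n - x0) < 1 / real (Suc n)" and nz: "!!n. snd (Xi n) ~= 0"
  and R: "!!n. abs (fst (Xi n) / snd (Xi n) - rho) < 1 / real (Suc n)" and large: "!!n. real (Suc n) < abs (snd (Xi n))"
  and small: "!!n. abs (snd (Xi n)) * norm (OI (Xi n) B (X n)) < 1 / real (Suc n)"
  by metis
 define m where "m n = snd (Xi n)" for n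
 define sg where "sg n = fst (Xi n) / m n" for n
 have lim0: "(%n. 1 / real (Suc n)) \<longlonglongrightarrow> 0" using LIMSEQ_Suc[OF lim_const_over_n[of "1::real"]] by simp
 have Xl: "X \<longlonglongrightarrow> x0"
  by (rule LIM_zero_cancel, rule Lim_null_comparison[OF _ lim0]) (use X in \<open>auto simp: less_imp_le\<close>)
 have sigmal: "sg \<longlonglongrightarrow> rho"
  by (rule LIM_zero_cancel, rule Lim_null_comparison[OF _ lim0]) (use R in \<open>auto simp: sg_def m_def less_imp_le\<close>)
 have ml: "(%n. u / m n) \<longlonglongrightarrow> 0" for u
 proof -
  have "norm (1 / m n) <= 1 / real (Suc n)" for n
   using large[of n] by (auto simp: m_def intro!: frac_le)
  hence "(%n. 1 / m n) \<longlonglongrightarrow> 0" by (intro Lim_null_comparison[OF _ lim0]) auto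
  from tendsto_mult_right[OF this, of u] show ?thesis by simp
 qed
 have m0: "m n ~= 0" for n using nz by (simp add: m_def)
 define F where "F n u = integral {-T..T} (%t. B ((X n, u / m n), t) * owave (Xi n) ((X n, u / m n), t))" for n u
 define v where "v t = snd x0 * G t + rho" for t
 define F0 where "F0 u = integral {-T..T} (%t. of_real (b t) * exp (- \<i> * of_real (u * v t)))" for u
 have T0: "T > 0" using params by (simp add: T_def)
 have FI: "(%n. LINT u|lborel. F n u) \<longlonglongrightarrow> 0"
 proof (rule Lim_null_comparison[OF _ lim0])
  have "norm (LINT u|lborel. F n u) <= 1 / real (Suc n)" for n
   using OI_substitution[OF sB good nz, of n "X n"] small[of n] unfolding F_def m_def by simp
  thus "\<forall>\<^sub>F n in sequentially. norm (LINT u|lborel. F n u) <= 1 / real (Suc n)" by simp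
 qed
 define V where "V = {xi :: R2. snd xi ~= 0}"
 have "compact ((KX \<times> {-2*T..2*T}) \<times> {-T..T})" by (intro compact_Times compact_KX compact_Icc)
 from unif_Ck_fix_s[OF smooth_unif_Ck[OF this sB]]
 have Bk: "unif_Ck k UNIV (KX \<times> {-T..T}) (V \<times> ({-2*T..2*T} - {0})) (%i p. B ((fst p, snd i), snd p))" for k .
 obtain C where C0: "\<forall>xi\<in>V. \<forall>s\<in>{-2*T..2*T} - {0}. \<forall>x\<in>KX. (1 + abs (snd xi * s)) ^ 2 *
  norm (iter_deriv [] (%x. integral {-T..T} (%t. (%i p. B ((fst p, snd i), snd p)) (xi, s) (x, t) * exp (- \<i> * of_real (snd xi * Mphase ((x, s), t))))) x) <= C"
  using OI_inner_decay[OF Bk, of "[]" 2] good by auto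
 have C: "(1 + abs (snd xi * s)) ^ 2 *
  norm (integral {-T..T} (%t. B ((x, s), t) * exp (- \<i> * of_real (snd xi * Mphase ((x, s), t))))) <= C"
  if "snd xi ~= 0" "s \<in> {-2*T..2*T} - {0}" "x \<in> KX" for xi :: "R2" and s x
  using C0[THEN bspec, THEN bspec, THEN bspec, of xi s x] that by (simp add: V_def)
 \<comment> \<open>Decay of order 2 of the inner integral in \<open>u\<close>, the rescaled
   displacement, gives an integrable majorant independent of \<open>n\<close>.\<close>
 have Fb: "norm (F n u) <= abs C * (1 / (1 + abs u)^2)" if u: "u ~= 0" for n u
 proof (cases "u / m n \<in> {-2*T..2*T} & X n \<in> KX")
  case True
  have s: "u / m n ~= 0" using u m0 by simp
  have "(1 + abs (m n * (u / m n))) ^ 2 * norm (integral {-T..T} (%t. B ((X n, u / m n), t) * exp (- \<i> * of_real (m n * Mphase ((X n, u / m n), t))))) <= C"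
   unfolding m_def by (rule C) (use True s nz in \<open>auto simp: m_def\<close>)
  moreover have "F n u = (exp (- \<i> * of_real (u / m n * fst (Xi n))) * of_real ((u / m n) ^ 0)) *
    integral {-T..T} (%t. (%p. B ((fst p, u / m n), snd p)) (X n, t) * exp (- \<i> * of_real (snd (Xi n) * Mphase ((X n, u / m n), t))))"
   unfolding F_def by (rule OI_inner_split[OF s]) (use True in auto)
  ultimately have "(1 + abs u)^2 * norm (F n u) <= abs C" using m0[of n] by (simp add: norm_mult m_def)
  moreover have "(1 + abs u)^2 > 0" by (simp add: add_pos_nonneg)
  ultimately show ?thesis by (simp add: field_simps)
 next
  case False
  have "B ((X n, u / m n), t) = 0" for t
  proof (rule ccontr)
   assume "B ((X n, u / m n), t) ~= 0"
   from good_bounds(2,4,5)[OF good[OF this]] False show False by (auto simp: T_def)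
  qed
  thus ?thesis by (simp add: F_def)
 qed
 obtain C1 where C1: "!!p. norm (B p) <= C1"
 proof -
  have "compact ((KX \<times> {-2*T..2*T}) \<times> {-T..T})" by (intro compact_Times compact_KX compact_Icc)
  from smooth_unif_Ck[OF this sB, of 0 UNIV]
  obtain C1 where C1: "!!p. p \<in> (KX \<times> {-2*T..2*T}) \<times> {-T..T} ==> norm (B p) <= C1" by auto
  have "norm (B p) <= abs C1" for p
  proof (cases "B p = 0")
   case False
   obtain x s t where p: "p = ((x, s), t)" by (metis prod.exhaust)
   from good_bounds(2,4,5)[OF good[OF False, unfolded p]] have "p \<in> (KX \<times> {-2*T..2*T}) \<times> {-T..T}" by (auto simp: p T_def)
   from C1[OF this] show ?thesis by simp
  qed simp
  thus ?thesis by (rule that)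
 qed
 have point: "(%n. F n u) \<longlonglongrightarrow> F0 u" if u: "u ~= 0" for u
  unfolding F_def F0_def
 proof (rule dominated_convergence(2))
  show "(%t. B ((X n, u / m n), t) * owave (Xi n) ((X n, u / m n), t)) integrable_on {-T..T}" for n
   by (intro integrable_continuous_interval continuous_on_mult smooth_on_slice(2)[OF sB] smooth_on_slice(2)[OF smooth_owave])
  show "(%t. C1) integrable_on {-T..T}" by (rule integrable_const_ivl)
  show "norm (B ((X n, u / m n), t) * owave (Xi n) ((X n, u / m n), t)) <= C1" for n t
   using C1 by (simp add: norm_mult norm_owave)
  fix t
  have "isCont B ((x0, 0), t)" by (rule smooth_isCont[OF sB])
  hence 1: "(%n. B ((X n, u / m n), t)) \<longlonglongrightarrow> of_real (b t)"
   unfolding b(1)[symmetric] by (rule isCont_tendsto_compose) (intro tendsto_Pair Xl ml tendsto_const)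
  \<comment> \<open>The rescaled phase is \<open>u\<close> times a difference quotient of
    \<open>Q\<close>, hence linear in \<open>u\<close> in the limit.\<close>
  have "((%h. (Q (t + h) - Q t) / h) \<longlongrightarrow> deriv Q t) (at 0)" using Q_deriv[of t] by (simp add: DERIV_def)
  hence "(%n. (Q (t + u / m n) - Q t) / (u / m n)) \<longlonglongrightarrow> deriv Q t"
   by (rule filterlim_compose) (use ml[of u] u m0 in \<open>auto simp: filterlim_at\<close>)
  hence "(%n. snd (X n) * (u * ((Q (t + u / m n) - Q t) / (u / m n))) / Q t) \<longlonglongrightarrow> snd x0 * (u * deriv Q t) / Q t"
   using Q_pos[of t] by (intro tendsto_intros Xl) auto
  moreover have "snd (X n) * (u * ((Q (t + u / m n) - Q t) / (u / m n))) / Q t = m n * Mphase ((X n, u / m n), t)" for n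
   using u by (simp add: Mphase_def)
  ultimately have "(%n. m n * Mphase ((X n, u / m n), t)) \<longlonglongrightarrow> u * (snd x0 * G t)" by (simp add: G_def field_simps)
  moreover have "(%n. u * sg n) \<longlonglongrightarrow> u * rho" by (intro tendsto_intros sigmal)
  ultimately have "(%n. u * sg n + m n * Mphase ((X n, u / m n), t)) \<longlonglongrightarrow> u * rho + u * (snd x0 * G t)" by (rule tendsto_add[rotated])
  hence "(%n. exp (- \<i> * of_real (u * sg n + m n * Mphase ((X n, u / m n), t)))) \<longlonglongrightarrow> exp (- \<i> * of_real (u * rho + u * (snd x0 * G t)))"
   by (intro tendsto_exp tendsto_mult tendsto_const tendsto_of_real)
  moreover have "u * rho + u * (snd x0 * G t) = u * v t" by (simp add: v_def algebra_simps)
  moreover have "owave (Xi n) ((X n, u / m n), t) = exp (- \<i> * of_real (u * sg n + m n * Mphase ((X n, u / m n), t)))" for n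
   by (simp add: owave_def sg_def m_def)
  ultimately have "(%n. owave (Xi n) ((X n, u / m n), t)) \<longlonglongrightarrow> exp (- \<i> * of_real (u * v t))" by simp
  from tendsto_mult[OF 1 this]
  show "(%n. B ((X n, u / m n), t) * owave (Xi n) ((X n, u / m n), t)) \<longlonglongrightarrow> of_real (b t) * exp (- \<i> * of_real (u * v t))" .
 qed
 have AE0: "AE u in lborel. u ~= (0::real)" by (rule AE_lborel_singleton)
 have vc: "continuous_on A v" for A unfolding v_def
  by (intro continuous_intros smooth_continuous[OF G_smooth])
 have bc: "continuous_on A b" for A
 proof -
  have "continuous_on A (%t. Re (B ((x0, 0), t)))" by (intro continuous_intros smooth_on_slice(2)[OF sB])
  thus ?thesis by (simp add: b(1))
 qed
 have F0i: "(%t. of_real (b t) * exp (- \<i> * of_real (u * v t))) integrable_on {-T..T}" for u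
  by (intro integrable_continuous_interval continuous_intros bc vc)
 have F0c: "continuous_on UNIV F0"
 proof -
  have "continuous_on UNIV (%u. integral (cbox (-T) T) (%t. of_real (b t) * exp (- \<i> * of_real (u * v t))))"
  proof (rule integral_continuous_on_param)
   have c: "continuous_on (UNIV \<times> cbox (-T) T) (%p :: R2. b (snd p))" "continuous_on (UNIV \<times> cbox (-T) T) (%p :: R2. v (snd p))"
    by (rule continuous_on_compose2[OF bc continuous_on_snd[OF continuous_on_id] subset_UNIV])
     (rule continuous_on_compose2[OF vc continuous_on_snd[OF continuous_on_id] subset_UNIV])
   show "continuous_on (UNIV \<times> cbox (-T) T) (%(u, t). complex_of_real (b t) * exp (- \<i> * of_real (u * v t)))"
    unfolding case_prod_unfold by (intro continuous_intros c)
  qed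
  thus ?thesis unfolding F0_def[abs_def] by simp
 qed
 have Fm: "F n \<in> borel_measurable lborel" for n
 proof -
  have "continuous_on UNIV (%u. integral {-T..T} (%t. B ((X n, u / m n), t) * owave (Xi n) ((X n, u / m n), t)))"
   by (rule continuous_on_compose2[OF smooth_on_slice(2)[OF smooth_OI_inner[OF sB], of UNIV "X n" "Xi n"], of UNIV "%u. u / m n"])
    (intro continuous_on_divide continuous_on_id continuous_on_const ballI m0, rule subset_UNIV)
  thus ?thesis unfolding F_def[abs_def] by (simp add: borel_measurable_continuous_onI)
 qed
 have hi: "integrable lborel (%u. abs C * (1 / (1 + abs u)^2))" by (intro integrable_mult_right decay_integrable)
 note dct = integral_dominated_convergence[of F0 lborel F "%u. abs C * (1 / (1 + abs u)^2)"]
  and dci = integrable_dominated_convergence[of F0 lborel F "%u. abs C * (1 / (1 + abs u)^2)"]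
 have F0m: "F0 \<in> borel_measurable lborel" using borel_measurable_continuous_onI[OF F0c] by simp
 have A1: "AE u in lborel. (%n. F n u) \<longlonglongrightarrow> F0 u" using AE0 by (rule eventually_mono) (rule point)
 have A2: "AE u in lborel. norm (F n u) <= abs C * (1 / (1 + abs u)^2)" for n using AE0 by (rule eventually_mono) (rule Fb)
 have "(LINT u|lborel. F0 u) = 0" by (rule LIMSEQ_unique[OF dct[OF F0m Fm hi A1 A2] FI])
 have F0int: "integrable lborel F0" by (rule dci[OF F0m Fm hi A1 A2])
 have Re0: "Re (F0 u) = integral {-T..T} (%t. b t * cos (u * v t))" for u
  unfolding F0_def using integral_linear[OF F0i bounded_linear_Re, of u] by (simp add: o_def Re_exp)
 have t0: "t0 \<in> {-T<..<T}"
 proof -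
  have "good ((x0, 0), t0)" using good[of "((x0, 0), t0)"] b(1)[of t0] b(3) by simp
  from good_bounds(2)[OF this] show ?thesis by (auto simp: T_def)
 qed
 \<comment> \<open>\<open>v\<close> vanishes at \<open>t0\<close> and \<open>G\<close> is Lipschitz
   on the compact interval.\<close>
 obtain K where K: "K > 0" "!!t. t \<in> {-T..T} ==> abs (v t) <= K * abs (t - t0)"
 proof -
  have "compact (deriv G ` {-T..T})"
   by (intro compact_continuous_image compact_Icc smooth_continuous[OF smooth_on_deriv[OF open_UNIV G_smooth]])
  from compact_imp_bounded[OF this] obtain K0 where K0: "K0 > 0" "\<forall>y\<in>deriv G ` {-T..T}. norm y <= K0" unfolding bounded_pos by (elim exE conjE)
  have GL: "norm (G t - G t0) <= K0 * norm (t - t0)" if "t \<in> {-T..T}" for t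
  proof (rule field_differentiable_bound[of "{-T..T}" G "deriv G"])
   show "(G has_field_derivative deriv G z) (at z within {-T..T})" for z
    using DERIV_smooth[OF open_UNIV G_smooth, of z] by (auto intro: has_field_derivative_at_within)
  qed (use K0 that t0 in auto)
  show ?thesis
  proof (rule that[of "(abs (snd x0) + 1) * K0"])
   fix t assume t: "t \<in> {-T..T}"
   have "v t = snd x0 * (G t - G t0)" using rho by (simp add: v_def algebra_simps)
   hence "abs (v t) = abs (snd x0) * abs (G t - G t0)" by (simp add: abs_mult)
   also have "... <= (abs (snd x0) + 1) * (K0 * abs (t - t0))" using GL[OF t] by (intro mult_mono) auto
   finally show "abs (v t) <= (abs (snd x0) + 1) * K0 * abs (t - t0)" by (simp add: mult.assoc)
  qed (use K0 in auto)
 qed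
 have "(LINT u|lborel. Re (F0 u)) > 0"
  by (rule fourier_mass_positive[OF bc b(2) vc K(2) t0 b(3) K(1) Re0]) (use integrable_Re[OF F0int] continuous_on_Re[OF F0c] in auto)
 moreover have "(LINT u|lborel. Re (F0 u)) = Re (LINT u|lborel. F0 u)" using F0int by (rule integral_Re)
 ultimately show False using \<open>(LINT u|lborel. F0 u) = 0\<close> by simp
qed

end

section \<open>Parametrix\<close>

context cone_reg
begin

text \<open>Bounds are demanded on every compact set because the amplitudes are composed with smooth
  maps before they are estimated.\<close>

definition amp_family :: "R2 set => (R2 => R2 \<times> real => complex) => bool" where
 "amp_family V beta \<longleftrightarrow> (\<forall>S k. compact S --> unif_Ck k UNIV S V beta) & (\<forall>xi\<in>V. admissible (beta xi))"

definition radon_amp :: "(R2 => complex) => (R2 => complex) => R2 \<times> real => complex" where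
 "radon_amp kappa psi p = kappa (fst p) * (of_real (Dn (fst (fst p)) (snd p)) * psi (snd (fst p) + snd p, fst (fst p) * Q (snd p)))"

lemma amp_family_smooth: "amp_family V beta ==> xi \<in> V ==> smooth (beta xi)"
 by (simp add: amp_family_def admissible_def)

lemma amp_family_radon:
 assumes kappa: "kappa \<in> smooth_supp KY" and Psi: "!!k. unif_Ck k UNIV UNIV V Psi" "!!xi. xi \<in> V ==> Psi xi \<in> smooth_supp KX"
 shows "amp_family V (%xi. radon_amp kappa (Psi xi))"
proof -
 have skappa: "smooth kappa" using kappa by (rule smooth_suppD)
 have s: "smooth (%p :: R2 \<times> real. kappa (fst p))" "smooth (%p :: R2 \<times> real. complex_of_real (Dn (fst (fst p)) (snd p)))"
  "smooth (%p :: R2 \<times> real. (snd (fst p) + snd p, fst (fst p) * Q (snd p)))"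
  by (intro smooth_intros smooth_comp[OF skappa])+
 have u: "unif_Ck k UNIV S V (%xi. radon_amp kappa (Psi xi))" if "compact S" for S k
  unfolding radon_amp_def[abs_def]
  by (intro unif_Ck_mult open_UNIV subset_UNIV smooth_unif_Ck[OF that] s
    unif_Ck_comp[OF Psi(1) smooth_unif_Ck[OF that s(3)]]) auto
 have "admissible (radon_amp kappa (Psi xi))" if "xi \<in> V" for xi
 proof -
  have "smooth (radon_amp kappa (Psi xi))" by (rule unif_Ck_imp_smooth[OF u[OF compact_empty] that])
  thus ?thesis using kappa Psi(2)[OF that] by (auto simp: admissible_def radon_amp_def smooth_supp_def)
 qed
 thus ?thesis using u by (simp add: amp_family_def)
qed

lemma amp_family_mult:
 assumes "amp_family V beta" "smooth h"
 shows "amp_family V (%xi p. h p * beta xi p)"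
proof -
 have "unif_Ck k UNIV S V (%xi p. h p * beta xi p)" if "compact S" for S k
  using assms that unfolding amp_family_def
  by (intro unif_Ck_mult open_UNIV subset_UNIV smooth_unif_Ck[OF that assms(2)]) auto
 moreover have "admissible (%p. h p * beta xi p)" if "xi \<in> V" for xi
  using assms that by (auto simp: amp_family_def admissible_def intro!: smooth_on_mult)
 ultimately show ?thesis by (simp add: amp_family_def)
qed

text \<open>The support conditions describe a closed set, off which the derivatives vanish as
  well.\<close>

lemma amp_family_deriv:
 assumes "amp_family V beta" "v \<in> Basis"
 shows "amp_family V (%xi p. fderiv (beta xi) p v)"
proof -
 have "unif_Ck k UNIV S V (%xi p. fderiv (beta xi) p v)" if "compact S" for S k
 proof (rule unif_Ck_frechet[OF _ assms(2)])
  show "unif_Ck (Suc k) UNIV S V beta" using assms(1) that unfolding amp_family_def by blast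
 qed
 moreover have "admissible (%p. fderiv (beta xi) p v)" if "xi \<in> V" for xi
 proof -
  define D where "D = {p :: R2 \<times> real. fst p \<in> KY & (snd (fst p) + snd p, fst (fst p) * Q (snd p)) \<in> KX}"
  have "closed D"
  proof -
   have "continuous_on UNIV (%p :: R2 \<times> real. (snd (fst p) + snd p, fst (fst p) * Q (snd p)))"
    by (rule smooth_continuous) (intro smooth_intros)
   hence "closed ((%p :: R2 \<times> real. (snd (fst p) + snd p, fst (fst p) * Q (snd p))) -` KX)"
    using closed_vimage[OF compact_imp_closed[OF compact_KX]] by blast
   moreover have "closed (fst -` KY :: (R2 \<times> real) set)"
    by (rule closed_vimage[OF compact_imp_closed[OF compact_KY] continuous_on_fst[OF continuous_on_id]])
   ultimately have "closed (fst -` KY \<inter> (%p :: R2 \<times> real. (snd (fst p) + snd p, fst (fst p) * Q (snd p))) -` KX)"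
    by (intro closed_Int)
   moreover have "D = fst -` KY \<inter> (%p :: R2 \<times> real. (snd (fst p) + snd p, fst (fst p) * Q (snd p))) -` KX"
    by (auto simp: D_def)
   ultimately show ?thesis by simp
  qed
  moreover have "beta xi \<in> smooth_supp D"
  proof -
   have a: "admissible (beta xi)" using assms(1) that by (simp add: amp_family_def)
   have "beta xi p = 0" if "p \<notin> D" for p
    using admissible_D[OF a, of "fst p" "snd p"] that by (auto simp: D_def)
   thus ?thesis using a by (simp add: smooth_supp_def admissible_def)
  qed
  ultimately have z: "fderiv (beta xi) p v = 0" if "p \<notin> D" for p
   using smooth_supp_iter_deriv_0[of "beta xi" D p "[v]"] that by simp
  show ?thesis unfolding admissible_def
  proof (intro conjI allI impI)
   show "smooth (%p. fderiv (beta xi) p v)"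
    by (rule smooth_on_frechet[OF open_UNIV amp_family_smooth[OF assms(1) that] assms(2)])
   fix y t assume "fderiv (beta xi) (y, t) v ~= 0"
   hence "(y, t) \<in> D" using z by blast
   thus "y \<in> KY" "(snd y + t, fst y * Q t) \<in> KX" by (simp_all add: D_def)
  qed
 qed
 ultimately show ?thesis by (simp add: amp_family_def)
qed

lemma amp_family_compose:
 assumes theta: "theta \<in> smooth_supp KX" and beta: "amp_family V beta"
 shows "unif_Ck k UNIV ((KX \<times> {-2*T..2*T}) \<times> {-T..T}) V (%xi. compose_amp theta (beta xi))"
proof -
 let ?S = "(KX \<times> {-2*T..2*T}) \<times> {-T..T}"
 have c: "compact ?S" by (intro compact_Times compact_KX compact_Icc)
 have stheta: "smooth theta" using theta by (rule smooth_suppD)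
 have s: "smooth (%p :: (R2 \<times> real) \<times> real. theta (fst (fst p)) * of_real (Wn (snd (fst (fst p))) (snd p)))"
  by (intro smooth_intros smooth_comp[OF stheta])
 let ?m = "%p :: (R2 \<times> real) \<times> real. ((snd (fst (fst p)) / Q (snd p), fst (fst (fst p)) - snd p), snd p + snd (fst p))"
 have "compact (?m ` ?S)"
  by (intro compact_continuous_image c smooth_continuous[OF smooth_amp_map])
 hence "unif_Ck k UNIV (?m ` ?S) V beta" using beta by (simp add: amp_family_def)
 hence "unif_Ck k UNIV ?S V (%xi p. beta xi (?m p))"
  by (rule unif_Ck_comp[OF _ smooth_unif_Ck[OF c smooth_amp_map]]) auto
 thus ?thesis unfolding compose_amp_def[abs_def]
  by (intro unif_Ck_times smooth_unif_Ck[OF c s])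
qed

lemma amp_family_compose_good:
 assumes "theta \<in> smooth_supp KX" "amp_family V beta" "xi \<in> V"
 shows "smooth (compose_amp theta (beta xi))" "compose_amp theta (beta xi) p ~= 0 ==> good p"
 using assms smooth_compose_amp[of theta "beta xi"] compose_amp_good[of theta "beta xi" p]
 unfolding amp_family_def smooth_supp_def admissible_def by blast+

lemma power_drop_one:
 fixes m :: real and z :: complex
 shows "(1 + abs m) ^ n * norm z <= C ==> abs m ^ n * norm z <= C"
 by (rule order_trans[OF mult_right_mono[OF power_mono]]) auto

text \<open>The case \<open>j = 0\<close> of \<open>OI_bound\<close>: the integral gains one order
  in \<open>snd xi\<close>.\<close>

lemma OI_family_bound:
 assumes theta: "theta \<in> smooth_supp KX" and beta: "amp_family V beta" and n: "n <= 1" and vs: "dirs vs"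
 shows "\<exists>C. \<forall>xi\<in>V. \<forall>x. abs (snd xi) ^ n * norm (iter_deriv vs (OI xi (compose_amp theta (beta xi))) x) <= C"
proof -
 have "\<exists>C. \<forall>xi\<in>V. \<forall>x. (1 + abs (snd xi)) ^ n * norm (iter_deriv vs (OI xi (compose_amp theta (beta xi))) x) <= C"
  by (rule OI_bound[OF amp_family_compose_good[OF theta beta] unif_Ck_fix_s[OF amp_family_compose[OF theta beta]], where j = 0]) (use n vs in simp_all)
 thus ?thesis by (meson power_drop_one)
qed

definition shifted :: "(R2 \<times> real) \<times> real => R2" where
 "shifted p = (fst (fst (fst p)) + snd (fst p), snd (fst (fst p)) / Q (snd p) * Q (snd p + snd (fst p)))"

lemma smooth_shifted: "smooth shifted"
 unfolding shifted_def[abs_def] by (intro smooth_intros smooth_on_divide) (metis less_irrefl Q_pos)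

lemma shifted_0: "shifted ((x, 0), t) = x"
 using Q_pos[of t] by (simp add: shifted_def)

text \<open>At \<open>s = 0\<close> the shifted point is \<open>x\<close>, so the difference
  vanishes there and the case \<open>j = 1\<close> of \<open>OI_bound\<close> gains two orders. This
  is the commutator of the operator with multiplication by \<open>c xi\<close>.\<close>

lemma OI_family_difference:
 assumes theta: "theta \<in> smooth_supp KX" and beta: "admissible beta" and c: "!!k. unif_Ck k UNIV UNIV V c"
  and vs: "dirs vs"
 shows "\<exists>C. \<forall>xi\<in>V. \<forall>x. abs (snd xi)^2 * norm (iter_deriv vs
  (OI xi (%p. compose_amp theta beta p * (c xi (shifted p) - c xi (fst (fst p))))) x) <= C"
proof -
 have stheta: "smooth theta" and sbeta: "smooth beta" using theta beta by (simp_all add: smooth_supp_def admissible_def)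
 note sM = smooth_compose_amp[OF stheta sbeta]
 have sc: "smooth (c xi)" if "xi \<in> V" for xi by (rule unif_Ck_imp_smooth[OF c that])
 \<comment> \<open>The variables are reordered so that \<open>s\<close> comes last, as the division
   by \<open>s\<close> requires.\<close>
 define F where "F xi p = compose_amp theta beta ((fst (fst p), snd p), snd (fst p)) *
  (c xi (shifted ((fst (fst p), snd p), snd (fst p))) - c xi (fst (fst p)))" for xi and p :: "(R2 \<times> real) \<times> real"
 have cS: "compact ((KX \<times> {-T..T}) \<times> {-(2*T)..2*T})" by (intro compact_Times compact_KX compact_Icc)
 have sm: "smooth (%p :: (R2 \<times> real) \<times> real. ((fst (fst p), snd p), snd (fst p)))"
  "smooth (%p :: (R2 \<times> real) \<times> real. fst (fst p))" by (intro smooth_intros)+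
 note sm1 = smooth_unif_Ck[OF cS smooth_comp[OF smooth_shifted sm(1) open_UNIV]]
  and sm2 = smooth_unif_Ck[OF cS sm(2)]
  and sm3 = smooth_unif_Ck[OF cS smooth_comp[OF sM sm(1) open_UNIV]]
 have c1: "unif_Ck n UNIV ((KX \<times> {-T..T}) \<times> {-(2*T)..2*T}) V (%xi p. c xi (shifted ((fst (fst p), snd p), snd (fst p))))"
  "unif_Ck n UNIV ((KX \<times> {-T..T}) \<times> {-(2*T)..2*T}) V (%xi p. c xi (fst (fst p)))" for n
  by (rule unif_Ck_comp[OF c sm1]; simp)
   (rule unif_Ck_comp[OF c sm2]; simp)
 have uF: "unif_Ck n UNIV ((KX \<times> {-T..T}) \<times> {-(2*T)..2*T}) V F" for n
  unfolding F_def[abs_def] by (intro unif_Ck_times[OF sm3] unif_Ck_diff[OF open_UNIV subset_UNIV] c1)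
 have F0: "F xi (z, 0) = 0" for xi z by (simp add: F_def shifted_0)
 have "\<exists>C. \<forall>xi\<in>V. \<forall>x. (1 + abs (snd xi)) ^ 2 * norm (iter_deriv vs
  (OI xi (%p. compose_amp theta beta p * (c xi (shifted p) - c xi (fst (fst p))))) x) <= C"
 proof (rule OI_bound[OF _ _ _ _ _ vs])
  show "unif_Ck k UNIV (KX \<times> {-T..T}) (V \<times> ({-2*T..2*T} - {0})) (%(u, s) z. F u (z, s) /\<^sub>R s)" for k
   using unif_Ck_divide_param[OF uF F0] by simp
  show "smooth (%p. compose_amp theta beta p * (c xi (shifted p) - c xi (fst (fst p))))" if "xi \<in> V" for xi
   by (intro smooth_intros sM smooth_comp[OF sc[OF that]] smooth_shifted)
  show "good p" if "compose_amp theta beta p * (c xi (shifted p) - c xi (fst (fst p))) ~= 0" for xi p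
   by (rule compose_amp_good[OF theta beta]) (use that in auto)
  show "compose_amp theta beta ((x, s), t) * (c xi (shifted ((x, s), t)) - c xi (fst (fst ((x, s), t)))) =
   of_real (s ^ 1) * (case (xi, s) of (u, s) => %z. F u (z, s) /\<^sub>R s) (x, t)" if "s \<in> {-2*T..2*T} - {0}" for xi s x t
   using that by (simp add: F_def scaleR_conv_of_real)
 qed simp
 thus ?thesis by (meson power_drop_one)
qed

text \<open>If the second point keeps the distance \<open>delta\<close> from \<open>x\<close>, then
  \<open>s\<close> is bounded away from 0 on the support. The amplitude can therefore be divided by
  any power \<open>s ^ N\<close>, and each power gains an order.\<close>

lemma OI_family_decay:
 assumes theta: "theta \<in> smooth_supp KX" and beta: "amp_family V beta"
  and delta: "delta > 0" "!!xi x z t. xi \<in> V ==> theta x ~= 0 ==> beta xi (z, t) ~= 0 ==> delta <= dist (snd z + t, fst z * Q t) x"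
  and vs: "dirs vs"
 shows "\<exists>C. \<forall>xi\<in>V. \<forall>x. (1 + abs (snd xi)) ^ N * norm (iter_deriv vs (OI xi (compose_amp theta (beta xi))) x) <= C"
proof -
 let ?S = "(KX \<times> {-2*T..2*T}) \<times> {-T..T}"
 have T0: "T > 0" using params by (simp add: T_def)
 have "compact ?S" by (intro compact_Times compact_KX compact_Icc)
 hence "uniformly_continuous_on ?S shifted"
  by (intro compact_uniformly_continuous smooth_continuous[OF smooth_shifted])
 then obtain d where d: "d > 0" "!!p p'. p \<in> ?S ==> p' \<in> ?S ==> dist p' p < d ==> dist (shifted p') (shifted p) < delta"
  unfolding uniformly_continuous_on_def using delta(1) by metis
 have z: "compose_amp theta (beta xi) ((x, s), t) = 0" if xi: "xi \<in> V" and s: "abs s < d" for xi x s t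
 proof (rule ccontr)
  assume nz: "compose_amp theta (beta xi) ((x, s), t) ~= 0"
  note gb = good_bounds[OF amp_family_compose_good(2)[OF theta beta xi nz]]
  have S: "((x, s), t) \<in> ?S" "((x, 0), t) \<in> ?S" using gb(2,4,5) T0 by (auto simp: T_def)
  have "dist ((x, s), t) ((x, 0), t) < d" using s by (simp add: dist_prod_def)
  from d(2)[OF S(2,1) this] have "dist (shifted ((x, s), t)) x < delta" by (simp add: shifted_0)
  moreover have "theta x ~= 0" "beta xi ((snd x / Q t, fst x - t), t + s) ~= 0" using nz by (auto simp: compose_amp_def)
  from delta(2)[OF xi this] have "delta <= dist (shifted ((x, s), t)) x" by (simp add: shifted_def)
  ultimately show False by simp
 qed
 \<comment> \<open>Equal to \<open>1 / s ^ N\<close> where the amplitude may be nonzero, and 0 for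
   small \<open>s\<close> to keep the family bounded.\<close>
 define w where "w i = complex_of_real (if abs (snd i) < d then 0 else 1 / snd i ^ N)" for i :: "R2 \<times> real"
 have "norm (w i) <= 1 / d ^ N" for i
  using d(1) by (auto simp: w_def norm_divide norm_power power_abs intro!: divide_left_mono power_mono mult_pos_pos)
 hence wk: "unif_Ck k UNIV (KX \<times> {-T..T}) I (%i x. w i)" for k I by (intro unif_Ck_const) blast
 show ?thesis
  by (rule OI_bound[OF amp_family_compose_good[OF theta beta]
    unif_Ck_times[OF wk unif_Ck_fix_s[OF amp_family_compose[OF theta beta]]] _ _ vs, where j = N])
   (auto simp: w_def z)
qed

text \<open>The \<open>E\<close>-derivative transported to the amplitude: the exponential
  \<open>fwave xi (y + t, E * Q t)\<close> contributes the factor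
  \<open>- \<i> * snd xi * Q t\<close>.\<close>

definition DE :: "R2 => (R2 \<times> real => complex) => R2 \<times> real => complex" where
 "DE xi beta p = fderiv beta p ((1, 0), 0) - \<i> * of_real (snd xi * Q (snd p)) * beta p"

lemma E_Basis: "((1, 0), 0) \<in> (Basis :: (R2 \<times> real) set)"
 by (simp add: Basis_prod_def)

lemma smooth_DE: "smooth beta ==> smooth (DE xi beta)"
 unfolding DE_def[abs_def] by (intro smooth_intros smooth_on_frechet E_Basis)

lemma deriv_E_Q_mult:
 fixes beta :: "R2 \<times> real => complex"
 assumes "smooth beta"
 shows "fderiv (%p. of_real (Q (snd p)) * beta p) p ((1, 0), 0) = of_real (Q (snd p)) * fderiv beta p ((1, 0), 0)"
proof -
 have s: "smooth (%p :: R2 \<times> real. complex_of_real (Q (snd p)) * beta p)" by (intro smooth_intros assms)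
 obtain z t where p: "p = (z, t)" by (rule prod.exhaust)
 have "((%z. beta (z, t)) has_derivative (%v. fderiv beta (z, t) (v, 0))) (at z)"
  by (intro has_derivative_slice(1) smooth_has_derivative[OF assms] UNIV_I)
 hence 1: "((%z. complex_of_real (Q t) * beta (z, t)) has_derivative (%v. of_real (Q t) * fderiv beta (z, t) (v, 0))) (at z)"
  by (rule has_derivative_mult_right)
 have 2: "((%z. (%p. complex_of_real (Q (snd p)) * beta p) (z, t)) has_derivative
  (%v. fderiv (%p. complex_of_real (Q (snd p)) * beta p) (z, t) (v, 0))) (at z)"
  by (intro has_derivative_slice(1) smooth_has_derivative[OF s] UNIV_I)
 from has_derivative_unique[OF 1 2[simplified]] show ?thesis unfolding p by (metis snd_conv)
qed

lemma frechet_add_cmult: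
 fixes f h :: "'a::euclidean_space => complex"
 assumes "smooth f" "smooth h"
 shows "fderiv (%p. f p - c * h p) p v = fderiv f p v - c * fderiv h p v"
proof -
 have "((%p. f p - c * h p) has_derivative (%v. fderiv f p v - c * fderiv h p v)) (at p)"
  by (intro has_derivative_diff has_derivative_mult_right smooth_has_derivative assms UNIV_I)
 thus ?thesis by (simp flip: frechet_derivative_at)
qed

text \<open>Sorted by powers of \<open>snd xi\<close>. The quadratic term has a coefficient of
  constant sign, on which ellipticity rests.\<close>

lemma DE_DE:
 assumes "smooth beta"
 shows "DE xi (DE xi beta) p = - ((of_real (snd xi))^2) * (of_real ((Q (snd p))^2) * beta p)
  + of_real (snd xi) * (- (2 * \<i> * of_real (Q (snd p))) * fderiv beta p ((1, 0), 0))
  + fderiv (%p. fderiv beta p ((1, 0), 0)) p ((1, 0), 0)"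
proof -
 have eq: "DE xi beta = (%p. fderiv beta p ((1, 0), 0) - (\<i> * of_real (snd xi)) * (of_real (Q (snd p)) * beta p))"
  by (simp add: DE_def fun_eq_iff mult.assoc)
 have s: "smooth (%p :: R2 \<times> real. complex_of_real (Q (snd p)) * beta p)" by (intro smooth_intros assms)
 have "fderiv (DE xi beta) p ((1, 0), 0) =
  fderiv (%p. fderiv beta p ((1, 0), 0)) p ((1, 0), 0)
  - (\<i> * of_real (snd xi)) * (of_real (Q (snd p)) * fderiv beta p ((1, 0), 0))"
  unfolding eq frechet_add_cmult[OF smooth_on_frechet[OF open_UNIV assms E_Basis] s] deriv_E_Q_mult[OF assms] ..
 thus ?thesis unfolding DE_def[of xi "DE xi beta"] by (simp add: DE_def power2_eq_square algebra_simps)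
qed

text \<open>The common form of \<open>kappa * Rt (psi * fwave xi)\<close> and of its derivatives in
  \<open>E\<close>.\<close>

definition osc_radon :: "R2 => (R2 \<times> real => complex) => R2 => complex" where
 "osc_radon xi beta z = integral {-T..T} (%t. beta (z, t) * fwave xi (snd z + t, fst z * Q t))"

lemma osc_radon_eq: "kappa p * Rt (%x. psi x * fwave xi x) p = osc_radon xi (radon_amp kappa psi) p"
 unfolding osc_radon_def Rt_def radon_amp_def by (simp add: mult.assoc flip: integral_mult_right)

lemma smooth_osc_radon_integrand:
 assumes "smooth beta"
 shows "smooth (%p. beta p * fwave xi (snd (fst p) + snd p, fst (fst p) * Q (snd p)))"
 by (intro smooth_intros assms smooth_comp[OF smooth_on_fwave])

lemma smooth_osc_radon: "smooth beta ==> smooth (osc_radon xi beta)"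
 unfolding osc_radon_def using smooth_on_integral[OF smooth_osc_radon_integrand, of beta "-T" T xi] by simp

lemma deriv_osc_radon:
 assumes s: "smooth beta"
 shows "fderiv (osc_radon xi beta) z (1, 0) = osc_radon xi (DE xi beta) z"
proof -
 let ?F = "%p. beta p * fwave xi (snd (fst p) + snd p, fst (fst p) * Q (snd p))"
 have B: "set [(1, 0)] \<subseteq> (Basis :: R2 set)" by (simp add: Basis_prod_def)
 have "fderiv (osc_radon xi beta) z (1, 0) = integral {-T..T} (%t. fderiv (%z. ?F (z, t)) z (1, 0))"
  using iter_deriv_integral[OF smooth_osc_radon_integrand[OF s] B, of "-T" T xi z] by (simp add: osc_radon_def[abs_def])
 also have "... = osc_radon xi (DE xi beta) z"
  unfolding osc_radon_def
 proof (rule integral_cong)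
  fix t
  let ?m = "%z :: R2. (snd z + t, fst z * Q t)"
  have 1: "((%z. beta (z, t)) has_derivative (%v. fderiv beta (z, t) (v, 0))) (at z)"
   by (intro has_derivative_slice(1) smooth_has_derivative[OF s] UNIV_I)
  have m: "(?m has_derivative (%v. (snd v, fst v * Q t))) (at z)"
   by (auto intro!: derivative_eq_intros)
  have 2: "((%z. fwave xi (?m z)) has_derivative (%v. (- \<i> * of_real ((snd v, fst v * Q t) \<bullet> xi)) * fwave xi (?m z))) (at z)"
   by (rule has_derivative_compose[OF m fwave_has_derivative])
  from has_derivative_mult[OF 1 2]
  have "fderiv (%z. ?F (z, t)) z =
   (%v. beta (z, t) * ((- \<i> * of_real ((snd v, fst v * Q t) \<bullet> xi)) * fwave xi (?m z)) + fderiv beta (z, t) (v, 0) * fwave xi (?m z))"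
   unfolding fst_conv snd_conv by (rule frechet_derivative_at[symmetric])
  thus "fderiv (%z. ?F (z, t)) z (1, 0) = DE xi beta (z, t) * fwave xi (?m z)"
   by (cases xi) (simp add: DE_def algebra_simps)
 qed
 finally show ?thesis .
qed

lemma OI_linear:
 assumes "smooth B" "smooth B'"
 shows "OI xi (%p. a * B p + B' p) x = a * OI xi B x + OI xi B' x"
proof -
 define h where "h B s = integral {-T..T} (%t. B ((x, s), t) * owave xi ((x, s), t))" for B s
 have i: "(%t. B ((x, s), t) * owave xi ((x, s), t)) integrable_on {-T..T}" if "smooth B" for B :: "(R2 \<times> real) \<times> real => complex" and s
  by (intro integrable_continuous_interval continuous_on_mult smooth_on_slice(2)[OF that] smooth_on_slice(2)[OF smooth_owave])
 have ih: "h B integrable_on {-2*T..2*T}" if "smooth B" for B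
  unfolding h_def by (intro integrable_continuous_interval smooth_on_slice(2)[OF smooth_OI_inner[OF that]])
 have "h (%p. a * B p + B' p) s = a * h B s + h B' s" for s
 proof -
  have "h (%p. a * B p + B' p) s = integral {-T..T} (%t. a * (B ((x, s), t) * owave xi ((x, s), t)) + B' ((x, s), t) * owave xi ((x, s), t))"
   by (simp add: h_def algebra_simps)
  also have "... = integral {-T..T} (%t. a * (B ((x, s), t) * owave xi ((x, s), t))) + h B' s"
   unfolding h_def by (intro integral_add integrable_on_mult_right i assms)
  finally show ?thesis by (simp add: h_def)
 qed
 moreover have "OI xi (%p. a * B p + B' p) x = integral {-2*T..2*T} (h (%p. a * B p + B' p))"
  unfolding OI_def h_def[abs_def] ..
 ultimately have "OI xi (%p. a * B p + B' p) x = integral {-2*T..2*T} (%s. a * h B s + h B' s)"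
  by presburger
 also have "... = integral {-2*T..2*T} (%s. a * h B s) + integral {-2*T..2*T} (h B')"
  by (intro integral_add integrable_on_mult_right ih assms)
 finally show ?thesis by (simp add: OI_def h_def[abs_def])
qed

end

context cone_reg
begin

text \<open>\<open>fwave xi\<close> times \<open>Pop theta kappa xi psi\<close> is \<open>theta R\<^sup>* \<partial>\<^sub>E\<^sup>2 (kappa R (psi * fwave xi))\<close>.\<close>

definition Pop :: "(R2 => complex) => (R2 => complex) => R2 => (R2 => complex) => R2 => complex" where
 "Pop theta kappa xi psi = OI xi (compose_amp theta (DE xi (DE xi (radon_amp kappa psi))))"

lemma OI_mult_left: "OI xi (%p. B p * c (fst (fst p))) x = c x * OI xi B x"
 by (simp add: OI_def mult.commute[of _ "c x"] mult.assoc)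

definition dE :: "(R2 \<times> real => complex) => R2 \<times> real => complex" where
 "dE beta p = fderiv beta p ((1, 0), 0)"

text \<open>Each \<open>OI\<close> gains one order, so the three terms have order 1, 0 and -1 in
  \<open>snd xi\<close>.\<close>

lemma Pop_expand:
 assumes theta: "smooth theta" and s: "smooth beta"
 shows "OI xi (compose_amp theta (DE xi (DE xi beta))) x =
 - ((of_real (snd xi))^2) * OI xi (compose_amp theta (%p. of_real ((Q (snd p))^2) * beta p)) x +
  (of_real (snd xi) * OI xi (compose_amp theta (%p. - (2 * \<i> * of_real (Q (snd p))) * dE beta p)) x +
  OI xi (compose_amp theta (dE (dE beta))) x)"
proof -
 have s2: "smooth (dE beta)" unfolding dE_def[abs_def] by (rule smooth_on_frechet[OF open_UNIV s E_Basis])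
 hence s3: "smooth (dE (dE beta))" unfolding dE_def[of "dE beta", abs_def] by (rule smooth_on_frechet[OF open_UNIV _ E_Basis])
 have sq: "smooth (%p :: R2 \<times> real. complex_of_real ((Q (snd p))^2))"
  unfolding power2_eq_square by (intro smooth_intros)
 have s1: "smooth (%p. of_real ((Q (snd p))^2) * beta p)" by (intro smooth_on_mult open_UNIV sq s)
 have s2': "smooth (%p. - (2 * \<i> * of_real (Q (snd p))) * dE beta p)" by (intro smooth_on_mult smooth_on_minus smooth_intros s2)
 note c1 = smooth_compose_amp[OF theta s1] and c2 = smooth_compose_amp[OF theta s2'] and c3 = smooth_compose_amp[OF theta s3]
 have "compose_amp theta (DE xi (DE xi beta)) p =
 - ((of_real (snd xi))^2) * compose_amp theta (%p. of_real ((Q (snd p))^2) * beta p) p +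
   (of_real (snd xi) * compose_amp theta (%p. - (2 * \<i> * of_real (Q (snd p))) * dE beta p) p + compose_amp theta (dE (dE beta)) p)" for p
  unfolding compose_amp_def DE_DE[OF s] dE_def by (simp add: algebra_simps)
 hence "OI xi (compose_amp theta (DE xi (DE xi beta))) x = OI xi (%p. - ((of_real (snd xi))^2) * compose_amp theta (%p. of_real ((Q (snd p))^2) * beta p) p +
   (of_real (snd xi) * compose_amp theta (%p. - (2 * \<i> * of_real (Q (snd p))) * dE beta p) p + compose_amp theta (dE (dE beta)) p)) x"
  by presburger
 also have "... = - ((of_real (snd xi))^2) * OI xi (compose_amp theta (%p. of_real ((Q (snd p))^2) * beta p)) x +
   OI xi (%p. of_real (snd xi) * compose_amp theta (%p. - (2 * \<i> * of_real (Q (snd p))) * dE beta p) p + compose_amp theta (dE (dE beta)) p) x"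
  by (rule OI_linear[OF c1]) (intro smooth_on_add smooth_on_mult smooth_on_const open_UNIV c2 c3)
 also have "OI xi (%p. of_real (snd xi) * compose_amp theta (%p. - (2 * \<i> * of_real (Q (snd p))) * dE beta p) p + compose_amp theta (dE (dE beta)) p) x =
   of_real (snd xi) * OI xi (compose_amp theta (%p. - (2 * \<i> * of_real (Q (snd p))) * dE beta p)) x + OI xi (compose_amp theta (dE (dE beta))) x"
  by (rule OI_linear[OF c2 c3])
 finally show ?thesis .
qed

text \<open>With \<open>phi\<close> equal to 1 where \<open>c\<close> does not vanish, the amplitude
  belonging to \<open>c\<close> is a fixed amplitude, independent of the frequency, times
  \<open>c\<close> at the shifted point. Comparison with \<open>c x\<close> then separates the
  leading coefficient from a commutator.\<close>

lemma compose_radon_amp: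
 assumes "!!x. phi x * c x = c x"
 shows "compose_amp theta (%p. h p * radon_amp kappa c p) p = compose_amp theta (%p. h p * radon_amp kappa phi p) p * c (shifted p)"
proof -
 have "phi (shifted p) * c (shifted p) = c (shifted p)" by (rule assms)
 thus ?thesis unfolding compose_amp_def radon_amp_def shifted_def
  by (simp add: mult.assoc)
qed

lemma amp_family_dE: "amp_family V beta ==> amp_family V (%xi. dE (beta xi))"
 unfolding dE_def[abs_def] by (rule amp_family_deriv[OF _ E_Basis])

lemma amp_family_terms:
 assumes "amp_family V beta"
 shows "amp_family V (%xi p. of_real ((Q (snd p))^2) * beta xi p)"
  "amp_family V (%xi p. - (2 * \<i> * of_real (Q (snd p))) * dE (beta xi) p)" "amp_family V (%xi. dE (dE (beta xi)))"
proof -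
 show "amp_family V (%xi p. of_real ((Q (snd p))^2) * beta xi p)"
  unfolding power2_eq_square by (rule amp_family_mult[OF assms]) (intro smooth_intros)
 show "amp_family V (%xi p. - (2 * \<i> * of_real (Q (snd p))) * dE (beta xi) p)"
  by (rule amp_family_mult[OF amp_family_dE[OF assms]]) (intro smooth_on_minus smooth_intros)
 show "amp_family V (%xi. dE (dE (beta xi)))" by (intro amp_family_dE assms)
qed

lemma iter_deriv_combination:
 fixes f1 f2 f3 :: "R2 => complex"
 assumes "smooth f1" "smooth f2" "smooth f3" "dirs vs"
 shows "iter_deriv vs (%x. a * f1 x + (b * f2 x + f3 x)) x = a * iter_deriv vs f1 x + (b * iter_deriv vs f2 x + iter_deriv vs f3 x)"
proof -
 have m: "smooth (%x. a * f1 x)" "smooth (%x. b * f2 x)"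
  by (intro smooth_on_mult smooth_on_const open_UNIV assms)+
 show ?thesis
  unfolding iter_deriv_add[OF open_UNIV m(1) smooth_on_add[OF open_UNIV m(2) assms(3)] assms(4) UNIV_I]
   iter_deriv_add[OF open_UNIV m(2) assms(3,4) UNIV_I]
   iter_deriv_cmult[OF open_UNIV assms(1,4) UNIV_I] iter_deriv_cmult[OF open_UNIV assms(2,4) UNIV_I] ..
qed

text \<open>The operator is pseudolocal: with a positive distance between the supports of
  \<open>theta\<close> and of \<open>c xi\<close>, all three terms of the expansion decay rapidly.
  The exponent \<open>N + 2\<close> pays for the factor \<open>(snd xi)^2\<close>.\<close>

lemma Pop_decay:
 assumes theta: "theta \<in> smooth_supp KX" and kappa: "kappa \<in> smooth_supp KY"
  and c: "!!k. unif_Ck k UNIV UNIV V c" "!!xi. xi \<in> V ==> c xi \<in> smooth_supp KX"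
  and delta: "delta > 0" "!!xi x x'. xi \<in> V ==> theta x ~= 0 ==> x' \<in> S ==> delta <= dist x' x"
  and S: "closed S" "!!xi x. xi \<in> V ==> c xi x ~= 0 ==> x \<in> S"
  and vs: "dirs vs"
 shows "\<exists>C. \<forall>xi\<in>V. \<forall>x. (1 + abs (snd xi)) ^ N * norm (iter_deriv vs (Pop theta kappa xi (c xi)) x) <= C"
proof -
 define beta where "beta xi = radon_amp kappa (c xi)" for xi
 have a: "amp_family V beta" unfolding beta_def by (rule amp_family_radon[OF kappa c])
 note at = amp_family_terms[OF a]
 have stheta: "smooth theta" using theta(1) by (rule smooth_suppD)
 \<comment> \<open>A closed set of parameters outside which the amplitude and its
   \<open>E\<close>-derivatives vanish.\<close>
 define D where "D = {p :: R2 \<times> real. (snd (fst p) + snd p, fst (fst p) * Q (snd p)) \<in> S}"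
 have cD: "closed D"
 proof -
  have "continuous_on UNIV (%p :: R2 \<times> real. (snd (fst p) + snd p, fst (fst p) * Q (snd p)))"
   by (rule smooth_continuous) (intro smooth_intros)
  hence "closed ((%p :: R2 \<times> real. (snd (fst p) + snd p, fst (fst p) * Q (snd p))) -` S)"
   using closed_vimage[OF S(1)] by blast
  thus ?thesis by (simp add: D_def vimage_def)
 qed
 have z: "beta xi \<in> smooth_supp D" "dE (beta xi) \<in> smooth_supp D" "dE (dE (beta xi)) \<in> smooth_supp D" if "xi \<in> V" for xi
 proof -
  have d: "dE f \<in> smooth_supp D" if "f \<in> smooth_supp D" for f
  proof -
   have "dE f p = 0" if "p \<notin> D" for p
    using smooth_supp_iter_deriv_0[OF \<open>f \<in> smooth_supp D\<close> cD that, of "[((1, 0), 0)]"] by (simp add: dE_def)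
   moreover have "smooth (dE f)" unfolding dE_def[abs_def]
    using \<open>f \<in> smooth_supp D\<close> by (intro smooth_on_frechet open_UNIV E_Basis) (simp add: smooth_supp_def)
   ultimately show ?thesis by (simp add: smooth_supp_def)
  qed
  show "beta xi \<in> smooth_supp D"
   using amp_family_smooth[OF a that] S(2)[OF that] by (auto simp: smooth_supp_def beta_def radon_amp_def D_def)
  thus "dE (beta xi) \<in> smooth_supp D" by (rule d)
  thus "dE (dE (beta xi)) \<in> smooth_supp D" by (rule d)
 qed
 have far: "delta <= dist (snd z + t, fst z * Q t) x" if "xi \<in> V" "theta x ~= 0" "(z, t) \<in> D" for xi x z t
  by (rule delta(2)[OF that(1,2)]) (use that(3) in \<open>simp add: D_def\<close>)
 have key: "\<exists>C. \<forall>xi\<in>V. \<forall>x. (1 + abs (snd xi)) ^ (N + 2) * norm (iter_deriv vs (OI xi (compose_amp theta (gam xi))) x) <= C"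
  if "amp_family V gam" "!!xi p. xi \<in> V ==> p \<notin> D ==> gam xi p = 0" for gam
  by (rule OI_family_decay[OF theta that(1) delta(1) _ vs]) (use far that(2) in blast)
 have z0: "beta xi p = 0" "dE (beta xi) p = 0" "dE (dE (beta xi)) p = 0" if "xi \<in> V" "p \<notin> D" for xi p
  using z[OF that(1)] that(2) unfolding smooth_supp_def by blast+
 have "\<exists>C. \<forall>xi\<in>V. \<forall>x. (1 + abs (snd xi)) ^ (N + 2) * norm (iter_deriv vs (OI xi (compose_amp theta (%p. of_real ((Q (snd p))^2) * beta xi p))) x) <= C"
  by (rule key[OF at(1)]) (simp add: z0)
 then obtain C1 where C1: "\<forall>xi\<in>V. \<forall>x. (1 + abs (snd xi)) ^ (N + 2) * norm (iter_deriv vs (OI xi (compose_amp theta (%p. of_real ((Q (snd p))^2) * beta xi p))) x) <= C1"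
  by (elim exE)
 have "\<exists>C. \<forall>xi\<in>V. \<forall>x. (1 + abs (snd xi)) ^ (N + 2) * norm (iter_deriv vs (OI xi (compose_amp theta (%p. - (2 * \<i> * of_real (Q (snd p))) * dE (beta xi) p))) x) <= C"
  by (rule key[OF at(2)]) (simp add: z0)
 then obtain C2 where C2: "\<forall>xi\<in>V. \<forall>x. (1 + abs (snd xi)) ^ (N + 2) * norm (iter_deriv vs (OI xi (compose_amp theta (%p. - (2 * \<i> * of_real (Q (snd p))) * dE (beta xi) p))) x) <= C2"
  by (elim exE)
 have "\<exists>C. \<forall>xi\<in>V. \<forall>x. (1 + abs (snd xi)) ^ (N + 2) * norm (iter_deriv vs (OI xi (compose_amp theta (dE (dE (beta xi))))) x) <= C"
  by (rule key[OF at(3)]) (simp add: z0)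
 then obtain C3 where C3: "\<forall>xi\<in>V. \<forall>x. (1 + abs (snd xi)) ^ (N + 2) * norm (iter_deriv vs (OI xi (compose_amp theta (dE (dE (beta xi))))) x) <= C3"
  by (elim exE)
 have "(1 + abs (snd xi)) ^ N * norm (iter_deriv vs (Pop theta kappa xi (c xi)) x) <= C1 + C2 + C3" if xi: "xi \<in> V" for xi x
 proof -
  let ?f1 = "OI xi (compose_amp theta (%p. of_real ((Q (snd p))^2) * beta xi p))"
  let ?f2 = "OI xi (compose_amp theta (%p. - (2 * \<i> * of_real (Q (snd p))) * dE (beta xi) p))"
  let ?f3 = "OI xi (compose_amp theta (dE (dE (beta xi))))"
  have s: "smooth ?f1" "smooth ?f2" "smooth ?f3"
   by (intro smooth_OI smooth_compose_amp stheta amp_family_smooth[OF at(1) xi] amp_family_smooth[OF at(2) xi] amp_family_smooth[OF at(3) xi])+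
  have P: "Pop theta kappa xi (c xi) = (%x. - ((of_real (snd xi))^2) * ?f1 x + (of_real (snd xi) * ?f2 x + ?f3 x))"
   unfolding Pop_def beta_def[symmetric] by (rule ext) (rule Pop_expand[OF stheta amp_family_smooth[OF a xi]])
  let ?m = "abs (snd xi)" and ?D = "%f. norm (iter_deriv vs f x)"
  have D: "?D (Pop theta kappa xi (c xi)) <= ?m^2 * ?D ?f1 + (?m * ?D ?f2 + ?D ?f3)"
   unfolding P iter_deriv_combination[OF s vs]
   by (rule order_trans[OF norm_triangle_ineq add_mono[OF _ order_trans[OF norm_triangle_ineq]]])
    (simp_all add: norm_mult norm_power)
  have m: "?m^2 <= (1 + ?m)^2" "?m <= (1 + ?m)^2" "1 <= (1 + ?m)^2"
   by (auto simp: power2_eq_square algebra_simps)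
  have "?D (Pop theta kappa xi (c xi)) <= (1 + ?m)^2 * (?D ?f1 + ?D ?f2 + ?D ?f3)"
   using D mult_right_mono[OF m(1), of "?D ?f1"] mult_right_mono[OF m(2), of "?D ?f2"] mult_right_mono[OF m(3), of "?D ?f3"]
   by (simp add: distrib_left)
  hence "(1 + ?m) ^ N * ?D (Pop theta kappa xi (c xi)) <= (1 + ?m) ^ N * ((1 + ?m)^2 * (?D ?f1 + ?D ?f2 + ?D ?f3))"
   by (intro mult_left_mono) auto
  also have "... = (1 + ?m) ^ (N + 2) * ?D ?f1 + (1 + ?m) ^ (N + 2) * ?D ?f2 + (1 + ?m) ^ (N + 2) * ?D ?f3"
   by (simp only: power_add distrib_left mult.assoc)
  also have "... <= C1 + C2 + C3" using C1[THEN bspec[OF _ xi], THEN spec[of _ x]] C2[THEN bspec[OF _ xi], THEN spec[of _ x]]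
   C3[THEN bspec[OF _ xi], THEN spec[of _ x]] by linarith
  finally show ?thesis .
 qed
 thus ?thesis by blast
qed

text \<open>Applied to \<open>psi * j\<close>, the operator reproduces \<open>snd xi * psi\<close>
  up to an error of order 0. The factor \<open>j\<close> may depend on the frequency in any way that
  keeps its derivatives in \<open>x\<close> bounded.\<close>

definition has_parametrix where
 "has_parametrix theta kappa V psi \<longleftrightarrow> (\<exists>j. (\<forall>n. unif_Ck n UNIV UNIV V j) &
  (\<forall>n. unif_Ck n UNIV UNIV V (%xi x. Pop theta kappa xi (%x. psi x * j xi x) x - of_real (snd xi) * psi x)))"

text \<open>The leading coefficient divided by \<open>snd xi\<close> is bounded with all
  derivatives, and bounded below near \<open>x0\<close> for large frequencies in the cone;
  \<open>j\<close> is its reciprocal. What remains is a commutator, which gains two orders against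
  the factor \<open>(snd xi)^2\<close>, and the lower order terms of the expansion.\<close>

lemma parametrix:
 assumes theta: "theta \<in> smooth_supp KX" "!!x. theta x = of_real (th x)" "!!x. th x >= 0"
  and kappa: "kappa \<in> smooth_supp KY" "!!z. kappa z = of_real (k z)" "!!z. k z >= 0"
  and phi: "phi \<in> smooth_supp KX" "!!x. phi x = of_real (ph x)" "!!x. ph x >= 0"
  and pos: "th x0 > 0" "ph x0 > 0" "k (snd x0 / Q t0, fst x0 - t0) > 0" and rho: "snd x0 * G t0 + rho = 0"
 obtains eps where "eps > 0" "!!psi V. psi \<in> smooth_supp KX ==> (!!x. psi x ~= 0 ==> norm (x - x0) < eps & phi x = 1) ==>
   (!!xi. xi \<in> V ==> snd xi ~= 0 & abs (fst xi / snd xi - rho) < eps & 1 / eps < abs (snd xi)) ==>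
   has_parametrix theta kappa V psi"
proof -
 define beta0 where "beta0 p = of_real ((Q (snd p))^2) * radon_amp kappa phi p" for p
 define M0 where "M0 = compose_amp theta beta0"
 have stheta: "smooth theta" using theta(1) by (rule smooth_suppD)
 have "amp_family UNIV (%xi. radon_amp kappa phi)"
 proof (rule amp_family_radon[OF kappa(1)])
  show "unif_Ck n UNIV UNIV UNIV (%xi. phi)" for n
   by (rule smooth_supp_unif_Ck[OF phi(1) compact_KX])
 qed (rule phi(1))
 from amp_family_terms(1)[OF this] have a0: "amp_family UNIV (%xi. beta0)" by (simp add: beta0_def[abs_def])
 have adm0: "admissible beta0" using a0 by (simp add: amp_family_def)
 have sM: "smooth M0" and gM: "M0 p ~= 0 ==> good p" for p
  unfolding M0_def using amp_family_compose_good[OF theta(1) a0, of 0] by auto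
 \<comment> \<open>The amplitude on the diagonal \<open>s = 0\<close> over \<open>x0\<close>:
   nonnegative, and positive at the stationary parameter \<open>t0\<close>.\<close>
 define b where "b t = th x0 * Wn (snd x0) t * ((Q t)^2 * (k (snd x0 / Q t, fst x0 - t) * (Dn (snd x0 / Q t) t * ph x0)))" for t
 have W: "Wn y t > 0" for y t using Dn_pos Q_pos by (simp add: Wn_def)
 have b1: "M0 ((x0, 0), t) = of_real (b t)" for t
  using Q_pos[of t] by (simp add: M0_def compose_amp_def beta0_def radon_amp_def b_def theta(2) kappa(2) phi(2))
 have b2: "b t >= 0" for t
  using W[of "snd x0" t] Dn_pos[of "snd x0 / Q t" t] pos kappa(3) unfolding b_def by (intro mult_nonneg_nonneg) (auto simp: less_imp_le)
 have b3: "b t0 > 0"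
  using W[of "snd x0" t0] Dn_pos[of "snd x0 / Q t0" t0] Q_pos[of t0] pos unfolding b_def by (intro mult_pos_pos) auto
 from OI_lower_bound[OF sM gM b1 b2 b3 rho] obtain eps where eps: "eps > 0"
  "!!x xi. norm (x - x0) < eps & snd xi ~= 0 & abs (fst xi / snd xi - rho) < eps & 1 / eps < abs (snd xi) ==> eps <= abs (snd xi) * norm (OI xi M0 x)"
  by blast
 show ?thesis
 proof (rule that[OF eps(1)])
  fix psi V
  assume psi: "psi \<in> smooth_supp KX" "!!x. psi x ~= 0 ==> norm (x - x0) < eps & phi x = 1"
   and V: "!!xi. xi \<in> V ==> snd xi ~= 0 & abs (fst xi / snd xi - rho) < eps & 1 / eps < abs (snd xi)"
  have spsi: "smooth psi" using psi(1) by (rule smooth_suppD)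
  \<comment> \<open>The sign and one factor \<open>snd xi\<close> come from the leading term
    \<open>- (snd xi)^2\<close>; the other factor remains as the order of the operator.\<close>
  define u where "u xi x = - of_real (snd xi) * OI xi M0 x" for xi x
  have a0': "amp_family V (%xi. beta0)" using a0 unfolding amp_family_def by (auto intro: unif_Ck_mono[OF _ _ order_refl])
  have uk: "unif_Ck n UNIV UNIV V u" for n
  proof (rule unif_Ck_smooth)
   show "smooth (u xi)" for xi unfolding u_def[abs_def] by (intro smooth_on_mult smooth_on_const open_UNIV smooth_OI sM)
   fix vs :: "R2 list" assume vs: "dirs vs"
   have "norm (iter_deriv vs (u xi) x) = abs (snd xi) * norm (iter_deriv vs (OI xi M0) x)" for xi x
    unfolding u_def[abs_def] iter_deriv_cmult[OF open_UNIV smooth_OI[OF sM] vs UNIV_I] by (simp add: norm_mult)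
   thus "\<exists>C. \<forall>xi\<in>V. \<forall>x\<in>UNIV. norm (iter_deriv vs (u xi) x) <= C"
    using OI_family_bound[OF theta(1) a0' order_refl vs] by (simp add: M0_def)
  qed
  \<comment> \<open>A globally smooth version of \<open>1 / (norm (u xi x))^2\<close>, correct where
    \<open>norm (u xi x) >= eps\<close> and thus where \<open>psi\<close> does not vanish.\<close>
  define r where "r xi x = recip (eps^2) ((Re (u xi x))^2 + (Im (u xi x))^2)" for xi x
  define j where "j xi x = cnj (u xi x) * of_real (r xi x)" for xi x
  have jk: "unif_Ck n UNIV UNIV V j" for n
  proof -
   have "unif_Ck n UNIV UNIV V (%xi x. (Re (u xi x))^2 + (Im (u xi x))^2)" for n
    unfolding power2_eq_square
    by (intro unif_Ck_add unif_Ck_mult open_UNIV subset_UNIV unif_Ck_blinear[OF bounded_linear_Re] unif_Ck_blinear[OF bounded_linear_Im] uk)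
   hence "unif_Ck n UNIV UNIV V r"
    unfolding r_def[abs_def] by (rule unif_Ck_recip) (use eps in simp)
   thus ?thesis unfolding j_def[abs_def]
    by (intro unif_Ck_times unif_Ck_blinear[OF bounded_linear_cnj] unif_Ck_blinear[OF bounded_linear_of_real] uk open_UNIV subset_UNIV)
  qed
  have uj: "u xi x * j xi x * psi x = psi x" if "xi \<in> V" for xi x
  proof (cases "psi x = 0")
   case False
   have "eps <= norm (u xi x)" using eps(2)[of x xi] psi(2)[OF False] V[OF that] by (simp add: u_def norm_mult)
   hence "eps^2 <= (norm (u xi x))^2" using eps(1) by (intro power_mono) auto
   hence "eps^2 <= (Re (u xi x))^2 + (Im (u xi x))^2" by (simp add: cmod_power2)
   hence "r xi x * ((Re (u xi x))^2 + (Im (u xi x))^2) = 1" unfolding r_def using eps(1) by (intro recip_mult) auto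
   hence "of_real (r xi x) * (u xi x * cnj (u xi x)) = 1"
    unfolding complex_mult_cnj by (metis of_real_1 of_real_mult)
   hence "u xi x * j xi x = 1" by (simp add: j_def mult_ac)
   thus ?thesis by simp
  qed simp
  define c where "c xi x = psi x * j xi x" for xi x
  have sj: "smooth (j xi)" if "xi \<in> V" for xi by (rule unif_Ck_imp_smooth[OF jk that])
  have cK: "c xi \<in> smooth_supp KX" if "xi \<in> V" for xi
   unfolding c_def by (rule smooth_supp_mult[OF psi(1) sj[OF that]])
  have psik: "unif_Ck n UNIV UNIV V (%xi. psi)" for n
   by (rule smooth_supp_unif_Ck[OF psi(1) compact_KX])
  have ck: "unif_Ck n UNIV UNIV V c" for n
   unfolding c_def[abs_def] by (intro unif_Ck_times psik jk)
  define beta where "beta xi = radon_amp kappa (c xi)" for xi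
  have a: "amp_family V beta" unfolding beta_def by (rule amp_family_radon[OF kappa(1) ck cK])
  note at = amp_family_terms[OF a]
  define f1 where "f1 xi = OI xi (%p. M0 p * (c xi (shifted p) - c xi (fst (fst p))))" for xi
  define f2 where "f2 xi = OI xi (compose_amp theta (%p. - (2 * \<i> * of_real (Q (snd p))) * dE (beta xi) p))" for xi
  define f3 where "f3 xi = OI xi (compose_amp theta (dE (dE (beta xi))))" for xi
  have sdiff: "smooth (%p. M0 p * (c xi (shifted p) - c xi (fst (fst p))))" if "xi \<in> V" for xi
  proof -
   have sc: "smooth (c xi)" using cK[OF that] by (rule smooth_suppD)
   show ?thesis
    by (intro smooth_on_mult[OF open_UNIV sM] smooth_on_diff[OF open_UNIV] smooth_comp[OF sc smooth_shifted open_UNIV]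
      smooth_comp[OF sc smooth_on_fst[OF open_UNIV smooth_on_fst[OF open_UNIV smooth_on_id[OF open_UNIV]]] open_UNIV])
  qed
  have s: "smooth (f1 xi)" "smooth (f2 xi)" "smooth (f3 xi)" if "xi \<in> V" for xi
   unfolding f1_def f2_def f3_def
   by (intro smooth_OI sdiff that smooth_compose_amp stheta amp_family_smooth[OF at(2) that] amp_family_smooth[OF at(3) that])+
  \<comment> \<open>The term of order 1 cancels against \<open>snd xi * psi\<close> because
    \<open>u * j = 1\<close> where \<open>psi\<close> does not vanish.\<close>
  have d: "Pop theta kappa xi (c xi) x - of_real (snd xi) * psi x = - ((of_real (snd xi))^2) * f1 xi x + (of_real (snd xi) * f2 xi x + f3 xi x)"
   if xi: "xi \<in> V" for xi x
  proof -
   have P: "Pop theta kappa xi (c xi) x = - ((of_real (snd xi))^2) * OI xi (compose_amp theta (%p. of_real ((Q (snd p))^2) * beta xi p)) x + (of_real (snd xi) * f2 xi x + f3 xi x)"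
    unfolding Pop_def f2_def f3_def beta_def[symmetric] by (rule Pop_expand[OF stheta amp_family_smooth[OF a xi]])
   have "phi x * c xi x = c xi x" for x using psi(2)[of x] by (cases "psi x = 0") (auto simp: c_def)
   hence "compose_amp theta (%p. of_real ((Q (snd p))^2) * beta xi p) p = 1 * (M0 p * c xi (fst (fst p))) + M0 p * (c xi (shifted p) - c xi (fst (fst p)))" for p
    unfolding beta_def M0_def beta0_def[abs_def] by (subst compose_radon_amp[of phi]) (auto simp: algebra_simps)
   hence "OI xi (compose_amp theta (%p. of_real ((Q (snd p))^2) * beta xi p)) x = OI xi (%p. 1 * (M0 p * c xi (fst (fst p))) + M0 p * (c xi (shifted p) - c xi (fst (fst p)))) x"
    by presburger
   also have "... = 1 * OI xi (%p. M0 p * c xi (fst (fst p))) x + f1 xi x"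
    unfolding f1_def
   proof (rule OI_linear[OF _ sdiff[OF xi]])
    have sc: "smooth (c xi)" using cK[OF xi] by (rule smooth_suppD)
    show "smooth (%p. M0 p * c xi (fst (fst p)))"
     by (intro smooth_on_mult[OF open_UNIV sM]
       smooth_comp[OF sc smooth_on_fst[OF open_UNIV smooth_on_fst[OF open_UNIV smooth_on_id[OF open_UNIV]]] open_UNIV])
   qed
   also have "OI xi (%p. M0 p * c xi (fst (fst p))) x = c xi x * OI xi M0 x" by (rule OI_mult_left)
   finally have "- ((of_real (snd xi))^2) * OI xi (compose_amp theta (%p. of_real ((Q (snd p))^2) * beta xi p)) x =
     of_real (snd xi) * (u xi x * j xi x * psi x) - (of_real (snd xi))^2 * f1 xi x"
    by (simp add: u_def c_def power2_eq_square algebra_simps)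
   thus ?thesis unfolding P uj[OF xi] by simp
  qed
  have "unif_Ck n UNIV UNIV V (%xi x. Pop theta kappa xi (c xi) x - of_real (snd xi) * psi x)" for n
  proof (rule unif_Ck_smooth)
   show "smooth (%x. Pop theta kappa xi (c xi) x - of_real (snd xi) * psi x)" if "xi \<in> V" for xi
    unfolding d[OF that] by (intro smooth_on_add smooth_on_mult smooth_on_const open_UNIV s that)
   fix vs :: "R2 list" assume vs: "dirs vs"
   obtain C1 where C1: "\<forall>xi\<in>V. \<forall>x. abs (snd xi)^2 * norm (iter_deriv vs (f1 xi) x) <= C1"
    using OI_family_difference[OF theta(1) adm0 ck vs] unfolding f1_def M0_def by blast
   obtain C2 where C2: "\<forall>xi\<in>V. \<forall>x. abs (snd xi) * norm (iter_deriv vs (f2 xi) x) <= C2"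
    using OI_family_bound[OF theta(1) at(2) order_refl vs] unfolding f2_def by auto
   obtain C3 where C3: "\<forall>xi\<in>V. \<forall>x. norm (iter_deriv vs (f3 xi) x) <= C3"
    using OI_family_bound[OF theta(1) at(3) _ vs, of 0] unfolding f3_def by auto
   have "norm (iter_deriv vs (%x. Pop theta kappa xi (c xi) x - of_real (snd xi) * psi x) x) <= C1 + (C2 + C3)" if xi: "xi \<in> V" for xi x
   proof -
    let ?D = "%f. norm (iter_deriv vs f x)"
    have "norm (iter_deriv vs (%x. Pop theta kappa xi (c xi) x - of_real (snd xi) * psi x) x) <= abs (snd xi)^2 * ?D (f1 xi) + (abs (snd xi) * ?D (f2 xi) + ?D (f3 xi))"
     unfolding d[OF xi] iter_deriv_combination[OF s[OF xi] vs]
     by (rule order_trans[OF norm_triangle_ineq add_mono[OF _ order_trans[OF norm_triangle_ineq]]])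
      (simp_all add: norm_mult norm_power)
    thus ?thesis using C1 C2 C3 xi by (smt (verit))
   qed
   thus "\<exists>C. \<forall>xi\<in>V. \<forall>x\<in>UNIV. norm (iter_deriv vs (%x. Pop theta kappa xi (c xi) x - of_real (snd xi) * psi x) x) <= C" by blast
  qed
  thus "has_parametrix theta kappa V psi"
   using jk unfolding c_def[abs_def] has_parametrix_def by blast
 qed
qed

end

section \<open>Weighted square integrability\<close>

text \<open>The closure rules below are pointwise comparisons, which carry over to the
  majorants.\<close>

lemma weighted_L2_dominated:
 assumes "weighted_L2 V1 s1 F1" "weighted_L2 V2 s2 F2"
  and le: "!!xi. xi \<in> V ==> (norm (F xi))^2 * jb s xi <= C * ((norm (F1 xi))^2 * jb s1 xi * indicator V1 xi + (norm (F2 xi))^2 * jb s2 xi * indicator V2 xi)"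
 shows "weighted_L2 V s F"
proof -
 obtain G where G [measurable]: "G \<in> borel_measurable borel" and 1: "\<forall>xi\<in>V1. ennreal ((norm (F1 xi))^2 * jb s1 xi) <= G xi"
  and fin: "(\<integral>\<^sup>+ xi. G xi \<partial>lborel) < \<infinity>"
  using assms(1) unfolding weighted_L2_def by blast
 obtain G' where G' [measurable]: "G' \<in> borel_measurable borel" and 2: "\<forall>xi\<in>V2. ennreal ((norm (F2 xi))^2 * jb s2 xi) <= G' xi"
  and fin': "(\<integral>\<^sup>+ xi. G' xi \<partial>lborel) < \<infinity>"
  using assms(2) unfolding weighted_L2_def by blast
 let ?G = "%xi. ennreal (abs C) * (G xi + G' xi)"
 have "ennreal ((norm (F xi))^2 * jb s xi) <= ?G xi" if "xi \<in> V" for xi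
 proof -
  let ?a = "(norm (F1 xi))^2 * jb s1 xi * indicator V1 xi" and ?b = "(norm (F2 xi))^2 * jb s2 xi * indicator V2 xi"
  have nn: "?a >= 0" "?b >= 0" using jb_pos[of s1 xi] jb_pos[of s2 xi] by simp_all
  hence "C * (?a + ?b) <= abs C * (?a + ?b)" by (intro mult_right_mono) auto
  hence "ennreal ((norm (F xi))^2 * jb s xi) <= ennreal (abs C * (?a + ?b))" using le[OF that] by (intro ennreal_leI) linarith
  also have "... = ennreal (abs C) * (ennreal ?a + ennreal ?b)" using nn by (simp add: ennreal_mult)
  also have "... <= ?G xi" using 1 2 by (intro mult_left_mono add_mono) (auto simp: indicator_def)
  finally show ?thesis .
 qed
 moreover have "(\<integral>\<^sup>+ xi. ?G xi \<partial>lborel) < \<infinity>"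
  using fin fin' by (simp add: nn_integral_cmult nn_integral_add ennreal_mult_less_top)
 moreover have "?G \<in> borel_measurable borel" by measurable
 ultimately show ?thesis unfolding weighted_L2_def by (intro bexI[of _ ?G] conjI ballI)
qed

lemma weighted_L2_mono:
 assumes "weighted_L2 V s F" "V' \<subseteq> V" "!!xi. xi \<in> V' ==> (norm (F' xi))^2 * jb s' xi <= C * ((norm (F xi))^2 * jb s xi)"
 shows "weighted_L2 V' s' F'"
 by (rule weighted_L2_dominated[OF assms(1,1), of _ _ _ "C / 2"]) (use assms(3) subsetD[OF assms(2)] in \<open>simp add: mult_ac\<close>)

lemma weighted_L2_add:
 assumes "weighted_L2 V s F" "weighted_L2 V s F'"
 shows "weighted_L2 V s (%xi. F xi + F' xi)"
proof (rule weighted_L2_dominated[OF assms, of _ _ _ 2])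
 fix xi assume xi: "xi \<in> V"
 have "(norm (F xi + F' xi))^2 <= (norm (F xi) + norm (F' xi))^2" by (intro power_mono norm_triangle_ineq) simp
 also have "... <= 2 * ((norm (F xi))^2 + (norm (F' xi))^2)"
  using sum_squares_bound[of "norm (F xi)" "norm (F' xi)"] by (simp add: power2_sum)
 finally have "(norm (F xi + F' xi))^2 * jb s xi <= 2 * ((norm (F xi))^2 + (norm (F' xi))^2) * jb s xi"
  using jb_pos[of s xi] by (intro mult_right_mono) auto
 thus "(norm (F xi + F' xi))^2 * jb s xi <= 2 * ((norm (F xi))^2 * jb s xi * indicator V xi + (norm (F' xi))^2 * jb s xi * indicator V xi)"
  using xi by (simp add: algebra_simps)
qed

lemma weighted_L2_Un:
 assumes "weighted_L2 V s F" "weighted_L2 V' s F"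
 shows "weighted_L2 (V \<union> V') s F"
 by (rule weighted_L2_dominated[OF assms, of _ _ _ 1]) (auto simp: indicator_def jb_pos less_imp_le)

lemma weighted_L2_from_integral:
 assumes [measurable]: "V \<in> sets borel" "F \<in> borel_measurable borel"
  and "(\<integral>\<^sup>+ xi\<in>V. ennreal ((norm (F xi))^2 * jb s xi) \<partial>lborel) < \<infinity>"
 shows "weighted_L2 V s F"
 unfolding weighted_L2_def
 by (intro bexI[of _ "%xi. ennreal ((norm (F xi))^2 * jb s xi) * indicator V xi"] conjI ballI)
  (use assms(3) in simp_all)

lemma weighted_L2_jb:
 assumes "!!xi. xi \<in> V ==> (norm (F xi))^2 * jb (s + 2) xi <= C"
 shows "weighted_L2 V s F"
proof (rule weighted_L2_mono)
 show "weighted_L2 UNIV (-2) (%xi. 1)"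
  by (rule weighted_L2_from_integral) (use jb_nn_integral in auto)
 fix xi assume "xi \<in> V"
 hence "(norm (F xi))^2 * jb (s + 2) xi * jb (-2) xi <= C * jb (-2) xi"
  using assms jb_pos[of "-2" xi] by (intro mult_right_mono) auto
 moreover have "jb s xi = jb (s + 2) xi * jb (-2) xi" using jb_add[of "s + 2" "-2" xi] by simp
 ultimately show "(norm (F xi))^2 * jb s xi <= C * ((norm (1 :: complex))^2 * jb (-2) xi)" by (simp add: mult.assoc)
qed simp

text \<open>In a cone where \<open>norm xi\<close> is controlled by \<open>abs (snd xi)\<close>,
  rapid decay in \<open>snd xi\<close> is rapid decay in \<open>xi\<close>.\<close>

lemma weighted_L2_rapid:
 assumes C1: "!!xi. xi \<in> V ==> norm xi <= C1 * abs (snd xi)" "C1 >= 0"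
  and F: "!!M. \<exists>C. \<forall>xi\<in>V. (1 + abs (snd xi)) ^ M * norm (F xi) <= C"
 shows "weighted_L2 V s F"
proof -
 define m where "m = nat \<lceil>abs (s + 2)\<rceil>"
 obtain C where C: "\<forall>xi\<in>V. (1 + abs (snd xi)) ^ m * norm (F xi) <= C" using F by blast
 show ?thesis
 proof (rule weighted_L2_jb)
  fix xi assume xi: "xi \<in> V"
  have "1 + (norm xi)^2 <= (1 + norm xi)^2" by (simp add: power2_eq_square algebra_simps)
  also have "... <= ((1 + C1) * (1 + abs (snd xi)))^2"
   using C1(1)[OF xi] C1(2) by (intro power_mono) (auto simp: algebra_simps)
  finally have "(1 + (norm xi)^2) ^ m <= (((1 + C1) * (1 + abs (snd xi)))^2) ^ m" by (intro power_mono) auto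
  also have "... = (1 + C1) ^ (2 * m) * ((1 + abs (snd xi)) ^ m)^2"
   by (simp add: power_mult_distrib power_mult[symmetric] mult.commute)
  finally have "(norm (F xi))^2 * jb (s + 2) xi <= (norm (F xi))^2 * ((1 + C1) ^ (2 * m) * ((1 + abs (snd xi)) ^ m)^2)"
   using jb_le_power[of "s + 2" xi] by (intro mult_left_mono) (auto simp: m_def)
  also have "... = (1 + C1) ^ (2 * m) * ((1 + abs (snd xi)) ^ m * norm (F xi))^2" by (simp add: power_mult_distrib)
  also have "... <= (1 + C1) ^ (2 * m) * C^2"
   using C xi C1(2) by (intro mult_left_mono power_mono) auto
  finally show "(norm (F xi))^2 * jb (s + 2) xi <= (1 + C1) ^ (2 * m) * C^2" .
 qed
qed

text \<open>The square of a function of growth \<open>norm xi ^ N\<close> is compensated by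
  \<open>jb (- N)\<close>, and \<open>jb (-2)\<close> is integrable. This starts the
  bootstrap.\<close>

lemma weighted_L2_growth:
 assumes "!!xi. xi \<in> V ==> norm (F xi) <= D * (1 + norm xi) ^ N" "s <= - real N - 2"
 shows "weighted_L2 V s F"
proof (rule weighted_L2_jb)
 fix xi assume xi: "xi \<in> V"
 have p: "1 + (norm xi)^2 > 0" by (simp add: add_pos_nonneg)
 have "(1 + norm xi)^2 <= 2 * (1 + (norm xi)^2)" using sum_squares_bound[of 1 "norm xi"] by (simp add: power2_sum)
 hence "((1 + norm xi)^2) ^ N <= (2 * (1 + (norm xi)^2)) ^ N" by (intro power_mono) auto
 hence 1: "((1 + norm xi) ^ N)^2 <= 2 ^ N * (1 + (norm xi)^2) ^ N"
  by (simp only: power_mult_distrib power_mult[symmetric] mult.commute[of 2 N])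
 have "(norm (F xi))^2 <= (D * (1 + norm xi) ^ N)^2" using assms(1)[OF xi] by (intro power_mono) auto
 also have "... <= D^2 * (2 ^ N * (1 + (norm xi)^2) ^ N)" unfolding power_mult_distrib by (intro mult_left_mono 1) simp
 finally have "(norm (F xi))^2 * jb (s + 2) xi <= (D^2 * (2 ^ N * (1 + (norm xi)^2) ^ N)) * jb (- real N) xi"
  using jb_mono[of "s + 2" "- real N" xi] assms(2) jb_pos[of "s + 2" xi] by (intro mult_mono) auto
 also have "... = D^2 * 2 ^ N" using p by (simp add: jb_def powr_minus powr_realpow)
 finally show "(norm (F xi))^2 * jb (s + 2) xi <= D^2 * 2 ^ N" .
qed

lemma weighted_L2_bounded:
 assumes "!!xi. xi \<in> V ==> norm (F xi) <= D * (1 + norm xi) ^ N" "!!xi. xi \<in> V ==> norm xi <= r" "D >= 0"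
 shows "weighted_L2 V s F"
proof (rule weighted_L2_jb)
 fix xi assume xi: "xi \<in> V"
 let ?m = "nat \<lceil>abs (s + 2)\<rceil>"
 have r: "norm xi <= r" by (rule assms(2)[OF xi])
 have "norm (F xi) <= D * (1 + r) ^ N"
  by (rule order_trans[OF assms(1)[OF xi]]) (intro mult_left_mono power_mono assms(3), use r in auto)
 hence 1: "(norm (F xi))^2 <= (D * (1 + r) ^ N)^2" by (intro power_mono) auto
 have "jb (s + 2) xi <= (1 + (norm xi)^2) ^ ?m" by (rule jb_le_power)
 also have "... <= (1 + r^2) ^ ?m" using r by (intro power_mono add_left_mono) auto
 finally show "(norm (F xi))^2 * jb (s + 2) xi <= (D * (1 + r) ^ N)^2 * (1 + r^2) ^ ?m"
  using 1 jb_pos[of "s + 2" xi] by (intro mult_mono) auto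
qed

text \<open>A cone around the direction with slope \<open>fst xi / snd xi = rho\<close> in which
  \<open>snd xi\<close> has the sign of \<open>sg\<close>. Inequalities in the two coordinates make
  openness and separation elementary.\<close>

definition sector :: "real => real => real => R2 set" where
 "sector sg rho eps = {xi. sg * snd xi > 0 & abs (fst xi - rho * snd xi) < eps * abs (snd xi)}"

lemma open_sector: "open (sector sg rho eps)"
 unfolding sector_def by (intro open_Collect_conj open_Collect_less continuous_intros)

lemma sector_norm:
 assumes "xi \<in> sector sg rho eps"
 shows "norm xi <= (1 + abs rho + eps) * abs (snd xi)" "snd xi ~= 0" "abs (fst xi / snd xi - rho) < eps"
proof -
 have s: "sg * snd xi > 0" "abs (fst xi - rho * snd xi) < eps * abs (snd xi)" using assms by (auto simp: sector_def)
 thus nz: "snd xi ~= 0" by auto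
 have "abs (fst xi) <= abs (fst xi - rho * snd xi) + abs (rho * snd xi)" by linarith
 also have "... <= eps * abs (snd xi) + abs rho * abs (snd xi)" using s(2) by (simp add: abs_mult)
 finally have "abs (fst xi) + abs (snd xi) <= (1 + abs rho + eps) * abs (snd xi)" by (simp add: algebra_simps)
 moreover have "norm xi <= abs (fst xi) + abs (snd xi)" using norm_Pair_le[of "fst xi" "snd xi"] by simp
 ultimately show "norm xi <= (1 + abs rho + eps) * abs (snd xi)" by linarith
 have "abs (fst xi / snd xi - rho) * abs (snd xi) = abs (fst xi - rho * snd xi)"
  using nz by (simp add: abs_mult[symmetric] left_diff_distrib)
 thus "abs (fst xi / snd xi - rho) < eps" using s(2) mult_less_cancel_right_pos[of "abs (snd xi)" "abs (fst xi / snd xi - rho)" eps] nz by simp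
qed

lemma sector_mono: "eps <= eps' ==> sector sg rho eps \<subseteq> sector sg rho eps'"
 unfolding sector_def using mult_right_mono[of eps eps', OF _ abs_ge_zero] by (fastforce intro: less_le_trans)

text \<open>A perturbation by less than \<open>e * abs (snd xi)\<close> keeps the sign of the second
  coordinate and widens the opening from \<open>eps\<close> to at most \<open>eps'\<close>; the
  number \<open>e\<close> solves \<open>eps + e * (1 + abs rho) = eps' * (1 - e)\<close>. The factor
  \<open>C1\<close> passes from \<open>snd xi\<close> to \<open>norm xi\<close>.\<close>

lemma sector_separation:
 assumes "0 < eps" "eps < eps'"
 obtains c where "c > 0" "!!xi eta. xi \<in> sector sg rho eps ==> eta \<notin> sector sg rho eps' ==> c * norm xi <= norm (xi - eta)"
proof -
 define C1 where "C1 = 1 + abs rho + eps"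
 have C1: "C1 > 0" using assms by (simp add: C1_def)
 define e where "e = (eps' - eps) / (1 + abs rho + eps')"
 have e: "e > 0" "e < 1" "eps + e * (1 + abs rho) = eps' * (1 - e)"
 proof -
  have p: "1 + abs rho + eps' > 0" using assms by simp
  show "e > 0" "e < 1" using assms p by (auto simp: e_def)
  have "e * (1 + abs rho + eps') = eps' - eps" using p by (simp add: e_def)
  thus "eps + e * (1 + abs rho) = eps' * (1 - e)" by (simp add: algebra_simps)
 qed
 show ?thesis
 proof (rule that[of "e / C1"])
  show "e / C1 > 0" using e C1 by simp
  fix xi eta assume xi: "xi \<in> sector sg rho eps" and eta: "eta \<notin> sector sg rho eps'"
  show "e / C1 * norm xi <= norm (xi - eta)"
  proof (rule ccontr)
   assume "\<not> ?thesis"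
   hence lt: "norm (xi - eta) < e / C1 * norm xi" by simp
   have "e / C1 * norm xi <= e / C1 * (C1 * abs (snd xi))"
    using sector_norm(1)[OF xi] e C1 by (intro mult_left_mono) (auto simp: C1_def)
   hence d: "norm (xi - eta) < e * abs (snd xi)" using lt C1 by simp
   have d1: "abs (fst xi - fst eta) < e * abs (snd xi)" "abs (snd xi - snd eta) < e * abs (snd xi)"
   proof -
    have "xi - eta = (fst xi - fst eta, snd xi - snd eta)" by (simp add: prod_eq_iff)
    thus "abs (fst xi - fst eta) < e * abs (snd xi)" "abs (snd xi - snd eta) < e * abs (snd xi)"
     using d norm_fst_le[of "fst xi - fst eta" "snd xi - snd eta"] norm_snd_le[of "snd xi - snd eta" "fst xi - fst eta"]
     by (simp_all only: real_norm_def)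
   qed
   have s: "sg * snd xi > 0" "abs (fst xi - rho * snd xi) < eps * abs (snd xi)" using xi by (auto simp: sector_def)
   have ex: "e * abs (snd xi) <= abs (snd xi)" using e by (simp add: mult_left_le_one_le)
   have big: "(1 - e) * abs (snd xi) <= abs (snd eta)" using d1(2) by (simp add: left_diff_distrib)
   have dd: "abs (snd xi - snd eta) < abs (snd xi)" using d1(2) ex by linarith
   have "snd xi > 0 ==> snd eta > 0" "snd xi < 0 ==> snd eta < 0" using dd by linarith+
   hence "sg * snd eta > 0" using s(1) by (auto simp: zero_less_mult_iff)
   moreover have "abs (fst eta - rho * snd eta) < eps' * abs (snd eta)"
   proof -
    have "abs (rho * (snd xi - snd eta)) <= abs rho * (e * abs (snd xi))" unfolding abs_mult using d1(2) by (intro mult_left_mono) auto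
    hence "abs (fst eta - rho * snd eta) < eps * abs (snd xi) + e * abs (snd xi) + abs rho * (e * abs (snd xi))"
     using s(2) d1(1) unfolding right_diff_distrib by linarith
    also have "... = (eps + e * (1 + abs rho)) * abs (snd xi)" by (simp add: algebra_simps)
    also have "... = eps' * ((1 - e) * abs (snd xi))" by (simp add: e(3))
    also have "... <= eps' * abs (snd eta)" using big assms by (intro mult_left_mono) auto
    finally show ?thesis .
   qed
   ultimately show False using eta by (simp add: sector_def)
  qed
 qed
qed

lemma sector_cone: "t > 0 ==> xi \<in> sector sg rho eps ==> t *\<^sub>R xi \<in> sector sg rho eps"
proof -
 assume t: "t > 0" and xi: "xi \<in> sector sg rho eps"
 have "abs (fst (t *\<^sub>R xi) - rho * snd (t *\<^sub>R xi)) = t * abs (fst xi - rho * snd xi)"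
 proof -
  have "fst (t *\<^sub>R xi) - rho * snd (t *\<^sub>R xi) = t * (fst xi - rho * snd xi)" by (simp add: algebra_simps)
  thus ?thesis using t by (simp add: abs_mult)
 qed
 moreover have "t * abs (fst xi - rho * snd xi) < t * (eps * abs (snd xi))" using t xi by (simp add: sector_def)
 moreover have "sg * snd (t *\<^sub>R xi) = t * (sg * snd xi)" by simp
 moreover have "t * (sg * snd xi) > 0" by (rule mult_pos_pos[OF t]) (use xi in \<open>simp add: sector_def\<close>)
 moreover have "eps * abs (snd (t *\<^sub>R xi)) = t * (eps * abs (snd xi))" using t by (simp add: abs_mult)
 ultimately show ?thesis by (simp only: sector_def mem_Collect_eq)
qed

text \<open>By homogeneity a frequency may be scaled until its second coordinate is that of
  \<open>xi0\<close>; then only the first coordinate is off, by less than the radius of a ball in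
  \<open>V\<close>.\<close>

lemma sector_subset_cone:
 assumes V: "open V" "xi0 \<in> V" "!!eta t. eta \<in> V ==> t > 0 ==> t *\<^sub>R eta \<in> V" and nz: "snd xi0 ~= 0"
 obtains eps where "eps > 0" "sector (snd xi0) (fst xi0 / snd xi0) eps \<subseteq> V"
proof -
 obtain d where d: "d > 0" "ball xi0 d \<subseteq> V" using V(1,2) open_contains_ball by blast
 show ?thesis
 proof (rule that[of "d / abs (snd xi0)"])
  show "d / abs (snd xi0) > 0" using d nz by simp
  show "sector (snd xi0) (fst xi0 / snd xi0) (d / abs (snd xi0)) \<subseteq> V"
  proof
   fix xi assume xi: "xi \<in> sector (snd xi0) (fst xi0 / snd xi0) (d / abs (snd xi0))"
   define t where "t = snd xi / snd xi0"
   have nz': "snd xi ~= 0" by (rule sector_norm(2)[OF xi])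
   have t: "t > 0" using xi by (auto simp: t_def sector_def zero_less_mult_iff zero_less_divide_iff)
   have "abs (fst xi / snd xi - fst xi0 / snd xi0) * abs (snd xi0) < d" using sector_norm(3)[OF xi] nz by (simp add: pos_less_divide_eq)
   moreover have "(fst xi / snd xi - fst xi0 / snd xi0) * snd xi0 = fst xi / t - fst xi0"
    using nz nz' by (simp add: t_def field_simps)
   ultimately have "abs (fst xi / t - fst xi0) < d" by (simp flip: abs_mult)
   moreover have "snd xi / t = snd xi0" using nz nz' by (simp add: t_def)
   ultimately have "dist xi0 ((1 / t) *\<^sub>R xi) < d"
    by (simp add: dist_prod_def dist_real_def abs_minus_commute)
   hence "(1 / t) *\<^sub>R xi \<in> V" using d(2) by auto
   from V(3)[OF this t] show "xi \<in> V" using t by simp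
  qed
 qed
qed

lemma in_sector: "snd xi0 ~= 0 ==> eps > 0 ==> xi0 \<in> sector (snd xi0) (fst xi0 / snd xi0) eps"
 by (auto simp: sector_def zero_less_mult_iff)

section \<open>Bootstrap\<close>

lemma weighted_L2_minus: "weighted_L2 V s F ==> weighted_L2 V s (%xi. - F xi)"
 unfolding weighted_L2_def norm_minus_cancel .

text \<open>A functional of order \<open>N\<close> loses at most \<open>N\<close> powers of the
  frequency on \<open>fwave xi\<close>, and the decay of all derivatives of \<open>H\<close> makes
  up for this. Rescaling both factors reduces the estimate to uniform bounds for a product.\<close>

lemma functional_decay:
 assumes f: "finite_order K f N C" and H: "!!xi. xi \<in> V ==> H xi \<in> smooth_supp K"
  and dec: "!!M vs. dirs vs ==> \<exists>B. \<forall>xi\<in>V. \<forall>x. (1 + abs (snd xi)) ^ M * norm (iter_deriv vs (H xi) x) <= B"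
  and C1: "!!xi. xi \<in> V ==> norm xi <= C1 * abs (snd xi)" "C1 >= 0"
 shows "\<exists>B. \<forall>xi\<in>V. (1 + abs (snd xi)) ^ M * norm (f (%x. H xi x * fwave xi x)) <= B"
proof -
 interpret finite_order K f N C by fact
 define a where "a xi = (1 + abs (snd xi)) ^ (M + N)" for xi :: "R2"
 define e where "e xi = inverse ((1 + norm xi) ^ N)" for xi :: "R2"
 have ap: "a xi > 0" for xi unfolding a_def by (intro zero_less_power add_pos_nonneg) auto
 have ep: "e xi > 0" for xi unfolding e_def by (intro positive_imp_inverse_positive zero_less_power add_pos_nonneg) auto
 have sH: "smooth (H xi)" if "xi \<in> V" for xi using H[OF that] by (rule smooth_suppD)
 have 1: "unif_Ck N UNIV UNIV V (%xi x. of_real (a xi) * H xi x)"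
 proof (rule unif_Ck_smooth)
  show "smooth (%x. of_real (a xi) * H xi x)" if "xi \<in> V" for xi
   by (intro smooth_on_mult smooth_on_const open_UNIV sH that)
  fix vs :: "R2 list" assume vs: "dirs vs"
  obtain B where B: "\<forall>xi\<in>V. \<forall>x. (1 + abs (snd xi)) ^ (M + N) * norm (iter_deriv vs (H xi) x) <= B" using dec[OF vs] by blast
  have "norm (iter_deriv vs (%x. of_real (a xi) * H xi x) x) <= B" if "xi \<in> V" for xi x
   unfolding iter_deriv_cmult[OF open_UNIV sH[OF that] vs UNIV_I]
   using B[THEN bspec[OF _ that], THEN spec[of _ x], folded a_def] ap[of xi] by (simp add: norm_mult)
  thus "\<exists>C. \<forall>xi\<in>V. \<forall>x\<in>UNIV. norm (iter_deriv vs (%x. of_real (a xi) * H xi x) x) <= C" by blast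
 qed
 have 2: "unif_Ck N UNIV UNIV V (%xi x. of_real (e xi) * fwave xi x)"
 proof (rule unif_Ck_smooth)
  show "smooth (%x. of_real (e xi) * fwave xi x)" for xi
   by (intro smooth_on_mult smooth_on_const open_UNIV smooth_on_fwave)
  fix vs :: "R2 list" assume vs: "dirs vs" "length vs <= N"
  have "norm (iter_deriv vs (%x. of_real (e xi) * fwave xi x) x) <= 1" for xi x
  proof -
   have "norm (iter_deriv vs (fwave xi) x) <= norm xi ^ length vs" by (rule norm_iter_deriv_fwave[OF vs(1)])
   also have "... <= (1 + norm xi) ^ length vs" by (intro power_mono) auto
   also have "... <= (1 + norm xi) ^ N" using vs(2) by (intro power_increasing) auto
   finally have "e xi * norm (iter_deriv vs (fwave xi) x) <= e xi * (1 + norm xi) ^ N" using ep[of xi] by (intro mult_left_mono) auto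
   also have "... = 1" unfolding e_def by (intro left_inverse) (simp add: add_nonneg_eq_0_iff)
   finally show ?thesis unfolding iter_deriv_cmult[OF open_UNIV smooth_on_fwave vs(1) UNIV_I]
    using ep[of xi] by (simp add: norm_mult)
  qed
  thus "\<exists>C. \<forall>xi\<in>V. \<forall>x\<in>UNIV. norm (iter_deriv vs (%x. of_real (e xi) * fwave xi x) x) <= C" by blast
 qed
 from unif_Ck_uniform_bound[OF unif_Ck_times[OF 1 2]]
 obtain D where D: "D >= 0" "\<forall>vs. dirs vs --> length vs <= N --> (\<forall>xi\<in>V. \<forall>x\<in>UNIV.
  norm (iter_deriv vs (%x. of_real (a xi) * H xi x * (of_real (e xi) * fwave xi x)) x) <= D)"
  by blast
 have "(1 + abs (snd xi)) ^ M * norm (f (%x. H xi x * fwave xi x)) <= (1 + C1) ^ N * (C * D)" if xi: "xi \<in> V" for xi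
 proof -
  have Hf: "(%x. H xi x * fwave xi x) \<in> smooth_supp K" by (rule smooth_supp_mult[OF H[OF xi] smooth_on_fwave])
  have "norm (f (%x. of_real (a xi) * H xi x * (of_real (e xi) * fwave xi x))) <= C * D"
  proof (rule bound)
   have "(%x. of_real (a xi) * H xi x) \<in> smooth_supp K"
    using H[OF xi] sH[OF xi] by (auto simp: smooth_supp_def intro!: smooth_on_mult smooth_on_const)
   thus "(%x. of_real (a xi) * H xi x * (of_real (e xi) * fwave xi x)) \<in> smooth_supp K"
    by (rule smooth_supp_mult) (intro smooth_on_mult smooth_on_const open_UNIV smooth_on_fwave)
  qed (use D(2) xi in blast)
  also have "(%x. of_real (a xi) * H xi x * (of_real (e xi) * fwave xi x)) = (%x. of_real (a xi * e xi) * (H xi x * fwave xi x))"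
   by (simp add: fun_eq_iff mult_ac)
  also have "norm (f ...) = a xi * e xi * norm (f (%x. H xi x * fwave xi x))"
   unfolding cmult[OF Hf] using ap[of xi] ep[of xi] by (simp add: norm_mult)
  finally have 3: "a xi * e xi * norm (f (%x. H xi x * fwave xi x)) <= C * D" .
  have "(1 + norm xi) ^ N <= ((1 + C1) * (1 + abs (snd xi))) ^ N"
   using C1(1)[OF xi] C1(2) by (intro power_mono) (auto simp: algebra_simps)
  hence "(1 + abs (snd xi)) ^ M * (1 + norm xi) ^ N <= (1 + C1) ^ N * a xi"
   unfolding a_def power_add power_mult_distrib using mult_left_mono[of _ _ "(1 + abs (snd xi)) ^ M"] by (simp add: mult_ac)
  hence "((1 + abs (snd xi)) ^ M * (1 + norm xi) ^ N) * e xi <= ((1 + C1) ^ N * a xi) * e xi"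
   using ep[of xi] by (intro mult_right_mono) auto
  moreover have "(1 + norm xi) ^ N * e xi = 1" unfolding e_def by (intro right_inverse) (simp add: add_nonneg_eq_0_iff)
  ultimately have "(1 + abs (snd xi)) ^ M <= (1 + C1) ^ N * (a xi * e xi)" by (simp add: mult.assoc)
  hence "(1 + abs (snd xi)) ^ M * norm (f (%x. H xi x * fwave xi x)) <= (1 + C1) ^ N * (a xi * e xi) * norm (f (%x. H xi x * fwave xi x))"
   by (rule mult_right_mono) simp
  also have "... <= (1 + C1) ^ N * (C * D)"
   unfolding mult.assoc[of "(1 + C1) ^ N"] using 3 C1(2) by (intro mult_left_mono) auto
  finally show ?thesis .
 qed
 thus ?thesis by blast
qed

definition square :: "R2 => real => R2 set" where
 "square x eps = {fst x - eps..fst x + eps} \<times> {snd x - eps..snd x + eps}"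

lemma compact_square: "compact (square x eps)"
 unfolding square_def by (intro compact_Times compact_Icc)

lemma square_mono: "eps <= eps' ==> square x eps \<subseteq> square x eps'"
 unfolding square_def by (intro Sigma_mono) auto

lemma square_separated:
 assumes "x' \<in> square x0 eps" "x \<notin> square x0 (eps + delta)"
 shows "delta <= dist x' x"
proof -
 obtain u v u' v' a b where x: "x = (u, v)" "x' = (u', v')" "x0 = (a, b)" by (metis prod.exhaust)
 have "abs (u' - a) <= eps" "abs (v' - b) <= eps" using assms(1) unfolding square_def x by auto
 moreover have "\<not> (abs (u - a) <= eps + delta & abs (v - b) <= eps + delta)" using assms(2) unfolding square_def x by auto
 ultimately have "delta <= abs (u' - u) \<or> delta <= abs (v' - v)" by linarith
 moreover have "abs (u' - u) <= dist x' x" "abs (v' - v) <= dist x' x"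
  using dist_fst_le[of x' x] dist_snd_le[of x' x] by (simp_all add: x dist_real_def)
 ultimately show ?thesis by linarith
qed

lemma smooth_supp_subset_mult: "phi \<in> smooth_supp K ==> smooth r ==> (%x. r x * phi x) \<in> smooth_supp K"
 by (auto simp: smooth_supp_def intro!: smooth_on_mult)

lemma smooth_supp_diff: "phi \<in> smooth_supp K ==> psi \<in> smooth_supp K ==> (%x. phi x - psi x) \<in> smooth_supp K"
 by (auto simp: smooth_supp_def intro!: smooth_on_diff)

text \<open>Division by \<open>phi\<close> on a set where it is bounded below, by means of the
  everywhere smooth \<open>recip\<close>. It allows a cutoff \<open>psi\<close> to be written as a
  multiple of the cutoff for which regularity is known.\<close>

lemma smooth_supp_quotient:
 assumes psi: "psi \<in> smooth_supp K" and phi: "smooth phi" and c: "c > 0" "!!x. x \<in> K ==> c <= norm (phi x)"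
 obtains mu where "mu \<in> smooth_supp K" "!!x. phi x * mu x = psi x"
proof
 let ?n = "%x. (Re (phi x))^2 + (Im (phi x))^2"
 let ?mu = "%x. psi x * (cnj (phi x) * of_real (recip (c^2) (?n x)))"
 have "smooth ?n" unfolding power2_eq_square
  by (intro smooth_on_add smooth_on_mult open_UNIV smooth_on_blinear[OF open_UNIV bounded_linear_Re phi] smooth_on_blinear[OF open_UNIV bounded_linear_Im phi])
 hence "smooth (%x. recip (c^2) (?n x))"
  using c by (intro smooth_comp[OF smooth_recip]) auto
 thus "?mu \<in> smooth_supp K"
  by (intro smooth_supp_mult[OF psi] smooth_on_mult[OF open_UNIV] smooth_on_blinear[OF open_UNIV bounded_linear_cnj phi]
    smooth_on_blinear[OF open_UNIV bounded_linear_of_real])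
 fix x
 show "phi x * ?mu x = psi x"
 proof (cases "x \<in> K")
  case True
  have "c^2 <= (norm (phi x))^2" using c(1) c(2)[OF True] by (intro power_mono) auto
  hence "recip (c^2) (?n x) * ?n x = 1" using c(1) by (intro recip_mult) (auto simp: cmod_power2)
  hence "of_real (recip (c^2) (?n x)) * (phi x * cnj (phi x)) = 1"
   unfolding complex_mult_cnj by (metis of_real_1 of_real_mult)
  hence "phi x * (cnj (phi x) * of_real (recip (c^2) (?n x))) = 1" by (simp add: mult_ac)
  hence "psi x * (phi x * (cnj (phi x) * of_real (recip (c^2) (?n x)))) = psi x" by simp
  thus ?thesis by (simp only: mult.left_commute)
 qed (use psi in \<open>simp add: smooth_supp_def\<close>)
qed

context cone_reg
begin

lemma admissible_DE: "admissible beta ==> admissible (DE xi beta)"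
proof -
 assume a: "admissible beta"
 hence s: "smooth beta" by (simp add: admissible_def)
 have "amp_family UNIV (%xi. beta)"
  using a by (auto simp: amp_family_def intro!: smooth_unif_Ck[OF _ s])
 from amp_family_deriv[OF this E_Basis] have b: "admissible (%p. fderiv beta p ((1, 0), 0))"
  by (simp add: amp_family_def)
 show ?thesis unfolding admissible_def
 proof (intro conjI allI impI)
  show "smooth (DE xi beta)" by (rule smooth_DE[OF s])
  fix z t assume "DE xi beta (z, t) ~= 0"
  hence "fderiv beta (z, t) ((1, 0), 0) ~= 0 \<or> beta (z, t) ~= 0" by (auto simp: DE_def)
  thus "z \<in> KY" "(snd z + t, fst z * Q t) \<in> KX"
   using admissible_D[OF a, of z t] admissible_D[OF b, of z t] by blast+
 qed
qed

lemma admissible_radon_amp: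
 assumes "kappa \<in> smooth_supp KY" "psi \<in> smooth_supp KX"
 shows "admissible (radon_amp kappa psi)"
proof -
 have "unif_Ck k UNIV UNIV UNIV (%xi :: R2. psi)" for k
  by (rule smooth_supp_unif_Ck[OF assms(2) compact_KX])
 from amp_family_radon[OF assms(1) this] assms(2) show ?thesis by (simp add: amp_family_def)
qed

lemma Pop_smooth_supp:
 assumes "theta \<in> smooth_supp KX" "kappa \<in> smooth_supp KY" "psi \<in> smooth_supp KX"
 shows "Pop theta kappa xi psi \<in> smooth_supp KX"
proof -
 have a: "admissible (DE xi (DE xi (radon_amp kappa psi)))" by (intro admissible_DE admissible_radon_amp assms)
 show ?thesis unfolding Pop_def
 proof (rule OI_smooth_supp)
  show "smooth (compose_amp theta (DE xi (DE xi (radon_amp kappa psi))))"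
   using assms(1) a by (intro smooth_compose_amp) (auto simp: smooth_supp_def admissible_def)
 qed (rule compose_amp_good[OF assms(1) a])
qed

text \<open>The outer cutoff is evaluated at the variable of the result, so its factors come out of
  the integral.\<close>

lemma Pop_mult: "Pop (%x. theta x * r x) kappa xi psi x = r x * Pop theta kappa xi psi x"
proof -
 have "compose_amp (%x. theta x * r x) beta = (%p. compose_amp theta beta p * r (fst (fst p)))" for beta
  by (simp add: compose_amp_def fun_eq_iff mult_ac)
 thus ?thesis unfolding Pop_def by (simp only: OI_mult_left)
qed

end

text \<open>The data of the bootstrap at one point: \<open>v\<close> stands for \<open>Lf\<close>,
  and \<open>rem\<close> for the part of it that comes from \<open>(E, y)\<close> away from the
  stationary point. A single \<open>e0\<close> limits the size of the square, the opening of the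
  cone and the inverse of the least frequency.\<close>

locale elliptic_point = cone_reg +
 fixes f v :: "(R2 => complex) => complex" and Nf Nv :: nat and Cf Cv :: real
  and rem :: "R2 => (R2 => complex) => complex"
  and theta kappa phi0 :: "R2 => complex" and x0 :: "R2" and rho sg al e0 c0 :: real
 assumes f: "finite_order KX f Nf Cf" and v: "finite_order KX v Nv Cv"
  and theta: "theta \<in> smooth_supp KX" and kappa: "kappa \<in> smooth_supp KY" and phi0: "phi0 \<in> smooth_supp KX"
  and e0: "e0 > 0" "square x0 e0 \<subseteq> KX" and c0: "c0 > 0" "!!x. x \<in> square x0 e0 ==> c0 <= norm (phi0 x)"
  and identity: "!!psi xi. psi \<in> smooth_supp KX ==>
   f (%x. fwave xi x * Pop theta kappa xi psi x) = v (%x. psi x * fwave xi x) - rem xi psi"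
  and rem: "!!V c M. (!!n. unif_Ck n UNIV UNIV V c) ==> (!!xi. xi \<in> V ==> c xi \<in> smooth_supp (square x0 e0)) ==>
   V \<subseteq> sector sg rho e0 ==> \<exists>B. \<forall>xi\<in>V. (1 + abs (snd xi)) ^ M * norm (rem xi (c xi)) <= B"
  and parametrix_exists: "!!psi V. psi \<in> smooth_supp (square x0 e0) ==>
   (!!xi. xi \<in> V ==> xi \<in> sector sg rho e0 & 1 / e0 < abs (snd xi)) ==>
   has_parametrix theta kappa V psi"
  and v_L2: "weighted_L2 (sector sg rho e0) (al - 1) (%xi. v (%x. phi0 x * fwave xi x))"
begin

text \<open>All cutoffs supported in the square are included, since the induction step applies its
  hypothesis to a wider cutoff than the one under consideration.\<close>

definition claim :: "real => real => bool" where
 "claim s eps \<longleftrightarrow> (\<forall>psi\<in>smooth_supp (square x0 eps). weighted_L2 (sector sg rho eps) s (%xi. f (%x. psi x * fwave xi x)))"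

lemma f_growth:
 assumes "psi \<in> smooth_supp (square x0 eps)" "eps <= e0"
 obtains D where "D >= 0" "!!xi. norm (f (%x. psi x * fwave xi x)) <= D * (1 + norm xi) ^ Nf"
proof -
 have "psi \<in> smooth_supp KX" using assms square_mono[OF assms(2)] e0(2) by (intro smooth_supp_mono[OF _ assms(1)]) blast
 from finite_order.hat_growth[OF f this] show ?thesis using that unfolding finite_order.hat_def[OF f] by blast
qed

lemma claim_start:
 assumes "eps <= e0" "s <= - real Nf - 2"
 shows "claim s eps"
 unfolding claim_def
proof
 fix psi assume "psi \<in> smooth_supp (square x0 eps)"
 from f_growth[OF this assms(1)] obtain D where "!!xi. norm (f (%x. psi x * fwave xi x)) <= D * (1 + norm xi) ^ Nf" by blast
 thus "weighted_L2 (sector sg rho eps) s (%xi. f (%x. psi x * fwave xi x))"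
  by (rule weighted_L2_growth[OF _ assms(2)])
qed

text \<open>The identity for the corrected cutoff \<open>c xi = psi * j xi\<close> expresses
  \<open>snd xi\<close> times the transform of \<open>psi * f\<close> by four terms.
  \<open>T1\<close> is controlled by the regularity of \<open>Lf\<close> and \<open>T2\<close>
  decays rapidly; \<open>T3\<close> contains the error of order 0 near \<open>x0\<close> and is
  estimated by the claim for \<open>s\<close>; \<open>T4\<close> is the error away from
  \<open>x0\<close> and decays by pseudolocality. Division by \<open>snd xi\<close> gains the
  order.\<close>

lemma claim_step:
 assumes eps: "0 < eps" "eps < eps'" "eps' < e0" and s: "claim s eps'" and s': "s' <= s + 1" "s' <= al"
 shows "claim s' eps"
 unfolding claim_def
proof
 fix psi assume psi: "psi \<in> smooth_supp (square x0 eps)"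
 \<comment> \<open>The parametrix is available for large frequencies; the bounded part of the sector
   is added at the end.\<close>
 define W where "W = sector sg rho eps \<inter> {xi. 1 / e0 < abs (snd xi)}"
 have We: "W \<subseteq> sector sg rho eps" by (simp add: W_def)
 have sub: "sector sg rho eps \<subseteq> sector sg rho eps'" "sector sg rho eps' \<subseteq> sector sg rho e0" using eps by (auto intro!: sector_mono)
 have sq: "square x0 eps \<subseteq> square x0 eps'" "square x0 eps' \<subseteq> square x0 e0" using eps by (auto intro!: square_mono)
 have psie: "psi \<in> smooth_supp (square x0 e0)" by (rule smooth_supp_mono[OF _ psi]) (use sq in blast)
 have psiK: "psi \<in> smooth_supp KX" by (rule smooth_supp_mono[OF e0(2) psie])
 have spsi: "smooth psi" using psi by (rule smooth_suppD)
 have We0: "xi \<in> sector sg rho e0 & 1 / e0 < abs (snd xi)" if "xi \<in> W" for xi using that sub by (auto simp: W_def)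
 from parametrix_exists[OF psie, of W, OF We0] obtain j where
  j: "!!n. unif_Ck n UNIV UNIV W j"
  and dk: "!!n. unif_Ck n UNIV UNIV W (%xi x. Pop theta kappa xi (%x. psi x * j xi x) x - of_real (snd xi) * psi x)"
  unfolding has_parametrix_def by blast
 have sj: "smooth (j xi)" if "xi \<in> W" for xi by (rule unif_Ck_imp_smooth[OF j that])
 define c where "c xi x = psi x * j xi x" for xi x
 have ceps: "c xi \<in> smooth_supp (square x0 eps)" if "xi \<in> W" for xi unfolding c_def by (rule smooth_supp_mult[OF psi sj[OF that]])
 have ce: "c xi \<in> smooth_supp (square x0 e0)" if "xi \<in> W" for xi by (rule smooth_supp_mono[OF _ ceps[OF that]]) (use sq in blast)
 have cK: "c xi \<in> smooth_supp KX" if "xi \<in> W" for xi by (rule smooth_supp_mono[OF e0(2) ce[OF that]])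
 have ck: "unif_Ck n UNIV UNIV W c" for n
 proof -
  have "unif_Ck n UNIV UNIV W (%xi. psi)"
   by (rule smooth_supp_unif_Ck[OF psiK compact_KX])
  thus ?thesis unfolding c_def[abs_def] by (intro unif_Ck_times j)
 qed
 define P where "P xi = Pop theta kappa xi (c xi)" for xi
 have PK: "P xi \<in> smooth_supp KX" if "xi \<in> W" for xi unfolding P_def by (rule Pop_smooth_supp[OF theta kappa cK[OF that]])
 define d where "d xi x = P xi x - of_real (snd xi) * psi x" for xi x
 have dk': "unif_Ck n UNIV UNIV W d" for n using dk[of n] unfolding d_def[abs_def] P_def c_def .
 have dK: "d xi \<in> smooth_supp KX" if "xi \<in> W" for xi
  unfolding d_def by (intro smooth_supp_diff PK that smooth_supp_subset_mult psiK smooth_on_const open_UNIV)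
 \<comment> \<open>Leaves room for \<open>psi2\<close> to be 1 on the square enlarged by
   \<open>delta\<close> and to vanish off the square of size \<open>eps'\<close>.\<close>
 define delta where "delta = (eps' - eps) / 2"
 have delta: "delta > 0" "eps + 2 * delta = eps'" using eps unfolding delta_def by (auto simp: field_simps)
 define psi2 where "psi2 x = complex_of_real (cutoff delta (fst x0 - eps) (fst x0 + eps) (snd x0 - eps) (snd x0 + eps) x)" for x
 have psi2: "psi2 \<in> smooth_supp (square x0 eps')"
  unfolding psi2_def by (rule cutoff_smooth_supp[OF delta(1)]) (use delta(2) in \<open>auto simp: square_def\<close>)
 have psi2_1: "psi2 x = 1" if "x \<in> square x0 (eps + delta)" for x
  unfolding psi2_def using cutoff_eq_1[OF delta(1), of x] that by (simp add: square_def diff_diff_eq add.assoc)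
 have spsi2: "smooth psi2" using psi2 by (rule smooth_suppD)
 have psi2K: "psi2 \<in> smooth_supp KX" by (rule smooth_supp_mono[OF _ psi2]) (use sq e0 in blast)
 \<comment> \<open>Since \<open>psi\<close> vanishes where \<open>1 - psi2\<close> does not, the
   error off the square equals the operator with outer cutoff \<open>theta'\<close>. This exposes
   the distance that pseudolocality requires.\<close>
 define theta' where "theta' x = theta x * (1 - psi2 x)" for x
 have s1: "smooth (%x. 1 - psi2 x)" by (intro smooth_on_diff smooth_on_const open_UNIV spsi2)
 have theta': "theta' \<in> smooth_supp KX" unfolding theta'_def by (rule smooth_supp_mult[OF theta s1])
 have P': "Pop theta' kappa xi (c xi) x = (1 - psi2 x) * d xi x" if "xi \<in> W" for xi x
 proof -
  have "(1 - psi2 x) * psi x = 0"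
  proof (cases "psi x = 0")
   case False
   hence "x \<in> square x0 eps" using psi unfolding smooth_supp_def by blast
   hence "x \<in> square x0 (eps + delta)" using square_mono[of eps "eps + delta" x0] delta(1) by auto
   thus ?thesis using psi2_1 by simp
  qed simp
  hence "(1 - psi2 x) * d xi x = (1 - psi2 x) * P xi x" by (simp add: d_def right_diff_distrib mult.left_commute)
  thus ?thesis unfolding theta'_def[abs_def] Pop_mult P_def by (rule sym)
 qed
 interpret F: finite_order KX f Nf Cf by (rule f)
 define T1 where "T1 xi = v (%x. c xi x * fwave xi x)" for xi
 define T2 where "T2 xi = rem xi (c xi)" for xi
 define T3 where "T3 xi = f (%x. psi2 x * d xi x * fwave xi x)" for xi
 define T4 where "T4 xi = f (%x. Pop theta' kappa xi (c xi) x * fwave xi x)" for xi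
 have main: "of_real (snd xi) * f (%x. psi x * fwave xi x) = T1 xi + - T2 xi + (- T3 xi + - T4 xi)" if xi: "xi \<in> W" for xi
 proof -
  have a: "(%x. psi x * fwave xi x) \<in> smooth_supp KX" "(%x. d xi x * fwave xi x) \<in> smooth_supp KX"
   by (intro smooth_supp_mult psiK dK xi smooth_on_fwave)+
  have a': "(%x. of_real (snd xi) * (psi x * fwave xi x)) \<in> smooth_supp KX"
   by (intro smooth_supp_subset_mult a smooth_on_const open_UNIV)
  have a3: "(%x. psi2 x * d xi x * fwave xi x) \<in> smooth_supp KX"
   using dK[OF xi] by (intro smooth_supp_mult psi2K smooth_on_fwave) (simp add: smooth_supp_def)
  have a4: "(%x. Pop theta' kappa xi (c xi) x * fwave xi x) \<in> smooth_supp KX"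
   by (intro smooth_supp_mult Pop_smooth_supp theta' kappa cK xi smooth_on_fwave)
  have "T1 xi - T2 xi = f (%x. fwave xi x * P xi x)"
   unfolding T1_def T2_def P_def by (rule identity[OF cK[OF xi], symmetric])
  also have "(%x. fwave xi x * P xi x) = (%x. of_real (snd xi) * (psi x * fwave xi x) + d xi x * fwave xi x)"
   by (simp add: d_def fun_eq_iff algebra_simps)
  also have "f ... = of_real (snd xi) * f (%x. psi x * fwave xi x) + f (%x. d xi x * fwave xi x)"
   unfolding F.add[OF a' a(2)] F.cmult[OF a(1)] ..
  also have "(%x. d xi x * fwave xi x) = (%x. psi2 x * d xi x * fwave xi x + Pop theta' kappa xi (c xi) x * fwave xi x)"
   unfolding P'[OF xi] by (simp add: fun_eq_iff algebra_simps)
  also have "f ... = T3 xi + T4 xi" unfolding T3_def T4_def by (rule F.add[OF a3 a4])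
  finally show ?thesis by (simp add: algebra_simps)
 qed
 define C1 where "C1 = 1 + abs rho + eps"
 have C1: "C1 >= 0" "!!xi. xi \<in> sector sg rho eps ==> norm xi <= C1 * abs (snd xi)"
  using sector_norm(1)[of _ sg rho eps] eps by (auto simp: C1_def)
 have C1W: "norm xi <= C1 * abs (snd xi)" if "xi \<in> W" for xi using C1(2) We that by blast
 \<comment> \<open>Half the side of a square that contains \<open>KX\<close>; the period is taken
   larger to leave a margin.\<close>
 define l0 where "l0 = X0 + X2"
 have fb: "fourier_box (l0 + 1)" using params by unfold_locales (simp add: l0_def)
 have KXb: "KX \<subseteq> fourier_box.box l0"
  unfolding KX_def fourier_box.box_def[OF fb] l0_def using params by (intro Sigma_mono) auto
 interpret FB: finite_order_box KX f Nf Cf "l0 + 1" l0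
  using f fb KXb by (intro finite_order_box.intro finite_order_box_axioms.intro) auto
 interpret VB: finite_order_box KX v Nv Cv "l0 + 1" l0
  using v fb KXb by (intro finite_order_box.intro finite_order_box_axioms.intro) auto
 have T1: "weighted_L2 W (s' - 1) T1"
 proof -
  have phi0s: "smooth phi0" using phi0 by (rule smooth_suppD)
  \<comment> \<open>Regularity of \<open>Lf\<close> is known after multiplication by
    \<open>phi0\<close>, so \<open>psi\<close> is factored through it.\<close>
  obtain mu where mu: "mu \<in> smooth_supp (square x0 eps)" "!!x. phi0 x * mu x = psi x"
   by (rule smooth_supp_quotient[OF psi phi0s c0(1)]) (use c0(2) sq in blast)+
  have muK: "mu \<in> smooth_supp KX" by (rule smooth_supp_mono[OF _ mu(1)]) (use sq e0 in blast)
  obtain cs where cs: "cs > 0" "!!xi eta. xi \<in> sector sg rho eps ==> eta \<notin> sector sg rho e0 ==> cs * norm xi <= norm (xi - eta)"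
   by (rule sector_separation[of eps e0 sg rho]) (use eps in auto)
  have "weighted_L2 W (al - 1) (%xi. v (%x. phi0 x * (mu x * j xi x) * fwave xi x))"
  proof (rule VB.schur[OF phi0 _ _ cs(1)])
   have "unif_Ck k UNIV UNIV W (%xi. mu)" for k
    by (rule smooth_supp_unif_Ck[OF muK compact_KX])
   hence "unif_Ck k UNIV UNIV W (%xi x. mu x * j xi x)" for k by (intro unif_Ck_times j)
   thus "unif_Ck k UNIV (fourier_box.box (l0 + 1)) W (%xi x. mu x * j xi x)" for k
    by (rule unif_Ck_mono) auto
   show "mu x * j xi x = 0" if "x \<notin> fourier_box.box l0" for xi x
   proof -
    have "x \<notin> KX" using that KXb by blast
    hence "mu x = 0" using muK unfolding smooth_supp_def by blast
    thus ?thesis by simp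
   qed
   show "weighted_L2 (sector sg rho e0) (al - 1) (finite_order.hat v phi0)" using v_L2 unfolding finite_order.hat_def[OF v, abs_def] .
   show "cs * norm xi <= norm (xi - eta)" if "xi \<in> W" "eta \<notin> sector sg rho e0" for xi eta
    using cs(2) We that by blast
  qed
  thus ?thesis
  proof (rule weighted_L2_mono[OF _ order_refl])
   fix xi
   have "(%x. phi0 x * (mu x * j xi x) * fwave xi x) = (%x. c xi x * fwave xi x)"
    unfolding c_def mu(2)[symmetric] by (simp add: mult.assoc)
   moreover have "jb (s' - 1) xi <= jb (al - 1) xi" using s' by (intro jb_mono) simp
   ultimately show "(norm (T1 xi))^2 * jb (s' - 1) xi <= 1 * ((norm (v (%x. phi0 x * (mu x * j xi x) * fwave xi x)))^2 * jb (al - 1) xi)"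
    unfolding T1_def by (simp add: mult_left_mono)
  qed
 qed
 have T2: "weighted_L2 W (s' - 1) T2"
  by (rule weighted_L2_rapid[OF C1W C1(1)]) (use rem[OF ck ce] We sub in \<open>auto simp: T2_def\<close>)
 have T3: "weighted_L2 W (s' - 1) T3"
 proof -
  obtain cs where cs: "cs > 0" "!!xi eta. xi \<in> sector sg rho eps ==> eta \<notin> sector sg rho eps' ==> cs * norm xi <= norm (xi - eta)"
   by (rule sector_separation[OF eps(1,2), of sg rho]) (rule that)
  have "weighted_L2 W s T3" unfolding T3_def
  proof (rule FB.schur[OF psi2K _ _ cs(1)])
   show "unif_Ck k UNIV (fourier_box.box (l0 + 1)) W d" for k
    by (rule unif_Ck_mono[OF dk']) auto
   show "d xi x = 0" if "xi \<in> W" "x \<notin> fourier_box.box l0" for xi x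
    using dK[OF that(1)] that(2) KXb unfolding smooth_supp_def by blast
   show "weighted_L2 (sector sg rho eps') s (finite_order.hat f psi2)" using s psi2 unfolding claim_def finite_order.hat_def[OF f, abs_def] by blast
   show "cs * norm xi <= norm (xi - eta)" if "xi \<in> W" "eta \<notin> sector sg rho eps'" for xi eta
    using cs(2) We that by blast
  qed
  thus ?thesis
  proof (rule weighted_L2_mono[OF _ order_refl])
   fix xi :: "R2"
   have "jb (s' - 1) xi <= jb s xi" using s' by (intro jb_mono) simp
   thus "(norm (T3 xi))^2 * jb (s' - 1) xi <= 1 * ((norm (T3 xi))^2 * jb s xi)" by (simp add: mult_left_mono)
  qed
 qed
 have T4: "weighted_L2 W (s' - 1) T4"
 proof (rule weighted_L2_rapid[OF C1W C1(1)])
  fix M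
  show "\<exists>C. \<forall>xi\<in>W. (1 + abs (snd xi)) ^ M * norm (T4 xi) <= C"
   unfolding T4_def
  proof (rule functional_decay[OF f _ _ C1W C1(1)])
   show "Pop theta' kappa xi (c xi) \<in> smooth_supp KX" if "xi \<in> W" for xi by (rule Pop_smooth_supp[OF theta' kappa cK[OF that]])
   fix M' and vs :: "R2 list" assume vs: "dirs vs"
   show "\<exists>B. \<forall>xi\<in>W. \<forall>x. (1 + abs (snd xi)) ^ M' * norm (iter_deriv vs (Pop theta' kappa xi (c xi)) x) <= B"
   proof (rule Pop_decay[OF theta' kappa ck cK delta(1) _ compact_imp_closed[OF compact_square] _ vs])
    show "x \<in> square x0 eps" if "xi \<in> W" "c xi x ~= 0" for xi x using ceps[OF that(1)] that(2) unfolding smooth_supp_def by blast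
    show "delta <= dist x' x" if "theta' x ~= 0" "x' \<in> square x0 eps" for x x'
    proof (rule square_separated[OF that(2)])
     show "x \<notin> square x0 (eps + delta)" using psi2_1[of x] that(1) by (auto simp: theta'_def)
    qed
   qed
  qed
 qed
 have "weighted_L2 W (s' - 1) (%xi. T1 xi + - T2 xi + (- T3 xi + - T4 xi))"
  by (intro weighted_L2_add weighted_L2_minus T1 T2 T3 T4)
 hence "weighted_L2 W s' (%xi. f (%x. psi x * fwave xi x))"
 proof (rule weighted_L2_mono[OF _ order_refl])
  fix xi assume xi: "xi \<in> W"
  let ?f = "norm (f (%x. psi x * fwave xi x))"
  have n: "norm (T1 xi + - T2 xi + (- T3 xi + - T4 xi)) = abs (snd xi) * ?f"
   unfolding main[OF xi, symmetric] by (simp add: norm_mult)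
  \<comment> \<open>In the truncated sector \<open>abs (snd xi)\<close> dominates
    \<open>norm xi\<close> and 1 up to constants, so its square supplies the factor
    \<open>1 + (norm xi)^2\<close>, that is, one order.\<close>
  have "1 <= e0 * abs (snd xi)" using xi e0(1) by (auto simp: W_def field_simps)
  hence "1 <= (e0 * abs (snd xi))^2" by (simp add: one_le_power)
  moreover have "(norm xi)^2 <= (C1 * abs (snd xi))^2" using C1W[OF xi] by (intro power_mono) auto
  ultimately have "1 + (norm xi)^2 <= (e0^2 + C1^2) * abs (snd xi)^2" by (simp add: power_mult_distrib algebra_simps)
  hence "?f^2 * (1 + (norm xi)^2) <= ?f^2 * ((e0^2 + C1^2) * abs (snd xi)^2)" by (rule mult_left_mono) simp
  hence "?f^2 * (1 + (norm xi)^2) * jb (s' - 1) xi <= ?f^2 * ((e0^2 + C1^2) * abs (snd xi)^2) * jb (s' - 1) xi"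
   using jb_pos[of "s' - 1" xi] by (intro mult_right_mono) auto
  moreover have "jb s' xi = (1 + (norm xi)^2) * jb (s' - 1) xi"
   using jb_add[of 1 "s' - 1" xi] by (simp add: jb_def[of 1] add_nonneg_nonneg)
  ultimately show "?f^2 * jb s' xi <= (e0^2 + C1^2) * ((norm (T1 xi + - T2 xi + (- T3 xi + - T4 xi)))^2 * jb (s' - 1) xi)"
   unfolding n by (simp add: power_mult_distrib mult_ac)
 qed
 moreover have "weighted_L2 (sector sg rho eps - W) s' (%xi. f (%x. psi x * fwave xi x))"
 proof -
  obtain D where D: "D >= 0" "!!xi. norm (f (%x. psi x * fwave xi x)) <= D * (1 + norm xi) ^ Nf"
   by (rule f_growth[OF psi]) (use eps in auto)
  show ?thesis
  proof (rule weighted_L2_bounded[OF D(2) _ D(1)])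
   fix xi assume "xi \<in> sector sg rho eps - W"
   hence "xi \<in> sector sg rho eps" "abs (snd xi) <= 1 / e0" by (auto simp: W_def)
   thus "norm xi <= C1 * (1 / e0)" using C1 by (meson mult_left_mono order_trans)
  qed
 qed
 ultimately have "weighted_L2 (W \<union> (sector sg rho eps - W)) s' (%xi. f (%x. psi x * fwave xi x))" by (rule weighted_L2_Un)
 moreover have "W \<union> (sector sg rho eps - W) = sector sg rho eps" using We by blast
 ultimately show "weighted_L2 (sector sg rho eps) s' (%xi. f (%x. psi x * fwave xi x))" by simp
qed

text \<open>Finitely many steps lead from the initial order to \<open>al\<close>. A step at
  \<open>eps\<close> uses the claim halfway between \<open>eps\<close> and \<open>e0\<close>, so
  every \<open>eps\<close> below \<open>e0\<close> is reached.\<close>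

lemma bootstrap:
 assumes "0 < eps" "eps < e0"
 shows "claim al eps"
proof -
 define s where "s n = min al (- real Nf - 2 + real n)" for n
 have "claim (s n) eps" if "0 < eps" "eps < e0" for n eps
  using that
 proof (induction n arbitrary: eps)
  case 0
  thus ?case by (intro claim_start) (auto simp: s_def)
 next
  case (Suc n)
  have "claim (s n) ((eps + e0) / 2)" using Suc.prems by (intro Suc.IH) auto
  from claim_step[OF Suc.prems(1) _ _ this, of "s (Suc n)"] show ?case using Suc.prems by (auto simp: s_def)
 qed
 moreover obtain n :: nat where "al + real Nf + 2 <= real n" using real_arch_simple by blast
 hence "s n = al" by (simp add: s_def)
 ultimately show ?thesis using assms by metis
qed

end

section \<open>Geometry of the canonical relation\<close>

lemma real_divide_abs: "(z::real) / abs z = sgn z"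
 by (simp add: sgn_if)

context cone_reg
begin

lemma deriv_Q: "deriv Q t = Q t * G t"
 using Q_pos[of t] by (simp add: G_def)

text \<open>On the curve the stationarity condition reads \<open>xi1 = - xi2 * x2 * G t\<close>.
  Since \<open>G t\<close> is not 0 for \<open>abs t > tau\<close>, neither component of the
  covector vanishes; the moduli determine \<open>abs t\<close> through \<open>g\<close>, and the
  signs determine the sign of \<open>t\<close>.\<close>

lemma critical_point:
 assumes E: "E * Q t = x2" "0 < E" "E <= b1" "eta <= x2"
  and crit: "xi1 + xi2 * (E * deriv Q t) = 0" and nz: "(xi1, xi2) ~= 0"
 shows "xi1 ~= 0" "xi2 ~= 0" "abs xi1 / (x2 * abs xi2) = g (abs t)" "abs t > 0" "t = abs t * (- (xi1 * xi2) / abs (xi1 * xi2))" "E = x2 / q (abs t)"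
proof -
 have t: "abs t > tau" using Q_large[of E t] E by simp
 thus t0: "abs t > 0" using params by simp
 have g0: "g (abs t) > 0" by (rule g_pos[OF t0])
 have x2: "x2 > 0" using E(4) params by simp
 have "E * deriv Q t = x2 * G t" using E(1) by (simp add: deriv_Q)
 hence xi1: "xi1 = - xi2 * (x2 * (sgn t * g (abs t)))" using crit G_eq[OF t] by simp
 have s: "sgn t ~= 0" using t0 by (simp add: sgn_if)
 show n2: "xi2 ~= 0" using nz xi1 by (auto simp: zero_prod_def)
 show n1: "xi1 ~= 0" unfolding xi1 using n2 x2 s g0 by simp
 have "abs xi1 = abs xi2 * (x2 * g (abs t))" unfolding xi1 using x2 s g0 t0 by (simp add: abs_mult abs_sgn_eq)
 thus "abs xi1 / (x2 * abs xi2) = g (abs t)" using n2 x2 by simp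
 have "sgn (xi1 * xi2) = - sgn t"
  unfolding xi1 using n2 x2 g0 by (simp add: sgn_mult mult.commute[of "sgn xi2"] mult.assoc)
 hence "- (xi1 * xi2) / abs (xi1 * xi2) = sgn t" using real_divide_abs[of "xi1 * xi2"] by (simp only: divide_minus_left minus_minus)
 thus "t = abs t * (- (xi1 * xi2) / abs (xi1 * xi2))" using t0 by (simp add: abs_mult_sgn)
 show "E = x2 / q (abs t)" using E(1) Q_eq[OF t] q_pos[OF t0] by (auto simp: field_simps)
qed

text \<open>Conversely, the parameter formed from \<open>r\<close> and \<open>om\<close> lies beyond
  \<open>tau\<close>, where \<open>Q\<close> and \<open>G\<close> are given by \<open>q\<close> and
  \<open>g\<close>, and solves the stationarity equation.\<close>

lemma critical_point_exists:
 assumes r: "r > 0" "g r = abs xi1 / (x2 * abs xi2)" and xi: "xi1 ~= 0" "xi2 ~= 0" and x2: "eta <= x2" "x2 / q r <= b1"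
  and om: "om = - (xi1 * xi2) / abs (xi1 * xi2)"
 shows "Q (r * om) = q r" "x2 * G (r * om) + xi1 / xi2 = 0"
proof -
 have om2: "om = - (sgn xi1 * sgn xi2)" unfolding om using real_divide_abs[of "xi1 * xi2"] by (simp only: divide_minus_left sgn_mult)
 have om1: "abs om = 1" "sgn om = om" using xi unfolding om2 by (auto simp: sgn_if)
 have a: "abs (r * om) = r" using r(1) om1 by (simp add: abs_mult)
 have "x2 / q r * q (abs (r * om)) >= eta" using q_pos[OF r(1)] x2 by (simp add: a)
 from q_large[OF this x2(2)] have l: "abs (r * om) > tau" .
 show "Q (r * om) = q r" using Q_eq[OF l] by (simp add: a)
 have "G (r * om) = om * g r" using G_eq[OF l] r(1) om1 by (simp add: a sgn_mult)
 hence "x2 * G (r * om) = om * (abs xi1 / abs xi2)" using r(2) x2(1) params by simp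
 also have "... = - (xi1 / xi2)" using xi unfolding om2 by (auto simp: sgn_if)
 finally show "x2 * G (r * om) + xi1 / xi2 = 0" by simp
qed

text \<open>The sum of the defect of the incidence relation and the modulus of the phase derivative
  is continuous and, at the given covector, positive on the compact set \<open>P\<close>. By uniform
  continuity it stays bounded below nearby, and on the incidence relation only the second summand is
  left.\<close>

lemma nondegenerate:
 assumes P: "compact P"
  and nd: "!!E y. (E, y) \<in> P ==> E * Q (fst x0 - y) = snd x0 ==> fst xi0 + snd xi0 * (E * deriv Q (fst x0 - y)) ~= 0"
 obtains c delta where "c > 0" "delta > 0"
  "!!E y x xi. (E, y) \<in> P ==> dist x x0 < delta ==> dist xi xi0 < delta ==> E * Q (fst x - y) = snd x ==>
   c <= abs (fst xi + snd xi * (E * deriv Q (fst x - y)))"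
proof -
 define H where "H p = abs (snd (fst (snd p)) - fst (fst p) * Q (fst (fst (snd p)) - snd (fst p))) +
  (abs (fst (snd (snd p)) + snd (snd (snd p)) * (fst (fst p) * deriv Q (fst (fst (snd p)) - snd (fst p)))))"
  for p :: "R2 \<times> R2 \<times> R2"
 have Hc: "continuous_on A H" for A unfolding H_def
  by (intro continuous_intros continuous_on_compose2[OF Q_cont(1)] continuous_on_compose2[OF Q_cont(2)]) auto
 obtain m where m: "m > 0" "!!z. z \<in> P ==> m <= H (z, x0, xi0)"
 proof (cases "P = {}")
  case True
  show ?thesis by (rule that[of 1]) (use True in auto)
 next
  case False
  have "continuous_on P (%z. H (z, x0, xi0))" by (rule continuous_on_compose2[OF Hc[of UNIV]]) (auto intro!: continuous_intros)
  from continuous_attains_inf[OF P False this] obtain z0 where z0: "z0 \<in> P" "\<forall>z\<in>P. H (z0, x0, xi0) <= H (z, x0, xi0)" by blast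
  have "H (z0, x0, xi0) ~= 0"
  proof
   assume "H (z0, x0, xi0) = 0"
   hence "abs (snd x0 - fst z0 * Q (fst x0 - snd z0)) = 0" "abs (fst xi0 + snd xi0 * (fst z0 * deriv Q (fst x0 - snd z0))) = 0"
    unfolding H_def by (simp_all add: add_nonneg_eq_0_iff)
   thus False using nd[of "fst z0" "snd z0"] z0(1) by simp
  qed
  moreover have "H (z0, x0, xi0) >= 0" by (simp add: H_def)
  ultimately show ?thesis using z0(2) by (intro that[of "H (z0, x0, xi0)"]) auto
 qed
 let ?K = "P \<times> cball x0 1 \<times> cball xi0 1"
 have "uniformly_continuous_on ?K H"
  by (intro compact_uniformly_continuous Hc compact_Times P compact_cball)
 then obtain d where d: "d > 0" "!!p p'. p \<in> ?K ==> p' \<in> ?K ==> dist p' p < d ==> dist (H p') (H p) < m / 2"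
  unfolding uniformly_continuous_on_def using half_gt_zero[OF m(1)] by metis
 show ?thesis
 proof (rule that[of "m / 2" "min 1 (d / 2)"])
  fix E y x xi
  assume a: "(E, y) \<in> P" "dist x x0 < min 1 (d / 2)" "dist xi xi0 < min 1 (d / 2)" "E * Q (fst x - y) = snd x"
  have "dist ((E, y), x, xi) ((E, y), x0, xi0) = dist (x, xi) (x0, xi0)" by (simp add: dist_prod_def)
  also have "... <= dist x x0 + dist xi xi0" unfolding dist_Pair_Pair by (rule sqrt_sum_squares_le_sum) simp_all
  also have "... < d" using a(2,3) by simp
  finally have "dist (H ((E, y), x, xi)) (H ((E, y), x0, xi0)) < m / 2"
   using a by (intro d(2)) (auto simp: dist_commute)
  hence "m / 2 <= H ((E, y), x, xi)" using m(2)[OF a(1)] by (simp add: dist_real_def abs_if split: if_splits)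
  also have "H ((E, y), x, xi) = abs (fst xi + snd xi * (E * deriv Q (fst x - y)))" using a(4) by (simp add: H_def)
  finally show "m / 2 <= abs (fst xi + snd xi * (E * deriv Q (fst x - y)))" .
 qed (use m d in auto)
qed

lemma KY_subset: "KY \<subseteq> Y_space" and KX_subset: "KX \<subseteq> X_space"
 using params by (auto simp: KX_def KY_def X_space_def Y_space_def)

text \<open>The transform of \<open>psi\<close> is smooth on Y but in general not compactly
  supported. Since \<open>w\<close> vanishes off \<open>A\<close>, it may be multiplied by a cutoff
  supported in \<open>KY\<close>, where the regularised transform takes over.\<close>

lemma reconstruction_eq:
 assumes w: "compact_distr Y_space Kw w Nw Cw" and A: "compact A" "A \<subseteq> Y_space"
  and v0: "!!phi. phi \<in> test_functions (Y_space - A) ==> w phi = 0"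
  and theta: "theta \<in> smooth_supp KY" "open U" "A \<subseteq> U" "!!p. p \<in> U ==> theta p = 1"
  and psi: "psi \<in> smooth_supp KX"
 shows "w (cone_radon q psi) = w (%p. theta p * Rt psi p)"
proof -
 have s: "smooth_on Y_space (cone_radon q psi)"
  using smooth_cone_radon[of psi X0 eta X2] psi params by (simp add: KX_def)
 have "w (cone_radon q psi) = w (%p. theta p * cone_radon q psi p)"
  by (rule compact_distr.localise[OF w refl A v0 theta(1) compact_KY KY_subset theta(2,3,4) s])
 also have "(%p. theta p * cone_radon q psi p) = (%p. theta p * Rt psi p)"
 proof
  fix p
  show "theta p * cone_radon q psi p = theta p * Rt psi p"
  proof (cases "p \<in> KY")
   case True
   thus ?thesis using cone_radon_eq[OF psi, of "fst p" "snd p"] params by (auto simp: KY_def abs_le_iff)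
  next
   case False
   hence "theta p = 0" using theta(1) unfolding smooth_supp_def by blast
   thus ?thesis by simp
  qed
 qed
 finally show ?thesis .
qed

text \<open>Non-stationarity at one covector extends to a neighbourhood by compactness and to a cone
  of frequencies by homogeneity, with the scale \<open>norm xi\<close>.\<close>

lemma radon_smooth_direction:
 assumes w: "finite_order KY w N C" and theta: "theta \<in> smooth_supp KY" and P: "compact P" "!!p. theta p ~= 0 ==> p \<in> P"
  and nd: "!!E y. (E, y) \<in> P ==> E * Q (fst x0 - y) = snd x0 ==> fst xi0 + snd xi0 * (E * deriv Q (fst x0 - y)) ~= 0"
  and xi0: "xi0 ~= 0"
 obtains delta where "delta > 0" "!!phi M. phi \<in> smooth_supp KX ==> (!!x. phi x ~= 0 ==> dist x x0 < delta) ==>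
  \<exists>B. \<forall>zeta\<in>ball xi0 delta. \<forall>t>0. (1 + t) ^ M * norm (w (%p. theta p * Rt (%x. phi x * fwave (t *\<^sub>R zeta) x) p)) <= B"
proof -
 obtain c delta1 where c: "c > 0" "delta1 > 0"
  "!!E y x xi. (E, y) \<in> P ==> dist x x0 < delta1 ==> dist xi xi0 < delta1 ==> E * Q (fst x - y) = snd x ==>
   c <= abs (fst xi + snd xi * (E * deriv Q (fst x - y)))"
  using nondegenerate[OF P(1) nd] by blast
 define delta where "delta = min delta1 (norm xi0 / 2)"
 have delta: "delta > 0" "delta <= delta1" "delta <= norm xi0 / 2" using c(2) xi0 by (auto simp: delta_def)
 have nb: "norm xi0 / 2 < norm zeta" "norm zeta < 2 * norm xi0" if "zeta \<in> ball xi0 delta" for zeta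
 proof -
  have "norm (xi0 - zeta) < norm xi0 / 2" using that delta(3) by (simp add: dist_norm)
  thus "norm xi0 / 2 < norm zeta" "norm zeta < 2 * norm xi0"
   using norm_triangle_ineq2[of xi0 zeta] norm_triangle_ineq2[of zeta xi0] by (simp_all add: norm_minus_commute)
 qed
 define n0 where "n0 = norm xi0"
 have n0: "n0 > 0" using xi0 by (simp add: n0_def)
 show ?thesis
 proof (rule that[OF delta(1)])
  fix phi M assume phi: "phi \<in> smooth_supp KX" "!!x. phi x ~= 0 ==> dist x x0 < delta"
  \<comment> \<open>The cone over the ball of directions; the ball stays away from 0, so decay in
    \<open>norm xi\<close> is decay in \<open>t\<close>.\<close>
  define V where "V = {t *\<^sub>R zeta | t zeta. t > 0 & zeta \<in> ball xi0 delta}"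
  have phik: "unif_Ck k UNIV UNIV V (%xi. phi)" for k
   by (rule smooth_supp_unif_Ck[OF phi(1) compact_KX])
  have "\<exists>C. \<forall>xi\<in>V. (1 + norm xi) ^ M * norm (w (%p. theta p * Rt (%x. phi x * fwave xi x) p)) <= C"
  proof (rule radon_decay[OF w theta phik phi(1)])
   show "norm xi > 0" if xiV: "xi \<in> V" for xi
   proof -
    obtain u zeta where u: "xi = u *\<^sub>R zeta" "u > 0" "zeta \<in> ball xi0 delta" using xiV unfolding V_def by blast
    have "norm zeta > 0" using nb(1)[OF u(3)] n0 unfolding n0_def by linarith
    thus ?thesis using u(1,2) by simp
   qed
   show "norm xi <= 1 * norm xi" for xi :: "R2" by simp
   show "c / (2 * n0) > 0" using c(1) n0 by simp
   fix xi E y t assume a: "xi \<in> V" "theta (E, y) ~= 0" "phi (y + t, E * Q t) ~= 0"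
   obtain u zeta where u: "xi = u *\<^sub>R zeta" "u > 0" "zeta \<in> ball xi0 delta" using a(1) unfolding V_def by blast
   have "c <= abs (fst zeta + snd zeta * (E * deriv Q t))"
    using c(3)[OF P(2)[OF a(2)], of "(y + t, E * Q t)" zeta] phi(2)[OF a(3)] u(3) delta(2) by (simp add: dist_commute)
   moreover have "norm zeta <= 2 * n0" using nb(2)[OF u(3)] by (simp add: n0_def)
   hence "c / (2 * n0) * norm zeta <= c" using c(1) n0 by (simp add: divide_le_eq mult_left_mono)
   ultimately have "u * (c / (2 * n0) * norm zeta) <= u * abs (fst zeta + snd zeta * (E * deriv Q t))"
    using u(2) by (intro mult_left_mono) auto
   also have "... = abs (u * (fst zeta + snd zeta * (E * deriv Q t)))" using u(2) by (simp add: abs_mult)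
   finally show "c / (2 * n0) * norm xi <= abs (fst xi + snd xi * (E * deriv Q t))"
    using u(2) by (simp add: u(1) algebra_simps)
  qed
  then obtain B where B: "!!xi. xi \<in> V ==> (1 + norm xi) ^ M * norm (w (%p. theta p * Rt (%x. phi x * fwave xi x) p)) <= B" by blast
  \<comment> \<open>Chosen so that \<open>1 + t\<close> is at most \<open>k\<close> times one plus
    the norm of \<open>t\<close> times \<open>zeta\<close>, in view of
    \<open>norm zeta > n0 / 2\<close>.\<close>
  define k where "k = 1 + 2 / n0"
  have k: "k >= 1" using n0 by (simp add: k_def)
  have "(1 + t) ^ M * norm (w (%p. theta p * Rt (%x. phi x * fwave (t *\<^sub>R zeta) x) p)) <= k ^ M * B" if zeta: "zeta \<in> ball xi0 delta" and t: "t > 0" for zeta t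
  proof -
   let ?w = "norm (w (%p. theta p * Rt (%x. phi x * fwave (t *\<^sub>R zeta) x) p))"
   have "t * (n0 / 2) <= t * norm zeta" using nb(1)[OF zeta] t by (simp add: n0_def)
   hence "t <= 2 / n0 * norm (t *\<^sub>R zeta)" using n0 t by (simp add: field_simps)
   moreover have "k * (1 + norm (t *\<^sub>R zeta)) = 1 + 2 / n0 + norm (t *\<^sub>R zeta) + 2 / n0 * norm (t *\<^sub>R zeta)"
    unfolding k_def by (simp only: distrib_right distrib_left mult_1 mult_1_right add.assoc)
   moreover have "2 / n0 >= 0" using n0 by simp
   ultimately have "1 + t <= k * (1 + norm (t *\<^sub>R zeta))" using norm_ge_zero[of "t *\<^sub>R zeta"] by linarith
   hence "(1 + t) ^ M <= (k * (1 + norm (t *\<^sub>R zeta))) ^ M" using t by (intro power_mono) auto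
   hence "(1 + t) ^ M * ?w <= k ^ M * (1 + norm (t *\<^sub>R zeta)) ^ M * ?w" by (intro mult_right_mono) (simp_all add: power_mult_distrib)
   also have "... <= k ^ M * B"
    unfolding mult.assoc
   proof (intro mult_left_mono B)
    show "t *\<^sub>R zeta \<in> V" using zeta t unfolding V_def by blast
   qed (use k in simp)
   finally show ?thesis .
  qed
  thus "\<exists>B. \<forall>zeta\<in>ball xi0 delta. \<forall>t>0. (1 + t) ^ M * norm (w (%p. theta p * Rt (%x. phi x * fwave (t *\<^sub>R zeta) x) p)) <= B" by blast
 qed
qed

lemma second_derivative_distr:
 "distr_deriv (1, 0) (distr_deriv (1, 0) (cone_radon_distr q f)) phi =
  f (cone_backprojection q (%z. fderiv (%z. fderiv phi z (1, 0)) z (1, 0)))"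
 by (simp add: distr_deriv_def cone_radon_distr_def)

lemma osc_radon_smooth_supp:
 assumes "admissible beta"
 shows "osc_radon xi beta \<in> smooth_supp KY"
proof -
 have "osc_radon xi beta z = 0" if "z \<notin> KY" for z
 proof -
  have "beta (z, t) = 0" for t using admissible_D(1)[OF assms, of z t] that by blast
  thus ?thesis by (simp add: osc_radon_def)
 qed
 thus ?thesis using assms smooth_osc_radon[of beta xi] by (simp add: smooth_supp_def admissible_def)
qed

text \<open>Inside \<open>W\<close>, where \<open>h\<close> is 1, the product is the second
  \<open>E\<close>-derivative of \<open>R f\<close>. Both derivatives fall on the test function,
  where their signs cancel, and \<open>R\<close> becomes the backprojection. A cutoff equal to 1
  near \<open>Kf\<close> replaces the backprojection by its regularisation.\<close>

lemma elliptic_identity: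
 assumes f: "compact_distr X_space Kf f Nf Cf"
  and w: "is_distr_product Y_space h (distr_deriv (1, 0) (distr_deriv (1, 0) (cone_radon_distr q f))) w"
  and W: "open W" "W \<subseteq> Y_space" "!!p. p \<in> W ==> h p = 1"
  and kappa: "kappa \<in> smooth_supp KY" "compact K" "K \<subseteq> W" "!!p. p \<notin> K ==> kappa p = 0"
  and theta: "theta \<in> smooth_supp KX" "open U" "Kf \<subseteq> U" "!!x. x \<in> U ==> theta x = 1"
  and psi: "psi \<in> smooth_supp KX"
 shows "w (%p. kappa p * Rt (%x. psi x * fwave xi x) p) = f (%x. fwave xi x * Pop theta kappa xi psi x)"
proof -
 define beta where "beta = radon_amp kappa psi"
 have a: "admissible beta" unfolding beta_def by (rule admissible_radon_amp[OF kappa(1) psi])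
 have a1: "admissible (DE xi beta)" and a2: "admissible (DE xi (DE xi beta))" by (intro admissible_DE a)+
 have eq: "(%p. kappa p * Rt (%x. psi x * fwave xi x) p) = osc_radon xi beta"
  unfolding beta_def by (rule ext) (rule osc_radon_eq)
 have sd: "smooth (osc_radon xi beta)" using osc_radon_smooth_supp[OF a] by (rule smooth_suppD)
 have "osc_radon xi beta \<in> smooth_supp K"
  using sd kappa(4) unfolding eq[symmetric] smooth_supp_def by simp
 hence t: "osc_radon xi beta \<in> test_functions W" by (rule smooth_supp_test_functions[OF _ kappa(2,3)])
 have D1: "(%z. fderiv (osc_radon xi beta) z (1, 0)) = osc_radon xi (DE xi beta)"
  using a by (intro ext deriv_osc_radon) (simp add: admissible_def)
 have D2: "(%z. fderiv (osc_radon xi (DE xi beta)) z (1, 0)) = osc_radon xi (DE xi (DE xi beta))"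
  using a1 by (intro ext deriv_osc_radon) (simp add: admissible_def)
 let ?g = "osc_radon xi (DE xi (DE xi beta))"
 have g: "?g \<in> smooth_supp KY" by (rule osc_radon_smooth_supp[OF a2])
 have "w (osc_radon xi beta) = f (cone_backprojection q ?g)"
  using is_distr_product_const[OF w W(1,2,3) t] by (simp add: second_derivative_distr D1 D2)
 also have "... = f (%x. theta x * Rst ?g x)"
 proof (rule compact_distr.local_eq[OF f _ _ theta(2,3)])
  show "smooth_on X_space (cone_backprojection q ?g)"
   using smooth_cone_backprojection[of ?g a1 b1 Y0] g params by (simp add: KY_def)
  have "smooth (%x. theta x * Rst ?g x)"
   using theta(1) g by (intro smooth_on_mult open_UNIV smooth_Rst) (auto simp: smooth_supp_def)
  thus "smooth_on X_space (%x. theta x * Rst ?g x)"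
   by (rule smooth_on_subset[OF open_UNIV open_X_space subset_UNIV])
  fix x assume x: "x \<in> U"
  hence "theta x ~= 0" using theta(4) by simp
  hence "x \<in> KX" using theta(1) unfolding smooth_supp_def by blast
  thus "cone_backprojection q ?g x = theta x * Rst ?g x"
   using cone_backprojection_eq[OF g, of "snd x" "fst x"] theta(4)[OF x] by (auto simp: KX_def)
 qed
 also have "(%x. theta x * Rst ?g x) = (%x. fwave xi x * Pop theta kappa xi psi x)"
  unfolding osc_radon_def[abs_def] Pop_def beta_def[symmetric] by (rule ext) (rule Rst_osc[OF a2 theta(1)])
 finally show ?thesis unfolding eq .
qed

end

section \<open>Wavefront sets\<close>

text \<open>The distance from the closed rectangle is positive; a quarter of it still leaves the
  point outside the enlarged rectangle.\<close>

lemma box_margin: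
 fixes E y a b l u e :: real
 assumes "(E, y) \<notin> {a..b} \<times> {l..u}" "e > 0"
 obtains delta where "delta > 0" "delta <= e" "(E, y) \<notin> {a - 2 * delta..b + 2 * delta} \<times> {l - 2 * delta..u + 2 * delta}"
proof -
 define d where "d = max (max (a - E) (E - b)) (max (l - y) (y - u))"
 have d: "d > 0" using assms(1) by (auto simp: d_def less_max_iff_disj not_le)
 show ?thesis
 proof (rule that[of "min e (d / 4)"])
  show "(E, y) \<notin> {a - 2 * min e (d / 4)..b + 2 * min e (d / 4)} \<times> {l - 2 * min e (d / 4)..u + 2 * min e (d / 4)}"
  proof
   assume "(E, y) \<in> {a - 2 * min e (d / 4)..b + 2 * min e (d / 4)} \<times> {l - 2 * min e (d / 4)..u + 2 * min e (d / 4)}"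
   hence "d <= 2 * min e (d / 4)" by (simp add: d_def algebra_simps del: min_mult_distrib_left)
   thus False using d by linarith
  qed
 qed (use d assms(2) in auto)
qed

lemma fourier_cutoff_fwave: "fourier_cutoff u phi xi = u (%x. phi x * fwave xi x)"
 by (simp add: fourier_cutoff_def fwave_def mult.commute)

context cone
begin

text \<open>Off the closed set \<open>A\<close> the characteristic function is the constant
  0.\<close>

lemma product_vanishes:
 assumes f: "f \<in> compactly_supported_distributions X_space"
  and w: "is_distr_product Y_space (indicator A) (distr_deriv (1, 0) (distr_deriv (1, 0) (cone_radon_distr q f))) w"
  and A: "closed A" and phi: "phi \<in> test_functions (Y_space - A)"
 shows "w phi = 0"
proof -
 obtain Kf Nf Cf where "compact_distr X_space Kf f Nf Cf" using compact_distr_obtain[OF f open_X_space] .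
 then interpret f: compact_distr X_space Kf f Nf Cf .
 have "w phi = distr_deriv (1, 0) (distr_deriv (1, 0) (cone_radon_distr q f)) (%y. 0 * phi y)"
  by (rule is_distr_product_const[OF w _ _ _ phi]) (use A open_Y_space in auto)
 also have "... = 0"
  by (simp add: distr_deriv_def cone_radon_distr_def frechet_derivative_const cone_backprojection_def
    set_lebesgue_integral_def case_prod_unfold f.zero)
 finally show ?thesis .
qed

end

context cone_reg
begin

lemma reconstruction_cutoff:
 assumes f: "f \<in> compactly_supported_distributions X_space" and abc: "0 < a" "a < b" "0 < c"
  and w: "is_distr_product Y_space (indicator ({a..b} \<times> {-c..c})) (distr_deriv (1, 0) (distr_deriv (1, 0) (cone_radon_distr q f))) w"
  and delta: "delta > 0" "{a - 2 * delta..b + 2 * delta} \<times> {-c - 2 * delta..c + 2 * delta} \<subseteq> KY" (is "?P \<subseteq> KY")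
 obtains theta where "theta \<in> smooth_supp ?P" "theta \<in> smooth_supp KY" "!!p. p \<in> {a..b} \<times> {-c..c} ==> theta p = 1"
  "!!psi. psi \<in> smooth_supp KX ==> cone_backprojection_distr q w psi = w (%p. theta p * Rt psi p)"
proof (rule that)
 let ?A = "{a..b} \<times> {-c..c}" and ?theta = "%p. complex_of_real (cutoff delta a b (-c) c p)"
 define U where "U = {a - delta<..<b + delta} \<times> {-c - delta<..<c + delta}"
 have A: "compact ?A" "?A \<subseteq> Y_space" using abc by (auto simp: Y_space_def intro: compact_Times)
 have U: "open U" "?A \<subseteq> U" unfolding U_def using delta(1) by (auto intro: open_Times)
 have U1: "?theta p = 1" if "p \<in> U" for p
 proof -
  have "p \<in> {a - delta..b + delta} \<times> {-c - delta..c + delta}" using that unfolding U_def by auto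
  thus ?thesis using cutoff_eq_1[OF delta(1)] by simp
 qed
 show "?theta \<in> smooth_supp ?P" by (rule cutoff_smooth_supp[OF delta(1)]) simp
 thus theta: "?theta \<in> smooth_supp KY" by (rule smooth_supp_mono[OF delta(2)])
 show "?theta p = 1" if "p \<in> ?A" for p by (rule U1) (use that U in blast)
 have wc: "w \<in> compactly_supported_distributions Y_space" using w by (simp add: is_distr_product_def)
 obtain Kw Nw Cw where cw: "compact_distr Y_space Kw w Nw Cw" using compact_distr_obtain[OF wc open_Y_space] .
 show "cone_backprojection_distr q w psi = w (%p. ?theta p * Rt psi p)" if "psi \<in> smooth_supp KX" for psi
  unfolding cone_backprojection_distr_def
  by (rule reconstruction_eq[OF cw A product_vanishes[OF f w compact_imp_closed[OF A(1)]] theta U U1 that])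
qed

text \<open>As \<open>g\<close> is injective, a stationary point must be the one computed from its
  inverse; in particular there is none when the ratio lies outside the range of
  \<open>g\<close>.\<close>

lemma critical_point_unique:
 fixes x1 x2 xi1 xi2 :: real
 defines "r \<equiv> inv_into {0<..} g (abs xi1 / (x2 * abs xi2))" and "om \<equiv> - (xi1 * xi2) / abs (xi1 * xi2)"
 assumes e: "E * Q (x1 - y) = x2" "0 < E" "E <= b1" "eta <= x2"
  and crit: "xi1 + xi2 * (E * deriv Q (x1 - y)) = 0" and xi: "(xi1, xi2) ~= 0"
 shows "xi1 ~= 0" "xi2 ~= 0" "abs xi1 / (x2 * abs xi2) \<in> g ` {0<..}" "x2 / q r = E" "x1 - r * om = y"
proof -
 note cp = critical_point[OF e crit xi]
 have r: "r = abs (x1 - y)" unfolding r_def cp(3) by (rule inv_into_f_f[OF g_inj]) (use cp(4) in simp)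
 have "x1 - y = r * om" using cp(5) unfolding r om_def .
 thus "x1 - r * om = y" by simp
 show "x2 / q r = E" using cp(6) by (simp add: r)
 show "xi1 ~= 0" "xi2 ~= 0" "abs xi1 / (x2 * abs xi2) \<in> g ` {0<..}" using cp by simp_all
qed

end

context cone
begin

text \<open>The only possible stationary point lies outside the closed rectangle, or there is none.
  Hence a slightly larger rectangle, which supports the cutoff of the reconstruction, contains no
  stationary point either, and the non-stationary estimate applies to all of it.\<close>

lemma smooth_part:
 fixes x1 x2 xi1 xi2 :: real
 defines "r \<equiv> inv_into {0<..} g (abs xi1 / (x2 * abs xi2))" and "om \<equiv> - (xi1 * xi2) / abs (xi1 * xi2)"
 assumes f: "f \<in> compactly_supported_distributions X_space" and abc: "0 < a" "a < b" "0 < c"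
  and w: "is_distr_product Y_space (indicator ({a..b} \<times> {-c..c})) (distr_deriv (1, 0) (distr_deriv (1, 0) (cone_radon_distr q f))) w"
  and x2: "x2 > 0" and xi: "(xi1, xi2) ~= 0"
  and no: "xi1 ~= 0 ==> xi2 ~= 0 ==> abs xi1 / (x2 * abs xi2) \<in> g ` {0<..} ==> (x2 / q r, x1 - r * om) \<notin> {a..b} \<times> {-c..c}"
 shows "smooth_at_direction X_space (cone_backprojection_distr q w) (x1, x2) (xi1, xi2)"
proof -
 \<comment> \<open>The bound \<open>a / 8\<close> keeps the enlarged rectangle inside
   \<open>KY\<close>, which starts at \<open>E = a / 2\<close>.\<close>
 obtain delta where delta: "delta > 0" "delta <= a / 8"
  and out: "xi1 ~= 0 ==> xi2 ~= 0 ==> abs xi1 / (x2 * abs xi2) \<in> g ` {0<..} ==>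
   (x2 / q r, x1 - r * om) \<notin> {a - 2 * delta..b + 2 * delta} \<times> {-c - 2 * delta..c + 2 * delta}"
 proof (cases "xi1 ~= 0 & xi2 ~= 0 & abs xi1 / (x2 * abs xi2) \<in> g ` {0<..}")
  case True
  hence "(x2 / q r, x1 - r * om) \<notin> {a..b} \<times> {-c..c}" using no by blast
  from box_margin[OF this, of "a / 8"] abc obtain delta where "delta > 0" "delta <= a / 8"
   "(x2 / q r, x1 - r * om) \<notin> {a - 2 * delta..b + 2 * delta} \<times> {-c - 2 * delta..c + 2 * delta}" by auto
  thus ?thesis by (intro that[of delta])
 next
  case False
  show ?thesis by (rule that[of "a / 8"]) (use False abc in auto)
 qed
 define P where "P = {a - 2 * delta..b + 2 * delta} \<times> {-c - 2 * delta..c + 2 * delta}"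
 obtain tau Q where "cone_reg q g (abs x1 + 1) (x2 / 2) (x2 + 1) (a / 2) (b + a) (c + a) tau Q"
  by (rule cone_reg_exists[of "abs x1 + 1" "x2 / 2" "x2 + 1" "a / 2" "b + a" "c + a"]) (use abc x2 in auto)
 then interpret cone_reg q g "abs x1 + 1" "x2 / 2" "x2 + 1" "a / 2" "b + a" "c + a" tau Q .
 have wc: "w \<in> compactly_supported_distributions Y_space" using w by (simp add: is_distr_product_def)
 obtain Kw Nw Cw where cw: "compact_distr Y_space Kw w Nw Cw" using compact_distr_obtain[OF wc open_Y_space] .
 have PK: "P \<subseteq> KY" unfolding P_def KY_def using delta abc by (intro Sigma_mono) auto
 obtain theta where thetaP: "theta \<in> smooth_supp P" and theta: "theta \<in> smooth_supp KY"
  and Lf: "!!psi. psi \<in> smooth_supp KX ==> cone_backprojection_distr q w psi = w (%p. theta p * Rt psi p)"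
  using reconstruction_cutoff[OF f abc w delta(1) PK[unfolded P_def]] unfolding P_def by blast
 have cP: "compact P" unfolding P_def by (intro compact_Times compact_Icc)
 have P: "p \<in> P" if "theta p ~= 0" for p using thetaP that unfolding smooth_supp_def by blast
 have nd: "fst (xi1, xi2) + snd (xi1, xi2) * (E * deriv Q (fst (x1, x2) - y)) ~= 0"
  if p: "(E, y) \<in> P" and e: "E * Q (fst (x1, x2) - y) = snd (x1, x2)" for E y
 proof
  assume "fst (xi1, xi2) + snd (xi1, xi2) * (E * deriv Q (fst (x1, x2) - y)) = 0"
  hence crit: "xi1 + xi2 * (E * deriv Q (x1 - y)) = 0" by simp
  have E: "0 < E" "E <= b + a" using p PK abc unfolding KY_def by auto
 have h: "x2 / 2 <= x2" using x2 by simp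
  have e': "E * Q (x1 - y) = x2" using e by simp
  note cp = critical_point_unique[OF e' E h crit xi, folded r_def om_def]
  show False using out[OF cp(1,2,3)] p unfolding P_def cp(4,5) by simp
 qed
 obtain delta' where delta': "delta' > 0" "!!phi M. phi \<in> smooth_supp KX ==> (!!x. phi x ~= 0 ==> dist x (x1, x2) < delta') ==>
  \<exists>B. \<forall>zeta\<in>ball (xi1, xi2) delta'. \<forall>t>0. (1 + t) ^ M * norm (w (%p. theta p * Rt (%x. phi x * fwave (t *\<^sub>R zeta) x) p)) <= B"
  using radon_smooth_direction[OF compact_distr.finite_order[OF cw compact_KY] theta cP P nd xi] by blast
 define X where "X = ball (x1, x2) delta' \<inter> ({- (abs x1 + 1)<..<abs x1 + 1} \<times> {x2 / 2<..<x2 + 1})"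
 have X: "open X" "(x1, x2) \<in> X" "X \<subseteq> KX" using delta'(1) x2
  by (auto simp: X_def KX_def intro!: open_Int open_Times)
 show ?thesis unfolding smooth_at_direction_def
 proof (rule exI[of _ X], rule exI[of _ "ball (xi1, xi2) delta'"], intro conjI ballI allI)
  show "X \<subseteq> X_space" using X(3) KX_subset by blast
  fix phi and N :: real assume phi: "phi \<in> test_functions X"
  hence supp: "x \<in> X" if "phi x ~= 0" for x
   using that closure_subset[of "{x. phi x ~= 0}"] unfolding test_functions_def by blast
  have phiK: "phi \<in> smooth_supp KX" using phi supp X(3) unfolding smooth_supp_def test_functions_def by blast
  \<comment> \<open>An integer exponent for the real number \<open>N\<close>, which may be
    negative.\<close>
  define M where "M = nat \<lceil>abs N\<rceil>"
  have "dist x (x1, x2) < delta'" if "phi x ~= 0" for x using supp[OF that] by (simp add: X_def dist_commute)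
  from delta'(2)[OF phiK this, of M] obtain B where B: "!!zeta t. zeta \<in> ball (xi1, xi2) delta' ==> t > 0 ==>
    (1 + t) ^ M * norm (w (%p. theta p * Rt (%x. phi x * fwave (t *\<^sub>R zeta) x) p)) <= B"
   by blast
  show "\<exists>C. \<forall>zeta\<in>ball (xi1, xi2) delta'. \<forall>t>0. norm (fourier_cutoff (cone_backprojection_distr q w) phi (t *\<^sub>R zeta)) <= C * (1 + abs t) powr (- N)"
  proof (intro exI[of _ B] ballI allI impI)
   fix zeta and t :: real assume a: "zeta \<in> ball (xi1, xi2) delta'" "t > 0"
   have "(%x. phi x * fwave (t *\<^sub>R zeta) x) \<in> smooth_supp KX" by (rule smooth_supp_mult[OF phiK smooth_on_fwave])
   from Lf[OF this] have "(1 + t) ^ M * norm (fourier_cutoff (cone_backprojection_distr q w) phi (t *\<^sub>R zeta)) <= B"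
    using B[OF a] by (simp add: fourier_cutoff_fwave)
   moreover have "(1 + t) powr N <= (1 + t) ^ M"
   proof -
    have "(1 + t) powr N <= (1 + t) powr (abs N)" using a(2) by (intro powr_mono) auto
    also have "... <= (1 + t) ^ M" unfolding M_def using a(2) by (intro powr_le_power_nat) auto
    finally show ?thesis .
   qed
   ultimately have "(1 + t) powr N * norm (fourier_cutoff (cone_backprojection_distr q w) phi (t *\<^sub>R zeta)) <= B"
    by (meson mult_right_mono norm_ge_zero order_trans)
   thus "norm (fourier_cutoff (cone_backprojection_distr q w) phi (t *\<^sub>R zeta)) <= B * (1 + abs t) powr (- N)"
    using a(2) by (simp add: powr_minus field_simps)
  qed
 qed (use X delta' in auto)
qed

text \<open>A cutoff \<open>kappa\<close> around the stationary point, inside \<open>A\<close>,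
  splits the reconstruction: the part with \<open>kappa\<close> is an elliptic operator of order 1,
  the rest has no stationary point at the given covector and decays rapidly. The form is
  contrapositive because ellipticity carries regularity from \<open>Lf\<close> back to
  \<open>f\<close>.\<close>

lemma elliptic_part:
 fixes x1 x2 xi1 xi2 :: real
 defines "r \<equiv> inv_into {0<..} g (abs xi1 / (x2 * abs xi2))" and "om \<equiv> - (xi1 * xi2) / abs (xi1 * xi2)"
 assumes f: "f \<in> compactly_supported_distributions X_space" and abc: "0 < a" "a < b" "0 < c"
  and w: "is_distr_product Y_space (indicator ({a..b} \<times> {-c..c})) (distr_deriv (1, 0) (distr_deriv (1, 0) (cone_radon_distr q f))) w"
  and x2: "x2 > 0" and xi: "xi1 ~= 0" "xi2 ~= 0" and ratio: "abs xi1 / (x2 * abs xi2) \<in> g ` {0<..}"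
  and inside: "x2 / q r \<in> {a<..<b}" "x1 - r * om \<in> {-c<..<c}"
  and sob: "sobolev_smooth_at X_space (al - 1) (cone_backprojection_distr q w) (x1, x2) (xi1, xi2)"
 shows "sobolev_smooth_at X_space al f (x1, x2) (xi1, xi2)"
proof -
 define x0 where "x0 = (x1, x2)"
 define rho where "rho = xi1 / xi2"
 have fs: "fst x0 = x1" "snd x0 = x2" by (simp_all add: x0_def)
 define A where "A = {a..b} \<times> {-c..c}"
 obtain Kf Nf Cf where cf: "compact_distr X_space Kf f Nf Cf" using compact_distr_obtain[OF f open_X_space] .
 have wc: "w \<in> compactly_supported_distributions Y_space" using w by (simp add: is_distr_product_def)
 obtain Kw Nw Cw where cw: "compact_distr Y_space Kw w Nw Cw" using compact_distr_obtain[OF wc open_Y_space] .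
 obtain phi0 V0 where phi0: "phi0 \<in> test_functions X_space" "phi0 x0 ~= 0" and V0: "open V0" "(xi1, xi2) \<in> V0" "!!zeta t. zeta \<in> V0 ==> t > 0 ==> t *\<^sub>R zeta \<in> V0"
  and fin: "(\<integral>\<^sup>+ zeta\<in>V0. ennreal ((norm (fourier_cutoff (cone_backprojection_distr q w) phi0 zeta))^2 * (1 + (norm zeta)^2) powr (al - 1)) \<partial>lborel) < \<infinity>"
  using sob unfolding sobolev_smooth_at_def x0_def by blast
 \<comment> \<open>\<open>KX\<close> has to contain the set that carries \<open>f\<close>, the
   support of the given cutoff and the point itself.\<close>
 define Kx where "Kx = Kf \<union> closure {x. phi0 x ~= 0} \<union> {x0}"
 have Kx: "compact Kx" "Kx \<subseteq> X_space"
 proof -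
  have c: "compact (closure {x. phi0 x ~= 0})" "closure {x. phi0 x ~= 0} \<subseteq> X_space" using phi0(1) unfolding test_functions_def by blast+
  show "compact Kx" unfolding Kx_def by (intro compact_Un compact_distr.K(1)[OF cf] c(1) compact_sing)
  have "x0 \<in> X_space" using x2 by (simp add: x0_def X_space_def)
  thus "Kx \<subseteq> X_space" unfolding Kx_def using compact_distr.K(2)[OF cf] c(2) by blast
 qed
 obtain e M where eM: "e > 0" "M > e" "Kx \<subseteq> {-M<..<M} \<times> {e<..<M}" by (rule compact_X_bounds[OF Kx])
 obtain tau Q where "cone_reg q g (M + e) (e / 2) (M + e) (a / 2) (b + a) (c + a) tau Q"
  by (rule cone_reg_exists[of "M + e" "e / 2" "M + e" "a / 2" "b + a" "c + a"]) (use abc eM in auto)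
 then interpret cone_reg q g "M + e" "e / 2" "M + e" "a / 2" "b + a" "c + a" tau Q .
 have x0e: "abs x1 < M" "e < x2" "x2 < M" using eM(3) by (auto simp: Kx_def x0_def)
 have squareK: "square x0 (e / 2) \<subseteq> KX" unfolding square_def KX_def fs using x0e eM by (intro Sigma_mono) auto
 define U where "U = {-M<..<M} \<times> {e<..<M}"
 have U: "open U" "Kf \<subseteq> U" using eM(3) unfolding U_def Kx_def by (auto intro: open_Times)
 define th where "th = cutoff (e / 4) (-M) M e M"
 define theta where "theta x = complex_of_real (th x)" for x
 have e4: "e / 4 > 0" using eM by simp
 have thetaK: "theta \<in> smooth_supp KX" unfolding theta_def th_def
  by (rule cutoff_smooth_supp[OF e4], unfold KX_def) (use eM in \<open>intro Sigma_mono, auto\<close>)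
 have thU: "th x = 1" if "x \<in> U" for x
 proof -
  have "x \<in> {-M - e / 4..M + e / 4} \<times> {e - e / 4..M + e / 4}" using that eM unfolding U_def by auto
  thus ?thesis unfolding th_def by (rule cutoff_eq_1[OF e4])
 qed
 have x0U: "x0 \<in> U" using eM(3) unfolding U_def Kx_def by auto
 define ph where "ph = cutoff (e / 4) x1 x1 x2 x2"
 define phi where "phi x = complex_of_real (ph x)" for x
 have phis: "phi \<in> smooth_supp (square x0 (e / 2))" unfolding phi_def ph_def
  by (rule cutoff_smooth_supp[OF e4]) (simp add: square_def fs)
 have phiK: "phi \<in> smooth_supp KX" by (rule smooth_supp_mono[OF squareK phis])
 have ph1: "ph x = 1" if "x \<in> square x0 (e / 4)" for x
  unfolding ph_def by (rule cutoff_eq_1[OF e4]) (use that in \<open>simp add: square_def fs\<close>)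
 obtain r': "r > 0" "g r = abs xi1 / (x2 * abs xi2)"
  using inv_into_into[OF ratio] f_inv_into_f[OF ratio] unfolding r_def by simp
 define E0 where "E0 = x2 / q r"
 define y0 where "y0 = x1 - r * om"
 define t0 where "t0 = r * om"
 have bnd: "e / 2 <= x2" "x2 / q r <= b + a" using x0e eM inside abc by auto
 have crit0: "Q t0 = q r" "x2 * G t0 + rho = 0"
  unfolding t0_def rho_def using critical_point_exists[OF r' xi bnd, of om] by (simp_all add: om_def)
 \<comment> \<open>The cutoff \<open>kappa\<close> needs \<open>2 * dk\<close> on each side; a
   quarter of the distance to the boundary keeps its support in the open rectangle.\<close>
 define dk where "dk = min (min (E0 - a) (b - E0)) (min (y0 + c) (c - y0)) / 4"
 have dk: "dk > 0" "a < E0 - 2 * dk" "E0 + 2 * dk < b" "- c < y0 - 2 * dk" "y0 + 2 * dk < c"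
 proof -
  have i: "a < E0" "E0 < b" "- c < y0" "y0 < c" using inside by (simp_all add: E0_def y0_def)
  thus p: "dk > 0" by (simp add: dk_def)
  have "4 * dk <= E0 - a" "4 * dk <= b - E0" "4 * dk <= y0 + c" "4 * dk <= c - y0" by (simp_all add: dk_def)
  thus "a < E0 - 2 * dk" "E0 + 2 * dk < b" "- c < y0 - 2 * dk" "y0 + 2 * dk < c" using p by linarith+
 qed
 define k where "k = cutoff dk E0 E0 y0 y0"
 define kappa where "kappa p = complex_of_real (k p)" for p
 define Kk where "Kk = {E0 - 2 * dk..E0 + 2 * dk} \<times> {y0 - 2 * dk..y0 + 2 * dk}"
 define W where "W = {a<..<b} \<times> {-c<..<c}"
 have W: "open W" "W \<subseteq> Y_space" "!!p. p \<in> W ==> (indicator ({a..b} \<times> {-c..c}) p :: complex) = 1" and KkW: "compact Kk" "Kk \<subseteq> W"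
  using dk abc unfolding W_def Kk_def by (auto simp: Y_space_def intro: open_Times compact_Times)
 have WA: "W \<subseteq> A" unfolding W_def A_def by (intro Sigma_mono) auto
 have AK: "A \<subseteq> KY" unfolding A_def KY_def using abc by (intro Sigma_mono) auto
 have kappak: "kappa \<in> smooth_supp Kk" unfolding kappa_def k_def Kk_def by (rule cutoff_smooth_supp[OF dk(1)]) simp
 have kappaK: "kappa \<in> smooth_supp KY" by (rule smooth_supp_mono[OF _ kappak]) (use KkW WA AK in blast)
 have k1: "k p = 1" if "p \<in> {E0 - dk..E0 + dk} \<times> {y0 - dk..y0 + dk}" for p
  unfolding k_def by (rule cutoff_eq_1[OF dk(1) that])
 have a8: "a / 8 > 0" using abc by simp
 define P where "P = {a - 2 * (a / 8)..b + 2 * (a / 8)} \<times> {-c - 2 * (a / 8)..c + 2 * (a / 8)}"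
 have PK: "P \<subseteq> KY" unfolding P_def KY_def using abc by (intro Sigma_mono) auto
 obtain thetaA where thetaAP: "thetaA \<in> smooth_supp P" and thetaAK: "thetaA \<in> smooth_supp KY" and A1: "!!p. p \<in> A ==> thetaA p = 1"
  and Lf: "!!psi. psi \<in> smooth_supp KX ==> cone_backprojection_distr q w psi = w (%p. thetaA p * Rt psi p)"
  using reconstruction_cutoff[OF f abc w a8 PK[unfolded P_def]] unfolding P_def A_def by blast
 have AP: "A \<subseteq> P" unfolding A_def P_def using a8 by (intro Sigma_mono) auto
 \<comment> \<open>Where \<open>thetaA - kappa\<close> may be nonzero: near the stationary point
   both cutoffs are 1.\<close>
 define P' where "P' = P - {E0 - dk<..<E0 + dk} \<times> {y0 - dk<..<y0 + dk}"
 have cP': "compact P'" unfolding P'_def P_def by (intro compact_diff compact_Times compact_Icc open_Times open_greaterThanLessThan)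
 have diffP': "p \<in> P'" if nz: "thetaA p - kappa p ~= 0" for p
 proof -
  have "p \<in> P"
  proof (rule ccontr)
   assume "p \<notin> P"
   hence "p \<notin> Kk" using KkW WA AP by blast
   hence "kappa p = 0" using kappak unfolding smooth_supp_def by blast
   moreover have "thetaA p = 0" using thetaAP \<open>p \<notin> P\<close> unfolding smooth_supp_def by blast
   ultimately show False using nz by simp
  qed
  moreover have "p \<notin> {E0 - dk<..<E0 + dk} \<times> {y0 - dk<..<y0 + dk}"
  proof
   assume "p \<in> {E0 - dk<..<E0 + dk} \<times> {y0 - dk<..<y0 + dk}"
   hence p: "p \<in> {E0 - dk..E0 + dk} \<times> {y0 - dk..y0 + dk}" by auto
   hence "p \<in> Kk" using dk(1) unfolding Kk_def by auto
   hence "p \<in> A" using KkW WA by blast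
   thus False using nz A1 k1[OF p] by (simp add: kappa_def)
  qed
  ultimately show ?thesis by (simp add: P'_def)
 qed
 \<comment> \<open>Normalised so that the second component is the sign of \<open>xi2\<close>;
   frequencies of the sector, divided by the modulus of their second component, are close to
   it.\<close>
 define zeta0 where "zeta0 = (xi1 / abs xi2, xi2 / abs xi2)"
 have nd: "fst zeta0 + snd zeta0 * (E * deriv Q (fst x0 - y)) ~= 0"
  if p: "(E, y) \<in> P'" and e: "E * Q (fst x0 - y) = snd x0" for E y
 proof
  assume "fst zeta0 + snd zeta0 * (E * deriv Q (fst x0 - y)) = 0"
  hence crit: "xi1 + xi2 * (E * deriv Q (x1 - y)) = 0" using xi(2) by (simp add: zeta0_def fs field_simps)
  have "(E, y) \<in> KY" using p PK unfolding P'_def by blast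
  hence E: "0 < E" "E <= b + a" using abc unfolding KY_def by auto
  have e': "E * Q (x1 - y) = x2" using e by (simp add: fs)
  have nz: "(xi1, xi2) ~= 0" using xi by (simp add: zero_prod_def)
  have "E = E0" "y = y0" using critical_point_unique(4,5)[OF e' E bnd(1) crit nz] unfolding E0_def y0_def r_def om_def by simp_all
  thus False using p dk(1) unfolding P'_def by auto
 qed
 obtain c1 delta1 where c1: "c1 > 0" "delta1 > 0"
  "!!E y x xi. (E, y) \<in> P' ==> dist x x0 < delta1 ==> dist xi zeta0 < delta1 ==> E * Q (fst x - y) = snd x ==>
   c1 <= abs (fst xi + snd xi * (E * deriv Q (fst x - y)))"
  using nondegenerate[OF cP' nd] by blast
 have pos: "th x0 > 0" "ph x0 > 0" "k (snd x0 / Q t0, fst x0 - t0) > 0"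
 proof -
  show "th x0 > 0" using thU[OF x0U] by simp
  show "ph x0 > 0" using ph1[of x0] eM by (simp add: square_def fs mem_Times_iff)
  have "snd x0 / Q t0 = E0" by (simp add: fs crit0(1) E0_def)
  moreover have "fst x0 - t0 = y0" by (simp add: fs y0_def t0_def)
  ultimately show "k (snd x0 / Q t0, fst x0 - t0) > 0" using k1[of "(E0, y0)"] dk(1) by simp
 qed
 have rho': "snd x0 * G t0 + rho = 0" using crit0(2) by (simp add: fs)
 have nn: "th x >= 0" "k p >= 0" "ph x >= 0" for x p
  using cutoff_range unfolding th_def k_def ph_def by auto
 obtain eps where eps: "eps > 0" "!!psi V. psi \<in> smooth_supp KX ==> (!!x. psi x ~= 0 ==> norm (x - x0) < eps & phi x = 1) ==>
   (!!xi. xi \<in> V ==> snd xi ~= 0 & abs (fst xi / snd xi - rho) < eps & 1 / eps < abs (snd xi)) ==>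
   has_parametrix theta kappa V psi"
  using parametrix[OF thetaK theta_def nn(1) kappaK kappa_def nn(2) phiK phi_def nn(3) pos rho'] by blast
 obtain d0 where d0: "d0 > 0" "!!x. dist x x0 < d0 ==> norm (phi0 x0) / 2 <= norm (phi0 x)"
 proof -
  have "smooth phi0" using phi0(1) by (simp add: test_functions_def)
  hence "isCont phi0 x0" by (intro smooth_isCont)
  moreover have "norm (phi0 x0) / 2 > 0" using phi0(2) by simp
  ultimately obtain d where d: "d > 0" "!!x. dist x x0 < d ==> dist (phi0 x) (phi0 x0) < norm (phi0 x0) / 2"
   unfolding continuous_at_eps_delta by blast
  have "norm (phi0 x0) / 2 <= norm (phi0 x)" if "dist x x0 < d" for x
   using d(2)[OF that] norm_triangle_ineq2[of "phi0 x0" "phi0 x"] by (simp add: dist_norm norm_minus_commute)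
  thus ?thesis using d(1) that by blast
 qed
 obtain eps1 where eps1: "eps1 > 0" "sector xi2 rho eps1 \<subseteq> V0"
  using sector_subset_cone[OF V0] xi(2) unfolding rho_def by auto
 \<comment> \<open>Small enough for the parametrix (\<open>eps\<close>), the lower bound of
   \<open>phi0\<close> (\<open>d0\<close>), the region where \<open>phi\<close> is 1
   (\<open>e\<close>), the non-stationarity of the remainder (\<open>delta1\<close>) and the cone of
   known regularity (\<open>eps1\<close>). The factor 4 covers the passage from the square to
   distances.\<close>
 define e0 where "e0 = min (min (eps / 4) (d0 / 4)) (min (min (e / 4) (delta1 / 4)) eps1)"
 have e0: "e0 > 0" "e0 <= eps / 4" "e0 <= d0 / 4" "e0 <= e / 4" "e0 <= delta1 / 4" "e0 <= eps1"
  using eps(1) d0(1) eM(1) c1(2) eps1(1) by (auto simp: e0_def)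
 have near: "dist x x0 <= 2 * e0" if "x \<in> square x0 e0" for x
 proof -
  have "abs (fst x - x1) <= e0" "abs (snd x - x2) <= e0" using that unfolding square_def fs by (auto simp: abs_le_iff)
  moreover have "dist x x0 <= abs (fst x - x1) + abs (snd x - x2)"
   unfolding dist_prod_def fs dist_real_def by (rule sqrt_sum_squares_le_sum) auto
  ultimately show ?thesis by linarith
 qed
 have sqK: "square x0 e0 \<subseteq> KX" using squareK square_mono[of e0 "e / 2" x0] e0 eM(1) by auto
 define v where "v psi = w (%p. thetaA p * Rt psi p)" for psi
 \<comment> \<open>The contribution of \<open>(E, y)\<close> away from the stationary point. It
   includes the edges of \<open>A\<close>, where the product is not known explicitly.\<close>
 define rem where "rem xi psi = w (%p. (thetaA p - kappa p) * Rt (%x. psi x * fwave xi x) p)" for xi psi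
 have fw: "finite_order KY w Nw Cw" by (rule compact_distr.finite_order[OF cw compact_KY])
 obtain Cv where fv: "finite_order KX v Nw Cv" using finite_order_radon[OF fw thetaAK] unfolding v_def by blast
 have Lf_eq: "cone_backprojection_distr q w psi = v psi" if "psi \<in> smooth_supp KX" for psi
  unfolding v_def by (rule Lf[OF that])
 have phi0K: "phi0 \<in> smooth_supp KX"
 proof -
  have "x \<in> KX" if "phi0 x ~= 0" for x
  proof -
   have "x \<in> Kx" using that closure_subset[of "{x. phi0 x ~= 0}"] unfolding Kx_def by blast
   moreover have "{-M<..<M} \<times> {e<..<M} \<subseteq> KX" unfolding KX_def using eM by (intro Sigma_mono) auto
   ultimately show ?thesis using eM(3) by blast
  qed
  thus ?thesis using phi0(1) unfolding smooth_supp_def test_functions_def by blast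
 qed
 have "elliptic_point q g (M + e) (e / 2) (M + e) (a / 2) (b + a) (c + a) tau Q f v Nf Nw Cf Cv rem theta kappa phi0 x0 rho xi2 al e0 (norm (phi0 x0) / 2)"
 proof (intro elliptic_point.intro elliptic_point_axioms.intro cone_reg_axioms)
  show "finite_order KX f Nf Cf" by (rule compact_distr.finite_order[OF cf compact_KX])
  show "norm (phi0 x0) / 2 > 0" using phi0(2) by simp
  show "norm (phi0 x0) / 2 <= norm (phi0 x)" if "x \<in> square x0 e0" for x
   using near[OF that] e0 d0(1) by (intro d0(2)) auto
  show "f (%x. fwave zeta x * Pop theta kappa zeta psi x) = v (%x. psi x * fwave zeta x) - rem zeta psi" if psi: "psi \<in> smooth_supp KX" for psi zeta
  proof -
   let ?R = "Rt (%x. psi x * fwave zeta x)"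
   have sR: "smooth ?R" using psi by (intro smooth_Rt smooth_on_mult open_UNIV smooth_on_fwave) (simp add: smooth_supp_def)
   have "w (%p. kappa p * ?R p) = f (%x. fwave zeta x * Pop theta kappa zeta psi x)"
   proof (rule elliptic_identity[OF cf w W kappaK KkW _ thetaK U _ psi])
    show "kappa p = 0" if "p \<notin> Kk" for p using kappak that unfolding smooth_supp_def by blast
    show "theta x = 1" if "x \<in> U" for x using thU[OF that] by (simp add: theta_def)
   qed
   moreover have "(%p. kappa p * ?R p) = (%p. thetaA p * ?R p - (thetaA p - kappa p) * ?R p)" by (simp add: fun_eq_iff algebra_simps)
   moreover have "w (%p. thetaA p * ?R p - (thetaA p - kappa p) * ?R p) = w (%p. thetaA p * ?R p) - w (%p. (thetaA p - kappa p) * ?R p)"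
    by (intro finite_order.diff[OF fw] smooth_supp_mult[OF _ sR] thetaAK smooth_supp_diff kappaK)
   ultimately show ?thesis unfolding v_def rem_def by simp
  qed
  show "\<exists>B. \<forall>zeta\<in>V. (1 + abs (snd zeta)) ^ m * norm (rem zeta (h zeta)) <= B"
   if h: "!!n. unif_Ck n UNIV UNIV V h" "!!zeta. zeta \<in> V ==> h zeta \<in> smooth_supp (square x0 e0)" and V: "V \<subseteq> sector xi2 rho e0" for V h m
   unfolding rem_def
  proof (rule radon_decay[OF fw _ h(1)])
   show "(%p. thetaA p - kappa p) \<in> smooth_supp KY" by (intro smooth_supp_diff thetaAK kappaK)
   show "h zeta \<in> smooth_supp KX" if "zeta \<in> V" for zeta by (rule smooth_supp_mono[OF sqK h(2)[OF that]])
   show "abs (snd zeta) > 0" "norm zeta <= (1 + abs rho + e0) * abs (snd zeta)" if "zeta \<in> V" for zeta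
    using sector_norm[of zeta xi2 rho e0] that V by auto
   show "c1 > 0" by (rule c1(1))
   fix zeta E y t assume z: "zeta \<in> V" "thetaA (E, y) - kappa (E, y) ~= 0" "h zeta (y + t, E * Q t) ~= 0"
   have zeta: "zeta \<in> sector xi2 rho e0" using z(1) V by blast
   \<comment> \<open>Non-stationarity is known near the normalised covector; dividing by
     \<open>m\<close> and multiplying back transfers it to the sector.\<close>
   define m where "m = abs (snd zeta)"
   have m: "m > 0" using sector_norm(2)[OF zeta] by (simp add: m_def)
   have sg: "snd zeta / m = xi2 / abs xi2" using zeta m by (auto simp: sector_def m_def zero_less_mult_iff)
   have "fst zeta / m - xi1 / abs xi2 = (fst zeta / snd zeta - rho) * (xi2 / abs xi2)"
   proof -
    have "fst zeta / m = fst zeta / snd zeta * (snd zeta / m)" using sector_norm(2)[OF zeta] by simp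
    moreover have "xi1 / abs xi2 = rho * (xi2 / abs xi2)" using xi(2) by (simp add: rho_def)
    ultimately show ?thesis unfolding sg by (simp only: left_diff_distrib)
   qed
   hence "\<bar>fst zeta / m - xi1 / \<bar>xi2\<bar>\<bar> < e0" using sector_norm(3)[OF zeta] xi(2) by (simp add: abs_mult)
   hence "dist ((1 / m) *\<^sub>R zeta) zeta0 < delta1"
    using sg e0 c1(2) by (simp add: zeta0_def dist_prod_def dist_real_def)
   moreover have "(y + t, E * Q t) \<in> square x0 e0" using h(2)[OF z(1)] z(3) unfolding smooth_supp_def by blast
   hence "dist (y + t, E * Q t) x0 < delta1" using near e0 c1(2) by fastforce
   ultimately have "c1 <= abs (fst ((1 / m) *\<^sub>R zeta) + snd ((1 / m) *\<^sub>R zeta) * (E * deriv Q t))"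
    using c1(3)[OF diffP'[OF z(2)], of "(y + t, E * Q t)" "(1 / m) *\<^sub>R zeta"] by simp
   hence "c1 * m <= abs (fst ((1 / m) *\<^sub>R zeta) + snd ((1 / m) *\<^sub>R zeta) * (E * deriv Q t)) * m"
    using m by (intro mult_right_mono) auto
   also have "... = abs ((fst ((1 / m) *\<^sub>R zeta) + snd ((1 / m) *\<^sub>R zeta) * (E * deriv Q t)) * m)" using m by (simp add: abs_mult)
   also have "(fst ((1 / m) *\<^sub>R zeta) + snd ((1 / m) *\<^sub>R zeta) * (E * deriv Q t)) * m = fst zeta + snd zeta * (E * deriv Q t)"
    using m by (simp add: distrib_right)
   finally show "c1 * abs (snd zeta) <= abs (fst zeta + snd zeta * (E * deriv Q t))" by (simp add: m_def)
  qed
  show "has_parametrix theta kappa V psi"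
   if psi: "psi \<in> smooth_supp (square x0 e0)" and V: "!!xi. xi \<in> V ==> xi \<in> sector xi2 rho e0 & 1 / e0 < abs (snd xi)" for psi V
  proof (rule eps(2)[OF smooth_supp_mono[OF sqK psi]])
   fix x assume "psi x ~= 0"
   hence x: "x \<in> square x0 e0" using psi unfolding smooth_supp_def by blast
   have "norm (x - x0) < eps" using near[OF x] e0 eps(1) by (simp add: dist_norm)
   moreover have "x \<in> square x0 (e / 4)" using x square_mono[OF e0(4)] by blast
   ultimately show "norm (x - x0) < eps & phi x = 1" using ph1 by (simp add: phi_def)
  next
   fix zeta assume z: "zeta \<in> V"
   have s: "zeta \<in> sector xi2 rho e0" "1 / e0 < abs (snd zeta)" using V[OF z] by auto
   have "1 / eps <= 1 / e0" using e0 eps(1) by (intro frac_le) auto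
   thus "snd zeta ~= 0 & abs (fst zeta / snd zeta - rho) < eps & 1 / eps < abs (snd zeta)"
    using sector_norm(2,3)[OF s(1)] s(2) e0 by auto
  qed
  show "weighted_L2 (sector xi2 rho e0) (al - 1) (%xi. v (%x. phi0 x * fwave xi x))"
  proof (rule weighted_L2_mono[where C = 1])
   have eq: "fourier_cutoff (cone_backprojection_distr q w) phi0 zeta = v (%x. phi0 x * fwave zeta x)" for zeta
    unfolding fourier_cutoff_fwave by (rule Lf_eq[OF smooth_supp_mult[OF phi0K smooth_on_fwave]])
   show "weighted_L2 V0 (al - 1) (%xi. v (%x. phi0 x * fwave xi x))"
   proof (rule weighted_L2_from_integral)
    show "V0 \<in> sets borel" using V0(1) by simp
    show "(%xi. v (%x. phi0 x * fwave xi x)) \<in> borel_measurable borel"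
     using finite_order.hat_measurable[OF fv phi0K] unfolding finite_order.hat_def[OF fv, abs_def] .
    show "(\<integral>\<^sup>+ xi\<in>V0. ennreal ((norm (v (%x. phi0 x * fwave xi x)))^2 * jb (al - 1) xi) \<partial>lborel) < \<infinity>"
     using fin unfolding eq jb_def .
   qed
   show "sector xi2 rho e0 \<subseteq> V0" using sector_mono[OF e0(6)] eps1(2) by blast
  qed simp
 qed (use thetaK kappaK phi0K e0 sqK fv in auto)
 then interpret el: elliptic_point q g "M + e" "e / 2" "M + e" "a / 2" "b + a" "c + a" tau Q f v Nf Nw Cf Cv rem theta kappa phi0 x0 rho xi2 al e0 "norm (phi0 x0) / 2" .
 have cl: "el.claim al (e0 / 2)" by (rule el.bootstrap) (use e0 in auto)
 \<comment> \<open>The claim holds for every cutoff in the square; the Sobolev condition asks for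
   one that does not vanish at the point.\<close>
 define psi where "psi x = complex_of_real (cutoff (e0 / 4) x1 x1 x2 x2 x)" for x
 have e04: "e0 / 4 > 0" using e0 by simp
 have psi: "psi \<in> smooth_supp (square x0 (e0 / 2))" unfolding psi_def
  by (rule cutoff_smooth_supp[OF e04]) (simp add: square_def fs)
 have psix: "psi x0 = 1" unfolding psi_def using cutoff_eq_1[OF e04, of x0 x1 x1 x2 x2] e0(1) by (simp add: mem_Times_iff fs)
 have "square x0 (e0 / 2) \<subseteq> KX" using sqK square_mono[of "e0 / 2" e0 x0] e0(1) by auto
 hence t: "psi \<in> test_functions X_space"
  using smooth_supp_test_functions[OF psi compact_square] KX_subset by blast
 have L2: "weighted_L2 (sector xi2 rho (e0 / 2)) al (%xi. f (%x. psi x * fwave xi x))" using cl psi unfolding el.claim_def by blast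
 show ?thesis unfolding sobolev_smooth_at_def
 proof (intro bexI[OF _ t] conjI exI[of _ "sector xi2 rho (e0 / 2)"] ballI allI impI)
  show "psi (x1, x2) ~= 0" using psix by (simp add: x0_def)
  show "open (sector xi2 rho (e0 / 2))" by (rule open_sector)
  show "(xi1, xi2) \<in> sector xi2 rho (e0 / 2)" using in_sector[of "(xi1, xi2)" "e0 / 2"] xi(2) e0(1) by (simp add: rho_def)
  show "t *\<^sub>R zeta \<in> sector xi2 rho (e0 / 2)" if "zeta \<in> sector xi2 rho (e0 / 2)" "t > 0" for zeta t
   by (rule sector_cone[OF that(2,1)])
  show "(\<integral>\<^sup>+ zeta\<in>sector xi2 rho (e0 / 2). ennreal ((norm (fourier_cutoff f psi zeta))^2 * (1 + (norm zeta)^2) powr al) \<partial>lborel) < \<infinity>"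
   using weighted_L2_integral[OF L2] unfolding fourier_cutoff_fwave jb_def .
 qed
qed

end

text \<open>Outside the range of \<open>g\<close> the value of \<open>inv_into\<close> carries no
  meaning, so membership of the ratio in the range is a condition of its own. When it fails there is
  no stationary point, and the case belongs to the smooth alternative.\<close>

theorem theorem3p10:
  fixes q g :: "real \<Rightarrow> real"
    and \<alpha> a b c x1 x2 \<xi>1 \<xi>2 r \<omega> :: real
    and f Lf :: "(real \<times> real \<Rightarrow> complex) \<Rightarrow> complex"
  assumes "continuous_on {0..} q"
    and "smooth_on {0<..} q"
    and "q 0 = 0"
    and "\<forall>r>0. q r > 0"
    and "g = (\<lambda>r. deriv q r / q r)"
    and "\<forall>r>0. g r > 0"
    and "\<forall>r>0. deriv g r \<noteq> 0"
    and "0 < a" and "a < b" and "0 < c"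
    and "f \<in> compactly_supported_distributions X_space"
    and "is_cone_reconstruction q ({a..b} \<times> {-c..c}) f Lf"
    and "((x1, x2), (\<xi>1, \<xi>2)) \<in> sobolev_WF X_space \<alpha> f"
    and "r = inv_into {0<..} g (\<bar>\<xi>1\<bar> / (x2 * \<bar>\<xi>2\<bar>))"
    and "\<omega> = - (\<xi>1 * \<xi>2) / \<bar>\<xi>1 * \<xi>2\<bar>"
  shows "(\<xi>1 \<noteq> 0 \<and> \<xi>2 \<noteq> 0 \<and> \<bar>\<xi>1\<bar> / (x2 * \<bar>\<xi>2\<bar>) \<in> g ` {0<..} \<and>
            x2 / q r \<in> {a<..<b} \<and> x1 - r * \<omega> \<in> {-c<..<c}
          \<longrightarrow> ((x1, x2), (\<xi>1, \<xi>2)) \<in> sobolev_WF X_space (\<alpha> - 1) Lf) \<and>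
         (\<not> (\<xi>1 \<noteq> 0 \<and> \<xi>2 \<noteq> 0) \<or>
          (\<xi>1 \<noteq> 0 \<and> \<xi>2 \<noteq> 0 \<and>
            (\<bar>\<xi>1\<bar> / (x2 * \<bar>\<xi>2\<bar>) \<notin> g ` {0<..} \<or>
             x2 / q r \<notin> {a..b} \<or> x1 - r * \<omega> \<notin> {-c..c}))
          \<longrightarrow> smooth_at_direction X_space Lf (x1, x2) (\<xi>1, \<xi>2))"
proof -
  interpret cone q g
    using assms(1-7) by unfold_locales simp_all
  obtain w where w: "is_distr_product Y_space (indicator ({a..b} \<times> {-c..c})) (distr_deriv (1, 0) (distr_deriv (1, 0) (cone_radon_distr q f))) w"
    and Lf: "Lf = cone_backprojection_distr q w"
    using assms(12) unfolding is_cone_reconstruction_def by blast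
  have x: "x2 > 0" and \<xi>: "(\<xi>1, \<xi>2) \<noteq> 0" and WF: "\<not> sobolev_smooth_at X_space \<alpha> f (x1, x2) (\<xi>1, \<xi>2)"
    using assms(13) by (auto simp: sobolev_WF_def X_space_def)
  show ?thesis
  proof (intro conjI impI)
    assume h: "\<xi>1 \<noteq> 0 \<and> \<xi>2 \<noteq> 0 \<and> \<bar>\<xi>1\<bar> / (x2 * \<bar>\<xi>2\<bar>) \<in> g ` {0<..} \<and> x2 / q r \<in> {a<..<b} \<and> x1 - r * \<omega> \<in> {-c<..<c}"
    \<comment> \<open>Smoothness of \<open>Lf\<close> to order \<open>\<alpha> - 1\<close> would
      make \<open>f\<close> smooth to order \<open>\<alpha>\<close> by
      \<open>elliptic_part\<close>.\<close>
    have "\<not> sobolev_smooth_at X_space (\<alpha> - 1) Lf (x1, x2) (\<xi>1, \<xi>2)"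
      using elliptic_part[OF assms(11,8-10) w x, of \<xi>1 \<xi>2 x1 \<alpha>] h WF unfolding assms(14,15) Lf by blast
    then show "((x1, x2), (\<xi>1, \<xi>2)) \<in> sobolev_WF X_space (\<alpha> - 1) Lf"
      using x \<xi> by (simp add: sobolev_WF_def X_space_def)
  next
    assume h: "\<not> (\<xi>1 \<noteq> 0 \<and> \<xi>2 \<noteq> 0) \<or> (\<xi>1 \<noteq> 0 \<and> \<xi>2 \<noteq> 0 \<and>
      (\<bar>\<xi>1\<bar> / (x2 * \<bar>\<xi>2\<bar>) \<notin> g ` {0<..} \<or> x2 / q r \<notin> {a..b} \<or> x1 - r * \<omega> \<notin> {-c..c}))"
    show "smooth_at_direction X_space Lf (x1, x2) (\<xi>1, \<xi>2)"
      unfolding Lf by (rule smooth_part[OF assms(11,8-10) w x \<xi>]) (use h in \<open>auto simp: assms(14,15)\<close>)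
  qed
qed

end
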